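(* Let $\alpha\in\mathbb R$. If $\alpha\in\Lambda$, then $\mathcal C_{\alpha,\beta}=0$ for all $\beta$ with $\alpha\le\beta\le\alpha+1$. If $\alpha\notin\Lambda$, then $\mathcal C_{\alpha,\beta}>0$ for all $\beta$ with $\alpha\le\beta\le\alpha+1$.
   Context: $\Lambda:=\{k-\tfrac12: k\in\mathbb Z\setminus\{0\}\}$. Spinors are functions $\psi:\mathbb R^3\to\mathbb C^2$. $\sigma=(\sigma_1,\sigma_2,\sigma_3)$ are the Pauli matrices $\sigma_1=\begin{pmatrix}0&1\\1&0\end{pmatrix}$, $\sigma_2=\begin{pmatrix}0&-i\\i&0\end{pmatrix}$, $\sigma_3=\begin{pmatrix}1&0\\0&-1\end{pmatrix}$, and $\sigma\cdot\nabla\psi=\sum_{j=1}^3\sigma_j\partial_j\psi$. For $\alpha\le\beta\le\alpha+1$ let $p=6/(1-2\alpha+2\beta)\in[2,6]$ and $$\mathcal D_{\alpha,\beta}:=\{\psi:\ |x|^{-\beta}\psi\in L^p(\mathbb R^3,\mathbb C^2),\ |x|^{-\alpha}\sigma\cdot\nabla\psi\in L^2(\mathbb R^3,\mathbb C^2)\},$$ derivatives being taken in the sense of distributions on $\mathbb R^3\setminus\{0\}$. $\mathcal C_{\alpha,\beta}\ge0$ is the best (largest) constant such that $$\int_{\mathbb R^3}\frac{|\sigma\cdot\nabla\psi(x)|^2}{|x|^{2\alpha}}\,dx\ \ge\ \mathcal C_{\alpha,\beta}\left(\int_{\mathbb R^3}\frac{|\psi(x)|^p}{|x|^{\beta p}}\,dx\right)^{2/p}\qquad\forall\,\psi\in\mathcal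 D_{\alpha,\beta}.$$ *)

theory Defs
  imports "HOL-Analysis.Analysis"
begin

definition Lambda :: "real set" where
  "Lambda = {real_of_int k - 1/2 | k. k \<noteq> 0}"

definition pauli :: "complex^2^2^3" where
  "pauli = vector [vector [vector [0, 1],    vector [1, 0]],
                   vector [vector [0, -\<i>], vector [\<i>, 0]],
                   vector [vector [1, 0],    vector [0, -1]]]"

definition partial_deriv :: "3 \<Rightarrow> (real^3 \<Rightarrow> complex) \<Rightarrow> real^3 \<Rightarrow> complex" where
  "partial_deriv j \<phi> x = frechet_derivative \<phi> (at x) (axis j 1)"

primrec Ck :: "nat \<Rightarrow> (real^3 \<Rightarrow> complex) \<Rightarrow> bool" where
  "Ck 0 \<phi> \<longleftrightarrow> continuous_on UNIV \<phi>"
| "Ck (Suc k) \<phi> \<longleftrightarrow> \<phi> differentiable_on UNIV \<and> (\<forall>j. Ck k (partial_deriv j \<phi>))"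

text \<open>The test functions on the punctured space, extended by zero to the origin.\<close>

definition test_function :: "(real^3 \<Rightarrow> complex) \<Rightarrow> bool" where
  "test_function \<phi> \<longleftrightarrow>
     (\<forall>k. Ck k \<phi>) \<and> compact (closure {x. \<phi> x \<noteq> 0}) \<and> 0 \<notin> closure {x. \<phi> x \<noteq> 0}"

definition locally_integrable_punctured :: "(real^3 \<Rightarrow> complex^2) \<Rightarrow> bool" where
  "locally_integrable_punctured \<psi> \<longleftrightarrow>
     (\<forall>K. compact K \<and> 0 \<notin> K \<longrightarrow> set_integrable lebesgue K \<psi>)"

text \<open>The function \<open>f\<close> represents \<open>\<sigma> \<cdot> \<nabla>\<psi>\<close> in the sense of distributions on the punctured space:
  \<open>\<langle>f, \<phi>\<rangle> = \<Sum>j. \<sigma>\<^sub>j \<langle>\<partial>\<^sub>j \<psi>, \<phi>\<rangle>\<close> with \<open>\<langle>\<partial>\<^sub>j \<psi>, \<phi>\<rangle> = - \<integral> \<partial>\<^sub>j \<phi> \<psi>\<close>. Only the combination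
  \<open>\<sigma> \<cdot> \<nabla>\<psi>\<close>, not each partial derivative of \<open>\<psi>\<close>, is required to be a function. Such an \<open>f\<close> is
  unique almost everywhere.\<close>

definition has_sigma_grad :: "(real^3 \<Rightarrow> complex^2) \<Rightarrow> (real^3 \<Rightarrow> complex^2) \<Rightarrow> bool" where
  "has_sigma_grad \<psi> f \<longleftrightarrow>
     locally_integrable_punctured \<psi> \<and> locally_integrable_punctured f \<and>
     (\<forall>\<phi>. test_function \<phi> \<longrightarrow>
        (LINT x|lebesgue. \<phi> x *s f x)
          = (\<Sum>j\<in>UNIV. (pauli $ j) *v (- (LINT x|lebesgue. partial_deriv j \<phi> x *s \<psi> x))))"

definition in_Lp :: "real \<Rightarrow> (real^3 \<Rightarrow> complex^2) \<Rightarrow> bool" where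
  "in_Lp p f \<longleftrightarrow>
     f \<in> borel_measurable lebesgue \<and> integrable lebesgue (\<lambda>x. norm (f x) powr p)"

definition p_exp :: "real \<Rightarrow> real \<Rightarrow> real" where
  "p_exp \<alpha> \<beta> = 6 / (1 - 2 * \<alpha> + 2 * \<beta>)"

definition sigma_grad_in_L2 :: "real \<Rightarrow> (real^3 \<Rightarrow> complex^2) \<Rightarrow> (real^3 \<Rightarrow> complex^2) \<Rightarrow> bool" where
  "sigma_grad_in_L2 \<alpha> \<psi> f \<longleftrightarrow>
     has_sigma_grad \<psi> f \<and> in_Lp 2 (\<lambda>x. norm x powr (- \<alpha>) *\<^sub>R f x)"

definition D_space :: "real \<Rightarrow> real \<Rightarrow> (real^3 \<Rightarrow> complex^2) set" where
  "D_space \<alpha> \<beta> =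
     {\<psi>. in_Lp (p_exp \<alpha> \<beta>) (\<lambda>x. norm x powr (- \<beta>) *\<^sub>R \<psi> x) \<and>
         (\<exists>f. sigma_grad_in_L2 \<alpha> \<psi> f)}"

text \<open>For \<open>\<alpha> \<le> \<beta> \<le> \<alpha> + 1\<close> the set of admissible constants is closed, contains \<open>0\<close>, and is bounded above because
  \<open>D_space \<alpha> \<beta>\<close> contains all spinors with test function components, so its supremum is its largest
  element.\<close>

definition best_const :: "real \<Rightarrow> real \<Rightarrow> real" where
  "best_const \<alpha> \<beta> =
     Sup {C. 0 \<le> C \<and>
        (\<forall>\<psi> \<in> D_space \<alpha> \<beta>. \<forall>f. sigma_grad_in_L2 \<alpha> \<psi> f \<longrightarrow>
           (LINT x|lebesgue. (norm (f x))\<^sup>2 / norm x powr (2 * \<alpha>))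
             \<ge> C * (LINT x|lebesgue. norm (\<psi> x) powr p_exp \<alpha> \<beta> / norm x powr (\<beta> * p_exp \<alpha> \<beta>))
                     powr (2 / p_exp \<alpha> \<beta>))}"

end

theory Submission
  imports Defs "HOL-Complex_Analysis.Complex_Analysis"
begin

text \<open>
Suppose \<open>\<alpha> \<notin> \<Lambda>\<close>. The Cauchy kernel \<open>\<sigma> \<cdot> z / |z|\<^sup>3\<close> recovers a spinor from \<open>\<sigma> \<cdot> \<nabla>\<psi>\<close>, but its multipole expansions
in \<open>x\<close> and \<open>y\<close> contain homogeneous terms that are too large in the weighted norms. Let \<open>S\<close> be the dilation
\<open>(S \<psi>)(x) = \<psi> (x / 2)\<close> and \<open>Q = \<Prod>\<^sub>d (1 - 2\<^sup>d S)\<close>, where \<open>d \<noteq> -1\<close> runs over the homogeneity degrees of these terms.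
They cancel in \<open>Q \<psi>\<close>, which is therefore represented by \<open>\<sigma> \<cdot> \<nabla>\<psi>\<close> through a kernel bounded by
\<open>|x|\<^sup>\<alpha> |y|\<^sup>-\<^sup>\<alpha> W(x, y)\<close>, where \<open>W\<close> has the singularities of Riesz kernels and decays when \<open>|x|\<close> and \<open>|y|\<close> are of
different size. Schur's test gives the inequality at the exponent \<open>p = 2\<close>, the Hardy-Littlewood-Sobolev
inequality gives it at \<open>p = 6\<close>, and interpolation in between. Finally \<open>Q\<close> is bounded below on the weighted \<open>L\<^sup>p\<close> space: \<open>S\<close> multiplies
the norm by \<open>2 powr (1/2 - \<alpha>)\<close>, and \<open>\<alpha> \<notin> \<Lambda>\<close> says precisely that this is never \<open>2 powr (- d)\<close> for an integer \<open>d \<noteq> -1\<close>.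

If \<open>\<alpha> \<in> \<Lambda>\<close>, there is a homogeneous solution of \<open>\<sigma> \<cdot> \<nabla>\<psi> = 0\<close> of degree \<open>\<alpha> - 1/2\<close>. Cut off where
\<open>|ln |x|| \<sim> n\<close>, it has energy \<open>O(1/n)\<close>, while its weighted \<open>L\<^sup>p\<close> norm stays bounded below.
\<close>

section \<open>Smooth functions and cutoffs\<close>

text \<open>The Cauchy kernel has degree -2, so its expansion for small x has terms of degree 0, 1,
  2, ... in x and its expansion for large x terms of degree -2, -3, ...; degree -1 never occurs, and
  this gap is the missing k = 0 in \<open>Lambda\<close>. Which terms spoil the estimate depends on
  \<alpha>. The product Q removes finitely many of both families at once, without spherical
  harmonics and without a case distinction in \<alpha>; M \<ge> |\<alpha>| + 1 terms on each side
  leave enough decay. Two obstacles shape the rest. Only \<sigma> \<cdot> \<nabla>\<psi> is a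
  function, and it is known only against test functions supported off the origin. So the kernel is
  smoothed at its singularity and cut off at 0 and at infinity, and the cutoff leaves a boundary
  term containing \<psi> itself. It vanishes in the limit because Q has already improved the kernel
  and the weighted norm of \<psi> is finite. The same finiteness lets 1 - 2^d S be bounded below by
  absorption: a zero mode of degree d is annihilated by this factor, but its norm is
  infinite.\<close>

primrec Ck_on :: "(real^3) set \<Rightarrow> nat \<Rightarrow> (real^3 \<Rightarrow> complex) \<Rightarrow> bool" where
  "Ck_on S 0 \<phi> \<longleftrightarrow> continuous_on S \<phi>"
| "Ck_on S (Suc k) \<phi> \<longleftrightarrow> (\<forall>x\<in>S. \<phi> differentiable at x) \<and> (\<forall>j. Ck_on S k (partial_deriv j \<phi>))"

text \<open>\<open>test_function\<close> asks for smoothness on the whole space, but powers and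
  logarithms of the norm are smooth only off the origin. Hence a local notion, whose pieces are
  glued by \<open>smooth_on_Un\<close>: an explicit formula off a point and zero near it.\<close>

definition smooth_on :: "(real^3) set \<Rightarrow> (real^3 \<Rightarrow> complex) \<Rightarrow> bool" where
  "smooth_on S \<phi> \<longleftrightarrow> (\<forall>k. Ck_on S k \<phi>)"

definition rsmooth_on :: "(real^3) set \<Rightarrow> (real^3 \<Rightarrow> real) \<Rightarrow> bool" where
  "rsmooth_on S f \<longleftrightarrow> smooth_on S (\<lambda>x. complex_of_real (f x))"

section \<open>Calculus of smooth functions on open sets\<close>

lemma Ck_on_UNIV: "Ck_on UNIV k \<phi> \<longleftrightarrow> Ck k \<phi>"
  by (induction k arbitrary: \<phi>) (auto simp: differentiable_on_def)

lemma partial_deriv_eq: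
  assumes "(\<phi> has_derivative \<phi>') (at x)"
  shows "partial_deriv j \<phi> x = \<phi>' (axis j 1)"
  using frechet_derivative_at[OF assms] by (simp add: partial_deriv_def)

lemma partial_deriv_cong:
  assumes "open S" "x \<in> S" "\<And>x. x \<in> S \<Longrightarrow> \<phi> x = \<eta> x"
  shows "partial_deriv j \<phi> x = partial_deriv j \<eta> x"
proof -
  have "((\<phi> has_derivative F) (at x)) = ((\<eta> has_derivative F) (at x))" for F
    using assms(3) by (metis has_derivative_transform_within_open[OF _ assms(1,2)])
  then show ?thesis by (simp add: partial_deriv_def frechet_derivative_def)
qed

lemma Ck_on_cong:
  assumes "open S" "\<And>x. x \<in> S \<Longrightarrow> \<phi> x = \<eta> x" "Ck_on S k \<phi>"
  shows "Ck_on S k \<eta>"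
  using assms(2,3)
proof (induction k arbitrary: \<phi> \<eta>)
  case 0
  then show ?case using continuous_on_cong by fastforce
next
  case (Suc k)
  have "\<eta> differentiable at x" if x: "x \<in> S" for x
  proof -
    obtain F where "(\<phi> has_derivative F) (at x)"
      using Suc.prems x by (auto simp: differentiable_def)
    then have "(\<eta> has_derivative F) (at x)"
      by (rule has_derivative_transform_within_open[OF _ assms(1) x]) (use Suc.prems in auto)
    then show ?thesis by (auto simp: differentiable_def)
  qed
  moreover have "Ck_on S k (partial_deriv j \<eta>)" for j
    by (rule Suc.IH[of "partial_deriv j \<phi>"])
       (use Suc.prems in \<open>auto intro: partial_deriv_cong[OF assms(1)]\<close>)
  ultimately show ?case by simp
qed

lemma smooth_on_cong:
  assumes "open S" "smooth_on S \<phi>" "\<And>x. x \<in> S \<Longrightarrow> \<phi> x = \<eta> x"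
  shows "smooth_on S \<eta>"
  using assms Ck_on_cong unfolding smooth_on_def by blast

lemma Ck_on_Un:
  assumes "open S" "open T" "Ck_on S k \<phi>" "Ck_on T k \<phi>"
  shows "Ck_on (S \<union> T) k \<phi>"
  using assms(3,4)
  by (induction k arbitrary: \<phi>) (auto intro: continuous_on_open_Un assms)

lemma smooth_on_Un:
  "open S \<Longrightarrow> open T \<Longrightarrow> smooth_on S \<phi> \<Longrightarrow> smooth_on T \<phi> \<Longrightarrow> smooth_on (S \<union> T) \<phi>"
  unfolding smooth_on_def using Ck_on_Un by blast

lemma Ck_on_continuous: "Ck_on S k \<phi> \<Longrightarrow> continuous_on S \<phi>"
  by (cases k) (auto intro!: differentiable_imp_continuous_on simp: differentiable_on_def differentiable_at_withinI)

lemma Ck_on_Suc_imp: "Ck_on S (Suc k) \<phi> \<Longrightarrow> Ck_on S k \<phi>"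
proof (induction k arbitrary: \<phi>)
  case 0
  then show ?case using Ck_on_continuous by fastforce
qed auto

lemma Ck_on_add:
  assumes "open S" "Ck_on S k \<phi>" "Ck_on S k \<eta>"
  shows "Ck_on S k (\<lambda>x. \<phi> x + \<eta> x)"
  using assms(2,3)
proof (induction k arbitrary: \<phi> \<eta>)
  case (Suc k)
  have "partial_deriv j \<phi> x + partial_deriv j \<eta> x = partial_deriv j (\<lambda>x. \<phi> x + \<eta> x) x"
    if "x \<in> S" for x j
    unfolding partial_deriv_def using Suc.prems that
    by (subst frechet_derivative_at[symmetric, OF has_derivative_add])
       (auto simp: frechet_derivative_works)
  moreover have "Ck_on S k (\<lambda>x. partial_deriv j \<phi> x + partial_deriv j \<eta> x)" for j
    using Suc by auto
  ultimately have "Ck_on S k (partial_deriv j (\<lambda>x. \<phi> x + \<eta> x))" for j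
    by (rule Ck_on_cong[OF assms(1)])
  then show ?case using Suc.prems by auto
qed (auto intro: continuous_intros)

lemma partial_deriv_mult:
  assumes "\<phi> differentiable at x" "\<eta> differentiable at x"
  shows "partial_deriv j (\<lambda>x. \<phi> x * \<eta> x) x = partial_deriv j \<phi> x * \<eta> x + \<phi> x * partial_deriv j \<eta> x"
  unfolding partial_deriv_def using assms
  by (subst frechet_derivative_at[symmetric, OF has_derivative_mult])
     (auto simp: frechet_derivative_works)

lemma Ck_on_mult:
  assumes "open S" "Ck_on S k \<phi>" "Ck_on S k \<eta>"
  shows "Ck_on S k (\<lambda>x. \<phi> x * \<eta> x)"
  using assms(2,3)
proof (induction k arbitrary: \<phi> \<eta>)
  case (Suc k)
  have "Ck_on S k (\<lambda>x. partial_deriv j \<phi> x * \<eta> x + \<phi> x * partial_deriv j \<eta> x)" for j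
    using Suc.prems by (intro Ck_on_add assms Suc.IH) (auto intro: Ck_on_Suc_imp)
  then have "Ck_on S k (partial_deriv j (\<lambda>x. \<phi> x * \<eta> x))" for j
    by (rule Ck_on_cong[OF assms(1), rotated]) (use Suc.prems in \<open>simp add: partial_deriv_mult\<close>)
  then show ?case using Suc.prems by auto
qed (auto intro: continuous_intros)

lemma Ck_on_const: "Ck_on S k (\<lambda>x. c)"
proof (induction k arbitrary: c)
  case (Suc k)
  have "partial_deriv j (\<lambda>x. c) = (\<lambda>x. 0)" for j
    by (auto simp: partial_deriv_def)
  with Suc show ?case by simp
qed simp

lemma has_derivative_coord: "((\<lambda>x::real^3. complex_of_real (x $ i)) has_derivative (\<lambda>h. of_real (h $ i))) (at x)"
  by (auto intro!: derivative_eq_intros bounded_linear.has_derivative[OF bounded_linear_vec_nth])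

lemma Ck_on_coord: "Ck_on S k (\<lambda>x. complex_of_real (x $ i))"
proof (cases k)
  case (Suc m)
  have "partial_deriv j (\<lambda>x. complex_of_real (x $ i)) = (\<lambda>x. of_real (axis j 1 $ i))" for j
    by (rule ext, subst partial_deriv_eq[OF has_derivative_coord]) simp
  then show ?thesis using Suc has_derivative_coord[of i]
    by (auto simp: Ck_on_const differentiable_def)
qed (auto intro!: continuous_intros)

lemma rsmooth_on_const [intro]: "rsmooth_on S (\<lambda>x. c)"
  and rsmooth_on_coord [intro]: "rsmooth_on S (\<lambda>x. x $ i)"
  by (auto simp: rsmooth_on_def smooth_on_def Ck_on_const Ck_on_coord)

lemma rsmooth_on_add [intro]:
  assumes "open S" "rsmooth_on S f" "rsmooth_on S g"
  shows "rsmooth_on S (\<lambda>x. f x + g x)"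
  using assms by (auto simp: rsmooth_on_def smooth_on_def Ck_on_add)

lemma rsmooth_on_mult [intro]:
  assumes "open S" "rsmooth_on S f" "rsmooth_on S g"
  shows "rsmooth_on S (\<lambda>x. f x * g x)"
  using assms by (auto simp: rsmooth_on_def smooth_on_def Ck_on_mult)

lemma smooth_on_add [intro]:
  "open S \<Longrightarrow> smooth_on S f \<Longrightarrow> smooth_on S g \<Longrightarrow> smooth_on S (\<lambda>x. f x + g x)"
  by (auto simp: smooth_on_def Ck_on_add)

lemma smooth_on_mult [intro]:
  "open S \<Longrightarrow> smooth_on S f \<Longrightarrow> smooth_on S g \<Longrightarrow> smooth_on S (\<lambda>x. f x * g x)"
  by (auto simp: smooth_on_def Ck_on_mult)

lemma smooth_on_const [intro]: "smooth_on S (\<lambda>x. c)"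
  by (auto simp: smooth_on_def Ck_on_const)

lemma smooth_on_power [intro]: "open S \<Longrightarrow> smooth_on S f \<Longrightarrow> smooth_on S (\<lambda>x. f x ^ n)"
  by (induction n) auto

lemma rsmooth_on_minus [intro]:
  assumes "open S" "rsmooth_on S f"
  shows "rsmooth_on S (\<lambda>x. - f x)"
  using rsmooth_on_mult[OF assms(1) rsmooth_on_const[of S "-1"] assms(2)] by simp

lemma rsmooth_on_diff [intro]:
  assumes "open S" "rsmooth_on S f" "rsmooth_on S g"
  shows "rsmooth_on S (\<lambda>x. f x - g x)"
  using rsmooth_on_add[OF assms(1,2) rsmooth_on_minus[OF assms(1,3)]] by simp

lemma rsmooth_on_power [intro]: "open S \<Longrightarrow> rsmooth_on S f \<Longrightarrow> rsmooth_on S (\<lambda>x. f x ^ n)"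
  by (induction n) auto

lemma rsmooth_on_cong:
  assumes "open S" "rsmooth_on S f" "\<And>x. x \<in> S \<Longrightarrow> f x = g x"
  shows "rsmooth_on S g"
  using smooth_on_cong[OF assms(1), of "\<lambda>x. of_real (f x)" "\<lambda>x. of_real (g x)"] assms
  by (auto simp: rsmooth_on_def)

lemma rsmooth_on_Un:
  "open S \<Longrightarrow> open T \<Longrightarrow> rsmooth_on S f \<Longrightarrow> rsmooth_on T f \<Longrightarrow> rsmooth_on (S \<union> T) f"
  by (auto simp: rsmooth_on_def intro: smooth_on_Un)

lemma of_real_differentiable_imp:
  assumes "(\<lambda>x. complex_of_real (N x)) differentiable at x"
  obtains N' where "(N has_derivative N') (at x)" "\<And>j. partial_deriv j (\<lambda>x. complex_of_real (N x)) x = of_real (N' (axis j 1))"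
proof -
  obtain F where F: "((\<lambda>x. complex_of_real (N x)) has_derivative F) (at x)"
    using assms by (auto simp: differentiable_def)
  have 1: "(N has_derivative (\<lambda>h. Re (F h))) (at x)"
    using bounded_linear.has_derivative[OF bounded_linear_Re F] by simp
  then have "((\<lambda>x. complex_of_real (N x)) has_derivative (\<lambda>h. of_real (Re (F h)))) (at x)"
    by (rule has_derivative_of_real)
  from that[OF 1 partial_deriv_eq[OF this]] show ?thesis .
qed

text \<open>The outer function comes with the whole sequence of its derivatives. Differentiating
  \<open>D n (N x)\<close> produces \<open>D (Suc n) (N x)\<close>, so the induction on
  \<open>k\<close> is run for all \<open>n\<close> at once. The derivatives are demanded only at
  values of \<open>N\<close>, which admits \<open>powr\<close> and \<open>ln\<close> for positive
  \<open>N\<close>.\<close>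

lemma rsmooth_on_compose:
  assumes S: "open S" and N: "rsmooth_on S N"
    and D: "\<And>n x. x \<in> S \<Longrightarrow> (D n has_real_derivative D (Suc n) (N x)) (at (N x))"
  shows "rsmooth_on S (\<lambda>x. D n (N x))"
proof -
  have "Ck_on S k (\<lambda>x. complex_of_real (D n (N x)))" for k n
  proof (induction k arbitrary: n)
    case 0
    have "continuous_on S N"
    proof -
      have "continuous_on S (\<lambda>x. complex_of_real (N x))"
        using N unfolding rsmooth_on_def smooth_on_def by (metis Ck_on.simps(1))
      from continuous_on_Re[OF this] show ?thesis by simp
    qed
    then have "continuous (at x within S) (\<lambda>x. D n (N x))" if "x \<in> S" for x
      using D[OF that, THEN DERIV_isCont] that
      by (auto simp: continuous_on_eq_continuous_within intro: continuous_within_compose3)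
    then show ?case by (auto simp: continuous_on_eq_continuous_within intro!: continuous_intros)
  next
    case (Suc k)
    have N1: "Ck_on S (Suc k) (\<lambda>x. complex_of_real (N x))"
      using N unfolding rsmooth_on_def smooth_on_def by blast
    have *: "((\<lambda>x. complex_of_real (D n (N x))) differentiable at x) \<and>
        partial_deriv j (\<lambda>x. complex_of_real (D n (N x))) x =
        complex_of_real (D (Suc n) (N x)) * partial_deriv j (\<lambda>x. complex_of_real (N x)) x"
      if x: "x \<in> S" for x j
    proof -
      have "(\<lambda>x. complex_of_real (N x)) differentiable at x" using N1 x by auto
      then obtain N' where N': "(N has_derivative N') (at x)"
        "\<And>j. partial_deriv j (\<lambda>x. complex_of_real (N x)) x = of_real (N' (axis j 1))"
        by (auto elim!: of_real_differentiable_imp)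
      have "((\<lambda>x. D n (N x)) has_derivative (\<lambda>h. D (Suc n) (N x) * N' h)) (at x)"
        using has_derivative_compose[OF N'(1) D[OF x, unfolded has_field_derivative_def]] by simp
      then have "((\<lambda>x. complex_of_real (D n (N x))) has_derivative (\<lambda>h. of_real (D (Suc n) (N x) * N' h))) (at x)"
        by (rule has_derivative_of_real)
      from partial_deriv_eq[OF this] this N'(2) show ?thesis by (auto simp: differentiable_def)
    qed
    have "Ck_on S k (\<lambda>x. complex_of_real (D (Suc n) (N x)) * partial_deriv j (\<lambda>x. complex_of_real (N x)) x)" for j
      using N1 by (intro Ck_on_mult S Suc.IH) auto
    then have "Ck_on S k (partial_deriv j (\<lambda>x. complex_of_real (D n (N x))))" for j
      by (rule Ck_on_cong[OF S, rotated]) (use * in auto)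
    then show ?case using * by auto
  qed
  then show ?thesis by (auto simp: rsmooth_on_def smooth_on_def)
qed

lemma rsmooth_on_powr [intro]:
  assumes "open S" "rsmooth_on S N" "\<And>x. x \<in> S \<Longrightarrow> 0 < N x"
  shows "rsmooth_on S (\<lambda>x. N x powr a)"
proof -
  define D where "D n t = (\<Prod>i<n. a - real i) * t powr (a - real n)" for n t
  have "(D n has_real_derivative D (Suc n) t) (at t)" if "0 < t" for n t
  proof -
    have "((\<lambda>t. t powr (a - real n)) has_real_derivative (a - real n) * t powr (a - real n - 1)) (at t)"
      using has_real_derivative_powr[OF that] .
    from DERIV_cmult[OF this, of "\<Prod>i<n. a - real i"] show ?thesis
      by (simp add: D_def[abs_def] algebra_simps)
  qed
  then have "rsmooth_on S (\<lambda>x. D 0 (N x))"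
    by (intro rsmooth_on_compose[OF assms(1,2)]) (use assms in blast)
  then show ?thesis by (simp add: D_def)
qed

lemma rsmooth_on_inverse [intro]:
  assumes "open S" "rsmooth_on S N" "\<And>x. x \<in> S \<Longrightarrow> 0 < N x"
  shows "rsmooth_on S (\<lambda>x. inverse (N x))"
  by (rule rsmooth_on_cong[OF assms(1) rsmooth_on_powr[OF assms, of "-1"]])
     (use assms in \<open>auto simp: powr_minus less_imp_le\<close>)

lemma rsmooth_on_ln [intro]:
  assumes "open S" "rsmooth_on S N" "\<And>x. x \<in> S \<Longrightarrow> 0 < N x"
  shows "rsmooth_on S (\<lambda>x. ln (N x))"
proof -
  define D :: "nat \<Rightarrow> real \<Rightarrow> real" where
    "D n = (case n of 0 \<Rightarrow> ln | Suc m \<Rightarrow> (\<lambda>t. (\<Prod>i<m. - 1 - real i) * t powr (- 1 - real m)))" for n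
  have "(D n has_real_derivative D (Suc n) t) (at t)" if "0 < t" for n t
  proof (cases n)
    case 0
    then show ?thesis using DERIV_ln[OF that] that by (simp add: D_def powr_minus)
  next
    case (Suc m)
    have "((\<lambda>t. t powr (- 1 - real m)) has_real_derivative (- 1 - real m) * t powr (- 1 - real m - 1)) (at t)"
      using has_real_derivative_powr[OF that] .
    from DERIV_cmult[OF this, of "\<Prod>i<m. - 1 - real i"] show ?thesis
      by (simp add: D_def Suc algebra_simps)
  qed
  then have "rsmooth_on S (\<lambda>x. D 0 (N x))"
    by (intro rsmooth_on_compose[OF assms(1,2)]) (use assms in blast)
  then show ?thesis by (simp add: D_def)
qed

section \<open>A smooth step function\<close>

definition exp_bump :: "real \<Rightarrow> real" where
  "exp_bump t = (if 0 < t then exp (- inverse t) else 0)"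

definition exp_bump' :: "real \<Rightarrow> real" where
  "exp_bump' t = (if 0 < t then exp (- inverse t) / t\<^sup>2 else 0)"

lemma poly_exp_tendsto_0: "((\<lambda>t. poly q t * exp (- t)) \<longlongrightarrow> (0::real)) at_top"
proof -
  have "((\<lambda>t::real. \<Sum>i\<le>degree q. coeff q i * (t ^ i / exp t)) \<longlongrightarrow> (\<Sum>i\<le>degree q. coeff q i * 0)) at_top"
    by (intro tendsto_sum tendsto_mult tendsto_const tendsto_power_div_exp_0)
  then show ?thesis
    by (simp add: poly_altdef exp_minus divide_inverse sum_distrib_right mult.assoc)
qed

text \<open>Functions q(1/t) exp(-1/t), extended by zero to t \<le> 0, are closed under
  differentiation: q becomes X^2 (q - q'). One statement for all q therefore yields all derivatives
  of \<open>exp_bump\<close>, including those at 0.\<close>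

lemma poly_exp_bump_deriv:
  fixes q :: "real poly"
  shows "((\<lambda>t. if 0 < t then poly q (inverse t) * exp (- inverse t) else 0) has_real_derivative
     (if 0 < t then poly ([:0,0,1:] * (q - pderiv q)) (inverse t) * exp (- inverse t) else 0)) (at t)"
proof -
  define h where "h q t = (if 0 < t then poly q (inverse t) * exp (- inverse t) else 0)" for q and t :: real
  have pos: "(h q has_real_derivative h ([:0,0,1:] * (q - pderiv q)) t) (at t)" if "0 < t"
  proof -
    have "((\<lambda>t. poly q (inverse t) * exp (- inverse t)) has_real_derivative h ([:0,0,1:] * (q - pderiv q)) t) (at t)"
      using that unfolding h_def
      by (auto intro!: derivative_eq_intros simp: field_simps power2_eq_square)
    then show ?thesis
      by (rule has_field_derivative_transform_within_open[of _ _ _ "{0<..}"]) (use that in \<open>auto simp: h_def\<close>)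
  qed
  have neg: "(h q has_real_derivative h ([:0,0,1:] * (q - pderiv q)) t) (at t)" if "t < 0"
  proof -
    have "((\<lambda>t. 0) has_real_derivative h ([:0,0,1:] * (q - pderiv q)) t) (at t)"
      using that by (auto simp: h_def)
    then show ?thesis
      by (rule has_field_derivative_transform_within_open[of _ _ _ "{..<0}"]) (use that in \<open>auto simp: h_def\<close>)
  qed
  have zero: "(h q has_real_derivative 0) (at 0)"
  proof -
    \<comment> \<open>Dividing by t multiplies q by X, so the difference quotient at 0 is again of
      the same form and tends to 0 by the decay of polynomial times exponential.\<close>
    have "((\<lambda>t. poly (q * [:0,1:]) (inverse t) * exp (- inverse t)) \<longlongrightarrow> 0) (at_right (0::real))"
      using filterlim_compose[OF poly_exp_tendsto_0 filterlim_inverse_at_top_right] .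
    then have R: "((\<lambda>t. (h q t - h q 0) / (t - 0)) \<longlongrightarrow> 0) (at_right 0)"
      by (rule tendsto_cong[THEN iffD1, rotated])
         (auto simp: eventually_at_right_field h_def field_simps intro!: exI[of _ 1])
    have L: "((\<lambda>t. (h q t - h q 0) / (t - 0)) \<longlongrightarrow> 0) (at_left 0)"
      by (rule tendsto_cong[THEN iffD1, rotated, OF tendsto_const])
         (auto simp: eventually_at_left_field h_def intro!: exI[of _ "-1"])
    from L R show ?thesis
      by (simp add: has_field_derivative_iff filterlim_split_at)
  qed
  have "(h q has_real_derivative h ([:0,0,1:] * (q - pderiv q)) t) (at t)"
    using pos neg zero by (cases t "0::real" rule: linorder_cases) (auto simp: h_def[of _ 0])
  then show ?thesis by (simp only: h_def[abs_def])
qed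

lemma exp_bump_DERIV: "(exp_bump has_real_derivative exp_bump' t) (at t)"
  using poly_exp_bump_deriv[of 1 t]
  by (auto simp: exp_bump_def[abs_def] exp_bump'_def power2_eq_square field_simps cong: if_cong)

lemma exp_bump'_continuous: "isCont exp_bump' t"
proof -
  have *: "exp_bump' = (\<lambda>t. if 0 < t then poly [:0,0,1:] (inverse t) * exp (- inverse t) else 0)"
    by (auto simp: exp_bump'_def fun_eq_iff power2_eq_square field_simps)
  show ?thesis unfolding * using poly_exp_bump_deriv by (rule DERIV_isCont)
qed

lemma rsmooth_on_exp_bump:
  assumes "open S" "rsmooth_on S N"
  shows "rsmooth_on S (\<lambda>x. exp_bump (N x))"
proof -
  define p where "p = rec_nat (1::real poly) (\<lambda>_ q. [:0,0,1:] * (q - pderiv q))"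
  define D where "D n t = (if 0 < t then poly (p n) (inverse t) * exp (- inverse t) else 0)" for n t
  have "(D n has_real_derivative D (Suc n) t) (at t)" for n t
    using poly_exp_bump_deriv[of "p n" t] unfolding D_def p_def nat.rec .
  then have "rsmooth_on S (\<lambda>x. D 0 (N x))"
    by (intro rsmooth_on_compose[OF assms(1,2)]) (use assms in blast)
  moreover have "p 0 = 1" unfolding p_def by (rule nat.rec)
  ultimately show ?thesis by (simp add: D_def exp_bump_def[abs_def] cong: if_cong)
qed

definition step :: "real \<Rightarrow> real" where
  "step t = exp_bump t * inverse (exp_bump t + exp_bump (1 - t))"

definition step' :: "real \<Rightarrow> real" where
  "step' t = (exp_bump' t * exp_bump (1 - t) + exp_bump t * exp_bump' (1 - t)) / (exp_bump t + exp_bump (1 - t))\<^sup>2"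

lemma exp_bump_nonneg: "0 \<le> exp_bump t" and exp_bump'_nonneg: "0 \<le> exp_bump' t"
  by (auto simp: exp_bump_def exp_bump'_def)

lemma exp_bump_sum_pos: "0 < exp_bump t + exp_bump (1 - t)"
  by (auto simp: exp_bump_def intro: add_pos_pos)

lemma step_DERIV: "(step has_real_derivative step' t) (at t)"
proof -
  have 1: "((\<lambda>t. exp_bump (1 - t)) has_real_derivative - exp_bump' (1 - t)) (at t)"
  proof -
    have "((\<lambda>t. 1 - t) has_real_derivative -1) (at t)"
      by (auto intro!: derivative_eq_intros)
    from DERIV_chain2[OF exp_bump_DERIV this] show ?thesis by simp
  qed
  have nz: "exp_bump t + exp_bump (1 - t) \<noteq> 0"
    using exp_bump_sum_pos[of t] by simp
  have "((\<lambda>t. exp_bump t / (exp_bump t + exp_bump (1 - t))) has_real_derivative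
      (exp_bump' t * (exp_bump t + exp_bump (1 - t)) - exp_bump t * (exp_bump' t + - exp_bump' (1 - t)))
        / ((exp_bump t + exp_bump (1 - t)) * (exp_bump t + exp_bump (1 - t)))) (at t)"
    by (intro DERIV_divide DERIV_add exp_bump_DERIV 1 nz)
  also have "exp_bump' t * (exp_bump t + exp_bump (1 - t)) - exp_bump t * (exp_bump' t + - exp_bump' (1 - t))
      = exp_bump' t * exp_bump (1 - t) + exp_bump t * exp_bump' (1 - t)"
    by (simp add: algebra_simps)
  finally show ?thesis
    by (simp add: step_def[abs_def] step'_def power2_eq_square divide_inverse)
qed

lemma step'_continuous: "continuous_on S step'"
proof -
  have "continuous_on UNIV exp_bump" "continuous_on UNIV exp_bump'"
    using exp_bump'_continuous exp_bump_DERIV[THEN DERIV_isCont]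
    by (auto simp: continuous_on_eq_continuous_at)
  note c = this[THEN continuous_on_compose2[OF _ _ subset_UNIV]]
  have [simp]: "exp_bump t + exp_bump (1 - t) \<noteq> 0" for t
    using exp_bump_sum_pos[of t] by simp
  show ?thesis
    unfolding step'_def[abs_def] by (intro continuous_intros c) auto
qed

lemma step_continuous: "continuous_on S step"
  by (intro continuous_at_imp_continuous_on ballI DERIV_isCont[OF step_DERIV])

lemma step_nonneg: "0 \<le> step t" and step_le_1: "step t \<le> 1"
  using exp_bump_sum_pos[of t] exp_bump_nonneg[of t] exp_bump_nonneg[of "1 - t"]
  by (auto simp: step_def field_simps)

lemma step_eq_0: "t \<le> 0 \<Longrightarrow> step t = 0" and step_eq_1: "1 \<le> t \<Longrightarrow> step t = 1"
  by (auto simp: step_def exp_bump_def)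

lemma step'_nonneg: "0 \<le> step' t"
  by (auto simp: step'_def intro!: divide_nonneg_nonneg add_nonneg_nonneg mult_nonneg_nonneg exp_bump_nonneg exp_bump'_nonneg)

lemma step'_eq_0: "t \<le> 0 \<or> 1 \<le> t \<Longrightarrow> step' t = 0"
  by (auto simp: step'_def exp_bump_def exp_bump'_def)

lemma step'_pos: "0 < t \<Longrightarrow> t < 1 \<Longrightarrow> 0 < step' t"
proof -
  assume t: "0 < t" "t < 1"
  have "exp_bump t + exp_bump (1 - t) \<noteq> 0"
    using exp_bump_sum_pos[of t] by simp
  with t show ?thesis
    unfolding step'_def
    by (intro divide_pos_pos add_pos_pos mult_pos_pos) (auto simp: exp_bump_def exp_bump'_def)
qed

lemma step'_bounded: obtains B where "0 < B" "\<And>t. step' t \<le> B"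
proof -
  have "bounded (step' ` {0..1})"
    by (intro compact_imp_bounded compact_continuous_image step'_continuous) auto
  then obtain B where B: "B > 0" "\<And>t. t \<in> {0..1} \<Longrightarrow> \<bar>step' t\<bar> \<le> B"
    by (auto simp: bounded_pos)
  have "step' t \<le> B" for t
    using B(1) B(2)[of t] step'_eq_0[of t] by (cases "t \<in> {0..1}") auto
  with B(1) that show ?thesis by blast
qed

lemma rsmooth_on_step:
  assumes "open S" "rsmooth_on S N"
  shows "rsmooth_on S (\<lambda>x. step (N x))"
proof -
  have 1: "rsmooth_on S (\<lambda>x. exp_bump (N x))" "rsmooth_on S (\<lambda>x. exp_bump (1 - N x))"
    using assms by (auto intro!: rsmooth_on_exp_bump rsmooth_on_diff)
  show ?thesis
    unfolding step_def
    by (rule rsmooth_on_mult[OF assms(1) 1(1) rsmooth_on_inverse[OF assms(1) rsmooth_on_add[OF assms(1) 1]]])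
       (rule exp_bump_sum_pos)
qed

section \<open>Riesz potentials\<close>

abbreviation nn_lborel :: "(real^3 \<Rightarrow> ennreal) \<Rightarrow> ennreal" where
  "nn_lborel f \<equiv> integral\<^sup>N lborel f"

section \<open>Integrals of powers of the norm\<close>

lemma nn_integral_affine_euclidean:
  fixes t :: "'a::euclidean_space"
  assumes [measurable]: "f \<in> borel_measurable borel" and c: "c \<noteq> 0"
  shows "(\<integral>\<^sup>+x. f x \<partial>lborel) = ennreal (\<bar>c\<bar> ^ DIM('a)) * (\<integral>\<^sup>+x. f (t + c *\<^sub>R x) \<partial>lborel)"
  by (subst lborel_affine[OF c, of t])
     (simp add: nn_integral_density nn_integral_distr nn_integral_cmult)

lemma dyadic_shell:
  fixes r :: real
  assumes "0 < r" "r \<le> 1"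
  obtains k :: nat where "(1/2) ^ Suc k < r" "r \<le> (1/2) ^ k"
proof -
  obtain n where n: "(1/2) ^ n < r"
    using real_arch_pow_inv[of r "1/2"] assms by auto
  define m where "m = (LEAST n. (1/2) ^ n < r)"
  have m: "(1/2) ^ m < r" unfolding m_def by (rule LeastI[of _ n]) (rule n)
  have "m \<noteq> 0" using m assms by (cases m) auto
  then obtain k where k: "m = Suc k" by (cases m) auto
  have "\<not> (1/2) ^ k < r"
    using not_less_Least[of k "\<lambda>n. (1/2) ^ n < r"] k unfolding m_def by simp
  with m k that show ?thesis by simp
qed

lemma suminf_ennreal_geometric_finite:
  assumes "0 \<le> a" "0 \<le> x" "x < (1::real)"
  shows "(\<Sum>k. ennreal (a * x ^ k)) < \<infinity>"
  using assms by (subst suminf_ennreal2) (auto intro!: summable_mult summable_geometric)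

text \<open>On the shell between radii 2^-(k+1) and 2^-k the integrand is at most 2^(s(k+1)), and
  the ball containing the shell has volume of order 8^-k. The resulting geometric series has ratio
  2^s / 8, below 1 exactly when s < 3.\<close>

lemma nn_integral_powr_cball_1:
  fixes s :: real
  assumes s: "0 \<le> s" "s < 3"
  shows "nn_lborel (\<lambda>z. ennreal (norm z powr - s) * indicator {z. norm z \<le> 1} z) < \<infinity>"
proof -
  define g where "g k z = ennreal (2 powr (s * Suc k)) * indicator (cball 0 ((1/2)^k)) z" for k and z :: "real^3"
  have [measurable]: "g k \<in> borel_measurable borel" for k
    unfolding g_def
    by (intro borel_measurable_times_ennreal borel_measurable_const borel_measurable_indicator borel_closed closed_cball)
  have "ennreal (norm z powr - s) * indicator {z. norm z \<le> 1} z \<le> (\<Sum>k. g k z)" if "z \<noteq> 0" for z :: "real^3"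
  proof (cases "norm z \<le> 1")
    case True
    obtain k where k: "(1/2) ^ Suc k < norm z" "norm z \<le> (1/2) ^ k"
      by (rule dyadic_shell[of "norm z"]) (use True \<open>z \<noteq> 0\<close> in auto)
    have "norm z powr - s \<le> ((1/2) ^ Suc k) powr - s"
      using k s by (intro powr_mono2') auto
    also have "\<dots> = 2 powr (s * Suc k)"
    proof -
      have "(1/2::real) ^ Suc k = 2 powr - real (Suc k)"
        by (simp add: powr_minus powr_realpow power_one_over inverse_eq_divide del: power_Suc of_nat_Suc)
      then show ?thesis by (simp add: powr_powr mult.commute del: power_Suc of_nat_Suc)
    qed
    finally have "ennreal (norm z powr - s) * indicator {z. norm z \<le> 1} z \<le> g k z"
      using k True by (auto simp: g_def intro!: ennreal_leI)
    also have "\<dots> \<le> (\<Sum>k. g k z)"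
      using sum_le_suminf[of "\<lambda>k. g k z" "{k}"] by auto
    finally show ?thesis .
  qed auto
  then have "nn_lborel (\<lambda>z. ennreal (norm z powr - s) * indicator {z. norm z \<le> 1} z) \<le> nn_lborel (\<lambda>z. \<Sum>k. g k z)"
    by (intro nn_integral_mono_AE) (use AE_lborel_singleton[of "0::real^3"] in \<open>auto elim!: eventually_mono\<close>)
  also have "\<dots> = (\<Sum>k. nn_lborel (g k))"
    by (rule nn_integral_suminf) auto
  also have "\<dots> = (\<Sum>k. ennreal ((2 powr s * unit_ball_vol 3) * (2 powr s / 8) ^ k))"
  proof (intro arg_cong[where f=suminf] ext)
    fix k
    have "nn_lborel (g k) = ennreal (2 powr (s * Suc k)) * ennreal (unit_ball_vol 3 * ((1/2)^k)^3)"
      unfolding g_def by (subst nn_integral_cmult_indicator) (auto simp: emeasure_cball)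
    also have "\<dots> = ennreal (2 powr (s * Suc k) * (unit_ball_vol 3 * ((1/2)^k)^3))"
      by (simp add: ennreal_mult')
    also have "2 powr (s * Suc k) = 2 powr s * (2 powr s) ^ k"
    proof -
      have "(2 powr s) ^ k = 2 powr (s * k)"
        by (subst powr_realpow[symmetric]) (simp_all add: powr_powr)
      then show ?thesis by (simp add: powr_add distrib_left)
    qed
    also have "((1/2::real)^k)^3 = (1/8)^k"
      by (simp add: power_mult[symmetric] mult.commute[of k 3]) (simp add: power_mult power3_eq_cube)
    finally show "nn_lborel (g k) = ennreal ((2 powr s * unit_ball_vol 3) * (2 powr s / 8) ^ k)" by (simp add: power_divide algebra_simps)
  qed
  also have "\<dots> < \<infinity>"
  proof (rule suminf_ennreal_geometric_finite)
    have "2 powr s < 2 powr 3" using s by (intro powr_less_mono) auto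
    then show "2 powr s / 8 < 1" by simp
  qed auto
  finally show ?thesis .
qed

lemma nn_integral_powr_outside_1:
  fixes s :: real
  assumes s: "3 < s"
  shows "nn_lborel (\<lambda>z. ennreal (norm z powr - s) * indicator {z. 1 \<le> norm z} z) < \<infinity>"
proof -
  define g where "g k z = ennreal (2 powr - (s * k)) * indicator (cball 0 (2^Suc k)) z" for k :: nat and z :: "real^3"
  have [measurable]: "g k \<in> borel_measurable borel" for k
    unfolding g_def
    by (intro borel_measurable_times_ennreal borel_measurable_const borel_measurable_indicator borel_closed closed_cball)
  have "ennreal (norm z powr - s) * indicator {z. 1 \<le> norm z} z \<le> (\<Sum>k. g k z)" for z :: "real^3"
  proof (cases "1 \<le> norm z")
    case True
    obtain k where k: "(1/2) ^ Suc k < 1 / norm z" "1 / norm z \<le> (1/2) ^ k"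
    proof (rule dyadic_shell[of "1 / norm z"])
      show "0 < 1 / norm z" using True by (intro divide_pos_pos) auto
      show "1 / norm z \<le> 1" using True by (auto simp: divide_le_eq)
    qed
    then have k': "norm z < 2 ^ Suc k" "2 ^ k \<le> norm z"
    proof -
      have "0 < norm z" using True by linarith
      with k show "norm z < 2 ^ Suc k" "2 ^ k \<le> norm z"
        by (simp_all add: field_simps)
    qed
    have "norm z powr - s \<le> (2 ^ k) powr - s"
      using k' s by (intro powr_mono2') auto
    also have "\<dots> = 2 powr - (s * k)"
    proof -
      have "(2::real) ^ k = 2 powr k" by (simp add: powr_realpow)
      then show ?thesis by (simp add: powr_powr mult.commute)
    qed
    finally have "ennreal (norm z powr - s) * indicator {z. 1 \<le> norm z} z \<le> g k z"
      using k' True by (auto simp: g_def intro!: ennreal_leI)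
    also have "\<dots> \<le> (\<Sum>k. g k z)"
      using sum_le_suminf[of "\<lambda>k. g k z" "{k}"] by auto
    finally show ?thesis .
  qed auto
  then have "nn_lborel (\<lambda>z. ennreal (norm z powr - s) * indicator {z. 1 \<le> norm z} z) \<le> nn_lborel (\<lambda>z. \<Sum>k. g k z)"
    by (intro nn_integral_mono) auto
  also have "\<dots> = (\<Sum>k. nn_lborel (g k))"
    by (rule nn_integral_suminf) auto
  also have "\<dots> = (\<Sum>k. ennreal (8 * unit_ball_vol 3 * (8 * 2 powr - s) ^ k))"
  proof (intro arg_cong[where f=suminf] ext)
    fix k
    have "nn_lborel (g k) = ennreal (2 powr - (s * k)) * ennreal (unit_ball_vol 3 * (2^Suc k)^3)"
      unfolding g_def by (subst nn_integral_cmult_indicator) (auto simp: emeasure_cball)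
    also have "\<dots> = ennreal (2 powr - (s * k) * (unit_ball_vol 3 * (2^Suc k)^3))"
      by (simp add: ennreal_mult')
    also have "2 powr - (s * k) = (2 powr - s) ^ k"
      by (subst powr_realpow[symmetric]) (simp_all add: powr_powr)
    also have "((2::real)^Suc k)^3 = 8 * 8^k"
      by (simp add: power_mult_distrib power_mult[symmetric] mult.commute[of k 3]) (simp add: power_mult)
    finally show "nn_lborel (g k) = ennreal (8 * unit_ball_vol 3 * (8 * 2 powr - s) ^ k)" by (simp add: power_mult_distrib algebra_simps)
  qed
  also have "\<dots> < \<infinity>"
  proof (rule suminf_ennreal_geometric_finite)
    have "2 powr - s < 2 powr - 3" using s by (intro powr_less_mono) auto
    then show "8 * 2 powr - s < 1" by (simp add: powr_minus)
  qed auto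
  finally show ?thesis .
qed

text \<open>Dilation by r reduces this to the unit ball and produces the power r^(3 - s). Adding 1
  to the constant only makes it positive.\<close>

lemma nn_integral_powr_cball:
  fixes s :: real
  assumes s: "0 \<le> s" "s < 3"
  obtains C where "0 < C" "\<And>r. 0 < r \<Longrightarrow>
    nn_lborel (\<lambda>z. ennreal (norm z powr - s) * indicator ({z. norm z \<le> r}) z) \<le> ennreal (C * r powr (3 - s))"
proof -
  define J where "J = nn_lborel (\<lambda>z. ennreal (norm z powr - s) * indicator {z. norm z \<le> 1} z)"
  obtain C where C: "J = ennreal C" "0 \<le> C"
    using nn_integral_powr_cball_1[OF s] unfolding J_def[symmetric] by (cases J) auto
  show ?thesis
  proof (rule that[of "C + 1"])
    fix r :: real assume r: "0 < r"
    have "nn_lborel (\<lambda>z. ennreal (norm z powr - s) * indicator ({z. norm z \<le> r}) z)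
       = ennreal (\<bar>r\<bar> ^ 3) * nn_lborel (\<lambda>z. ennreal (norm (0 + r *\<^sub>R z) powr - s) * indicator ({z. norm z \<le> r}) (0 + r *\<^sub>R z))"
      using r by (subst nn_integral_affine_euclidean[where t=0 and c=r]) auto
    also have "\<dots> = ennreal (r ^ 3) * nn_lborel (\<lambda>z. ennreal (r powr - s) * (ennreal (norm z powr - s) * indicator {z. norm z \<le> 1} z))"
      using r by (auto intro!: nn_integral_cong arg_cong2[of _ _ _ _ "(*)"]
          simp: powr_mult ennreal_mult' mult.assoc split: split_indicator)
    also have "\<dots> = ennreal (r ^ 3 * r powr - s * C)"
      using r C by (subst nn_integral_cmult) (auto simp: J_def[symmetric] ennreal_mult' mult.assoc)
    also have "r ^ 3 * r powr - s = r powr (3 - s)"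
      using r powr_realpow[of r 3] by (simp add: powr_diff powr_minus divide_inverse)
    finally show "nn_lborel (\<lambda>z. ennreal (norm z powr - s) * indicator ({z. norm z \<le> r}) z) \<le> ennreal ((C + 1) * r powr (3 - s))"
      by (simp add: ennreal_leI algebra_simps)
  qed (use C in auto)
qed

lemma nn_integral_powr_outside:
  fixes s :: real
  assumes s: "3 < s"
  obtains C where "0 < C" "\<And>r. 0 < r \<Longrightarrow>
    nn_lborel (\<lambda>z. ennreal (norm z powr - s) * indicator {z. r \<le> norm z} z) \<le> ennreal (C * r powr (3 - s))"
proof -
  define J where "J = nn_lborel (\<lambda>z. ennreal (norm z powr - s) * indicator {z. 1 \<le> norm z} z)"
  obtain C where C: "J = ennreal C" "0 \<le> C"
    using nn_integral_powr_outside_1[OF s] unfolding J_def[symmetric] by (cases J) auto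
  show ?thesis
  proof (rule that[of "C + 1"])
    fix r :: real assume r: "0 < r"
    have "nn_lborel (\<lambda>z. ennreal (norm z powr - s) * indicator {z. r \<le> norm z} z)
       = ennreal (\<bar>r\<bar> ^ 3) * nn_lborel (\<lambda>z. ennreal (norm (0 + r *\<^sub>R z) powr - s) * indicator {z. r \<le> norm z} (0 + r *\<^sub>R z))"
      using r by (subst nn_integral_affine_euclidean[where t=0 and c=r]) auto
    also have "\<dots> = ennreal (r ^ 3) * nn_lborel (\<lambda>z. ennreal (r powr - s) * (ennreal (norm z powr - s) * indicator {z. 1 \<le> norm z} z))"
      using r by (auto intro!: nn_integral_cong arg_cong2[of _ _ _ _ "(*)"]
          simp: powr_mult ennreal_mult' mult.assoc split: split_indicator)
    also have "\<dots> = ennreal (r ^ 3 * r powr - s * C)"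
      using r C by (subst nn_integral_cmult) (auto simp: J_def[symmetric] ennreal_mult' mult.assoc)
    also have "r ^ 3 * r powr - s = r powr (3 - s)"
      using r powr_realpow[of r 3] by (simp add: powr_diff powr_minus divide_inverse)
    finally show "nn_lborel (\<lambda>z. ennreal (norm z powr - s) * indicator {z. r \<le> norm z} z) \<le> ennreal ((C + 1) * r powr (3 - s))"
      by (simp add: ennreal_leI algebra_simps)
  qed (use C in auto)
qed

section \<open>Layer cake, Cauchy-Schwarz and the Hardy-Littlewood-Sobolev inequality\<close>

lemma layer_cake_square:
  fixes v :: ennreal
  shows "v\<^sup>2 \<le> (\<integral>\<^sup>+\<mu>. ennreal (2 * \<mu>) * indicator {\<mu>. 0 < \<mu> \<and> ennreal \<mu> < v} \<mu> \<partial>lborel)"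
proof -
  \<comment> \<open>The square of r is the integral of 2 \<mu> over [0, r]. Going through finite r
    \<le> v also covers v = \<infinity>; the endpoints 0 and r, where a strict inequality may fail,
    are null sets.\<close>
  have fin: "ennreal (r\<^sup>2) \<le> (\<integral>\<^sup>+\<mu>. ennreal (2 * \<mu>) * indicator {\<mu>. 0 < \<mu> \<and> ennreal \<mu> < v} \<mu> \<partial>lborel)"
    if r: "0 \<le> r" "ennreal r \<le> v" for r
  proof -
    have "ennreal (r\<^sup>2) = (\<integral>\<^sup>+\<mu>. ennreal (2 * \<mu>) * indicator {0..r} \<mu> \<partial>lborel)"
      by (subst nn_integral_FTC_Icc[where F="\<lambda>\<mu>. \<mu>\<^sup>2"]) (use r in \<open>auto intro!: derivative_eq_intros\<close>)
    also have "\<dots> \<le> (\<integral>\<^sup>+\<mu>. ennreal (2 * \<mu>) * indicator {\<mu>. 0 < \<mu> \<and> ennreal \<mu> < v} \<mu> \<partial>lborel)"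
    proof (rule nn_integral_mono_AE)
      have "ennreal \<mu> < v" if "\<mu> \<noteq> r" "\<mu> \<le> r" "0 \<le> \<mu>" for \<mu>
      proof -
        have "ennreal \<mu> < ennreal r" using that r by (subst ennreal_less_iff) (auto simp: less_le)
        then show ?thesis using r by auto
      qed
      then have *: "ennreal (2 * \<mu>) * indicator {0..r} \<mu> \<le> ennreal (2 * \<mu>) * indicator {\<mu>. 0 < \<mu> \<and> ennreal \<mu> < v} \<mu>"
        if "\<mu> \<noteq> 0" "\<mu> \<noteq> r" for \<mu>
        using that by (auto split: split_indicator)
      show "AE \<mu> in lborel. ennreal (2 * \<mu>) * indicator {0..r} \<mu> \<le> ennreal (2 * \<mu>) * indicator {\<mu>. 0 < \<mu> \<and> ennreal \<mu> < v} \<mu>"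
        using AE_lborel_singleton[of "0::real"] AE_lborel_singleton[of r]
        by eventually_elim (rule *)
    qed
    finally show ?thesis .
  qed
  show ?thesis
  proof (cases v)
    case (real r)
    then show ?thesis using fin[of r] by (simp add: ennreal_power)
  next
    case top
    have "ennreal (real n) \<le> (\<integral>\<^sup>+\<mu>. ennreal (2 * \<mu>) * indicator {\<mu>. 0 < \<mu> \<and> ennreal \<mu> < v} \<mu> \<partial>lborel)" for n
    proof -
      have "real n \<le> (real n)\<^sup>2" by (cases n) (auto simp: power2_eq_square)
      then have "ennreal (real n) \<le> ennreal ((real n)\<^sup>2)" by (rule ennreal_leI)
      also note fin[of "real n"]
      finally show ?thesis using top by simp
    qed
    then show ?thesis
    proof -
      assume *: "\<And>n. ennreal (real n) \<le> (\<integral>\<^sup>+\<mu>. ennreal (2 * \<mu>) * indicator {\<mu>. 0 < \<mu> \<and> ennreal \<mu> < v} \<mu> \<partial>lborel)"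
      show ?thesis
      proof (cases "\<integral>\<^sup>+\<mu>. ennreal (2 * \<mu>) * indicator {\<mu>. 0 < \<mu> \<and> ennreal \<mu> < v} \<mu> \<partial>lborel")
        case (real q)
        obtain n :: nat where "q < real n" using reals_Archimedean2 by blast
        with *[of n] real show ?thesis by (simp add: ennreal_le_iff)
      next
        case top
        then show ?thesis unfolding top by simp
      qed
    qed
  qed
qed

text \<open>Splitting w g into sqrt (w h) and sqrt (w / h) g. The proof goes through Young's
  inequality with a free parameter t, which needs no finiteness beforehand and shows that the left
  side is finite as soon as the right side is.\<close>

lemma nn_Cauchy_Schwarz_weighted:
  fixes w g h :: "'a \<Rightarrow> real"
  assumes [measurable]: "w \<in> borel_measurable M" "g \<in> borel_measurable M" "h \<in> borel_measurable M"
    and w: "\<And>y. 0 \<le> w y" and g: "\<And>y. 0 \<le> g y" and h: "AE y in M. 0 < h y"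
    and P: "0 < P" "(\<integral>\<^sup>+y. ennreal (w y * h y) \<partial>M) \<le> ennreal P"
  shows "(\<integral>\<^sup>+y. ennreal (w y * g y) \<partial>M)\<^sup>2 \<le> ennreal P * (\<integral>\<^sup>+y. ennreal (w y * (g y)\<^sup>2 / h y) \<partial>M)"
proof -
  let ?u = "\<integral>\<^sup>+y. ennreal (w y * g y) \<partial>M" and ?Q = "\<integral>\<^sup>+y. ennreal (w y * (g y)\<^sup>2 / h y) \<partial>M"
  have young: "?u \<le> ennreal (t / 2 * P) + ennreal (1 / (2 * t)) * ?Q" if t: "0 < t" for t
  proof -
    have "?u \<le> (\<integral>\<^sup>+y. ennreal (t / 2) * ennreal (w y * h y) + ennreal (1 / (2 * t)) * ennreal (w y * (g y)\<^sup>2 / h y) \<partial>M)"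
    proof (rule nn_integral_mono_AE)
      have "ennreal (w y * g y) \<le> ennreal (t / 2) * ennreal (w y * h y) + ennreal (1 / (2 * t)) * ennreal (w y * (g y)\<^sup>2 / h y)"
        if hy: "0 < h y" for y
      proof -
        have "0 \<le> (t * h y - g y)\<^sup>2 / (2 * t * h y)" using hy t by simp
        also have "\<dots> = t / 2 * h y + 1 / (2 * t) * (g y)\<^sup>2 / h y - g y"
          using hy t by (simp add: field_simps power2_eq_square)
        finally have "w y * g y \<le> w y * (t / 2 * h y + 1 / (2 * t) * (g y)\<^sup>2 / h y)"
          using w by (intro mult_left_mono) auto
        then have "w y * g y \<le> t / 2 * (w y * h y) + 1 / (2 * t) * (w y * (g y)\<^sup>2 / h y)"
          by (simp add: algebra_simps)
        then show ?thesis
          using t w hy by (subst (1 2) ennreal_mult[symmetric]) (auto simp flip: ennreal_plus intro!: ennreal_leI)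
      qed
      with h show "AE y in M. ennreal (w y * g y) \<le> ennreal (t / 2) * ennreal (w y * h y) + ennreal (1 / (2 * t)) * ennreal (w y * (g y)\<^sup>2 / h y)"
        by (auto elim!: eventually_mono)
    qed
    also have "\<dots> = ennreal (t / 2) * (\<integral>\<^sup>+y. ennreal (w y * h y) \<partial>M) + ennreal (1 / (2 * t)) * ?Q"
      by (simp add: nn_integral_add nn_integral_cmult)
    also have "\<dots> \<le> ennreal (t / 2) * ennreal P + ennreal (1 / (2 * t)) * ?Q"
      using P by (intro add_mono mult_left_mono) auto
    finally show ?thesis using t P by (simp flip: ennreal_mult)
  qed
  show ?thesis
  proof (cases ?Q)
    case top
    then show ?thesis using P by (simp add: ennreal_mult_top)
  next
    case (real q)
    have y: "?u \<le> ennreal (t / 2 * P + q / (2 * t))" if "0 < t" for t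
      using young[OF that] real that P by (simp add: ennreal_mult[symmetric] ennreal_plus[symmetric] del: ennreal_plus)
    obtain u where u: "?u = ennreal u" "0 \<le> u"
      using y[of 1] by (cases ?u) (auto simp: top_unique)
    have yu: "u \<le> t / 2 * P + q / (2 * t)" if "0 < t" for t
      using y[OF that] u that P real by (subst (asm) u) (auto simp: ennreal_le_iff simp flip: ennreal_plus)
    have "u\<^sup>2 \<le> P * q"
    proof (cases "u = 0")
      case False
      \<comment> \<open>The choice t = u / P makes the first term u / 2, which is absorbed into the
        left side.\<close>
      then have "u \<le> (u / P) / 2 * P + q / (2 * (u / P))" using yu[of "u / P"] u P by auto
      then show ?thesis using False u P by (simp add: field_simps power2_eq_square)
    qed (use P real in auto)
    then show ?thesis using u real P by (simp add: ennreal_power ennreal_mult[symmetric] ennreal_leI)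
  qed
qed

text \<open>Up to a constant the Riesz potential of order 1 in dimension three. Its kernel is the
  absolute value of the Cauchy kernel.\<close>

definition riesz :: "(real^3 \<Rightarrow> real) \<Rightarrow> real^3 \<Rightarrow> ennreal" where
  "riesz g x = (\<integral>\<^sup>+y. ennreal (norm (x - y) powr - 2 * g y) \<partial>lborel)"

lemma nn_integral_translate:
  fixes x :: "real^3"
  assumes "f \<in> borel_measurable borel"
  shows "(\<integral>\<^sup>+y. f (x - y) \<partial>lborel) = (\<integral>\<^sup>+y. f y \<partial>lborel)"
  using nn_integral_affine_euclidean[OF assms, of "-1" x] by simp

lemma nn_integral_translate':
  fixes x :: "real^3"
  assumes "f \<in> borel_measurable borel"
  shows "(\<integral>\<^sup>+y. f (y - x) \<partial>lborel) = (\<integral>\<^sup>+y. f y \<partial>lborel)"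
  using nn_integral_affine_euclidean[OF assms, of "1" "-x"] by simp

lemma riesz_measurable [measurable]:
  assumes [measurable]: "g \<in> borel_measurable borel"
  shows "riesz g \<in> borel_measurable borel"
  unfolding riesz_def[abs_def] by measurable

text \<open>Split \<open>riesz g\<close> at distance \<open>\<rho> \<sim> \<lambda>\<^sup>-\<^sup>2\<close> and the values of \<open>g\<close> at height \<open>a \<lambda>\<^sup>3\<close>: the far part and the
  low part are each at most a fraction of \<open>\<lambda>\<close>, so where \<open>riesz g > \<lambda>\<close> the remaining part is large.\<close>

lemma riesz_level_set:
  obtains a where "0 < a"
    "\<And>g \<mu>. \<lbrakk>g \<in> borel_measurable borel; \<And>y. 0 \<le> g y; nn_lborel (\<lambda>y. ennreal ((g y)\<^sup>2)) \<le> 1; 0 < \<mu>\<rbrakk> \<Longrightarrow>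
       ennreal \<mu> * emeasure lborel {x. ennreal \<mu> < (riesz g x) ^ 3}
         \<le> ennreal (1 / a) * nn_lborel (\<lambda>y. ennreal (g y) * indicator {y. a * \<mu> < g y} y)"
proof -
  obtain c2 where c2: "0 < c2" "\<And>r. 0 < r \<Longrightarrow>
      nn_lborel (\<lambda>z. ennreal (norm z powr - 2) * indicator {z. norm z \<le> r} z) \<le> ennreal (c2 * r powr (3 - 2))"
    using nn_integral_powr_cball[of 2] by auto
  obtain c4 where c4: "0 < c4" "\<And>r. 0 < r \<Longrightarrow>
      nn_lborel (\<lambda>z. ennreal (norm z powr - 4) * indicator {z. r \<le> norm z} z) \<le> ennreal (c4 * r powr (3 - 4))"
    using nn_integral_powr_outside[of 4] by auto
  \<comment> \<open>Solves \<open>a * \<mu> * c2 * \<rho> = l / 4\<close> for the \<open>l\<close>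
    and \<open>\<rho>\<close> chosen below: the near part of the low values of g then contributes a
    quarter of the height.\<close>
  define a where "a = 1 / (16 * c2 * c4)"
  have a: "0 < a" using c2 c4 by (simp add: a_def)
  show ?thesis
  proof (rule that[OF a])
    fix g :: "real^3 \<Rightarrow> real" and \<mu> :: real
    assume [measurable]: "g \<in> borel_measurable borel" and g: "\<And>y. 0 \<le> g y"
      and g2: "nn_lborel (\<lambda>y. ennreal ((g y)\<^sup>2)) \<le> 1" and \<mu>: "0 < \<mu>"
    \<comment> \<open>The height of the potential itself. The level sets are indexed by its cube
      because the sixth power will be treated as the square of the cube.\<close>
    define l where "l = \<mu> powr (1/3)"
    have l: "0 < l" "l ^ 3 = \<mu>"
      using \<mu> by (auto simp: l_def powr_realpow[symmetric] powr_powr)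
    \<comment> \<open>With this radius Young's inequality and the unit norm of g bound the far part
      by \<open>c4 / (l * \<rho>) + l / 4 = l / 2\<close>.\<close>
    define \<rho> where "\<rho> = 4 * c4 / l\<^sup>2"
    have \<rho>: "0 < \<rho>" using c4 l by (simp add: \<rho>_def)
    have al: "a * \<mu> * c2 * \<rho> = l / 4"
      using c2 c4 l(1) unfolding l(2)[symmetric] a_def \<rho>_def by (simp add: field_simps power3_eq_cube power2_eq_square)
    define Q where "Q x = (\<integral>\<^sup>+y. ennreal (norm (x - y) powr - 2 * g y) * indicator {y. norm (x - y) \<le> \<rho> \<and> a * \<mu> < g y} y \<partial>lborel)" for x
    have [measurable]: "Q \<in> borel_measurable borel"
      unfolding Q_def[abs_def] by measurable
    have main: "riesz g x \<le> ennreal (3 * l / 4) + Q x" for x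
    proof -
      have "riesz g x \<le> (\<integral>\<^sup>+y. (ennreal (1 / l) * (ennreal (norm (x - y) powr - 4) * indicator {z. \<rho> \<le> norm z} (x - y)) + ennreal (l / 4) * ennreal ((g y)\<^sup>2))
          + (ennreal (a * \<mu>) * (ennreal (norm (x - y) powr - 2) * indicator {z. norm z \<le> \<rho>} (x - y)) +
             ennreal (norm (x - y) powr - 2 * g y) * indicator {y. norm (x - y) \<le> \<rho> \<and> a * \<mu> < g y} y) \<partial>lborel)"
        unfolding riesz_def
      proof (intro nn_integral_mono)
        fix y
        define b where "b = norm (x - y) powr - 2"
        have b0: "0 \<le> b" by (simp add: b_def)
        have b2: "norm (x - y) powr - 4 = b\<^sup>2"
          by (simp add: b_def power2_eq_square powr_add[symmetric])
        consider "\<rho> < norm (x - y)" | "norm (x - y) \<le> \<rho>" "a * \<mu> < g y" | "norm (x - y) \<le> \<rho>" "g y \<le> a * \<mu>"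
          by linarith
        then show "ennreal (norm (x - y) powr - 2 * g y) \<le>
            (ennreal (1 / l) * (ennreal (norm (x - y) powr - 4) * indicator {z. \<rho> \<le> norm z} (x - y)) + ennreal (l / 4) * ennreal ((g y)\<^sup>2))
          + (ennreal (a * \<mu>) * (ennreal (norm (x - y) powr - 2) * indicator {z. norm z \<le> \<rho>} (x - y)) +
             ennreal (norm (x - y) powr - 2 * g y) * indicator {y. norm (x - y) \<le> \<rho> \<and> a * \<mu> < g y} y)"
        proof cases
          case 1
          have "0 \<le> (b - l / 2 * g y)\<^sup>2 / l" using l by simp
          also have "\<dots> = b\<^sup>2 / l + l / 4 * (g y)\<^sup>2 - b * g y"
            using l by (simp add: field_simps power2_eq_square)
          finally have "ennreal (b * g y) \<le> ennreal (1 / l * b\<^sup>2 + l / 4 * (g y)\<^sup>2)"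
            by (intro ennreal_leI) simp
          also have "\<dots> = ennreal (1 / l) * ennreal (b\<^sup>2) + ennreal (l / 4) * ennreal ((g y)\<^sup>2)"
            using l by (subst (1 2) ennreal_mult[symmetric]) (auto simp flip: ennreal_plus)
          finally show ?thesis unfolding b2 using 1 unfolding b_def by simp
        next
          case 2
          then show ?thesis by (simp add: add_increasing)
        next
          case 3
          have "ennreal (b * g y) \<le> ennreal (a * \<mu> * b)"
            using 3 b0 by (intro ennreal_leI) (simp add: mult.commute mult_left_mono)
          also have "\<dots> = ennreal (a * \<mu>) * ennreal b"
            using b0 a \<mu> by (simp add: ennreal_mult')
          finally show ?thesis using 3 unfolding b_def by (simp add: add_increasing)
        qed
      qed
      also have "\<dots> = (ennreal (1 / l) * (\<integral>\<^sup>+y. ennreal (norm (x - y) powr - 4) * indicator {z. \<rho> \<le> norm z} (x - y) \<partial>lborel)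
           + ennreal (l / 4) * (\<integral>\<^sup>+y. ennreal ((g y)\<^sup>2) \<partial>lborel))
          + (ennreal (a * \<mu>) * (\<integral>\<^sup>+y. ennreal (norm (x - y) powr - 2) * indicator {z. norm z \<le> \<rho>} (x - y) \<partial>lborel) + Q x)"
        unfolding Q_def by (simp add: nn_integral_add nn_integral_cmult)
      also have "\<dots> \<le> (ennreal (1 / l) * ennreal (c4 * \<rho> powr (3 - 4)) + ennreal (l / 4) * 1)
          + (ennreal (a * \<mu>) * ennreal (c2 * \<rho> powr (3 - 2)) + Q x)"
      proof (intro add_mono mult_left_mono order_refl g2)
        show "(\<integral>\<^sup>+y. ennreal (norm (x - y) powr - 4) * indicator {z. \<rho> \<le> norm z} (x - y) \<partial>lborel) \<le> ennreal (c4 * \<rho> powr (3 - 4))"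
          by (subst nn_integral_translate[of "\<lambda>z. ennreal (norm z powr - 4) * indicator {z. \<rho> \<le> norm z} z"]) (use c4 \<rho> in auto)
        show "(\<integral>\<^sup>+y. ennreal (norm (x - y) powr - 2) * indicator {z. norm z \<le> \<rho>} (x - y) \<partial>lborel) \<le> ennreal (c2 * \<rho> powr (3 - 2))"
          by (subst nn_integral_translate[of "\<lambda>z. ennreal (norm z powr - 2) * indicator {z. norm z \<le> \<rho>} z"]) (use c2 \<rho> in auto)
      qed auto
      also have "\<dots> = ennreal (1 / l * (c4 / \<rho>) + l / 4 + a * \<mu> * (c2 * \<rho>)) + Q x"
      proof -
        have p: "\<rho> powr (3 - 4) = 1 / \<rho>" "\<rho> powr (3 - 2) = \<rho>"
          using \<rho> powr_minus_divide[of \<rho> 1] by auto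
        have 1: "ennreal (1 / l) * ennreal (c4 * (1 / \<rho>)) = ennreal (1 / l * (c4 / \<rho>))"
          using l c4 \<rho> by (subst ennreal_mult[symmetric]) auto
        have 2: "ennreal (a * \<mu>) * ennreal (c2 * \<rho>) = ennreal (a * \<mu> * (c2 * \<rho>))"
          using a \<mu> c2 \<rho> by (subst ennreal_mult[symmetric]) auto
        have 3: "ennreal (1 / l * (c4 / \<rho>) + l / 4 + a * \<mu> * (c2 * \<rho>)) =
            ennreal (1 / l * (c4 / \<rho>)) + ennreal (l / 4) + ennreal (a * \<mu> * (c2 * \<rho>))"
          using l c4 \<rho> a \<mu> c2 by (subst ennreal_plus[symmetric], simp, simp)+ simp
        show ?thesis unfolding p 1 2 3 by (simp add: add.assoc)
      qed
      also have "1 / l * (c4 / \<rho>) + l / 4 + a * \<mu> * (c2 * \<rho>) = 3 * l / 4"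
        using al c4 l by (simp add: \<rho>_def mult.assoc field_simps power2_eq_square)
      finally show ?thesis .
    qed
    \<comment> \<open>Three quarters of the height are already accounted for, so \<open>Q\<close>
      has to supply l / 4. Markov's inequality for \<open>Q\<close>, which is linear in the high
      part of g, then bounds the level set after an exchange of integrals.\<close>
    have "{x. ennreal \<mu> < (riesz g x) ^ 3} \<subseteq> {x\<in>UNIV. 1 \<le> ennreal (4 / l) * Q x}"
    proof (intro subsetI CollectI conjI UNIV_I, rule ccontr)
      fix x assume "x \<in> {x. ennreal \<mu> < (riesz g x) ^ 3}" and "\<not> 1 \<le> ennreal (4 / l) * Q x"
      then have q: "ennreal (4 / l) * Q x < 1" and x: "ennreal \<mu> < (riesz g x) ^ 3" by auto
      then obtain q where q': "Q x = ennreal q" "0 \<le> q"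
        using l by (cases "Q x") (auto simp: ennreal_mult_top)
      have "q < l / 4"
        using q l q' by (auto simp flip: ennreal_mult simp: ennreal_less_one_iff field_simps)
      then have "riesz g x \<le> ennreal l"
        using main[of x] q' l by (auto simp flip: ennreal_plus intro: order_trans ennreal_leI)
      then have "(riesz g x) ^ 3 \<le> (ennreal l) ^ 3" by (rule power_mono) simp
      also have "\<dots> = ennreal \<mu>" using l by (simp add: ennreal_power)
      finally show False using x by simp
    qed
    then have "emeasure lborel {x. ennreal \<mu> < (riesz g x) ^ 3} \<le> emeasure lborel {x\<in>UNIV. 1 \<le> ennreal (4 / l) * Q x}"
      by (rule emeasure_mono) simp
    also have "\<dots> \<le> ennreal (4 / l) * nn_lborel (\<lambda>x. Q x * indicator UNIV x)"
      by (rule nn_integral_Markov_inequality) auto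
    also have "nn_lborel (\<lambda>x. Q x * indicator UNIV x) = (\<integral>\<^sup>+y. \<integral>\<^sup>+x. ennreal (norm (x - y) powr - 2 * g y) * indicator {y. norm (x - y) \<le> \<rho> \<and> a * \<mu> < g y} y \<partial>lborel \<partial>lborel)"
    proof -
      have "(\<lambda>(x, y). ennreal (norm (x - y) powr - 2 * g y) * indicator {y. norm (x - y) \<le> \<rho> \<and> a * \<mu> < g y} y)
          \<in> borel_measurable (lborel \<Otimes>\<^sub>M lborel)"
        by measurable
      from lborel_pair.Fubini'[OF this] show ?thesis unfolding Q_def by simp
    qed
    also have "\<dots> = (\<integral>\<^sup>+y. (ennreal (g y) * indicator {y. a * \<mu> < g y} y) * (\<integral>\<^sup>+x. ennreal (norm (x - y) powr - 2) * indicator {z. norm z \<le> \<rho>} (x - y) \<partial>lborel) \<partial>lborel)"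
    proof (intro nn_integral_cong)
      fix y :: "real^3"
      have "(\<integral>\<^sup>+x. ennreal (norm (x - y) powr - 2 * g y) * indicator {y. norm (x - y) \<le> \<rho> \<and> a * \<mu> < g y} y \<partial>lborel)
          = (\<integral>\<^sup>+x. (ennreal (g y) * indicator {y. a * \<mu> < g y} y) * (ennreal (norm (x - y) powr - 2) * indicator {z. norm z \<le> \<rho>} (x - y)) \<partial>lborel)"
        by (intro nn_integral_cong) (auto simp: ennreal_mult g mult.commute split: split_indicator)
      also have "\<dots> = (ennreal (g y) * indicator {y. a * \<mu> < g y} y) * (\<integral>\<^sup>+x. ennreal (norm (x - y) powr - 2) * indicator {z. norm z \<le> \<rho>} (x - y) \<partial>lborel)"
        by (rule nn_integral_cmult) simp
      finally show "(\<integral>\<^sup>+x. ennreal (norm (x - y) powr - 2 * g y) * indicator {y. norm (x - y) \<le> \<rho> \<and> a * \<mu> < g y} y \<partial>lborel) = \<dots>" .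
    qed
    also have "\<dots> \<le> (\<integral>\<^sup>+y. (ennreal (g y) * indicator {y. a * \<mu> < g y} y) * ennreal (c2 * \<rho>) \<partial>lborel)"
    proof (intro nn_integral_mono mult_left_mono)
      fix y :: "real^3"
      show "(\<integral>\<^sup>+x. ennreal (norm (x - y) powr - 2) * indicator {z. norm z \<le> \<rho>} (x - y) \<partial>lborel) \<le> ennreal (c2 * \<rho>)"
      proof -
        have "(\<integral>\<^sup>+x. ennreal (norm (x - y) powr - 2) * indicator {z. norm z \<le> \<rho>} (x - y) \<partial>lborel)
           = nn_lborel (\<lambda>z. ennreal (norm z powr - 2) * indicator {z. norm z \<le> \<rho>} z)"
          by (rule nn_integral_translate'[where f="\<lambda>z. ennreal (norm z powr - 2) * indicator {z. norm z \<le> \<rho>} z" and x=y]) simp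
        also have "\<dots> \<le> ennreal (c2 * \<rho>)"
          using c2(2)[OF \<rho>] \<rho> by simp
        finally show ?thesis .
      qed
    qed auto
    also have "\<dots> = ennreal (c2 * \<rho>) * nn_lborel (\<lambda>y. ennreal (g y) * indicator {y. a * \<mu> < g y} y)"
      by (subst mult.commute, rule nn_integral_cmult) simp
    finally have "emeasure lborel {x. ennreal \<mu> < (riesz g x) ^ 3} \<le>
        ennreal (4 / l) * (ennreal (c2 * \<rho>) * nn_lborel (\<lambda>y. ennreal (g y) * indicator {y. a * \<mu> < g y} y))"
      by (simp add: mult_left_mono)
    then have "ennreal \<mu> * emeasure lborel {x. ennreal \<mu> < (riesz g x) ^ 3} \<le>
        ennreal \<mu> * (ennreal (4 / l) * (ennreal (c2 * \<rho>) * nn_lborel (\<lambda>y. ennreal (g y) * indicator {y. a * \<mu> < g y} y)))"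
      by (rule mult_left_mono) simp
    also have "\<dots> = ennreal (\<mu> * (4 / l) * (c2 * \<rho>)) * nn_lborel (\<lambda>y. ennreal (g y) * indicator {y. a * \<mu> < g y} y)"
    proof -
      have "ennreal (\<mu> * (4 / l) * (c2 * \<rho>)) = ennreal \<mu> * ennreal (4 / l) * ennreal (c2 * \<rho>)"
        using l \<mu> c2 \<rho> by (subst ennreal_mult, simp, simp)+ simp
      then show ?thesis by (simp only: mult.assoc)
    qed
    also have "\<mu> * (4 / l) * (c2 * \<rho>) = 1 / a"
      using al a l c2 by (simp add: field_simps)
    finally show "ennreal \<mu> * emeasure lborel {x. ennreal \<mu> < (riesz g x) ^ 3}
         \<le> ennreal (1 / a) * nn_lborel (\<lambda>y. ennreal (g y) * indicator {y. a * \<mu> < g y} y)" .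
  qed
qed

text \<open>Integrating the level set bound over \<mu> and exchanging the integrals leaves, for each
  y, the length g(y) / a of the interval of those \<mu> with a \<mu> < g(y), multiplied by g(y).
  This is the square of g, so the strong bound from exponent 2 to exponent 6 comes out directly,
  without an interpolation theorem.\<close>

lemma Hardy_Littlewood_Sobolev_2_6:
  obtains C where "0 < C"
    "\<And>g. \<lbrakk>g \<in> borel_measurable borel; \<And>y. 0 \<le> g y; nn_lborel (\<lambda>y. ennreal ((g y)\<^sup>2)) \<le> 1\<rbrakk> \<Longrightarrow>
       nn_lborel (\<lambda>x. (riesz g x) ^ 6) \<le> ennreal C"
proof -
  obtain a where a: "0 < a"
    "\<And>g \<mu>. \<lbrakk>g \<in> borel_measurable borel; \<And>y. 0 \<le> g y; nn_lborel (\<lambda>y. ennreal ((g y)\<^sup>2)) \<le> 1; 0 < \<mu>\<rbrakk> \<Longrightarrow>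
       ennreal \<mu> * emeasure lborel {x. ennreal \<mu> < (riesz g x) ^ 3}
         \<le> ennreal (1 / a) * nn_lborel (\<lambda>y. ennreal (g y) * indicator {y. a * \<mu> < g y} y)"
    using riesz_level_set by blast
  show ?thesis
  proof (rule that[of "2 / a\<^sup>2"])
    fix g :: "real^3 \<Rightarrow> real"
    assume [measurable]: "g \<in> borel_measurable borel" and g: "\<And>y. 0 \<le> g y"
      and g2: "nn_lborel (\<lambda>y. ennreal ((g y)\<^sup>2)) \<le> 1"
    have "nn_lborel (\<lambda>x. (riesz g x) ^ 6) \<le> (\<integral>\<^sup>+x. \<integral>\<^sup>+\<mu>. ennreal (2 * \<mu>) * indicator {\<mu>. 0 < \<mu> \<and> ennreal \<mu> < riesz g x ^ 3} \<mu> \<partial>lborel \<partial>lborel)"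
      by (intro nn_integral_mono order_trans[OF _ layer_cake_square]) (simp flip: power_mult)
    also have "\<dots> = (\<integral>\<^sup>+\<mu>. \<integral>\<^sup>+x. ennreal (2 * \<mu>) * indicator {\<mu>. 0 < \<mu> \<and> ennreal \<mu> < riesz g x ^ 3} \<mu> \<partial>lborel \<partial>lborel)"
    proof -
      have [measurable]: "Measurable.pred (borel \<Otimes>\<^sub>M borel) (\<lambda>(x::real^3, \<mu>). ennreal \<mu> < riesz g x ^ 3)"
        by measurable
      have "(\<lambda>(x, \<mu>). ennreal (2 * \<mu>) * indicator {\<mu>. 0 < \<mu> \<and> ennreal \<mu> < riesz g x ^ 3} \<mu>)
          \<in> borel_measurable (lborel \<Otimes>\<^sub>M lborel)"
        by measurable
      from lborel_pair.Fubini'[OF this] show ?thesis by simp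
    qed
    also have "\<dots> = (\<integral>\<^sup>+\<mu>. (ennreal 2 * indicator {0<..} \<mu>) * (ennreal \<mu> * emeasure lborel {x. ennreal \<mu> < riesz g x ^ 3}) \<partial>lborel)"
    proof (intro nn_integral_cong)
      fix \<mu> :: real
      have "(\<integral>\<^sup>+x. ennreal (2 * \<mu>) * indicator {\<mu>. 0 < \<mu> \<and> ennreal \<mu> < riesz g x ^ 3} \<mu> \<partial>lborel)
         = (\<integral>\<^sup>+x. (ennreal (2 * \<mu>) * indicator {0<..} \<mu>) * indicator {x. ennreal \<mu> < riesz g x ^ 3} x \<partial>lborel)"
        by (intro nn_integral_cong) (auto split: split_indicator)
      also have "\<dots> = (ennreal (2 * \<mu>) * indicator {0<..} \<mu>) * emeasure lborel {x. ennreal \<mu> < riesz g x ^ 3}"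
        by (subst nn_integral_cmult_indicator) auto
      also have "\<dots> = (ennreal 2 * indicator {0<..} \<mu>) * (ennreal \<mu> * emeasure lborel {x. ennreal \<mu> < riesz g x ^ 3})"
        by (auto simp: ennreal_mult mult.assoc split: split_indicator)
      finally show "(\<integral>\<^sup>+x. ennreal (2 * \<mu>) * indicator {\<mu>. 0 < \<mu> \<and> ennreal \<mu> < riesz g x ^ 3} \<mu> \<partial>lborel) = \<dots>" .
    qed
    also have "\<dots> \<le> (\<integral>\<^sup>+\<mu>. (ennreal 2 * indicator {0<..} \<mu>) * (ennreal (1 / a) * nn_lborel (\<lambda>y. ennreal (g y) * indicator {y. a * \<mu> < g y} y)) \<partial>lborel)"
    proof (intro nn_integral_mono)
      fix \<mu> :: real
      show "(ennreal 2 * indicator {0<..} \<mu>) * (ennreal \<mu> * emeasure lborel {x. ennreal \<mu> < riesz g x ^ 3})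
        \<le> (ennreal 2 * indicator {0<..} \<mu>) * (ennreal (1 / a) * nn_lborel (\<lambda>y. ennreal (g y) * indicator {y. a * \<mu> < g y} y))"
        using a(2)[of g \<mu>] g g2 by (cases "0 < \<mu>") (auto intro: mult_left_mono)
    qed
    also have "\<dots> = (\<integral>\<^sup>+\<mu>. \<integral>\<^sup>+y. ennreal (2 / a) * (ennreal (g y) * indicator {\<mu>. 0 < \<mu> \<and> a * \<mu> < g y} \<mu>) \<partial>lborel \<partial>lborel)"
    proof (intro nn_integral_cong)
      fix \<mu> :: real
      have "(\<integral>\<^sup>+y. ennreal (2 / a) * (ennreal (g y) * indicator {\<mu>. 0 < \<mu> \<and> a * \<mu> < g y} \<mu>) \<partial>lborel)
          = (\<integral>\<^sup>+y. (ennreal (2 / a) * indicator {0<..} \<mu>) * (ennreal (g y) * indicator {y. a * \<mu> < g y} y) \<partial>lborel)"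
        by (intro nn_integral_cong) (auto split: split_indicator)
      also have "\<dots> = (ennreal (2 / a) * indicator {0<..} \<mu>) * nn_lborel (\<lambda>y. ennreal (g y) * indicator {y. a * \<mu> < g y} y)"
        by (subst nn_integral_cmult) auto
      also have e: "ennreal (2 / a) = ennreal 2 * ennreal (1 / a)"
        using a ennreal_mult[of 2 "1 / a"] by simp
      finally have *: "(\<integral>\<^sup>+y. ennreal (2 / a) * (ennreal (g y) * indicator {\<mu>. 0 < \<mu> \<and> a * \<mu> < g y} \<mu>) \<partial>lborel) = (ennreal 2 * ennreal (1 / a) * indicator {0<..} \<mu>) * nn_lborel (\<lambda>y. ennreal (g y) * indicator {y. a * \<mu> < g y} y)"
        unfolding e .
      show "(ennreal 2 * indicator {0<..} \<mu>) * (ennreal (1 / a) * nn_lborel (\<lambda>y. ennreal (g y) * indicator {y. a * \<mu> < g y} y))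
         = (\<integral>\<^sup>+y. ennreal (2 / a) * (ennreal (g y) * indicator {\<mu>. 0 < \<mu> \<and> a * \<mu> < g y} \<mu>) \<partial>lborel)"
        unfolding * by (simp only: mult_ac)
    qed
    also have "\<dots> = (\<integral>\<^sup>+y. \<integral>\<^sup>+\<mu>. ennreal (2 / a) * (ennreal (g y) * indicator {\<mu>. 0 < \<mu> \<and> a * \<mu> < g y} \<mu>) \<partial>lborel \<partial>lborel)"
    proof -
      have "(\<lambda>(\<mu>, y). ennreal (2 / a) * (ennreal (g y) * indicator {\<mu>. 0 < \<mu> \<and> a * \<mu> < g y} \<mu>))
          \<in> borel_measurable (lborel \<Otimes>\<^sub>M lborel)"
        by measurable
      from lborel_pair.Fubini'[OF this] show ?thesis by simp
    qed
    also have "\<dots> = (\<integral>\<^sup>+y. ennreal (2 / a\<^sup>2) * ennreal ((g y)\<^sup>2) \<partial>lborel)"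
    proof (intro nn_integral_cong)
      fix y :: "real^3"
      have "{\<mu>. 0 < \<mu> \<and> a * \<mu> < g y} = {0<..<g y / a}"
        using a by (auto simp: field_simps)
      then have "(\<integral>\<^sup>+\<mu>. ennreal (2 / a) * (ennreal (g y) * indicator {\<mu>. 0 < \<mu> \<and> a * \<mu> < g y} \<mu>) \<partial>lborel)
          = (\<integral>\<^sup>+\<mu>. (ennreal (2 / a) * ennreal (g y)) * indicator {0<..<g y / a} \<mu> \<partial>lborel)"
        by (simp add: mult.assoc)
      also have "\<dots> = (ennreal (2 / a) * ennreal (g y)) * ennreal (g y / a)"
        by (subst nn_integral_cmult_indicator) (use g a in auto)
      also have "\<dots> = ennreal (2 / a\<^sup>2) * ennreal ((g y)\<^sup>2)"
        using a g by (simp flip: ennreal_mult add: power2_eq_square)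
      finally show "(\<integral>\<^sup>+\<mu>. ennreal (2 / a) * (ennreal (g y) * indicator {\<mu>. 0 < \<mu> \<and> a * \<mu> < g y} \<mu>) \<partial>lborel) = \<dots>" .
    qed
    also have "\<dots> = ennreal (2 / a\<^sup>2) * nn_lborel (\<lambda>y. ennreal ((g y)\<^sup>2))"
      by (subst nn_integral_cmult) auto
    also have "\<dots> \<le> ennreal (2 / a\<^sup>2) * 1"
      using g2 by (intro mult_left_mono) auto
    finally show "nn_lborel (\<lambda>x. (riesz g x) ^ 6) \<le> ennreal (2 / a\<^sup>2)" by simp
  qed (use a in simp)
qed

section \<open>The potential comparing nearby dyadic scales\<close>

text \<open>The norms of the dilates x / 2^k with k \<le> m fill the range from |x| / 2^m to |x|.
  The relation says that |y| lies within a factor 4 of this range; outside it the kernels can be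
  expanded in a ratio of at most 1/4.\<close>

definition near :: "nat \<Rightarrow> real^3 \<Rightarrow> real^3 \<Rightarrow> bool" where
  "near m x y \<longleftrightarrow> norm x \<le> 2 ^ (m + 2) * norm y \<and> norm y \<le> 4 * norm x"

text \<open>Homogeneous of degree -2 like the Cauchy kernel. The near branch carries the
  singularities of all dilated kernels. The far branch is |x|^-2 where |x| is larger, and |x| |y|^-3
  where |y| is larger, one power better than the kernel. Divided by |x| the far branch is the
  symmetric max^-3; this quotient enters the Schur test at p = 2.\<close>

definition W :: "nat \<Rightarrow> real^3 \<Rightarrow> real^3 \<Rightarrow> real" where
  "W m x y = (if near m x y then \<Sum>k\<le>m. norm (y - (1 / 2 ^ k) *\<^sub>R x) powr - 2
              else norm x * max (norm x) (norm y) powr - 3)"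

definition pot :: "nat \<Rightarrow> (real^3 \<Rightarrow> real) \<Rightarrow> real^3 \<Rightarrow> ennreal" where
  "pot m g x = (\<integral>\<^sup>+y. ennreal (W m x y * g y) \<partial>lborel)"

lemma powr_mult_self: "0 \<le> x \<Longrightarrow> x powr a * x = x powr (a + 1)" for x :: real
  by (cases "x = 0") (auto simp: powr_add)

lemma W_nonneg: "0 \<le> W m x y"
  by (auto simp: W_def intro!: sum_nonneg)

lemma W_measurable [measurable]: "(\<lambda>(x, y). W m x y) \<in> borel_measurable (borel \<Otimes>\<^sub>M borel)"
  unfolding W_def near_def by measurable

lemma pot_measurable [measurable]:
  assumes [measurable]: "g \<in> borel_measurable borel"
  shows "pot m g \<in> borel_measurable borel"
  unfolding pot_def[abs_def] by measurable

text \<open>The far branch of \<open>W / |x|\<close> against the Schur weight: |z|^(-3/2) is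
  integrable at the origin and |z|^(-9/2) at infinity, and scaling gives the power of r.\<close>

lemma nn_integral_max_powr:
  obtains C where "0 < C" "\<And>r. 0 < r \<Longrightarrow>
    nn_lborel (\<lambda>z. ennreal (max r (norm z) powr - 3 * norm z powr - (3/2))) \<le> ennreal (C * r powr - (3/2))"
proof -
  obtain c where c: "0 < c" "\<And>r. 0 < r \<Longrightarrow>
      nn_lborel (\<lambda>z. ennreal (norm z powr - (3/2)) * indicator {z. norm z \<le> r} z) \<le> ennreal (c * r powr (3 - 3/2))"
    using nn_integral_powr_cball[of "3/2"] by auto
  obtain c' where c': "0 < c'" "\<And>r. 0 < r \<Longrightarrow>
      nn_lborel (\<lambda>z. ennreal (norm z powr - (9/2)) * indicator {z. r \<le> norm z} z) \<le> ennreal (c' * r powr (3 - 9/2))"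
    using nn_integral_powr_outside[of "9/2"] by auto
  show ?thesis
  proof (rule that[of "c + c'"])
    fix r :: real assume r: "0 < r"
    have "nn_lborel (\<lambda>z. ennreal (max r (norm z) powr - 3 * norm z powr - (3/2)))
       \<le> nn_lborel (\<lambda>z. ennreal (r powr - 3) * (ennreal (norm z powr - (3/2)) * indicator {z. norm z \<le> r} z)
            + ennreal (norm z powr - (9/2)) * indicator {z. r \<le> norm z} z)"
    proof (intro nn_integral_mono)
      fix z :: "real^3"
      show "ennreal (max r (norm z) powr - 3 * norm z powr - (3/2)) \<le>
          ennreal (r powr - 3) * (ennreal (norm z powr - (3/2)) * indicator {z. norm z \<le> r} z)
            + ennreal (norm z powr - (9/2)) * indicator {z. r \<le> norm z} z"
      proof (cases "norm z \<le> r")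
        case True
        then show ?thesis using r by (simp add: max_def ennreal_mult' add_increasing2)
      next
        case False
        then have "norm z powr - 3 * norm z powr - (3/2) = norm z powr - (9/2)"
          by (simp flip: powr_add)
        then show ?thesis using False by (simp add: max_def)
      qed
    qed
    also have "\<dots> = ennreal (r powr - 3) * nn_lborel (\<lambda>z. ennreal (norm z powr - (3/2)) * indicator {z. norm z \<le> r} z)
            + nn_lborel (\<lambda>z. ennreal (norm z powr - (9/2)) * indicator {z. r \<le> norm z} z)"
      by (simp add: nn_integral_add nn_integral_cmult)
    also have "\<dots> \<le> ennreal (r powr - 3) * ennreal (c * r powr (3 - 3/2)) + ennreal (c' * r powr (3 - 9/2))"
      by (intro add_mono mult_left_mono c(2) c'(2) r) auto
    also have "\<dots> = ennreal (c * (r powr - 3 * r powr (3 - 3/2)) + c' * r powr (3 - 9/2))"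
      using c c' by (subst ennreal_mult[symmetric]) (auto simp flip: ennreal_plus simp: mult_ac)
    also have "c * (r powr - 3 * r powr (3 - 3/2)) + c' * r powr (3 - 9/2) = (c + c') * r powr - (3/2)"
      by (simp flip: powr_add add: distrib_right)
    finally show "nn_lborel (\<lambda>z. ennreal (max r (norm z) powr - 3 * norm z powr - (3/2))) \<le> ennreal ((c + c') * r powr - (3/2))" .
  qed (use c c' in simp)
qed

text \<open>The two bounds of the Schur test with weight \<open>|x| powr - (3/2)\<close> for the kernel \<open>W / |x|\<close>.\<close>

lemma W_integral_right:
  obtains C where "0 < C" "\<And>x. x \<noteq> 0 \<Longrightarrow>
    (\<integral>\<^sup>+y. ennreal (W m x y * norm y powr - (3/2)) \<partial>lborel) \<le> ennreal (C * norm x powr - (1/2))"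
proof -
  obtain c2 where c2: "0 < c2" "\<And>r. 0 < r \<Longrightarrow>
      nn_lborel (\<lambda>z. ennreal (norm z powr - 2) * indicator {z. norm z \<le> r} z) \<le> ennreal (c2 * r powr (3 - 2))"
    using nn_integral_powr_cball[of 2] by auto
  obtain c where c: "0 < c" "\<And>r. 0 < r \<Longrightarrow>
    nn_lborel (\<lambda>z. ennreal (max r (norm z) powr - 3 * norm z powr - (3/2))) \<le> ennreal (c * r powr - (3/2))"
    using nn_integral_max_powr by blast
  define A :: real where "A = 2 ^ (m + 2)"
  have A: "0 < A" by (simp add: A_def)
  define B where "B = A powr (3/2)"
  have B: "0 < B" using A by (simp add: B_def)
  show ?thesis
  proof (rule that[of "real (Suc m) * (5 * B * c2) + c"])
    fix x :: "real^3" assume "x \<noteq> 0"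
    then have x: "0 < norm x" by simp
    \<comment> \<open>On the near region |y| is comparable to |x|, so the weight can be frozen at a
      multiple of |x|^(-3/2). What remains are translates of |z|^-2 on a ball of radius 5
      |x|.\<close>
    let ?K = "B * norm x powr - (3/2)"
    let ?p = "\<lambda>k y. ennreal (norm (y - (1 / 2 ^ k) *\<^sub>R x) powr - 2) * indicator {z. norm z \<le> 5 * norm x} (y - (1 / 2 ^ k) *\<^sub>R x)"
    have "(\<integral>\<^sup>+y. ennreal (W m x y * norm y powr - (3/2)) \<partial>lborel) \<le>
      (\<integral>\<^sup>+y. (\<Sum>k\<le>m. ennreal ?K * ?p k y) + ennreal (norm x) * ennreal (max (norm x) (norm y) powr - 3 * norm y powr - (3/2)) \<partial>lborel)"
    proof (intro nn_integral_mono)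
      fix y :: "real^3"
      show "ennreal (W m x y * norm y powr - (3/2)) \<le> (\<Sum>k\<le>m. ennreal ?K * ?p k y)
          + ennreal (norm x) * ennreal (max (norm x) (norm y) powr - 3 * norm y powr - (3/2))"
      proof (cases "near m x y")
        case True
        then have y: "norm x / A \<le> norm y" "norm y \<le> 4 * norm x"
          using A by (auto simp: near_def A_def field_simps)
        have "norm y powr - (3/2) \<le> (norm x / A) powr - (3/2)"
          using y x A by (intro powr_mono2') auto
        also have "\<dots> = ?K"
          using x A by (simp add: powr_divide B_def powr_minus_divide)
        finally have le: "norm y powr - (3/2) \<le> ?K" .
        have ind: "indicator {z. norm z \<le> 5 * norm x} (y - (1 / 2 ^ k) *\<^sub>R x) = (1::ennreal)" for k
        proof -
          have "norm (y - (1 / 2 ^ k) *\<^sub>R x) \<le> norm y + norm ((1 / 2 ^ k) *\<^sub>R x)"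
            by (rule norm_triangle_ineq4)
          also have "norm ((1 / 2 ^ k) *\<^sub>R x) \<le> norm x"
            using x by (simp add: field_simps)
          finally show ?thesis using y by simp
        qed
        have "ennreal (W m x y * norm y powr - (3/2)) \<le> ennreal (W m x y * ?K)"
          using le by (intro ennreal_leI mult_left_mono W_nonneg)
        also have "\<dots> = (\<Sum>k\<le>m. ennreal ?K * ?p k y)"
        proof -
          have "W m x y * ?K = (\<Sum>k\<le>m. ?K * norm (y - (1 / 2 ^ k) *\<^sub>R x) powr - 2)"
            using True by (simp add: W_def sum_distrib_left mult.commute)
          also have "ennreal \<dots> = (\<Sum>k\<le>m. ennreal (?K * norm (y - (1 / 2 ^ k) *\<^sub>R x) powr - 2))"
            using B by (intro sum_ennreal[symmetric]) auto
          also have "\<dots> = (\<Sum>k\<le>m. ennreal ?K * ?p k y)"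
            using B by (intro sum.cong refl) (simp only: ind mult_1_right ennreal_mult mult_nonneg_nonneg powr_ge_zero less_imp_le)
          finally show ?thesis .
        qed
        finally show ?thesis by (simp add: add_increasing2)
      next
        case False
        then show ?thesis
          by (simp add: W_def ennreal_mult'[symmetric] mult.assoc add_increasing)
      qed
    qed
    also have "\<dots> = (\<Sum>k\<le>m. ennreal ?K * (\<integral>\<^sup>+y. ?p k y \<partial>lborel))
        + ennreal (norm x) * nn_lborel (\<lambda>y. ennreal (max (norm x) (norm y) powr - 3 * norm y powr - (3/2)))"
      by (simp add: nn_integral_add nn_integral_sum nn_integral_cmult)
    also have "\<dots> \<le> (\<Sum>k\<le>m. ennreal ?K * ennreal (c2 * (5 * norm x) powr (3 - 2)))
        + ennreal (norm x) * ennreal (c * norm x powr - (3/2))"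
    proof (intro add_mono sum_mono mult_left_mono c(2) x)
      fix k
      show "(\<integral>\<^sup>+y. ?p k y \<partial>lborel) \<le> ennreal (c2 * (5 * norm x) powr (3 - 2))"
        by (subst nn_integral_translate'[where f="\<lambda>z. ennreal (norm z powr - 2) * indicator {z. norm z \<le> 5 * norm x} z"])
           (use c2 x in auto)
    qed auto
    also have "\<dots> = ennreal ((real (Suc m) * (5 * B * c2)) * (norm x powr - (3/2) * norm x) + c * (norm x powr - (3/2) * norm x))"
    proof -
      have 1: "ennreal ?K * ennreal (c2 * (5 * norm x) powr (3 - 2)) = ennreal (5 * B * c2 * (norm x powr - (3/2) * norm x))"
        using B c2 x by (subst ennreal_mult[symmetric]) (auto simp: mult_ac)
      have 2: "ennreal (norm x) * ennreal (c * norm x powr - (3/2)) = ennreal (c * (norm x powr - (3/2) * norm x))"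
        using c x by (subst ennreal_mult[symmetric]) (auto simp: mult_ac)
      have "(\<Sum>k\<le>m. ennreal (5 * B * c2 * (norm x powr - (3/2) * norm x))) = ennreal (\<Sum>k\<le>m. 5 * B * c2 * (norm x powr - (3/2) * norm x))"
        using B c2 by (intro sum_ennreal) auto
      also have "(\<Sum>k\<le>m. 5 * B * c2 * (norm x powr - (3/2) * norm x)) = (real (Suc m) * (5 * B * c2)) * (norm x powr - (3/2) * norm x)"
        by (simp add: mult.assoc del: of_nat_Suc)
      finally show ?thesis unfolding 1 2
        using B c2 c by (subst ennreal_plus) (auto simp del: of_nat_Suc intro!: mult_nonneg_nonneg)
    qed
    also have "norm x powr - (3/2) * norm x = norm x powr - (1/2)"
      by (subst powr_mult_self) auto
    finally show "(\<integral>\<^sup>+y. ennreal (W m x y * norm y powr - (3/2)) \<partial>lborel)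
        \<le> ennreal ((real (Suc m) * (5 * B * c2) + c) * norm x powr - (1/2))"
      by (simp add: distrib_right)
  qed (use B c2 c in \<open>auto intro!: add_nonneg_pos mult_nonneg_nonneg\<close>)
qed

lemma W_integral_left:
  obtains C where "0 < C" "\<And>y. y \<noteq> 0 \<Longrightarrow>
    (\<integral>\<^sup>+x. ennreal (W m x y * norm x powr - (5/2)) \<partial>lborel) \<le> ennreal (C * norm y powr - (3/2))"
proof -
  obtain c2 where c2: "0 < c2" "\<And>r. 0 < r \<Longrightarrow>
      nn_lborel (\<lambda>z. ennreal (norm z powr - 2) * indicator {z. norm z \<le> r} z) \<le> ennreal (c2 * r powr (3 - 2))"
    using nn_integral_powr_cball[of 2] by auto
  obtain c where c: "0 < c" "\<And>r. 0 < r \<Longrightarrow>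
    nn_lborel (\<lambda>z. ennreal (max r (norm z) powr - 3 * norm z powr - (3/2))) \<le> ennreal (c * r powr - (3/2))"
    using nn_integral_max_powr by blast
  define A :: real where "A = 2 ^ (m + 2)"
  have A: "0 < A" by (simp add: A_def)
  define B where "B = (1/4::real) powr - (5/2) * 4 ^ m"
  have B: "0 < B" by (simp add: B_def)
  show ?thesis
  proof (rule that[of "real (Suc m) * (2 * A * B * c2) + c"])
    fix y :: "real^3" assume "y \<noteq> 0"
    then have y: "0 < norm y" by simp
    let ?K = "B * norm y powr - (5/2)"
    let ?p = "\<lambda>k x. ennreal (norm (x - 2 ^ k *\<^sub>R y) powr - 2) * indicator {z. norm z \<le> 2 * A * norm y} (x - 2 ^ k *\<^sub>R y)"
    have "(\<integral>\<^sup>+x. ennreal (W m x y * norm x powr - (5/2)) \<partial>lborel) \<le>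
      (\<integral>\<^sup>+x. (\<Sum>k\<le>m. ennreal ?K * ?p k x) + ennreal (max (norm y) (norm x) powr - 3 * norm x powr - (3/2)) \<partial>lborel)"
    proof (intro nn_integral_mono)
      fix x :: "real^3"
      show "ennreal (W m x y * norm x powr - (5/2)) \<le> (\<Sum>k\<le>m. ennreal ?K * ?p k x)
          + ennreal (max (norm y) (norm x) powr - 3 * norm x powr - (3/2))"
      proof (cases "near m x y")
        case True
        then have x: "norm x \<le> A * norm y" "1 / 4 * norm y \<le> norm x"
          by (auto simp: near_def A_def)
        have "norm x powr - (5/2) \<le> (1 / 4 * norm y) powr - (5/2)"
          using x y by (intro powr_mono2') auto
        also have "\<dots> = (1/4) powr - (5/2) * norm y powr - (5/2)"
          by (simp only: powr_mult)
        finally have le: "norm x powr - (5/2) \<le> (1/4) powr - (5/2) * norm y powr - (5/2)" .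
        have ind: "indicator {z. norm z \<le> 2 * A * norm y} (x - 2 ^ k *\<^sub>R y) = (1::ennreal)" if "k \<le> m" for k
        proof -
          have "norm (x - 2 ^ k *\<^sub>R y) \<le> norm x + norm ((2 ^ k) *\<^sub>R y)"
            by (rule norm_triangle_ineq4)
          also have "norm ((2 ^ k) *\<^sub>R y) \<le> A * norm y"
          proof -
            have "(2::real) ^ k \<le> A"
              using that unfolding A_def by (intro power_increasing) auto
            then show ?thesis by (simp add: mult_right_mono)
          qed
          finally show ?thesis using x by simp
        qed
        \<comment> \<open>As a function of x the k-th singularity sits at 2^k y. Factoring out the
          dilation costs 4^k, bounded here by 4^m.\<close>
        have sh: "norm (y - (1 / 2 ^ k) *\<^sub>R x) powr - 2 \<le> 4 ^ m * norm (x - 2 ^ k *\<^sub>R y) powr - 2" if "k \<le> m" for k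
        proof -
          have "x - 2 ^ k *\<^sub>R y = (- (2 ^ k)) *\<^sub>R (y - (1 / 2 ^ k) *\<^sub>R x)"
            by (simp add: algebra_simps)
          then have "norm (x - 2 ^ k *\<^sub>R y) = 2 ^ k * norm (y - (1 / 2 ^ k) *\<^sub>R x)"
            by (simp only: norm_scaleR) simp
          then have "norm (x - 2 ^ k *\<^sub>R y) powr - 2 = (2 ^ k) powr - 2 * norm (y - (1 / 2 ^ k) *\<^sub>R x) powr - 2"
            by (simp add: powr_mult)
          also have "(2 ^ k :: real) powr - 2 = 1 / 4 ^ k"
          proof -
            have "(2 ^ k :: real) powr - 2 = 1 / (2 ^ k)\<^sup>2"
              by (simp add: powr_minus_divide)
            also have "(2 ^ k :: real)\<^sup>2 = 4 ^ k" by (simp flip: power_mult add: mult.commute[of k] power_mult)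
            finally show ?thesis .
          qed
          finally have "norm (y - (1 / 2 ^ k) *\<^sub>R x) powr - 2 = 4 ^ k * norm (x - 2 ^ k *\<^sub>R y) powr - 2" by simp
          also have "\<dots> \<le> 4 ^ m * norm (x - 2 ^ k *\<^sub>R y) powr - 2"
            using that by (intro mult_right_mono power_increasing) auto
          finally show ?thesis .
        qed
        have "W m x y * norm x powr - (5/2) \<le> (\<Sum>k\<le>m. 4 ^ m * norm (x - 2 ^ k *\<^sub>R y) powr - 2) * ((1/4) powr - (5/2) * norm y powr - (5/2))"
          using True sh unfolding W_def by (auto intro!: mult_mono le sum_mono sum_nonneg)
        also have "\<dots> = (\<Sum>k\<le>m. ?K * norm (x - 2 ^ k *\<^sub>R y) powr - 2)"
          unfolding B_def sum_distrib_right by (intro sum.cong refl) (simp only: mult_ac)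
        finally have "ennreal (W m x y * norm x powr - (5/2)) \<le> ennreal (\<Sum>k\<le>m. ?K * norm (x - 2 ^ k *\<^sub>R y) powr - 2)"
          by (rule ennreal_leI)
        also have "\<dots> = (\<Sum>k\<le>m. ennreal ?K * ?p k x)"
        proof -
          have "ennreal (\<Sum>k\<le>m. ?K * norm (x - 2 ^ k *\<^sub>R y) powr - 2) = (\<Sum>k\<le>m. ennreal (?K * norm (x - 2 ^ k *\<^sub>R y) powr - 2))"
            using B by (intro sum_ennreal[symmetric]) auto
          also have "\<dots> = (\<Sum>k\<le>m. ennreal ?K * ?p k x)"
            using B by (intro sum.cong refl) (simp only: ind atMost_iff mult_1_right ennreal_mult mult_nonneg_nonneg powr_ge_zero less_imp_le)
          finally show ?thesis .
        qed
        finally show ?thesis by (simp add: add_increasing2)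
      next
        case False
        have "norm x * norm x powr - (5/2) = norm x powr - (3/2)"
          by (subst mult.commute, subst powr_mult_self) auto
        moreover have "norm x * max (norm x) (norm y) powr - 3 * norm x powr - (5/2) =
            max (norm y) (norm x) powr - 3 * (norm x * norm x powr - (5/2))"
          by (simp only: max.commute[of "norm x"] mult.assoc mult.left_commute)
        ultimately have "norm x * max (norm x) (norm y) powr - 3 * norm x powr - (5/2) = max (norm y) (norm x) powr - 3 * norm x powr - (3/2)"
          by simp
        with False show ?thesis
          by (simp add: W_def add_increasing)
      qed
    qed
    also have "\<dots> = (\<Sum>k\<le>m. ennreal ?K * (\<integral>\<^sup>+x. ?p k x \<partial>lborel))
        + nn_lborel (\<lambda>x. ennreal (max (norm y) (norm x) powr - 3 * norm x powr - (3/2)))"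
      by (simp add: nn_integral_add nn_integral_sum nn_integral_cmult)
    also have "\<dots> \<le> (\<Sum>k\<le>m. ennreal ?K * ennreal (c2 * (2 * A * norm y) powr (3 - 2)))
        + ennreal (c * norm y powr - (3/2))"
    proof (intro add_mono sum_mono mult_left_mono c(2) y)
      fix k
      show "(\<integral>\<^sup>+x. ?p k x \<partial>lborel) \<le> ennreal (c2 * (2 * A * norm y) powr (3 - 2))"
        by (subst nn_integral_translate'[where f="\<lambda>z. ennreal (norm z powr - 2) * indicator {z. norm z \<le> 2 * A * norm y} z"])
           (use c2 y A in auto)
    qed auto
    also have "\<dots> = ennreal ((real (Suc m) * (2 * A * B * c2)) * (norm y powr - (5/2) * norm y) + c * norm y powr - (3/2))"
    proof -
      have 1: "ennreal ?K * ennreal (c2 * (2 * A * norm y) powr (3 - 2)) = ennreal (2 * A * B * c2 * (norm y powr - (5/2) * norm y))"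
        using A B c2 y by (subst ennreal_mult[symmetric]) (auto simp: mult_ac)
      have "(\<Sum>k\<le>m. ennreal (2 * A * B * c2 * (norm y powr - (5/2) * norm y))) = ennreal (\<Sum>k\<le>m. 2 * A * B * c2 * (norm y powr - (5/2) * norm y))"
        using A B c2 by (intro sum_ennreal) auto
      also have "(\<Sum>k\<le>m. 2 * A * B * c2 * (norm y powr - (5/2) * norm y)) = (real (Suc m) * (2 * A * B * c2)) * (norm y powr - (5/2) * norm y)"
        by (simp add: mult.assoc del: of_nat_Suc)
      finally show ?thesis unfolding 1
        using A B c2 c by (subst ennreal_plus) (auto simp del: of_nat_Suc intro!: mult_nonneg_nonneg)
    qed
    also have "norm y powr - (5/2) * norm y = norm y powr - (3/2)"
      by (subst powr_mult_self) auto
    finally show "(\<integral>\<^sup>+x. ennreal (W m x y * norm x powr - (5/2)) \<partial>lborel)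
        \<le> ennreal ((real (Suc m) * (2 * A * B * c2) + c) * norm y powr - (3/2))"
      by (simp add: distrib_right)
  qed (use A B c2 c in \<open>auto intro!: add_nonneg_pos mult_nonneg_nonneg\<close>)
qed

text \<open>Schur's test for \<open>W / |x|\<close> on the square integrable functions.
  Cauchy-Schwarz in y with the auxiliary weight |y|^(-3/2) uses the first bound and leaves |x|^(-2 -
  1/2) = |x|^(-5/2), which is the weight of the second bound after exchanging the integrals.\<close>

lemma pot_Schur:
  obtains C where "0 < C"
    "\<And>g. \<lbrakk>g \<in> borel_measurable borel; \<And>y. 0 \<le> g y; nn_lborel (\<lambda>y. ennreal ((g y)\<^sup>2)) \<le> 1\<rbrakk> \<Longrightarrow>
       nn_lborel (\<lambda>x. ennreal (norm x powr - 2) * (pot m g x)\<^sup>2) \<le> ennreal C"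
proof -
  obtain C1 where C1: "0 < C1" "\<And>x. x \<noteq> 0 \<Longrightarrow>
    (\<integral>\<^sup>+y. ennreal (W m x y * norm y powr - (3/2)) \<partial>lborel) \<le> ennreal (C1 * norm x powr - (1/2))"
    using W_integral_right by blast
  obtain C2 where C2: "0 < C2" "\<And>y. y \<noteq> 0 \<Longrightarrow>
    (\<integral>\<^sup>+x. ennreal (W m x y * norm x powr - (5/2)) \<partial>lborel) \<le> ennreal (C2 * norm y powr - (3/2))"
    using W_integral_left by blast
  have ae0: "AE y in lborel. y \<noteq> (0::real^3)" by (rule AE_lborel_singleton)
  show ?thesis
  proof (rule that[of "C1 * C2"])
    fix g :: "real^3 \<Rightarrow> real"
    assume [measurable]: "g \<in> borel_measurable borel" and g: "\<And>y. 0 \<le> g y"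
      and g2: "nn_lborel (\<lambda>y. ennreal ((g y)\<^sup>2)) \<le> 1"
    have "nn_lborel (\<lambda>x. ennreal (norm x powr - 2) * (pot m g x)\<^sup>2) \<le>
       (\<integral>\<^sup>+x. \<integral>\<^sup>+y. ennreal (C1 * ((g y)\<^sup>2 / norm y powr - (3/2))) * ennreal (W m x y * norm x powr - (5/2)) \<partial>lborel \<partial>lborel)"
    proof (rule nn_integral_mono_AE, use ae0 in eventually_elim)
      fix x :: "real^3" assume x: "x \<noteq> 0"
      have "(pot m g x)\<^sup>2 \<le> ennreal (C1 * norm x powr - (1/2)) * (\<integral>\<^sup>+y. ennreal (W m x y * (g y)\<^sup>2 / norm y powr - (3/2)) \<partial>lborel)"
        unfolding pot_def
        by (rule nn_Cauchy_Schwarz_weighted[where h="\<lambda>y. norm y powr - (3/2)"])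
           (use ae0 C1(1) C1(2)[OF x] x g W_nonneg in \<open>auto elim!: eventually_mono\<close>)
      then have "ennreal (norm x powr - 2) * (pot m g x)\<^sup>2 \<le> ennreal (norm x powr - 2) *
          (ennreal (C1 * norm x powr - (1/2)) * (\<integral>\<^sup>+y. ennreal (W m x y * (g y)\<^sup>2 / norm y powr - (3/2)) \<partial>lborel))"
        by (rule mult_left_mono) simp
      also have "\<dots> = ennreal (norm x powr - 2 * (C1 * norm x powr - (1/2))) * (\<integral>\<^sup>+y. ennreal (W m x y * (g y)\<^sup>2 / norm y powr - (3/2)) \<partial>lborel)"
        using C1 by (subst ennreal_mult) (auto simp: mult.assoc)
      also have "norm x powr - 2 * (C1 * norm x powr - (1/2)) = C1 * norm x powr - (5/2)"
      proof -
        have "norm x powr - 2 * norm x powr - (1/2) = norm x powr - (5/2)"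
          by (simp flip: powr_add)
        then show ?thesis by (simp add: mult.left_commute)
      qed
      also have "ennreal (C1 * norm x powr - (5/2)) * (\<integral>\<^sup>+y. ennreal (W m x y * (g y)\<^sup>2 / norm y powr - (3/2)) \<partial>lborel)
         = (\<integral>\<^sup>+y. ennreal (C1 * norm x powr - (5/2)) * ennreal (W m x y * (g y)\<^sup>2 / norm y powr - (3/2)) \<partial>lborel)"
        by (subst nn_integral_cmult) auto
      also have "\<dots> = (\<integral>\<^sup>+y. ennreal (C1 * ((g y)\<^sup>2 / norm y powr - (3/2))) * ennreal (W m x y * norm x powr - (5/2)) \<partial>lborel)"
        using C1 W_nonneg by (intro nn_integral_cong) (simp flip: ennreal_mult add: mult_ac)
      finally show "ennreal (norm x powr - 2) * (pot m g x)\<^sup>2 \<le> \<dots>" .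
    qed
    also have "\<dots> = (\<integral>\<^sup>+y. \<integral>\<^sup>+x. ennreal (C1 * ((g y)\<^sup>2 / norm y powr - (3/2))) * ennreal (W m x y * norm x powr - (5/2)) \<partial>lborel \<partial>lborel)"
    proof -
      have "(\<lambda>(x, y). ennreal (C1 * ((g y)\<^sup>2 / norm y powr - (3/2))) * ennreal (W m x y * norm x powr - (5/2)))
          \<in> borel_measurable (lborel \<Otimes>\<^sub>M lborel)"
        by measurable
      from lborel_pair.Fubini'[OF this] show ?thesis by simp
    qed
    also have "\<dots> \<le> (\<integral>\<^sup>+y. ennreal (C1 * C2) * ennreal ((g y)\<^sup>2) \<partial>lborel)"
    proof (rule nn_integral_mono_AE, use ae0 in eventually_elim)
      fix y :: "real^3" assume y: "y \<noteq> 0"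
      have "(\<integral>\<^sup>+x. ennreal (C1 * ((g y)\<^sup>2 / norm y powr - (3/2))) * ennreal (W m x y * norm x powr - (5/2)) \<partial>lborel)
         = ennreal (C1 * ((g y)\<^sup>2 / norm y powr - (3/2))) * (\<integral>\<^sup>+x. ennreal (W m x y * norm x powr - (5/2)) \<partial>lborel)"
        by (subst nn_integral_cmult) auto
      also have "\<dots> \<le> ennreal (C1 * ((g y)\<^sup>2 / norm y powr - (3/2))) * ennreal (C2 * norm y powr - (3/2))"
        by (intro mult_left_mono C2(2) y) simp
      also have "\<dots> = ennreal (C1 * C2 * (g y)\<^sup>2)"
        using y C1 C2 by (subst ennreal_mult[symmetric]) auto
      also have "\<dots> = ennreal (C1 * C2) * ennreal ((g y)\<^sup>2)"
        using C1 C2 by (subst ennreal_mult) auto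
      finally show "(\<integral>\<^sup>+x. ennreal (C1 * ((g y)\<^sup>2 / norm y powr - (3/2))) * ennreal (W m x y * norm x powr - (5/2)) \<partial>lborel) \<le> \<dots>" .
    qed
    also have "\<dots> = ennreal (C1 * C2) * nn_lborel (\<lambda>y. ennreal ((g y)\<^sup>2))"
      by (subst nn_integral_cmult) auto
    also have "\<dots> \<le> ennreal (C1 * C2) * 1"
      using g2 by (intro mult_left_mono) auto
    finally show "nn_lborel (\<lambda>x. ennreal (norm x powr - 2) * (pot m g x)\<^sup>2) \<le> ennreal (C1 * C2)" by simp
  qed (use C1 C2 in simp)
qed

text \<open>At the exponent 6 the extra decay of the far branch is given up: there it is at most
  max(|x|, |y|)^-2, and |x - y| \<le> 2 max(|x|, |y|), so the single undilated kernel dominates with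
  factor 4. Hence \<open>pot\<close> is controlled by dilated Riesz potentials.\<close>

lemma W_le_riesz_kernels: "W m x y \<le> 4 * (\<Sum>k\<le>m. norm ((1 / 2 ^ k) *\<^sub>R x - y) powr - 2)"
proof (cases "near m x y")
  case True
  then show ?thesis by (simp add: W_def norm_minus_commute sum_nonneg)
next
  case False
  show ?thesis
  proof (cases "x = 0")
    case True
    then show ?thesis using False by (simp add: W_def sum_nonneg)
  next
    case x: False
    let ?M = "max (norm x) (norm y)"
    have M: "0 < ?M" "norm x \<le> ?M" using x by (auto simp: less_max_iff_disj)
    have "x \<noteq> y"
    proof
      assume "x = y"
      moreover have "1 * norm x \<le> 2 ^ (m + 2) * norm x"
        by (intro mult_right_mono one_le_power) auto
      ultimately show False using False by (simp add: near_def)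
    qed
    then have d: "0 < norm (x - y)" by simp
    have "norm (x - y) \<le> 2 * ?M"
      using norm_triangle_ineq4[of x y] by linarith
    then have "(2 * ?M) powr - 2 \<le> norm (x - y) powr - 2"
      using d by (intro powr_mono2') auto
    also have "(2 * ?M) powr - 2 = ?M powr - 2 / 4"
      using M by (simp add: powr_mult powr_minus_divide[of 2])
    finally have "?M powr - 2 \<le> 4 * norm (x - y) powr - 2" by simp
    moreover have "norm x * ?M powr - 3 \<le> ?M * ?M powr - 3"
      using M by (intro mult_right_mono) auto
    moreover have "?M * ?M powr - 3 = ?M powr - 2"
      using M by (subst mult.commute, subst powr_mult_self) auto
    ultimately have "W m x y \<le> 4 * norm (x - y) powr - 2"
      using False by (simp add: W_def)
    also have "norm (x - y) powr - 2 \<le> (\<Sum>k\<le>m. norm ((1 / 2 ^ k) *\<^sub>R x - y) powr - 2)"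
      using member_le_sum[of 0 "{..m}" "\<lambda>k. norm ((1 / 2 ^ k) *\<^sub>R x - y) powr - 2"] by simp
    finally show ?thesis by simp
  qed
qed

lemma sum_power6_le:
  fixes f :: "nat \<Rightarrow> ennreal"
  shows "(\<Sum>k\<le>m. f k) ^ 6 \<le> of_nat (Suc m) ^ 6 * (\<Sum>k\<le>m. f k ^ 6)"
proof -
  have fin: "finite (f ` {..m})" "f ` {..m} \<noteq> {}" by auto
  obtain j where j: "j \<le> m" "f j = Max (f ` {..m})"
    using Max_in[OF fin] by (metis atMost_iff imageE)
  have "(\<Sum>k\<le>m. f k) \<le> (\<Sum>k\<le>m. f j)"
    unfolding j(2) by (intro sum_mono Max_ge) auto
  also have "\<dots> = of_nat (Suc m) * f j" by simp
  finally have "(\<Sum>k\<le>m. f k) ^ 6 \<le> (of_nat (Suc m) * f j) ^ 6"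
    by (rule power_mono) simp
  also have "\<dots> = of_nat (Suc m) ^ 6 * f j ^ 6" by (simp add: power_mult_distrib)
  also have "f j ^ 6 \<le> (\<Sum>k\<le>m. f k ^ 6)"
    using j by (intro member_le_sum) auto
  finally show ?thesis by (simp add: mult_left_mono)
qed

lemma pot_HLS:
  obtains C where "0 < C"
    "\<And>g. \<lbrakk>g \<in> borel_measurable borel; \<And>y. 0 \<le> g y; nn_lborel (\<lambda>y. ennreal ((g y)\<^sup>2)) \<le> 1\<rbrakk> \<Longrightarrow>
       nn_lborel (\<lambda>x. (pot m g x) ^ 6) \<le> ennreal C"
proof -
  obtain C where C: "0 < C" "\<And>g. \<lbrakk>g \<in> borel_measurable borel; \<And>y. 0 \<le> g y; nn_lborel (\<lambda>y. ennreal ((g y)\<^sup>2)) \<le> 1\<rbrakk> \<Longrightarrow>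
       nn_lborel (\<lambda>x. (riesz g x) ^ 6) \<le> ennreal C"
    using Hardy_Littlewood_Sobolev_2_6 by blast
  \<comment> \<open>The factor 4 comes from comparing kernels, (m + 1)^6 from the sixth power of a
    sum, and 8^m from the change of variables x = 2^k z in each of the m + 1 potentials.\<close>
  define D where "D = 4 ^ 6 * real (Suc m) ^ 6 * (real (Suc m) * (8 ^ m * C))"
  show ?thesis
  proof (rule that[of D])
    show "0 < D" using C by (simp add: D_def del: of_nat_Suc)
    fix g :: "real^3 \<Rightarrow> real"
    assume [measurable]: "g \<in> borel_measurable borel" and g: "\<And>y. 0 \<le> g y"
      and g2: "nn_lborel (\<lambda>y. ennreal ((g y)\<^sup>2)) \<le> 1"
    have le: "pot m g x \<le> 4 * (\<Sum>k\<le>m. riesz g ((1 / 2 ^ k) *\<^sub>R x))" for x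
    proof -
      have "pot m g x \<le> (\<integral>\<^sup>+y. 4 * (\<Sum>k\<le>m. ennreal (norm ((1 / 2 ^ k) *\<^sub>R x - y) powr - 2 * g y)) \<partial>lborel)"
        unfolding pot_def
      proof (intro nn_integral_mono)
        fix y
        have "ennreal (W m x y * g y) \<le> ennreal (4 * (\<Sum>k\<le>m. norm ((1 / 2 ^ k) *\<^sub>R x - y) powr - 2) * g y)"
          by (intro ennreal_leI mult_right_mono W_le_riesz_kernels g)
        also have "\<dots> = 4 * (\<Sum>k\<le>m. ennreal (norm ((1 / 2 ^ k) *\<^sub>R x - y) powr - 2 * g y))"
        proof -
          have "4 * (\<Sum>k\<le>m. norm ((1 / 2 ^ k) *\<^sub>R x - y) powr - 2) * g y = 4 * (\<Sum>k\<le>m. norm ((1 / 2 ^ k) *\<^sub>R x - y) powr - 2 * g y)"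
            by (simp only: mult.assoc sum_distrib_right)
          also have "ennreal \<dots> = ennreal 4 * ennreal (\<Sum>k\<le>m. norm ((1 / 2 ^ k) *\<^sub>R x - y) powr - 2 * g y)"
            by (rule ennreal_mult') simp
          also have "ennreal (\<Sum>k\<le>m. norm ((1 / 2 ^ k) *\<^sub>R x - y) powr - 2 * g y) = (\<Sum>k\<le>m. ennreal (norm ((1 / 2 ^ k) *\<^sub>R x - y) powr - 2 * g y))"
            using g by (intro sum_ennreal[symmetric]) auto
          finally show ?thesis by simp
        qed
        finally show "ennreal (W m x y * g y) \<le> \<dots>" .
      qed
      also have "\<dots> = 4 * (\<Sum>k\<le>m. riesz g ((1 / 2 ^ k) *\<^sub>R x))"
        unfolding riesz_def by (simp add: nn_integral_cmult nn_integral_sum)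
      finally show ?thesis .
    qed
    have "nn_lborel (\<lambda>x. (pot m g x) ^ 6) \<le> nn_lborel (\<lambda>x. (4 ^ 6 * of_nat (Suc m) ^ 6) * (\<Sum>k\<le>m. riesz g ((1 / 2 ^ k) *\<^sub>R x) ^ 6))"
    proof (intro nn_integral_mono)
      fix x
      have "pot m g x ^ 6 \<le> (4 * (\<Sum>k\<le>m. riesz g ((1 / 2 ^ k) *\<^sub>R x))) ^ 6"
        by (intro power_mono le) simp
      also have "\<dots> \<le> 4 ^ 6 * (of_nat (Suc m) ^ 6 * (\<Sum>k\<le>m. riesz g ((1 / 2 ^ k) *\<^sub>R x) ^ 6))"
        unfolding power_mult_distrib by (intro mult_left_mono sum_power6_le) simp
      finally show "pot m g x ^ 6 \<le> (4 ^ 6 * of_nat (Suc m) ^ 6) * (\<Sum>k\<le>m. riesz g ((1 / 2 ^ k) *\<^sub>R x) ^ 6)"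
        by (simp only: mult.assoc)
    qed
    also have "\<dots> = (4 ^ 6 * of_nat (Suc m) ^ 6) * (\<Sum>k\<le>m. nn_lborel (\<lambda>x. riesz g ((1 / 2 ^ k) *\<^sub>R x) ^ 6))"
      by (subst nn_integral_cmult) (auto simp: nn_integral_sum)
    also have "\<dots> \<le> (4 ^ 6 * of_nat (Suc m) ^ 6) * (\<Sum>k\<le>m. ennreal (8 ^ m * C))"
    proof (intro mult_left_mono sum_mono)
      fix k assume k: "k \<in> {..m}"
      have "nn_lborel (\<lambda>x. riesz g ((1 / 2 ^ k) *\<^sub>R x) ^ 6)
          = ennreal (\<bar>2 ^ k\<bar> ^ 3) * nn_lborel (\<lambda>x. riesz g ((1 / 2 ^ k) *\<^sub>R (0 + (2 ^ k) *\<^sub>R x)) ^ 6)"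
        using nn_integral_affine_euclidean[of "\<lambda>x. riesz g ((1 / 2 ^ k) *\<^sub>R x) ^ 6" "2 ^ k" 0] by simp
      also have "\<dots> = ennreal (8 ^ k) * nn_lborel (\<lambda>x. riesz g x ^ 6)"
        by (simp add: power_mult[symmetric] mult.commute[of k]) (simp add: power_mult)
      also have "\<dots> \<le> ennreal (8 ^ m) * ennreal C"
        using k g g2 by (intro mult_mono ennreal_leI power_increasing C(2)) auto
      finally show "nn_lborel (\<lambda>x. riesz g ((1 / 2 ^ k) *\<^sub>R x) ^ 6) \<le> ennreal (8 ^ m * C)"
        by (simp add: ennreal_mult')
    qed auto
    also have "\<dots> = ennreal D"
    proof -
      have "(\<Sum>k\<le>m. ennreal (8 ^ m * C)) = ennreal (real (Suc m) * (8 ^ m * C))"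
        using C by (simp add: ennreal_mult ennreal_of_nat_eq_real_of_nat[symmetric] del: of_nat_Suc)
      moreover have "(4 ^ 6 * of_nat (Suc m) ^ 6 :: ennreal) = ennreal (4 ^ 6 * real (Suc m) ^ 6)"
        by (simp add: ennreal_mult' ennreal_power[symmetric] ennreal_of_nat_eq_real_of_nat del: of_nat_Suc)
      ultimately show ?thesis
        unfolding D_def by (simp add: ennreal_mult'[symmetric] del: of_nat_Suc)
    qed
    finally show "nn_lborel (\<lambda>x. (pot m g x) ^ 6) \<le> ennreal D" .
  qed
qed

section \<open>Dilations of the Cauchy kernel\<close>

text \<open>The generating function of the Gegenbauer polynomials of index 3/2. On the complex disc
  of radius 1/3 the quadratic stays within 7/9 of 1, so the function is holomorphic and bounded
  there uniformly in c. Cauchy's estimates bound the n-th coefficient by a multiple of 3^n, and for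
  \<tau> \<le> 1/4 the tail is geometric with ratio 3/4, which accounts for the factor 4.\<close>

lemma cubic_kernel_taylor_scalar:
  obtains B :: real where "0 < B" "\<And>c. \<bar>c\<bar> \<le> 1 \<Longrightarrow> \<exists>b. \<forall>M \<tau>. 0 \<le> \<tau> \<and> \<tau> \<le> 1/4 \<longrightarrow>
    \<bar>(1 - 2 * c * \<tau> + \<tau>\<^sup>2) powr - (3/2) - (\<Sum>l<M. b l * \<tau> ^ l)\<bar> \<le> B * (3 * \<tau>) ^ M"
proof -
  define B where "B = (2/9::real) powr - (3/2)"
  have B: "0 < B" by (simp add: B_def)
  show ?thesis
  proof (rule that[of "4 * B"])
    fix c :: real assume c: "\<bar>c\<bar> \<le> 1"
    define p where "p z = 1 - 2 * of_real c * z + z\<^sup>2" for z :: complex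
    define f where "f z = exp (- (3/2) * Ln (p z))" for z
    have pR: "2/9 \<le> Re (p z)" if "norm z \<le> 1/3" for z
    proof -
      have "norm (p z - 1) \<le> norm (2 * of_real c * z) + norm (z\<^sup>2)"
        unfolding p_def using norm_triangle_ineq4[of "z\<^sup>2" "2 * of_real c * z"] by (simp add: algebra_simps)
      also have "\<dots> = 2 * \<bar>c\<bar> * norm z + (norm z)\<^sup>2"
        by (simp add: norm_mult norm_power)
      also have "\<dots> \<le> 2 * 1 * (1/3) + (1/3)\<^sup>2"
        using c that by (intro add_mono mult_mono power_mono) auto
      finally have "norm (p z - 1) \<le> 7/9" by (simp add: power2_eq_square)
      moreover have "\<bar>Re (p z - 1)\<bar> \<le> norm (p z - 1)" by (rule abs_Re_le_cmod)
      ultimately show ?thesis by simp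
    qed
    have hol: "f holomorphic_on cball 0 (1/3)"
      unfolding f_def
    proof (intro holomorphic_intros)
      show "p holomorphic_on cball 0 (1/3)" unfolding p_def by (intro holomorphic_intros)
      fix z :: complex assume "z \<in> cball 0 (1/3)"
      then have "0 < Re (p z)" using pR[of z] by simp
      then show "p z \<notin> \<real>\<^sub>\<le>\<^sub>0" by (auto simp: complex_nonpos_Reals_iff)
    qed
    have fB: "norm (f z) \<le> B" if "norm z \<le> 1/3" for z
    proof -
      have p: "2/9 \<le> norm (p z)" "p z \<noteq> 0"
        using pR[OF that] complex_Re_le_cmod[of "p z"] by auto
      have "norm (f z) = norm (p z) powr - (3/2)"
        using p by (simp add: f_def powr_def)
      also have "\<dots> \<le> B"
        unfolding B_def using p by (intro powr_mono2') auto
      finally show ?thesis .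
    qed
    define a where "a n = (deriv ^^ n) f 0 / fact n" for n
    have an: "norm (a n) \<le> B * 3 ^ n" for n
    proof -
      have "norm ((deriv ^^ n) f 0) \<le> fact n * B / (1/3) ^ n"
        by (rule Cauchy_inequality)
           (use hol fB in \<open>auto intro: holomorphic_on_subset holomorphic_on_imp_continuous_on simp: dist_norm\<close>)
      then show ?thesis by (simp add: a_def norm_divide field_simps power_divide)
    qed
    have "\<bar>(1 - 2 * c * \<tau> + \<tau>\<^sup>2) powr - (3/2) - (\<Sum>l<M. Re (a l) * \<tau> ^ l)\<bar> \<le> 4 * B * (3 * \<tau>) ^ M"
      if \<tau>: "0 \<le> \<tau>" "\<tau> \<le> 1/4" for M \<tau>
    proof -
      have "(\<lambda>n. a n * (of_real \<tau> - 0) ^ n) sums f (of_real \<tau>)"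
        unfolding a_def
        by (rule holomorphic_power_series[of f 0 "1/3"]) (use hol \<tau> in \<open>auto intro: holomorphic_on_subset\<close>)
      then have "(\<lambda>n. Re (a n * of_real \<tau> ^ n)) sums Re (f (of_real \<tau>))"
        using sums_Re by fastforce
      moreover have "Re (a n * of_real \<tau> ^ n) = Re (a n) * \<tau> ^ n" for n
        by (simp flip: of_real_power)
      moreover have "f (of_real \<tau>) = of_real ((1 - 2 * c * \<tau> + \<tau>\<^sup>2) powr - (3/2))"
      proof -
        have pp: "p (of_real \<tau>) = of_real (1 - 2 * c * \<tau> + \<tau>\<^sup>2)" by (simp add: p_def)
        have "2/9 \<le> 1 - 2 * c * \<tau> + \<tau>\<^sup>2"
          using pR[of "of_real \<tau>"] \<tau> unfolding pp by simp
        then have pos: "0 < 1 - 2 * c * \<tau> + \<tau>\<^sup>2" by linarith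
        show ?thesis
          unfolding f_def pp Ln_of_real[OF pos] using pos
          by (simp add: powr_def exp_of_real[symmetric])
      qed
      ultimately have sums: "(\<lambda>n. Re (a n) * \<tau> ^ n) sums ((1 - 2 * c * \<tau> + \<tau>\<^sup>2) powr - (3/2))" by simp
      have "(1 - 2 * c * \<tau> + \<tau>\<^sup>2) powr - (3/2) - (\<Sum>l<M. Re (a l) * \<tau> ^ l) = (\<Sum>n. Re (a (n + M)) * \<tau> ^ (n + M))"
        using suminf_minus_initial_segment[OF sums_summable[OF sums], of M] sums_unique[OF sums] by simp
      also have "\<bar>\<dots>\<bar> \<le> (\<Sum>n. B * (3 * \<tau>) ^ M * (3/4) ^ n)"
        unfolding real_norm_def[symmetric]
      proof (rule norm_suminf_le)
        fix n
        have "norm (Re (a (n + M)) * \<tau> ^ (n + M)) \<le> (B * 3 ^ (n + M)) * \<tau> ^ (n + M)"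
          unfolding norm_mult using \<tau> an[of "n + M"] abs_Re_le_cmod[of "a (n + M)"]
          by (auto intro!: mult_mono)
        also have "\<dots> = B * (3 * \<tau>) ^ M * (3 * \<tau>) ^ n"
          by (simp add: power_mult_distrib power_add algebra_simps)
        also have "\<dots> \<le> B * (3 * \<tau>) ^ M * (3/4) ^ n"
          using \<tau> B by (intro mult_left_mono power_mono) auto
        finally show "norm (Re (a (n + M)) * \<tau> ^ (n + M)) \<le> B * (3 * \<tau>) ^ M * (3/4) ^ n" .
      qed (auto intro!: summable_mult summable_geometric)
      also have "\<dots> = B * (3 * \<tau>) ^ M * 4"
        by (subst suminf_mult) (auto intro!: summable_geometric simp: suminf_geometric)
      finally show ?thesis by (simp add: mult_ac)
    qed
    then show "\<exists>b. \<forall>M \<tau>. 0 \<le> \<tau> \<and> \<tau> \<le> 1/4 \<longrightarrow>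
        \<bar>(1 - 2 * c * \<tau> + \<tau>\<^sup>2) powr - (3/2) - (\<Sum>l<M. b l * \<tau> ^ l)\<bar> \<le> 4 * B * (3 * \<tau>) ^ M"
      by (intro exI[of _ "\<lambda>l. Re (a l)"]) auto
  qed (use B in simp)
qed

text \<open>The field z / |z|^3, whose divergence is 4 pi times the point mass at 0. The matrix
  \<sigma> \<cdot> G is 4 pi times the fundamental solution of \<sigma> \<cdot> \<nabla>.\<close>

definition G :: "real^3 \<Rightarrow> real^3" where
  "G z = norm z powr - 3 *\<^sub>R z"

lemma G_scale: "0 < s \<Longrightarrow> G (s *\<^sub>R z) = s powr - 2 *\<^sub>R G z"
proof -
  assume s: "0 < s"
  have "s powr - 3 * s = s powr - 2"
    using s by (simp add: powr_minus_divide powr_numeral field_simps power2_eq_square power3_eq_cube)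
  then show ?thesis using s by (simp add: G_def powr_mult mult_ac)
qed

lemma G_minus: "G (- z) = - G z"
  by (simp add: G_def)

lemma norm_G: "norm (G z) = norm z powr - 2"
proof (cases "z = 0")
  case False
  then show ?thesis
    by (simp add: G_def powr_minus_divide powr_numeral field_simps power2_eq_square power3_eq_cube)
qed (simp add: G_def)

text \<open>The remainder is uniform over unit vectors while the coefficients may depend on them.
  This is all that is needed, because the coefficients will be annihilated and never
  estimated.\<close>

lemma G_taylor:
  fixes M :: nat
  obtains C where "0 < C" "\<And>w v. norm w = 1 \<Longrightarrow> norm v = 1 \<Longrightarrow> \<exists>a. \<forall>\<tau>. 0 \<le> \<tau> \<and> \<tau> \<le> 1/4 \<longrightarrow>
    norm (G (w - \<tau> *\<^sub>R v) - (\<Sum>l<M. \<tau> ^ l *\<^sub>R a l)) \<le> C * \<tau> ^ M"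
proof -
  obtain B :: real where B: "0 < B" "\<And>c. \<bar>c\<bar> \<le> 1 \<Longrightarrow> \<exists>b. \<forall>M \<tau>. 0 \<le> \<tau> \<and> \<tau> \<le> 1/4 \<longrightarrow>
    \<bar>(1 - 2 * c * \<tau> + \<tau>\<^sup>2) powr - (3/2) - (\<Sum>l<M. b l * \<tau> ^ l)\<bar> \<le> B * (3 * \<tau>) ^ M"
    using cubic_kernel_taylor_scalar by blast
  show ?thesis
  proof (rule that[of "2 * B * 3 ^ M"])
    fix w v :: "real^3" assume w: "norm w = 1" and v: "norm v = 1"
    define c where "c = w \<bullet> v"
    have "\<bar>c\<bar> \<le> 1" using Cauchy_Schwarz_ineq2[of w v] w v by (simp add: c_def)
    from B(2)[OF this] obtain b where b0: "\<forall>M \<tau>. 0 \<le> \<tau> \<and> \<tau> \<le> 1/4 \<longrightarrow>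
        \<bar>(1 - 2 * c * \<tau> + \<tau>\<^sup>2) powr - (3/2) - (\<Sum>l<M. b l * \<tau> ^ l)\<bar> \<le> B * (3 * \<tau>) ^ M"
      by (rule exE)
    have b: "\<And>M \<tau>. 0 \<le> \<tau> \<Longrightarrow> \<tau> \<le> 1/4 \<Longrightarrow>
      \<bar>(1 - 2 * c * \<tau> + \<tau>\<^sup>2) powr - (3/2) - (\<Sum>l<M. b l * \<tau> ^ l)\<bar> \<le> B * (3 * \<tau>) ^ M"
      using b0 by simp
    \<comment> \<open>G (w - \<tau> v) is the scalar series times w - \<tau> v; the factor \<tau> in
      front of v shifts its coefficients by one.\<close>
    define a where "a l = b l *\<^sub>R w - (if l = 0 then 0 else b (l - 1)) *\<^sub>R v" for l
    have "norm (G (w - \<tau> *\<^sub>R v) - (\<Sum>l<M. \<tau> ^ l *\<^sub>R a l)) \<le> 2 * B * 3 ^ M * \<tau> ^ M"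
      if \<tau>: "0 \<le> \<tau>" "\<tau> \<le> 1/4" for \<tau>
    proof -
      define F where "F = (1 - 2 * c * \<tau> + \<tau>\<^sup>2) powr - (3/2)"
      have n2: "(norm (w - \<tau> *\<^sub>R v))\<^sup>2 = 1 - 2 * c * \<tau> + \<tau>\<^sup>2"
      proof -
        have "(norm (w - \<tau> *\<^sub>R v))\<^sup>2 = (norm w)\<^sup>2 - 2 * \<tau> * c + \<tau>\<^sup>2 * (norm v)\<^sup>2"
          unfolding power2_norm_eq_inner c_def
          by (simp add: inner_diff inner_commute power2_eq_square algebra_simps)
        then show ?thesis using w v by (simp add: mult_ac)
      qed
      have "norm (w - \<tau> *\<^sub>R v) powr - 3 = ((norm (w - \<tau> *\<^sub>R v))\<^sup>2) powr - (3/2)"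
        by (simp add: powr_powr flip: powr_numeral)
      then have G: "G (w - \<tau> *\<^sub>R v) = F *\<^sub>R w - (\<tau> * F) *\<^sub>R v"
        unfolding G_def n2 by (simp add: F_def algebra_simps)
      \<comment> \<open>The v part is truncated one term earlier, as it already carries a factor
        \<tau>. For M = 0 the subtraction truncates at 0, and that case is settled by \<tau> \<le>
        1.\<close>
      define M' where "M' = M - 1"
      have S: "(\<Sum>l<M. \<tau> ^ l *\<^sub>R a l) = (\<Sum>l<M. b l * \<tau> ^ l) *\<^sub>R w - (\<tau> * (\<Sum>l<M'. b l * \<tau> ^ l)) *\<^sub>R v"
      proof (cases M)
        case (Suc N)
        have "(\<Sum>l<Suc N. \<tau> ^ l *\<^sub>R a l) = (\<Sum>l<Suc N. (b l * \<tau> ^ l) *\<^sub>R w) - (\<Sum>l<Suc N. ((if l = 0 then 0 else b (l - 1)) * \<tau> ^ l) *\<^sub>R v)"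
          unfolding sum_subtractf[symmetric]
          by (intro sum.cong refl) (simp add: a_def scaleR_diff_right mult.commute)
        also have "(\<Sum>l<Suc N. ((if l = 0 then 0 else b (l - 1)) * \<tau> ^ l) *\<^sub>R v) = (\<Sum>l<N. (b l * \<tau> ^ Suc l) *\<^sub>R v)"
          by (subst sum.lessThan_Suc_shift) simp
        finally show ?thesis unfolding Suc M'_def
          by (simp add: scaleR_sum_left scaleR_add_left sum_distrib_left mult_ac)
      qed (simp add: M'_def)
      have F2: "\<tau> * \<bar>F - (\<Sum>l<M'. b l * \<tau> ^ l)\<bar> \<le> B * (3 * \<tau>) ^ M"
      proof (cases M)
        case 0
        then have "\<tau> * \<bar>F - (\<Sum>l<M'. b l * \<tau> ^ l)\<bar> \<le> 1 * B"
          using b[OF \<tau>, of 0] \<tau> B by (intro mult_mono) (auto simp: F_def M'_def)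
        then show ?thesis using 0 by simp
      next
        case (Suc N)
        have "\<tau> * \<bar>F - (\<Sum>l<M'. b l * \<tau> ^ l)\<bar> \<le> (3 * \<tau>) * (B * (3 * \<tau>) ^ N)"
          using b[OF \<tau>, of N] \<tau> B by (intro mult_mono) (auto simp: F_def M'_def Suc)
        then show ?thesis by (simp add: Suc mult_ac)
      qed
      have "G (w - \<tau> *\<^sub>R v) - (\<Sum>l<M. \<tau> ^ l *\<^sub>R a l) =
          (F - (\<Sum>l<M. b l * \<tau> ^ l)) *\<^sub>R w - (\<tau> * (F - (\<Sum>l<M'. b l * \<tau> ^ l))) *\<^sub>R v"
        unfolding G S by (simp add: algebra_simps)
      also have "norm \<dots> \<le> \<bar>F - (\<Sum>l<M. b l * \<tau> ^ l)\<bar> + \<tau> * \<bar>F - (\<Sum>l<M'. b l * \<tau> ^ l)\<bar>"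
        using norm_triangle_ineq4[of "(F - (\<Sum>l<M. b l * \<tau> ^ l)) *\<^sub>R w" "(\<tau> * (F - (\<Sum>l<M'. b l * \<tau> ^ l))) *\<^sub>R v"] w v \<tau>
        by (simp add: abs_mult)
      also have "\<dots> \<le> B * (3 * \<tau>) ^ M + B * (3 * \<tau>) ^ M"
        by (rule add_mono[OF b[OF \<tau>, of M, folded F_def] F2])
      also have "\<dots> = 2 * B * 3 ^ M * \<tau> ^ M" by (simp add: power_mult_distrib)
      finally show ?thesis .
    qed
    then show "\<exists>a. \<forall>\<tau>. 0 \<le> \<tau> \<and> \<tau> \<le> 1/4 \<longrightarrow>
        norm (G (w - \<tau> *\<^sub>R v) - (\<Sum>l<M. \<tau> ^ l *\<^sub>R a l)) \<le> 2 * B * 3 ^ M * \<tau> ^ M"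
      by blast
  qed (use B in simp)
qed

text \<open>All the points y - t_k x share the same Taylor coefficients after scaling by |y|; the
  l-th one is multiplied by the l-th moment of the weights c_k at the nodes t_k. Vanishing moments
  below M leave only remainders of order (|x| / |y|)^M.\<close>

lemma G_moments_bound:
  fixes M n :: nat and c t :: "nat \<Rightarrow> real"
  assumes t: "\<And>k. k \<le> n \<Longrightarrow> 0 \<le> t k" "\<And>k. k \<le> n \<Longrightarrow> t k \<le> T" "0 < T"
    and moments: "\<And>l. l < M \<Longrightarrow> (\<Sum>k\<le>n. c k * t k ^ l) = 0"
  obtains C where "0 < C" "\<And>x y. x \<noteq> 0 \<Longrightarrow> 4 * T * norm x \<le> norm y \<Longrightarrow>
    norm (\<Sum>k\<le>n. c k *\<^sub>R G (y - t k *\<^sub>R x)) \<le> C * norm y powr - 2 * (norm x / norm y) ^ M"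
proof -
  obtain C where C: "0 < C" "\<And>w v. norm w = 1 \<Longrightarrow> norm v = 1 \<Longrightarrow> \<exists>a. \<forall>\<tau>. 0 \<le> \<tau> \<and> \<tau> \<le> 1/4 \<longrightarrow>
    norm (G (w - \<tau> *\<^sub>R v) - (\<Sum>l<M. \<tau> ^ l *\<^sub>R a l)) \<le> C * \<tau> ^ M"
    using G_taylor by blast
  define D where "D = (\<Sum>k\<le>n. \<bar>c k\<bar> * (C * t k ^ M))"
  have D: "0 \<le> D" using C t by (auto simp: D_def intro!: sum_nonneg)
  show ?thesis
  proof (rule that[of "D + 1"])
    fix x y :: "real^3" assume x: "x \<noteq> 0" and xy: "4 * T * norm x \<le> norm y"
    have "0 < 4 * T * norm x" using x t by simp
    then have y: "0 < norm y" using xy by linarith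
    define w where "w = (1 / norm y) *\<^sub>R y"
    define v where "v = (1 / norm x) *\<^sub>R x"
    define r where "r = norm x / norm y"
    have wv: "norm w = 1" "norm v = 1" using x y by (auto simp: w_def v_def)
    from C(2)[OF this] obtain a where a0: "\<forall>\<tau>. 0 \<le> \<tau> \<and> \<tau> \<le> 1/4 \<longrightarrow>
        norm (G (w - \<tau> *\<^sub>R v) - (\<Sum>l<M. \<tau> ^ l *\<^sub>R a l)) \<le> C * \<tau> ^ M"
      by (rule exE)
    have a: "\<And>\<tau>. 0 \<le> \<tau> \<Longrightarrow> \<tau> \<le> 1/4 \<Longrightarrow> norm (G (w - \<tau> *\<^sub>R v) - (\<Sum>l<M. \<tau> ^ l *\<^sub>R a l)) \<le> C * \<tau> ^ M"
      using a0 by simp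
    have tr: "0 \<le> t k * r" "t k * r \<le> 1/4" if "k \<le> n" for k
    proof -
      show "0 \<le> t k * r" using t that by (simp add: r_def)
      have "t k * r \<le> T * r" using t that by (intro mult_right_mono) (auto simp: r_def)
      also have "\<dots> \<le> 1/4" using xy y by (simp add: r_def field_simps)
      finally show "t k * r \<le> 1/4" .
    qed
    have Gk: "G (y - t k *\<^sub>R x) = norm y powr - 2 *\<^sub>R G (w - (t k * r) *\<^sub>R v)" for k
    proof -
      have "y - t k *\<^sub>R x = norm y *\<^sub>R (w - (t k * r) *\<^sub>R v)"
        using x y by (simp add: w_def v_def r_def algebra_simps)
      then show ?thesis using G_scale[OF y] by simp
    qed
    have "(\<Sum>k\<le>n. c k *\<^sub>R (\<Sum>l<M. (t k * r) ^ l *\<^sub>R a l)) = (\<Sum>k\<le>n. \<Sum>l<M. (c k * t k ^ l) *\<^sub>R (r ^ l *\<^sub>R a l))"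
      by (simp add: scaleR_sum_right power_mult_distrib mult_ac)
    also have "\<dots> = (\<Sum>l<M. (\<Sum>k\<le>n. c k * t k ^ l) *\<^sub>R (r ^ l *\<^sub>R a l))"
      by (subst sum.swap) (simp add: scaleR_sum_left sum_distrib_right)
    also have "\<dots> = 0" using moments by (intro sum.neutral) auto
    finally have z: "(\<Sum>k\<le>n. c k *\<^sub>R (\<Sum>l<M. (t k * r) ^ l *\<^sub>R a l)) = 0" .
    have "(\<Sum>k\<le>n. c k *\<^sub>R G (y - t k *\<^sub>R x)) = norm y powr - 2 *\<^sub>R (\<Sum>k\<le>n. c k *\<^sub>R G (w - (t k * r) *\<^sub>R v))"
      unfolding Gk scaleR_sum_right by (simp add: mult_ac)
    also have "(\<Sum>k\<le>n. c k *\<^sub>R G (w - (t k * r) *\<^sub>R v)) = (\<Sum>k\<le>n. c k *\<^sub>R (G (w - (t k * r) *\<^sub>R v) - (\<Sum>l<M. (t k * r) ^ l *\<^sub>R a l)))"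
      using z by (simp add: scaleR_diff_right sum_subtractf)
    finally have "norm (\<Sum>k\<le>n. c k *\<^sub>R G (y - t k *\<^sub>R x)) =
        norm y powr - 2 * norm (\<Sum>k\<le>n. c k *\<^sub>R (G (w - (t k * r) *\<^sub>R v) - (\<Sum>l<M. (t k * r) ^ l *\<^sub>R a l)))"
      by simp
    also have "\<dots> \<le> norm y powr - 2 * (\<Sum>k\<le>n. \<bar>c k\<bar> * (C * (t k * r) ^ M))"
      by (intro mult_left_mono sum_norm_le) (auto intro!: mult_left_mono a tr)
    also have "(\<Sum>k\<le>n. \<bar>c k\<bar> * (C * (t k * r) ^ M)) = D * r ^ M"
      unfolding D_def sum_distrib_right
      by (intro sum.cong refl) (simp add: power_mult_distrib mult_ac)
    also have "norm y powr - 2 * (D * r ^ M) \<le> (D + 1) * norm y powr - 2 * r ^ M"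
      by (simp add: r_def algebra_simps)
    finally show "norm (\<Sum>k\<le>n. c k *\<^sub>R G (y - t k *\<^sub>R x)) \<le> (D + 1) * norm y powr - 2 * (norm x / norm y) ^ M"
      by (simp add: r_def)
  qed (use D in simp)
qed

text \<open>The zeros of this polynomial are the factors \<open>2 powi (- d)\<close> by which the dilation \<open>\<psi> \<mapsto> \<psi> (x / 2)\<close> acts
  on homogeneous zero modes of degree \<open>d\<close>. Degree \<open>-1\<close> is left out: it carries no zero mode.\<close>

definition degs :: "nat \<Rightarrow> int set" where
  "degs M = {- 1 - int M..int M - 1} - {-1}"

definition dil_poly :: "nat \<Rightarrow> real poly" where
  "dil_poly M = (\<Prod>d\<in>degs M. [:1, - (2 powi d):])"

lemma dil_poly_root: "d \<in> degs M \<Longrightarrow> poly (dil_poly M) (2 powi - d) = 0"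
  unfolding dil_poly_def poly_prod
  by (rule prod_zero) (auto simp: degs_def power_int_minus intro!: bexI[of _ d])

lemma degree_dil_poly: "degree (dil_poly M) \<le> 2 * M"
proof -
  have "degree (dil_poly M) \<le> (\<Sum>d\<in>degs M. 1)"
    unfolding dil_poly_def
    by (rule order_trans[OF degree_prod_sum_le]) (auto simp: degs_def intro!: sum_mono)
  also have "\<dots> \<le> 2 * M"
    by (cases "M = 0") (auto simp: degs_def card_Diff_singleton)
  finally show ?thesis .
qed

lemma poly_sum_le:
  fixes p :: "real poly"
  assumes "degree p \<le> n"
  shows "poly p x = (\<Sum>k\<le>n. coeff p k * x ^ k)"
proof -
  have "(\<Sum>k\<le>degree p. coeff p k * x ^ k) = (\<Sum>k\<le>n. coeff p k * x ^ k)"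
    using assms by (intro sum.mono_neutral_left) (auto simp: coeff_eq_0)
  then show ?thesis by (simp add: poly_altdef)
qed

lemma powr_ratio_lower:
  fixes r A :: real
  assumes "1 / A \<le> r" "r \<le> A" "0 < A"
  shows "A powr - \<bar>a\<bar> \<le> r powr a"
proof (cases "0 \<le> a")
  case True
  have "A powr - \<bar>a\<bar> = (1 / A) powr a"
    using assms True by (simp add: powr_divide powr_minus_divide)
  also have "\<dots> \<le> r powr a"
    using assms True by (intro powr_mono2) auto
  finally show ?thesis .
next
  case False
  have "0 < r" using assms by (meson divide_pos_pos less_le_trans zero_less_one)
  then show ?thesis
    using assms False by (auto intro!: powr_mono2')
qed

text \<open>Moments are values of \<open>dil_poly\<close>: at 2^-l for the expansion at small x, and
  at 2^(l+2) for the one at large x. Both are zeros for l < M, so both expansions start at order M,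
  and M \<ge> |\<alpha>| + 1 converts the gained power into the weights. The kernel \<open>g\<close>
  is left free so that \<open>G\<close> and its mollified versions obey one and the same bound: near
  the dilated singularities only the size of \<open>g\<close> is used.\<close>

lemma kernel_bound:
  fixes \<alpha> :: real and M :: nat
  defines "m \<equiv> 2 * M" and "c \<equiv> coeff (dil_poly M)"
  assumes M: "\<bar>\<alpha>\<bar> + 1 \<le> real M"
  obtains C where "0 < C"
    "\<And>g x y. \<lbrakk>x \<noteq> 0; y \<noteq> 0; \<And>z. norm (g z) \<le> norm z powr - 2;
        \<not> near m x y \<Longrightarrow> (\<And>k. k \<le> m \<Longrightarrow> g (y - (1 / 2 ^ k) *\<^sub>R x) = G (y - (1 / 2 ^ k) *\<^sub>R x))\<rbrakk> \<Longrightarrow>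
      norm (\<Sum>k\<le>m. c k *\<^sub>R g (y - (1 / 2 ^ k) *\<^sub>R x)) \<le> C * (norm x powr \<alpha> * norm y powr - \<alpha> * W m x y)"
proof -
  have deg: "degree (dil_poly M) \<le> m" unfolding m_def by (rule degree_dil_poly)
  obtain C1 where C1: "0 < C1" "\<And>x y. x \<noteq> 0 \<Longrightarrow> 4 * 1 * norm x \<le> norm y \<Longrightarrow>
    norm (\<Sum>k\<le>m. c k *\<^sub>R G (y - (1 / 2 ^ k) *\<^sub>R x)) \<le> C1 * norm y powr - 2 * (norm x / norm y) ^ M"
  proof (rule G_moments_bound[where n=m and c=c and t="\<lambda>k. 1 / 2 ^ k" and T=1 and M=M])
    fix l assume l: "l < M"
    have "(\<Sum>k\<le>m. c k * (1 / 2 ^ k) ^ l) = (\<Sum>k\<le>m. coeff (dil_poly M) k * (2 powi - int l) ^ k)"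
      by (simp add: c_def power_int_minus power_one_over power_inverse inverse_eq_divide power_mult[symmetric] mult.commute)
    also have "\<dots> = poly (dil_poly M) (2 powi - int l)"
      by (rule poly_sum_le[OF deg, symmetric])
    also have "\<dots> = 0"
      by (rule dil_poly_root) (use l in \<open>auto simp: degs_def\<close>)
    finally show "(\<Sum>k\<le>m. c k * (1 / 2 ^ k) ^ l) = 0" .
  qed auto
  \<comment> \<open>The mirror case with x and y exchanged. The weights acquire 4^k from the degree
    -2 of \<open>G\<close>, so the l-th moment is \<open>dil_poly\<close> at 2^(l+2), the zero
    belonging to degree -2 - l.\<close>
  obtain C2 where C2: "0 < C2" "\<And>x y. x \<noteq> 0 \<Longrightarrow> 4 * 2 ^ m * norm x \<le> norm y \<Longrightarrow>
    norm (\<Sum>k\<le>m. (4 ^ k * c k) *\<^sub>R G (y - (2 ^ k) *\<^sub>R x)) \<le> C2 * norm y powr - 2 * (norm x / norm y) ^ M"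
  proof (rule G_moments_bound[where n=m and c="\<lambda>k. 4 ^ k * c k" and t="\<lambda>k. 2 ^ k" and T="2 ^ m" and M=M])
    fix l assume l: "l < M"
    have "(\<Sum>k\<le>m. 4 ^ k * c k * (2 ^ k) ^ l) = (\<Sum>k\<le>m. coeff (dil_poly M) k * (2 powi - (- 2 - int l)) ^ k)"
    proof (intro sum.cong refl)
      fix k
      have "(2::real) powi - (- 2 - int l) = 4 * 2 ^ l"
        using power_int_add[of "2::real" "int l" 2] by simp
      then show "4 ^ k * c k * (2 ^ k) ^ l = coeff (dil_poly M) k * (2 powi - (- 2 - int l)) ^ k"
        by (simp add: c_def power_mult_distrib power_mult[symmetric] mult.commute)
    qed
    also have "\<dots> = poly (dil_poly M) (2 powi - (- 2 - int l))"
      by (rule poly_sum_le[OF deg, symmetric])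
    also have "\<dots> = 0"
      by (rule dil_poly_root) (use l in \<open>auto simp: degs_def\<close>)
    finally show "(\<Sum>k\<le>m. 4 ^ k * c k * (2 ^ k) ^ l) = 0" .
  qed (auto intro: power_increasing)
  define A :: real where "A = 2 ^ (m + 2)"
  have A: "0 < A" "4 \<le> A" by (auto simp: A_def)
  \<comment> \<open>On the near region |x| / |y| lies between 1 / A and A, so replacing the weights
    by 1 costs at most A^|\<alpha>|.\<close>
  define C3 where "C3 = (\<Sum>k\<le>m. \<bar>c k\<bar>) * A powr \<bar>\<alpha>\<bar>"
  have C3: "0 \<le> C3" by (auto simp: C3_def intro!: sum_nonneg mult_nonneg_nonneg)
  show ?thesis
  proof (rule that[of "C1 + C2 + C3"])
    show "0 < C1 + C2 + C3" using C1(1) C2(1) C3 by linarith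
    fix g :: "real^3 \<Rightarrow> real^3" and x y :: "real^3"
    assume x: "x \<noteq> 0" and y: "y \<noteq> 0" and g: "\<And>z. norm (g z) \<le> norm z powr - 2"
      and gG: "\<not> near m x y \<Longrightarrow> (\<And>k. k \<le> m \<Longrightarrow> g (y - (1 / 2 ^ k) *\<^sub>R x) = G (y - (1 / 2 ^ k) *\<^sub>R x))"
    have pos: "0 < norm x" "0 < norm y" using x y by auto
    let ?K = "\<Sum>k\<le>m. c k *\<^sub>R g (y - (1 / 2 ^ k) *\<^sub>R x)"
    let ?R = "norm x powr \<alpha> * norm y powr - \<alpha> * W m x y"
    have R0: "0 \<le> ?R" using W_nonneg by simp
    have rat: "norm x powr \<alpha> * norm y powr - \<alpha> = (norm x / norm y) powr \<alpha>"
      using pos by (simp add: powr_divide powr_minus_divide)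
    have "near m x y \<or> (\<not> near m x y \<and> 4 * norm x < norm y) \<or> (\<not> near m x y \<and> 4 * 2 ^ m * norm y < norm x)"
      by (auto simp: near_def not_le)
    then consider "near m x y" | "\<not> near m x y" "4 * norm x < norm y" | "\<not> near m x y" "4 * 2 ^ m * norm y < norm x"
      by blast
    then have "norm ?K \<le> C1 * ?R \<or> norm ?K \<le> C2 * ?R \<or> norm ?K \<le> C3 * ?R"
    proof cases
      case 1
      have "norm ?K \<le> (\<Sum>k\<le>m. \<bar>c k\<bar> * norm (y - (1 / 2 ^ k) *\<^sub>R x) powr - 2)"
        by (intro sum_norm_le) (auto intro!: mult_left_mono g)
      also have "\<dots> \<le> (\<Sum>k\<le>m. (\<Sum>j\<le>m. \<bar>c j\<bar>) * norm (y - (1 / 2 ^ k) *\<^sub>R x) powr - 2)"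
        by (intro sum_mono mult_right_mono member_le_sum) auto
      also have "\<dots> = (\<Sum>j\<le>m. \<bar>c j\<bar>) * W m x y"
        using 1 by (simp add: W_def sum_distrib_left)
      also have "\<dots> \<le> C3 * ?R"
      proof -
        have r: "1 / A \<le> norm x / norm y" "norm x / norm y \<le> A"
        proof -
          have "1 / A \<le> 1 / 4" using A by (simp add: frac_le)
          also have "1 / 4 \<le> norm x / norm y" using 1 pos by (simp add: near_def field_simps)
          finally show "1 / A \<le> norm x / norm y" .
          show "norm x / norm y \<le> A" using 1 pos by (simp add: near_def field_simps A_def)
        qed
        have "A powr - \<bar>\<alpha>\<bar> \<le> (norm x / norm y) powr \<alpha>"
          using r A by (intro powr_ratio_lower) auto
        then have "A powr \<bar>\<alpha>\<bar> * A powr - \<bar>\<alpha>\<bar> \<le> A powr \<bar>\<alpha>\<bar> * (norm x / norm y) powr \<alpha>"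
          by (rule mult_left_mono) simp
        moreover have "A powr \<bar>\<alpha>\<bar> * A powr - \<bar>\<alpha>\<bar> = 1"
          using A by (simp flip: powr_add)
        ultimately have "(\<Sum>j\<le>m. \<bar>c j\<bar>) * W m x y * 1 \<le> (\<Sum>j\<le>m. \<bar>c j\<bar>) * W m x y * (A powr \<bar>\<alpha>\<bar> * (norm x / norm y) powr \<alpha>)"
          using W_nonneg by (intro mult_left_mono mult_nonneg_nonneg sum_nonneg) auto
        then show ?thesis unfolding C3_def rat by (simp only: mult_ac mult_1_right)
      qed
      finally show ?thesis by blast
    next
      case 2
      let ?r = "norm x / norm y"
      have xy: "norm x \<le> norm y" using 2 pos by linarith
      have r: "0 < ?r" "?r \<le> 1" using pos xy by auto
      have "norm ?K = norm (\<Sum>k\<le>m. c k *\<^sub>R G (y - (1 / 2 ^ k) *\<^sub>R x))"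
        using gG[OF 2(1)] by simp
      also have "\<dots> \<le> C1 * norm y powr - 2 * ?r ^ M"
        using C1(2)[OF x, of y] 2 by simp
      \<comment> \<open>Of the M powers gained, \<alpha> pay for the weights and one is the extra
        factor |x| / |y| in the far branch of \<open>W\<close>.\<close>
      also have "?r ^ M \<le> ?r powr (\<alpha> + 1)"
        using r M by (subst powr_realpow[symmetric]) (auto intro!: powr_mono')
      also have "C1 * norm y powr - 2 * ?r powr (\<alpha> + 1) = C1 * ?R"
      proof -
        have "max (norm x) (norm y) = norm y" using xy by simp
        then have W: "W m x y = norm x * norm y powr - 3" using 2 by (simp add: W_def)
        have e1: "norm y powr - 2 * ?r = norm x * norm y powr - 3"
          using pos by (simp add: powr_minus_divide field_simps power2_eq_square power3_eq_cube)
        have e2: "?r powr (\<alpha> + 1) = ?r powr \<alpha> * ?r"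
          using r by (simp add: powr_add)
        have "C1 * norm y powr - 2 * (?r powr \<alpha> * ?r) = C1 * (?r powr \<alpha> * (norm y powr - 2 * ?r))"
          by (simp only: mult.assoc mult.left_commute)
        then show ?thesis unfolding rat W e2 e1 .
      qed
      finally show ?thesis using C1 by (simp add: mult_left_mono)
    next
      case 3
      let ?s = "norm y / norm x"
      have "1 * norm y \<le> 4 * 2 ^ m * norm y" by (intro mult_right_mono) (auto intro: order_trans[OF _ mult_left_mono[of 1 "2^m" 4]])
      then have "norm y \<le> norm x" using 3 by simp
      then have s: "0 < ?s" "?s \<le> 1" using pos by auto
      \<comment> \<open>Factoring out -1 / 2^k turns an expansion in y / x into the situation of
        \<open>C2\<close>; oddness of \<open>G\<close> gives the sign and its degree gives
        4^k.\<close>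
      have "g (y - (1 / 2 ^ k) *\<^sub>R x) = - ((4 ^ k) *\<^sub>R G (x - 2 ^ k *\<^sub>R y))" if "k \<le> m" for k
      proof -
        have "y - (1 / 2 ^ k) *\<^sub>R x = (1 / 2 ^ k) *\<^sub>R (- (x - 2 ^ k *\<^sub>R y))"
          by (simp add: algebra_simps)
        moreover have "(1 / 2 ^ k :: real) powr - 2 = 4 ^ k"
          by (simp add: powr_minus_divide power_divide power_mult[symmetric] mult.commute[of k]) (simp add: power_mult)
        ultimately show ?thesis using gG[OF 3(1) that] by (simp add: G_scale G_minus del: minus_diff_eq)
      qed
      then have "?K = - (\<Sum>k\<le>m. (4 ^ k * c k) *\<^sub>R G (x - 2 ^ k *\<^sub>R y))"
        by (simp add: sum_negf mult.commute)
      then have "norm ?K \<le> C2 * norm x powr - 2 * ?s ^ M"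
        using C2(2)[OF y, of x] 3 by simp
      also have "?s ^ M \<le> ?s powr - \<alpha>"
        using s M by (subst powr_realpow[symmetric]) (auto intro!: powr_mono')
      also have "C2 * norm x powr - 2 * ?s powr - \<alpha> = C2 * ?R"
      proof -
        have "max (norm x) (norm y) = norm x" using \<open>norm y \<le> norm x\<close> by simp
        then have "W m x y = norm x * norm x powr - 3" using 3 by (simp add: W_def)
        moreover have "norm x * norm x powr - 3 = norm x powr - 2"
          by (subst mult.commute, subst powr_mult_self) auto
        moreover have "?s powr - \<alpha> = (norm x / norm y) powr \<alpha>"
          using pos by (simp add: powr_divide powr_minus_divide)
        ultimately show ?thesis unfolding rat by (simp add: mult_ac)
      qed
      finally show ?thesis using C2 by (simp add: mult_left_mono)
    qed
    moreover have "C1 * ?R \<le> (C1 + C2 + C3) * ?R" "C2 * ?R \<le> (C1 + C2 + C3) * ?R" "C3 * ?R \<le> (C1 + C2 + C3) * ?R"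
      using C1(1) C2(1) C3 R0 by (auto intro!: mult_right_mono)
    ultimately show "norm ?K \<le> (C1 + C2 + C3) * ?R" by linarith
  qed
qed

section \<open>Mollified representation formula\<close>

no_notation fps_nth (infixl "$" 75)

section \<open>Algebra of the Pauli matrices\<close>

definition sg :: "real^3 \<Rightarrow> complex^2 \<Rightarrow> complex^2" where
  "sg a v = (\<Sum>j\<in>UNIV. (a $ j) *\<^sub>R (pauli $ j *v v))"

lemma pauli_mult [simp]:
  "(pauli $ 1 *v v) $ 1 = v $ 2" "(pauli $ 1 *v v) $ 2 = v $ 1"
  "(pauli $ 2 *v v) $ 1 = - \<i> * v $ 2" "(pauli $ 2 *v v) $ 2 = \<i> * v $ 1"
  "(pauli $ 3 *v v) $ 1 = v $ 1" "(pauli $ 3 *v v) $ 2 = - v $ 2"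
  by (simp_all add: pauli_def matrix_vector_mult_def sum_2 vector_2 vector_3)

lemma vec2_eqI: "v $ 1 = w $ 1 \<Longrightarrow> v $ 2 = w $ 2 \<Longrightarrow> v = (w :: 'a^2)"
  by (simp add: vec_eq_iff forall_2)

lemma sg_1: "sg a v $ 1 = of_real (a $ 3) * v $ 1 + (of_real (a $ 1) - \<i> * of_real (a $ 2)) * v $ 2"
  and sg_2: "sg a v $ 2 = (of_real (a $ 1) + \<i> * of_real (a $ 2)) * v $ 1 - of_real (a $ 3) * v $ 2"
  by (simp_all add: sg_def sum_3 scaleR_conv_of_real[where 'a=complex] algebra_simps)

lemma bounded_linear_pauli: "bounded_linear (\<lambda>v. pauli $ j *v v)"
proof -
  have "linear (\<lambda>v. pauli $ j *v v)"
  proof (rule linearI)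
    show "pauli $ j *v (v + w) = pauli $ j *v v + pauli $ j *v w" for v w
      by (rule matrix_vector_right_distrib)
    show "pauli $ j *v (r *\<^sub>R v) = r *\<^sub>R (pauli $ j *v v)" for r v
      by (simp add: vec_eq_iff matrix_vector_mult_def scaleR_sum_right)
  qed
  then show ?thesis by (simp add: linear_conv_bounded_linear)
qed

lemma bounded_bilinear_sg: "bounded_bilinear sg"
proof -
  have "bilinear sg"
    unfolding bilinear_def linear_iff
    by (auto intro!: vec2_eqI simp: sg_1 sg_2 scaleR_conv_of_real[where 'a=complex] algebra_simps)
  then show ?thesis by (simp add: bilinear_conv_bounded_bilinear)
qed

interpretation sg: bounded_bilinear sg by (rule bounded_bilinear_sg)

lemma sg_sg: "sg a (sg a v) = (norm a)\<^sup>2 *\<^sub>R v"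
proof -
  have "complex_of_real ((norm a)\<^sup>2) = of_real (a $ 1) ^ 2 + of_real (a $ 2) ^ 2 + of_real (a $ 3) ^ 2"
  proof -
    have "(norm a)\<^sup>2 = (a $ 1)\<^sup>2 + (a $ 2)\<^sup>2 + (a $ 3)\<^sup>2"
      unfolding power2_norm_eq_inner by (simp add: inner_vec_def sum_3 power2_eq_square)
    then show ?thesis by simp
  qed
  moreover have "\<i> * (\<i> * z) = - z" for z by (simp flip: mult.assoc)
  ultimately show ?thesis
    by (intro vec2_eqI) (simp_all add: sg_1 sg_2 scaleR_conv_of_real[where 'a=complex] algebra_simps power2_eq_square)
qed

lemma sg_double_sum: "(\<Sum>i\<in>UNIV. \<Sum>j\<in>UNIV. (b $ i * a $ j) *\<^sub>R (pauli $ i *v (pauli $ j *v v))) = sg b (sg a v)"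
proof -
  have "pauli $ i *v sg a v = (\<Sum>j\<in>UNIV. a $ j *\<^sub>R (pauli $ i *v (pauli $ j *v v)))" for i
    unfolding sg_def by (simp add: linear_sum[OF bounded_linear.linear[OF bounded_linear_pauli]]
        linear_cmul[OF bounded_linear.linear[OF bounded_linear_pauli]])
  then show ?thesis by (simp add: sg_def[of b] scaleR_sum_right)
qed

lemma pauli_square: "pauli $ i *v (pauli $ i *v v) = v"
proof -
  have "\<i> * (\<i> * z) = - z" for z by (simp flip: mult.assoc)
  then have "\<forall>i. pauli $ i *v (pauli $ i *v v) = v"
    by (auto simp: forall_3 intro!: vec2_eqI)
  then show ?thesis by simp
qed

lemma of_real_smult_vec: "complex_of_real r *s v = r *\<^sub>R v"
  by (simp add: vec_eq_iff scaleR_conv_of_real[where 'a=complex])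

lemma norm_smult_vec: "norm (c *s v) = norm c * norm (v :: complex^2)"
  by (simp add: norm_vec_def L2_set_def sum_2 norm_mult power_mult_distrib real_sqrt_mult flip: distrib_left)

lemma smooth_on_UNIV_Ck: "smooth_on UNIV \<phi> \<longleftrightarrow> (\<forall>k. Ck k \<phi>)"
  by (simp add: smooth_on_def Ck_on_UNIV)

section \<open>Test functions and local integrability\<close>

lemma test_functionI:
  assumes "smooth_on UNIV \<phi>" "compact K" "0 \<notin> K" "\<And>x. \<phi> x \<noteq> 0 \<Longrightarrow> x \<in> K"
  shows "test_function \<phi>"
proof -
  have "closure {x. \<phi> x \<noteq> 0} \<subseteq> K"
    using assms by (intro closure_minimal) (auto intro: compact_imp_closed)
  moreover from this have "compact (closure {x. \<phi> x \<noteq> 0})"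
    using assms(2) by (metis closed_closure compact_Int_closed inf.absorb_iff2)
  ultimately show ?thesis
    using assms by (auto simp: test_function_def smooth_on_UNIV_Ck)
qed

lemma test_function_support:
  assumes "test_function \<phi>"
  obtains K where "compact K" "0 \<notin> K" "\<And>x. x \<notin> K \<Longrightarrow> \<phi> x = 0" "\<And>x j. x \<notin> K \<Longrightarrow> partial_deriv j \<phi> x = 0"
proof (rule that[of "closure {x. \<phi> x \<noteq> 0}"])
  let ?K = "closure {x. \<phi> x \<noteq> 0}"
  show "compact ?K" "0 \<notin> ?K" using assms by (auto simp: test_function_def)
  show z: "\<phi> x = 0" if "x \<notin> ?K" for x
  proof (rule ccontr)
    assume "\<phi> x \<noteq> 0"
    then have "x \<in> {x. \<phi> x \<noteq> 0}" by (rule CollectI)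
    then have "x \<in> ?K" using closure_subset by (rule rev_subsetD)
    with that show False by (rule notE)
  qed
  show "partial_deriv j \<phi> x = 0" if "x \<notin> ?K" for x j
  proof -
    have "partial_deriv j \<phi> x = partial_deriv j (\<lambda>x. 0) x"
      by (rule partial_deriv_cong[OF open_Compl[OF closed_closure] Compl_iff[THEN iffD2, OF that]]) (rule z, erule Compl_iff[THEN iffD1])
    then show ?thesis by (simp add: partial_deriv_def)
  qed
qed

lemma test_function_continuous:
  assumes "test_function \<phi>"
  shows "continuous_on UNIV \<phi>" "continuous_on UNIV (partial_deriv j \<phi>)" "\<phi> differentiable at x"
proof -
  have "Ck 0 \<phi>" "Ck 1 \<phi>" using assms by (auto simp: test_function_def)
  then show "continuous_on UNIV \<phi>" "continuous_on UNIV (partial_deriv j \<phi>)" "\<phi> differentiable at x"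
    by (auto simp: differentiable_on_def)
qed

text \<open>Integrability of \<psi> is available only on compact sets avoiding 0. Since
  \<open>b\<close> vanishes off \<open>K\<close>, the indicator of \<open>K\<close> can be inserted
  before measurability and integrability are claimed.\<close>

lemma integrable_smult_locally_integrable:
  assumes \<psi>: "locally_integrable_punctured \<psi>" and K: "compact K" "0 \<notin> K"
    and b: "continuous_on UNIV b" "\<And>x. x \<notin> K \<Longrightarrow> b x = 0"
  shows "integrable lebesgue (\<lambda>x. b x *s \<psi> x)"
proof -
  have si: "integrable lebesgue (\<lambda>x. indicator K x *\<^sub>R \<psi> x)"
    using \<psi> K by (auto simp: locally_integrable_punctured_def set_integrable_def)
  have "compact (b ` K)"
    using K b by (intro compact_continuous_image) (auto intro: continuous_on_subset)
  then have "bounded (b ` K)" by (rule compact_imp_bounded)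
  then obtain B where "\<forall>z\<in>b ` K. norm z \<le> B" unfolding bounded_iff by blast
  then have B: "\<And>x. x \<in> K \<Longrightarrow> norm (b x) \<le> B" by blast
  have bm: "b \<in> borel_measurable lebesgue"
    by (intro measurable_completion) (simp add: borel_measurable_continuous_onI[OF b(1)])
  show ?thesis
  proof (rule Bochner_Integration.integrable_bound)
    show "integrable lebesgue (\<lambda>x. B *\<^sub>R norm (indicator K x *\<^sub>R \<psi> x))"
      using si by (intro integrable_scaleR_right integrable_norm)
    show "(\<lambda>x. b x *s \<psi> x) \<in> borel_measurable lebesgue"
    proof -
      have "continuous_on UNIV (\<lambda>p :: complex \<times> (complex^2). fst p *s snd p)"
        unfolding vector_scalar_mult_def by (intro continuous_intros)
      then have "(\<lambda>x. b x *s (indicator K x *\<^sub>R \<psi> x)) \<in> borel_measurable lebesgue"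
        by (rule borel_measurable_continuous_Pair[OF bm borel_measurable_integrable[OF si]])
      moreover have "b x *s (indicator K x *\<^sub>R \<psi> x) = b x *s \<psi> x" for x
        using b(2)[of x] by (cases "x \<in> K") (simp_all add: vec_eq_iff)
      ultimately show ?thesis by simp
    qed
    show "AE x in lebesgue. norm (b x *s \<psi> x) \<le> norm (B *\<^sub>R norm (indicator K x *\<^sub>R \<psi> x))"
    proof (intro AE_I2)
      fix x
      show "norm (b x *s \<psi> x) \<le> norm (B *\<^sub>R norm (indicator K x *\<^sub>R \<psi> x))"
      proof (cases "x \<in> K")
        case True
        then have "norm (b x) \<le> \<bar>B\<bar>" using B[of x] by linarith
        then show ?thesis using True by (simp add: norm_smult_vec abs_mult mult_right_mono)
      qed (simp add: b(2))
    qed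
  qed
qed

lemma integrable_scaleR_locally_integrable:
  assumes "locally_integrable_punctured \<psi>" "compact K" "0 \<notin> K"
    and "continuous_on UNIV b" "\<And>x. x \<notin> K \<Longrightarrow> b x = 0"
  shows "integrable lebesgue (\<lambda>x. b x *\<^sub>R \<psi> x)"
  using integrable_smult_locally_integrable[of \<psi> K "\<lambda>x. of_real (b x)"] assms
  by (simp add: of_real_smult_vec continuous_on_of_real)

text \<open>Testing with a real vector field \<open>h\<close>: the components are tested separately and recombined by the Pauli matrices.\<close>

lemma has_sigma_grad_vector_test:
  fixes h :: "real^3 \<Rightarrow> real^3" and d :: "3 \<Rightarrow> 3 \<Rightarrow> real^3 \<Rightarrow> real"
  assumes sg: "has_sigma_grad \<psi> f"
    and h: "\<And>i. test_function (\<lambda>x. complex_of_real (h x $ i))"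
    and d: "\<And>i j x. partial_deriv j (\<lambda>x. complex_of_real (h x $ i)) x = complex_of_real (d i j x)"
  shows "integrable lebesgue (\<lambda>x. sg (h x) (f x))"
    and "integrable lebesgue (\<lambda>x. \<Sum>i\<in>UNIV. \<Sum>j\<in>UNIV. d i j x *\<^sub>R (pauli $ i *v (pauli $ j *v \<psi> x)))"
    and "(LINT x|lebesgue. sg (h x) (f x)) =
       - (LINT x|lebesgue. (\<Sum>i\<in>UNIV. \<Sum>j\<in>UNIV. d i j x *\<^sub>R (pauli $ i *v (pauli $ j *v \<psi> x))))"
proof -
  let ?P = "\<lambda>i v. pauli $ i *v v"
  have bl: "bounded_linear (?P i)" for i by (rule bounded_linear_pauli)
  have lin: "linear (?P i)" for i using bl by (rule bounded_linear.linear)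
  have lf: "locally_integrable_punctured f" and l\<psi>: "locally_integrable_punctured \<psi>"
    using sg by (auto simp: has_sigma_grad_def)
  have if1: "integrable lebesgue (\<lambda>x. (h x $ i) *\<^sub>R f x)" for i
  proof -
    obtain K where "compact K" "0 \<notin> K" "\<And>x. x \<notin> K \<Longrightarrow> complex_of_real (h x $ i) = 0"
      using test_function_support[OF h[of i]] by metis
    then show ?thesis
      using integrable_smult_locally_integrable[OF lf _ _ test_function_continuous(1)[OF h[of i]]]
      by (simp add: of_real_smult_vec)
  qed
  have i\<psi>1: "integrable lebesgue (\<lambda>x. d i j x *\<^sub>R \<psi> x)" for i j
  proof -
    obtain K where "compact K" "0 \<notin> K" "\<And>x. x \<notin> K \<Longrightarrow> partial_deriv j (\<lambda>x. complex_of_real (h x $ i)) x = 0"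
      using test_function_support[OF h[of i]] by metis
    then show ?thesis
      using integrable_smult_locally_integrable[OF l\<psi> _ _ test_function_continuous(2)[OF h[of i], of j]]
      by (simp add: of_real_smult_vec d)
  qed
  have sgf: "sg (h x) (f x) = (\<Sum>i\<in>UNIV. ?P i ((h x $ i) *\<^sub>R f x))" for x
    unfolding sg_def by (simp add: linear_cmul[OF lin])
  have ddf: "(\<Sum>i\<in>UNIV. \<Sum>j\<in>UNIV. d i j x *\<^sub>R ?P i (?P j (\<psi> x))) = (\<Sum>i\<in>UNIV. \<Sum>j\<in>UNIV. ?P i (?P j (d i j x *\<^sub>R \<psi> x)))" for x
    by (simp add: linear_cmul[OF lin])
  have bl2: "bounded_linear (\<lambda>v. ?P i (?P j v))" for i j
    using bounded_linear_compose[OF bl bl] .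
  show "integrable lebesgue (\<lambda>x. sg (h x) (f x))"
    unfolding sgf by (intro Bochner_Integration.integrable_sum integrable_bounded_linear[OF bl] if1)
  show "integrable lebesgue (\<lambda>x. \<Sum>i\<in>UNIV. \<Sum>j\<in>UNIV. d i j x *\<^sub>R ?P i (?P j (\<psi> x)))"
    unfolding ddf by (intro Bochner_Integration.integrable_sum integrable_bounded_linear[OF bl2] i\<psi>1)
  have eq: "(LINT x|lebesgue. (h x $ i) *\<^sub>R f x) = (\<Sum>j\<in>UNIV. ?P j (- (LINT x|lebesgue. d i j x *\<^sub>R \<psi> x)))" for i
  proof -
    have "\<forall>\<phi>. test_function \<phi> \<longrightarrow> (LINT x|lebesgue. \<phi> x *s f x)
        = (\<Sum>j\<in>UNIV. ?P j (- (LINT x|lebesgue. partial_deriv j \<phi> x *s \<psi> x)))"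
      using sg unfolding has_sigma_grad_def by blast
    from this[THEN spec, THEN mp, OF h[of i]] show ?thesis
      unfolding d of_real_smult_vec .
  qed
  have "(LINT x|lebesgue. sg (h x) (f x)) = (\<Sum>i\<in>UNIV. ?P i (LINT x|lebesgue. (h x $ i) *\<^sub>R f x))"
    unfolding sgf
    by (subst Bochner_Integration.integral_sum)
       (auto intro!: integrable_bounded_linear[OF bl] if1 sum.cong integral_bounded_linear[OF bl])
  also have "\<dots> = - (\<Sum>i\<in>UNIV. \<Sum>j\<in>UNIV. ?P i (?P j (LINT x|lebesgue. d i j x *\<^sub>R \<psi> x)))"
    unfolding eq by (simp add: linear_sum[OF lin] linear_neg[OF lin] sum_negf)
  also have "(\<Sum>i\<in>UNIV. \<Sum>j\<in>UNIV. ?P i (?P j (LINT x|lebesgue. d i j x *\<^sub>R \<psi> x)))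
      = (LINT x|lebesgue. (\<Sum>i\<in>UNIV. \<Sum>j\<in>UNIV. d i j x *\<^sub>R ?P i (?P j (\<psi> x))))"
    unfolding ddf
    by (subst Bochner_Integration.integral_sum)
       (auto intro!: Bochner_Integration.integrable_sum integrable_bounded_linear[OF bl2] i\<psi>1 sum.cong
         simp: Bochner_Integration.integral_sum integrable_bounded_linear[OF bl2] i\<psi>1 integral_bounded_linear[OF bl2])
  finally show "(LINT x|lebesgue. sg (h x) (f x)) =
       - (LINT x|lebesgue. (\<Sum>i\<in>UNIV. \<Sum>j\<in>UNIV. d i j x *\<^sub>R ?P i (?P j (\<psi> x))))" .
qed

section \<open>The cutoff and the mollified kernel\<close>

lemma norm_sq_vec3: "(norm (z :: real^3))\<^sup>2 = (z $ 1)\<^sup>2 + (z $ 2)\<^sup>2 + (z $ 3)\<^sup>2"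
  unfolding power2_norm_eq_inner by (simp add: inner_vec_def sum_3 power2_eq_square)

lemma rsmooth_on_norm_sq:
  assumes "open S"
  shows "rsmooth_on S (\<lambda>y. (norm (y - a))\<^sup>2)"
  unfolding norm_sq_vec3 vector_minus_component
  by (intro rsmooth_on_add rsmooth_on_power rsmooth_on_diff rsmooth_on_coord rsmooth_on_const assms)

lemma has_derivative_norm_sq: "((\<lambda>y :: 'a::real_inner. (norm (y - a))\<^sup>2) has_derivative (\<lambda>h. 2 * ((y - a) \<bullet> h))) (at y)"
  unfolding power2_norm_eq_inner
  by (auto intro!: derivative_eq_intros simp: inner_commute)

text \<open>Supported in 1/\<nu> \<le> |y| \<le> 2 \<nu> and equal to 1 for 2/\<nu> \<le> |y| \<le>
  \<nu>. It is built from the squared norm, a polynomial, so that smoothness is immediate.\<close>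

definition cutoff :: "real \<Rightarrow> real^3 \<Rightarrow> real" where
  "cutoff \<nu> y = step (\<nu>\<^sup>2 * (norm y)\<^sup>2 - 1) * step (2 - (norm y)\<^sup>2 / \<nu>\<^sup>2)"

definition grad_cutoff :: "real \<Rightarrow> real^3 \<Rightarrow> real^3" where
  "grad_cutoff \<nu> y = (2 * \<nu>\<^sup>2 * step' (\<nu>\<^sup>2 * (norm y)\<^sup>2 - 1) * step (2 - (norm y)\<^sup>2 / \<nu>\<^sup>2)
     - 2 / \<nu>\<^sup>2 * step (\<nu>\<^sup>2 * (norm y)\<^sup>2 - 1) * step' (2 - (norm y)\<^sup>2 / \<nu>\<^sup>2)) *\<^sub>R y"

text \<open>The radial profile of \<open>moll\<close> in the variable t = \<nu>^2 |z|^2: the power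
  gives |z|^-3 after scaling, and the step removes the region t < 1 around the singularity.\<close>

definition qk :: "real \<Rightarrow> real" where
  "qk t = step (t - 1) * t powr - (3/2)"

definition qk' :: "real \<Rightarrow> real" where
  "qk' t = step' (t - 1) * t powr - (3/2) - 3/2 * step (t - 1) * t powr - (5/2)"

text \<open>\<open>G\<close> cut off near the origin at scale \<open>1 / \<nu>\<close>; its divergence is the mollifier \<open>rho \<nu>\<close>.\<close>

definition moll :: "real \<Rightarrow> real^3 \<Rightarrow> real^3" where
  "moll \<nu> z = (\<nu> ^ 3 * qk (\<nu>\<^sup>2 * (norm z)\<^sup>2)) *\<^sub>R z"

definition rho :: "real \<Rightarrow> real^3 \<Rightarrow> real" where
  "rho \<nu> z = \<nu> ^ 3 * (2 * step' (\<nu>\<^sup>2 * (norm z)\<^sup>2 - 1) * (\<nu>\<^sup>2 * (norm z)\<^sup>2) powr - (1/2))"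

lemma qk_DERIV: "(qk has_real_derivative qk' t) (at t)"
proof (cases "t < 1")
  case True
  have z: "qk' t = 0" using True by (simp add: qk'_def step_eq_0 step'_eq_0)
  have "((\<lambda>t. 0) has_real_derivative qk' t) (at t)" unfolding z by simp
  then show ?thesis
    by (rule has_field_derivative_transform_within_open[of _ _ _ "{..<1}"])
       (use True in \<open>auto simp: qk_def step_eq_0\<close>)
next
  case False
  then have t: "0 < t" by simp
  have s: "((\<lambda>t. step (t - 1)) has_real_derivative step' (t - 1)) (at t)"
    using DERIV_shift[of step "step' (t - 1)" t "-1"] step_DERIV[of "t - 1"] by simp
  have p: "((\<lambda>t. t powr - (3/2)) has_real_derivative (- (3/2)) * t powr (- (3/2) - 1)) (at t)"
    by (rule has_real_derivative_powr[OF t])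
  show ?thesis
    using DERIV_mult[OF s p] by (simp add: qk_def[abs_def] qk'_def algebra_simps)
qed

text \<open>The left side, times \<nu>^3, is the divergence of qk (\<nu>^2 |z|^2) \<nu>^3 z in
  dimension three. The terms with the undifferentiated step cancel because z / |z|^3 is divergence
  free off the origin, which leaves a nonnegative function supported in 1 \<le> t \<le> 2.\<close>

lemma qk_identity: "3 * qk t + 2 * t * qk' t = 2 * step' (t - 1) * t powr - (1/2)"
proof (cases "t < 1")
  case True
  then show ?thesis by (simp add: qk_def qk'_def step_eq_0 step'_eq_0)
next
  case False
  then have t: "0 \<le> t" by simp
  have e: "t powr - (3/2) * t = t powr - (1/2)" "t powr - (5/2) * t = t powr - (3/2)"
    by (subst powr_mult_self[OF t], simp)+
  have "3 * qk t + 2 * t * qk' t = 3 * (step (t - 1) * t powr - (3/2))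
      + 2 * step' (t - 1) * (t powr - (3/2) * t) - 3 * (step (t - 1) * (t powr - (5/2) * t))"
    unfolding qk_def qk'_def by (simp add: algebra_simps)
  then show ?thesis unfolding e by simp
qed

lemma rsmooth_cutoff: "rsmooth_on UNIV (cutoff \<nu>)"
proof -
  have n: "rsmooth_on UNIV (\<lambda>y :: real^3. (norm y)\<^sup>2)" using rsmooth_on_norm_sq[of UNIV 0] by simp
  have 1: "rsmooth_on UNIV (\<lambda>y :: real^3. step (\<nu>\<^sup>2 * (norm y)\<^sup>2 - 1))"
    by (intro rsmooth_on_step rsmooth_on_diff rsmooth_on_mult rsmooth_on_const n open_UNIV)
  have "rsmooth_on UNIV (\<lambda>y :: real^3. step (2 - (norm y)\<^sup>2 * inverse (\<nu>\<^sup>2)))"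
    by (intro rsmooth_on_step rsmooth_on_diff rsmooth_on_mult rsmooth_on_const n open_UNIV)
  from rsmooth_on_mult[OF open_UNIV 1 this] show ?thesis
    by (simp add: cutoff_def[abs_def] divide_inverse)
qed

lemma rsmooth_moll:
  assumes \<nu>: "0 < \<nu>"
  shows "rsmooth_on UNIV (\<lambda>y. moll \<nu> (y - a) $ i)"
proof -
  let ?S = "- {a}" and ?T = "{y. \<nu>\<^sup>2 * (norm (y - a))\<^sup>2 < 1}"
  have S: "open ?S" by (simp add: open_Compl)
  have T: "open ?T" by (intro open_Collect_less continuous_intros)
  have N: "rsmooth_on ?S (\<lambda>y. \<nu>\<^sup>2 * (norm (y - a))\<^sup>2)"
    by (intro rsmooth_on_mult rsmooth_on_const rsmooth_on_norm_sq S)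
  have 1: "rsmooth_on ?S (\<lambda>y. \<nu> ^ 3 * (step (\<nu>\<^sup>2 * (norm (y - a))\<^sup>2 - 1) * (\<nu>\<^sup>2 * (norm (y - a))\<^sup>2) powr - (3/2)) * (y $ i - a $ i))"
    by (intro rsmooth_on_mult rsmooth_on_step rsmooth_on_diff rsmooth_on_powr rsmooth_on_const rsmooth_on_coord N S)
       (use \<nu> in auto)
  have "rsmooth_on ?S (\<lambda>y. moll \<nu> (y - a) $ i)"
    by (rule rsmooth_on_cong[OF S 1]) (simp add: moll_def qk_def)
  moreover have "rsmooth_on ?T (\<lambda>y. moll \<nu> (y - a) $ i)"
    by (rule rsmooth_on_cong[OF T rsmooth_on_const[of _ 0]]) (simp add: moll_def qk_def step_eq_0)
  ultimately have "rsmooth_on (?S \<union> ?T) (\<lambda>y. moll \<nu> (y - a) $ i)"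
    by (intro rsmooth_on_Un S T)
  moreover have "?S \<union> ?T = UNIV" by auto
  ultimately show ?thesis by simp
qed

lemma cutoff_has_derivative: "(cutoff \<nu> has_derivative (\<lambda>h. grad_cutoff \<nu> y \<bullet> h)) (at y)"
proof -
  have n: "((\<lambda>y :: real^3. (norm y)\<^sup>2) has_derivative (\<lambda>h. 2 * (y \<bullet> h))) (at y)"
    using has_derivative_norm_sq[of 0 y] by simp
  have 1: "((\<lambda>y :: real^3. \<nu>\<^sup>2 * (norm y)\<^sup>2 - 1) has_derivative (\<lambda>h. \<nu>\<^sup>2 * (2 * (y \<bullet> h)))) (at y)"
    by (auto intro!: derivative_eq_intros n)
  have 2: "((\<lambda>y :: real^3. 2 - (norm y)\<^sup>2 / \<nu>\<^sup>2) has_derivative (\<lambda>h. - (2 * (y \<bullet> h) / \<nu>\<^sup>2))) (at y)"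
    unfolding divide_inverse by (auto intro!: derivative_eq_intros n)
  have s1: "((\<lambda>y :: real^3. step (\<nu>\<^sup>2 * (norm y)\<^sup>2 - 1)) has_derivative (\<lambda>h. step' (\<nu>\<^sup>2 * (norm y)\<^sup>2 - 1) * (\<nu>\<^sup>2 * (2 * (y \<bullet> h))))) (at y)"
    using has_derivative_compose[OF 1 step_DERIV[unfolded has_field_derivative_def]] by simp
  have s2: "((\<lambda>y :: real^3. step (2 - (norm y)\<^sup>2 / \<nu>\<^sup>2)) has_derivative (\<lambda>h. step' (2 - (norm y)\<^sup>2 / \<nu>\<^sup>2) * (- (2 * (y \<bullet> h) / \<nu>\<^sup>2)))) (at y)"
    using has_derivative_compose[OF 2 step_DERIV[unfolded has_field_derivative_def]] by simp
  show ?thesis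
    using has_derivative_mult[OF s1 s2]
    by (simp add: cutoff_def[abs_def] grad_cutoff_def algebra_simps)
qed

lemma moll_has_derivative:
  "((\<lambda>y. moll \<nu> (y - a) $ i) has_derivative
     (\<lambda>h. \<nu> ^ 3 * (qk' (\<nu>\<^sup>2 * (norm (y - a))\<^sup>2) * (2 * \<nu>\<^sup>2 * ((y - a) \<bullet> h)) * (y - a) $ i
        + qk (\<nu>\<^sup>2 * (norm (y - a))\<^sup>2) * h $ i))) (at y)"
proof -
  have 1: "((\<lambda>y :: real^3. \<nu>\<^sup>2 * (norm (y - a))\<^sup>2) has_derivative (\<lambda>h. \<nu>\<^sup>2 * (2 * ((y - a) \<bullet> h)))) (at y)"
    by (rule has_derivative_mult_right[OF has_derivative_norm_sq])
  have q: "((\<lambda>y :: real^3. qk (\<nu>\<^sup>2 * (norm (y - a))\<^sup>2)) has_derivative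
      (\<lambda>h. qk' (\<nu>\<^sup>2 * (norm (y - a))\<^sup>2) * (\<nu>\<^sup>2 * (2 * ((y - a) \<bullet> h))))) (at y)"
    using has_derivative_compose[OF 1 qk_DERIV[unfolded has_field_derivative_def]] by simp
  have c: "((\<lambda>y. (y - a) $ i) has_derivative (\<lambda>h. h $ i)) (at y)"
    by (auto intro!: derivative_eq_intros bounded_linear.has_derivative[OF bounded_linear_vec_nth])
  show ?thesis
    using has_derivative_mult_right[OF has_derivative_mult[OF q c], of "\<nu> ^ 3"]
    by (simp add: moll_def[abs_def] algebra_simps)
qed

lemma cutoff_support:
  assumes "0 < \<nu>" "cutoff \<nu> y \<noteq> 0 \<or> grad_cutoff \<nu> y \<noteq> 0"
  shows "1 / \<nu> \<le> norm y" "norm y \<le> 2 * \<nu>"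
proof -
  have "0 < \<nu>\<^sup>2 * (norm y)\<^sup>2 - 1" "0 < 2 - (norm y)\<^sup>2 / \<nu>\<^sup>2"
  proof -
    show "0 < \<nu>\<^sup>2 * (norm y)\<^sup>2 - 1"
    proof (rule ccontr)
      assume "\<not> 0 < \<nu>\<^sup>2 * (norm y)\<^sup>2 - 1"
      then have "step (\<nu>\<^sup>2 * (norm y)\<^sup>2 - 1) = 0" "step' (\<nu>\<^sup>2 * (norm y)\<^sup>2 - 1) = 0"
        by (simp_all only: step_eq_0 step'_eq_0 not_less simp_thms)
      with assms(2) show False by (simp add: cutoff_def grad_cutoff_def)
    qed
    show "0 < 2 - (norm y)\<^sup>2 / \<nu>\<^sup>2"
    proof (rule ccontr)
      assume "\<not> 0 < 2 - (norm y)\<^sup>2 / \<nu>\<^sup>2"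
      then have "step (2 - (norm y)\<^sup>2 / \<nu>\<^sup>2) = 0" "step' (2 - (norm y)\<^sup>2 / \<nu>\<^sup>2) = 0"
        by (simp_all only: step_eq_0 step'_eq_0 not_less simp_thms)
      with assms(2) show False by (simp add: cutoff_def grad_cutoff_def)
    qed
  qed
  then have "1\<^sup>2 \<le> (\<nu> * norm y)\<^sup>2" "(norm y)\<^sup>2 \<le> (2 * \<nu>)\<^sup>2"
  proof -
    show "1\<^sup>2 \<le> (\<nu> * norm y)\<^sup>2"
      using \<open>0 < \<nu>\<^sup>2 * (norm y)\<^sup>2 - 1\<close> by (simp add: power_mult_distrib)
    have "(norm y)\<^sup>2 < 2 * \<nu>\<^sup>2"
      using \<open>0 < 2 - (norm y)\<^sup>2 / \<nu>\<^sup>2\<close> assms(1) by (simp add: field_simps)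
    moreover have "0 \<le> \<nu>\<^sup>2" by simp
    ultimately have "(norm y)\<^sup>2 \<le> 4 * \<nu>\<^sup>2" by linarith
    then show "(norm y)\<^sup>2 \<le> (2 * \<nu>)\<^sup>2" by (simp add: power_mult_distrib)
  qed
  then have "1 \<le> \<nu> * norm y" "norm y \<le> 2 * \<nu>"
    using assms(1) by (auto intro: power2_le_imp_le simp: less_imp_le)
  then show "1 / \<nu> \<le> norm y" "norm y \<le> 2 * \<nu>"
    using assms(1) by (auto simp: field_simps)
qed

definition annulus :: "real \<Rightarrow> real \<Rightarrow> (real^3) set" where
  "annulus a b = {y. a \<le> norm y \<and> norm y \<le> b}"

lemma compact_annulus: "compact (annulus a b)"
proof -
  have "annulus a b = cball 0 b \<inter> {y. a \<le> norm y}" by (auto simp: annulus_def)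
  moreover have "closed {y :: real^3. a \<le> norm y}" by (intro closed_Collect_le continuous_intros)
  ultimately show ?thesis by (metis compact_Int_closed compact_cball)
qed

lemma zero_notin_annulus: "0 < a \<Longrightarrow> 0 \<notin> annulus a b"
  by (simp add: annulus_def)

lemma cutoff_continuous: "continuous_on UNIV (cutoff \<nu>)"
  using has_derivative_continuous[OF cutoff_has_derivative] by (auto intro: continuous_at_imp_continuous_on)

lemma rho_continuous: "0 < \<nu> \<Longrightarrow> continuous_on UNIV (rho \<nu>)"
proof -
  assume \<nu>: "0 < \<nu>"
  have r: "rho \<nu> z = \<nu> ^ 3 * (3 * qk (\<nu>\<^sup>2 * (norm z)\<^sup>2) + 2 * (\<nu>\<^sup>2 * (norm z)\<^sup>2) * qk' (\<nu>\<^sup>2 * (norm z)\<^sup>2))" for z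
    unfolding qk_identity rho_def ..
  have "continuous_on UNIV (rho \<nu>)"
  proof -
    let ?S = "- {0 :: real^3}" and ?T = "{y :: real^3. \<nu>\<^sup>2 * (norm y)\<^sup>2 < 1}"
    have T: "open ?T" by (intro open_Collect_less continuous_intros)
    have "continuous_on ?S (rho \<nu>)"
      unfolding rho_def[abs_def] using \<nu>
      by (intro continuous_intros continuous_on_compose2[OF step'_continuous[of UNIV]]) auto
    moreover have "continuous_on ?T (rho \<nu>)"
      by (rule continuous_on_eq[of _ "\<lambda>_. 0"]) (auto simp: rho_def step'_eq_0)
    ultimately have "continuous_on (?S \<union> ?T) (rho \<nu>)"
      by (intro continuous_on_open_Un T) (auto simp: open_Compl)
    moreover have "?S \<union> ?T = UNIV" by auto
    ultimately show ?thesis by simp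
  qed
  then show ?thesis .
qed

text \<open>Testing with the field cutoff times \<open>moll\<close>. The derivative matrix of
  \<open>moll\<close> is symmetric, and the products of Pauli matrices collapse on symmetric
  matrices to the trace. So the mollified kernel contributes only its divergence \<open>rho\<close>,
  while differentiating the cutoff leaves the boundary term.\<close>

lemma mollified_identity:
  assumes sg: "has_sigma_grad \<psi> f" and \<nu>: "0 < \<nu>"
  shows "integrable lebesgue (\<lambda>y. (cutoff \<nu> y * rho \<nu> (y - a)) *\<^sub>R \<psi> y)"
    and "integrable lebesgue (\<lambda>y. sg (cutoff \<nu> y *\<^sub>R moll \<nu> (y - a)) (f y))"
    and "integrable lebesgue (\<lambda>y. sg (moll \<nu> (y - a)) (sg (grad_cutoff \<nu> y) (\<psi> y)))"
    and "(LINT y|lebesgue. (cutoff \<nu> y * rho \<nu> (y - a)) *\<^sub>R \<psi> y) =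
      - (LINT y|lebesgue. sg (cutoff \<nu> y *\<^sub>R moll \<nu> (y - a)) (f y))
      - (LINT y|lebesgue. sg (moll \<nu> (y - a)) (sg (grad_cutoff \<nu> y) (\<psi> y)))"
proof -
  define h where "h y = cutoff \<nu> y *\<^sub>R moll \<nu> (y - a)" for y
  define z where "z y = y - a" for y
  define t where "t y = \<nu>\<^sup>2 * (norm (z y))\<^sup>2" for y
  \<comment> \<open>The partial derivatives of the test field: a rank one term from the cutoff, and
    from \<open>moll\<close> a multiple of z z^T plus a multiple of the identity.\<close>
  define d where "d i j y = moll \<nu> (z y) $ i * grad_cutoff \<nu> y $ j
      + cutoff \<nu> y * \<nu> ^ 3 * (2 * \<nu>\<^sup>2 * qk' (t y)) * (z y $ i * z y $ j)
      + (cutoff \<nu> y * \<nu> ^ 3 * qk (t y)) * (if i = j then 1 else 0)" for i j y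
  have l\<psi>: "locally_integrable_punctured \<psi>" using sg by (simp add: has_sigma_grad_def)
  have K: "compact (annulus (1 / \<nu>) (2 * \<nu>))" "0 \<notin> annulus (1 / \<nu>) (2 * \<nu>)"
    using \<nu> by (auto simp: compact_annulus intro!: zero_notin_annulus)
  have supp: "cutoff \<nu> y = 0" if "y \<notin> annulus (1 / \<nu>) (2 * \<nu>)" for y
    using cutoff_support[OF \<nu>, of y] that by (auto simp: annulus_def)
  have test: "test_function (\<lambda>y. complex_of_real (h y $ i))" for i
  proof (rule test_functionI[OF _ K])
    have "rsmooth_on UNIV (\<lambda>y. cutoff \<nu> y * moll \<nu> (y - a) $ i)"
      by (intro rsmooth_on_mult rsmooth_cutoff rsmooth_moll \<nu> open_UNIV)
    then show "smooth_on UNIV (\<lambda>y. complex_of_real (h y $ i))"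
      by (simp add: rsmooth_on_def h_def)
    show "x \<in> annulus (1 / \<nu>) (2 * \<nu>)" if "complex_of_real (h x $ i) \<noteq> 0" for x
      using that supp[of x] by (auto simp: h_def)
  qed
  have pd: "partial_deriv j (\<lambda>y. complex_of_real (h y $ i)) y = complex_of_real (d i j y)" for i j y
  proof -
    have "((\<lambda>y. h y $ i) has_derivative (\<lambda>k. cutoff \<nu> y * (\<nu> ^ 3 * (qk' (\<nu>\<^sup>2 * (norm (y - a))\<^sup>2) * (2 * \<nu>\<^sup>2 * ((y - a) \<bullet> k)) * (y - a) $ i
        + qk (\<nu>\<^sup>2 * (norm (y - a))\<^sup>2) * k $ i)) + (grad_cutoff \<nu> y \<bullet> k) * moll \<nu> (y - a) $ i)) (at y)"
      using has_derivative_mult[OF cutoff_has_derivative moll_has_derivative] by (simp add: h_def)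
    note D = partial_deriv_eq[OF has_derivative_of_real[OF this], of j]
    have ax: "axis j (1::real) $ i = (if i = j then 1 else 0)" by (simp add: axis_def)
    have in1: "v \<bullet> axis j (1::real) = v $ j" for v :: "real^3" by (simp add: inner_axis)
    show ?thesis
      unfolding D in1 ax d_def z_def t_def by (simp only: of_real_eq_iff) (simp add: algebra_simps)
  qed
  note V = has_sigma_grad_vector_test[OF sg test pd]
  \<comment> \<open>The identity matrix contributes 3 and z z^T contributes |z|^2, since Pauli
    matrices square to 1 and so does \<sigma> \<cdot> z up to |z|^2. \<open>qk_identity\<close>
    turns the combination into \<open>rho\<close>.\<close>
  have sum: "(\<Sum>i\<in>UNIV. \<Sum>j\<in>UNIV. d i j y *\<^sub>R (pauli $ i *v (pauli $ j *v v))) =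
      sg (moll \<nu> (y - a)) (sg (grad_cutoff \<nu> y) v) + (cutoff \<nu> y * rho \<nu> (y - a)) *\<^sub>R v" for y v
  proof -
    have "(\<Sum>i\<in>UNIV. \<Sum>j\<in>UNIV. d i j y *\<^sub>R (pauli $ i *v (pauli $ j *v v))) =
        (\<Sum>i\<in>UNIV. \<Sum>j\<in>UNIV. (moll \<nu> (z y) $ i * grad_cutoff \<nu> y $ j) *\<^sub>R (pauli $ i *v (pauli $ j *v v)))
        + (cutoff \<nu> y * \<nu> ^ 3 * (2 * \<nu>\<^sup>2 * qk' (t y))) *\<^sub>R (\<Sum>i\<in>UNIV. \<Sum>j\<in>UNIV. (z y $ i * z y $ j) *\<^sub>R (pauli $ i *v (pauli $ j *v v)))
        + (cutoff \<nu> y * \<nu> ^ 3 * qk (t y)) *\<^sub>R (\<Sum>i\<in>UNIV. \<Sum>j\<in>UNIV. (if i = j then 1 else 0) *\<^sub>R (pauli $ i *v (pauli $ j *v v)))"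
      unfolding scaleR_sum_right scaleR_scaleR sum.distrib[symmetric] scaleR_add_left[symmetric] d_def ..
    also have "(\<Sum>i\<in>UNIV. \<Sum>j\<in>UNIV. (if i = j then 1 else 0) *\<^sub>R (pauli $ i *v (pauli $ j *v v))) = 3 *\<^sub>R v"
      by (simp add: sum_3 pauli_square) (simp add: vec_eq_iff scaleR_conv_of_real[where 'a=complex])
    also have "(\<Sum>i\<in>UNIV. \<Sum>j\<in>UNIV. (z y $ i * z y $ j) *\<^sub>R (pauli $ i *v (pauli $ j *v v))) = (norm (z y))\<^sup>2 *\<^sub>R v"
      unfolding sg_double_sum sg_sg ..
    also have "(\<Sum>i\<in>UNIV. \<Sum>j\<in>UNIV. (moll \<nu> (z y) $ i * grad_cutoff \<nu> y $ j) *\<^sub>R (pauli $ i *v (pauli $ j *v v)))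
        = sg (moll \<nu> (z y)) (sg (grad_cutoff \<nu> y) v)"
      by (rule sg_double_sum)
    also have "sg (moll \<nu> (z y)) (sg (grad_cutoff \<nu> y) v)
        + (cutoff \<nu> y * \<nu> ^ 3 * (2 * \<nu>\<^sup>2 * qk' (t y))) *\<^sub>R (norm (z y))\<^sup>2 *\<^sub>R v
        + (cutoff \<nu> y * \<nu> ^ 3 * qk (t y)) *\<^sub>R 3 *\<^sub>R v
        = sg (moll \<nu> (z y)) (sg (grad_cutoff \<nu> y) v) + (cutoff \<nu> y * (\<nu> ^ 3 * (3 * qk (t y) + 2 * t y * qk' (t y)))) *\<^sub>R v"
      by (simp add: t_def algebra_simps flip: scaleR_add_left)
    also have "\<nu> ^ 3 * (3 * qk (t y) + 2 * t y * qk' (t y)) = rho \<nu> (y - a)"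
      unfolding qk_identity rho_def t_def z_def ..
    finally show ?thesis by (simp add: z_def)
  qed
  show i1: "integrable lebesgue (\<lambda>y. (cutoff \<nu> y * rho \<nu> (y - a)) *\<^sub>R \<psi> y)"
  proof (rule integrable_scaleR_locally_integrable[OF l\<psi> K])
    show "continuous_on UNIV (\<lambda>y. cutoff \<nu> y * rho \<nu> (y - a))"
      by (intro continuous_on_mult cutoff_continuous continuous_on_compose2[OF rho_continuous[OF \<nu>]] continuous_intros) auto
  qed (simp add: supp)
  show i2: "integrable lebesgue (\<lambda>y. sg (cutoff \<nu> y *\<^sub>R moll \<nu> (y - a)) (f y))"
    using V(1) by (simp add: h_def)
  have i3: "integrable lebesgue (\<lambda>y. sg (moll \<nu> (y - a)) (sg (grad_cutoff \<nu> y) (\<psi> y)) + (cutoff \<nu> y * rho \<nu> (y - a)) *\<^sub>R \<psi> y)"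
    using V(2) unfolding sum .
  show i4: "integrable lebesgue (\<lambda>y. sg (moll \<nu> (y - a)) (sg (grad_cutoff \<nu> y) (\<psi> y)))"
    using Bochner_Integration.integrable_diff[OF i3 i1] by simp
  have "(LINT y|lebesgue. sg (h y) (f y)) = - (LINT y|lebesgue. sg (moll \<nu> (y - a)) (sg (grad_cutoff \<nu> y) (\<psi> y)) + (cutoff \<nu> y * rho \<nu> (y - a)) *\<^sub>R \<psi> y)"
    using V(3) unfolding sum .
  also have "\<dots> = - (LINT y|lebesgue. sg (moll \<nu> (y - a)) (sg (grad_cutoff \<nu> y) (\<psi> y))) - (LINT y|lebesgue. (cutoff \<nu> y * rho \<nu> (y - a)) *\<^sub>R \<psi> y)"
    by (subst Bochner_Integration.integral_add[OF i4 i1]) simp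
  finally have eq: "(LINT y|lebesgue. sg (h y) (f y)) = - (LINT y|lebesgue. sg (moll \<nu> (y - a)) (sg (grad_cutoff \<nu> y) (\<psi> y)))
      - (LINT y|lebesgue. (cutoff \<nu> y * rho \<nu> (y - a)) *\<^sub>R \<psi> y)" .
  have grp: "u = - v - w \<Longrightarrow> w = - u - v" for u v w :: "complex^2" by simp
  show "(LINT y|lebesgue. (cutoff \<nu> y * rho \<nu> (y - a)) *\<^sub>R \<psi> y) =
      - (LINT y|lebesgue. sg (cutoff \<nu> y *\<^sub>R moll \<nu> (y - a)) (f y))
      - (LINT y|lebesgue. sg (moll \<nu> (y - a)) (sg (grad_cutoff \<nu> y) (\<psi> y)))"
    using grp[OF eq] unfolding h_def .
qed

lemma norm_moll: "0 < \<nu> \<Longrightarrow> norm (moll \<nu> z) \<le> norm z powr - 2"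
  and moll_eq_G: "0 < \<nu> \<Longrightarrow> 2 \<le> \<nu>\<^sup>2 * (norm z)\<^sup>2 \<Longrightarrow> moll \<nu> z = G z"
proof -
  assume \<nu>: "0 < \<nu>"
  have m: "moll \<nu> z = step (\<nu>\<^sup>2 * (norm z)\<^sup>2 - 1) *\<^sub>R G z"
  proof (cases "z = 0")
    case False
    have "(\<nu> * norm z) powr 2 = \<nu>\<^sup>2 * (norm z)\<^sup>2"
      using \<nu> by (simp add: power_mult_distrib)
    then have "(\<nu>\<^sup>2 * (norm z)\<^sup>2) powr - (3/2) = ((\<nu> * norm z) powr 2) powr - (3/2)"
      by simp
    also have "\<dots> = (\<nu> * norm z) powr - 3"
      unfolding powr_powr by simp
    also have "\<dots> = \<nu> powr - 3 * norm z powr - 3"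
      by (simp only: powr_mult)
    finally have "\<nu> ^ 3 * (\<nu>\<^sup>2 * (norm z)\<^sup>2) powr - (3/2) = norm z powr - 3"
      using \<nu> by (simp add: powr_minus_divide[of \<nu>] powr_numeral)
    then show ?thesis by (simp add: moll_def qk_def G_def mult.left_commute)
  qed (simp add: moll_def G_def)
  show "norm (moll \<nu> z) \<le> norm z powr - 2"
    unfolding m by (simp add: norm_G step_nonneg step_le_1 mult_left_le_one_le)
  show "moll \<nu> z = G z" if "2 \<le> \<nu>\<^sup>2 * (norm z)\<^sup>2"
    unfolding m using that by (simp add: step_eq_1)
qed

lemma moll_0 [simp]: "moll \<nu> 0 = 0" and G_0 [simp]: "G 0 = 0"
  by (simp_all add: moll_def G_def)

lemma cutoff_eq_1:
  assumes "0 < \<nu>" "2 \<le> \<nu> * norm y" "norm y \<le> \<nu>"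
  shows "cutoff \<nu> y = 1" "grad_cutoff \<nu> y = 0"
proof -
  have "2\<^sup>2 \<le> (\<nu> * norm y)\<^sup>2" using assms by (intro power_mono) auto
  then have 1: "1 \<le> \<nu>\<^sup>2 * (norm y)\<^sup>2 - 1" by (simp add: power_mult_distrib)
  have "(norm y)\<^sup>2 \<le> \<nu>\<^sup>2" using assms by (intro power_mono) auto
  then have 2: "1 \<le> 2 - (norm y)\<^sup>2 / \<nu>\<^sup>2" using assms by (simp add: field_simps)
  show "cutoff \<nu> y = 1" "grad_cutoff \<nu> y = 0"
    using 1 2 by (auto simp: cutoff_def grad_cutoff_def step_eq_1 step'_eq_0)
qed

lemma cutoff_bounds: "0 \<le> cutoff \<nu> y" "cutoff \<nu> y \<le> 1"
  by (auto simp: cutoff_def step_nonneg step_le_1 intro!: mult_le_one mult_nonneg_nonneg)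

text \<open>Where a derivative of the step is nonzero, \<nu> |y| respectively |y| / \<nu> is at most
  sqrt 2, so every \<nu> is traded for 1 / |y|. The scale invariant bound independent of \<nu>
  provides one majorant for all boundary terms.\<close>

lemma grad_cutoff_bound:
  obtains B where "0 < B" "\<And>\<nu> y. 0 < \<nu> \<Longrightarrow> norm (grad_cutoff \<nu> y) \<le> B / norm y"
proof -
  obtain B where B: "0 < B" "\<And>t. step' t \<le> B" by (rule step'_bounded) blast
  have "norm (grad_cutoff \<nu> y) \<le> 8 * B / norm y" if \<nu>: "0 < \<nu>" for \<nu> and y :: "real^3"
  proof (cases "y = 0")
    case False
    then have y: "0 < norm y" by simp
    let ?t = "\<nu>\<^sup>2 * (norm y)\<^sup>2" and ?u = "(norm y)\<^sup>2 / \<nu>\<^sup>2"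
    have 1: "2 * \<nu>\<^sup>2 * step' (?t - 1) * norm y \<le> 4 * B / norm y"
    proof (cases "?t \<le> 2")
      case True
      have "2 * ?t * step' (?t - 1) \<le> 2 * 2 * B"
        using True B by (intro mult_mono) (auto simp: step'_nonneg)
      then show ?thesis using y by (simp add: field_simps power2_eq_square)
    qed (use B y in \<open>simp add: step'_eq_0\<close>)
    have 2: "2 / \<nu>\<^sup>2 * step' (2 - ?u) * norm y \<le> 4 * B / norm y"
    proof (cases "?u \<le> 2")
      case True
      have "2 * ?u * step' (2 - ?u) \<le> 2 * 2 * B"
        using True B by (intro mult_mono) (auto simp: step'_nonneg)
      then show ?thesis using y by (simp add: field_simps power2_eq_square)
    qed (use B y in \<open>simp add: step'_eq_0\<close>)
    have "norm (grad_cutoff \<nu> y) \<le> (2 * \<nu>\<^sup>2 * step' (?t - 1) * step (2 - ?u) + 2 / \<nu>\<^sup>2 * step (?t - 1) * step' (2 - ?u)) * norm y"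
      unfolding grad_cutoff_def norm_scaleR
      by (intro mult_right_mono order_trans[OF abs_triangle_ineq4]) (auto simp: step_nonneg step'_nonneg abs_mult)
    also have "\<dots> \<le> (2 * \<nu>\<^sup>2 * step' (?t - 1) * 1 + 2 / \<nu>\<^sup>2 * 1 * step' (2 - ?u)) * norm y"
      by (intro mult_right_mono add_mono mult_left_mono) (auto simp: step_le_1 step'_nonneg step_nonneg intro!: mult_left_mono)
    also have "\<dots> \<le> 8 * B / norm y" using 1 2 by (simp add: distrib_right)
    finally show ?thesis .
  qed (simp add: grad_cutoff_def)
  with B show ?thesis by (intro that[of "8 * B"]) auto
qed

section \<open>Removing the mollification\<close>

lemma lebesgue_integral_transfer:
  fixes F F0 :: "real^3 \<Rightarrow> 'b::{banach, second_countable_topology}"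
  assumes F: "integrable lebesgue F" and F0 [measurable]: "F0 \<in> borel_measurable borel"
    and ae: "AE x in lborel. F x = F0 x"
  shows "integrable lborel F0" "(LINT x|lebesgue. F x) = (LINT x|lborel. F0 x)"
proof -
  have ae': "AE x in lebesgue. F x = F0 x" using ae by (rule AE_completion)
  have m: "F0 \<in> borel_measurable lebesgue" by (intro measurable_completion) simp
  have "integrable lebesgue F0"
    by (rule integrable_cong_AE_imp[OF F m]) (use ae' in auto)
  then show "integrable lborel F0" by (simp add: integrable_completion)
  have "(LINT x|lebesgue. F x) = (LINT x|lebesgue. F0 x)"
    by (rule integral_cong_AE[OF borel_measurable_integrable[OF F] m ae'])
  also have "\<dots> = (LINT x|lborel. F0 x)" by (simp add: integral_completion)
  finally show "(LINT x|lebesgue. F x) = (LINT x|lborel. F0 x)" .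
qed

text \<open>The function spaces use the completed Lebesgue measure, while exchanging integrals takes
  place on the product of two copies of \<open>lborel\<close>. All spinors are therefore replaced by
  Borel versions; the real parts and imaginary parts of the components are treated one by
  one.\<close>

lemma lebesgue_ex_borel_measurable_spinor:
  fixes F :: "real^3 \<Rightarrow> complex^2"
  assumes "F \<in> borel_measurable lebesgue"
  obtains F0 where "F0 \<in> borel_measurable borel" "AE x in lborel. F x = F0 x"
proof -
  have comp: "\<exists>h\<in>borel_measurable borel. AE x in lborel. F x $ i = h x" for i
  proof -
    have Fi: "(\<lambda>x. F x $ i) \<in> borel_measurable lebesgue"
      using assms by (intro borel_measurable_continuous_on[OF _ assms]) (intro continuous_intros)
    have "(\<lambda>x. Re (F x $ i)) \<in> borel_measurable lebesgue" "(\<lambda>x. Im (F x $ i)) \<in> borel_measurable lebesgue"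
      using Fi by simp_all
    from this[THEN completion_ex_borel_measurable_real] obtain a b
      where [measurable]: "a \<in> borel_measurable borel" "b \<in> borel_measurable borel"
        and ab: "AE x in lborel. Re (F x $ i) = a x" "AE x in lborel. Im (F x $ i) = b x"
      by auto
    have "AE x in lborel. F x $ i = complex_of_real (a x) + \<i> * complex_of_real (b x)"
      using ab by eventually_elim (simp add: complex_eq_iff)
    then show ?thesis by (intro bexI[of _ "\<lambda>x. complex_of_real (a x) + \<i> * complex_of_real (b x)"]) auto
  qed
  from comp[of 1] comp[of 2] obtain a b where [measurable]: "a \<in> borel_measurable borel" "b \<in> borel_measurable borel"
    and ab: "AE x in lborel. F x $ 1 = a x" "AE x in lborel. F x $ 2 = b x" by auto
  define F0 :: "real^3 \<Rightarrow> complex^2" where "F0 x = a x *s axis 1 1 + b x *s axis 2 1" for x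
  have comp: "F0 x $ 1 = a x" "F0 x $ 2 = b x" for x
    by (simp_all add: F0_def axis_def)
  have "continuous_on UNIV (\<lambda>p :: complex \<times> complex. fst p *s axis 1 1 + snd p *s axis 2 1 :: complex^2)"
    unfolding vector_scalar_mult_def by (intro continuous_intros)
  then have "F0 \<in> borel_measurable borel"
    unfolding F0_def[abs_def] by (rule borel_measurable_continuous_Pair[rotated 2]) auto
  moreover have "AE x in lborel. F x = F0 x"
    using ab by eventually_elim (intro vec2_eqI, simp_all add: comp)
  ultimately show ?thesis by (rule that)
qed

lemma lborel_integral_affine_euclidean:
  fixes f :: "real^3 \<Rightarrow> 'b::{banach, second_countable_topology}"
  assumes [measurable]: "f \<in> borel_measurable borel" and c: "c \<noteq> 0"
  shows "(LINT x|lborel. f x) = \<bar>c\<bar> ^ 3 *\<^sub>R (LINT x|lborel. f (t + c *\<^sub>R x))"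
proof -
  have "(LINT x|lborel. f x) = (LINT x|density (distr lborel borel (\<lambda>x. t + c *\<^sub>R x)) (\<lambda>_. ennreal (\<bar>c\<bar> ^ 3)). f x)"
    using lborel_affine[OF c, of t] by simp
  also have "\<dots> = (LINT x|distr lborel borel (\<lambda>x. t + c *\<^sub>R x). \<bar>c\<bar> ^ 3 *\<^sub>R f x)"
    by (rule integral_density) auto
  also have "\<dots> = (LINT x|lborel. \<bar>c\<bar> ^ 3 *\<^sub>R f (t + c *\<^sub>R x))"
    by (rule integral_distr) auto
  finally show ?thesis by simp
qed

lemma lborel_integrable_affine_euclidean:
  fixes f :: "real^3 \<Rightarrow> 'b::{banach, second_countable_topology}"
  assumes f: "integrable lborel f" and c: "c \<noteq> 0"
  shows "integrable lborel (\<lambda>x. f (t + c *\<^sub>R x))"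
proof -
  have [measurable]: "f \<in> borel_measurable borel" using borel_measurable_integrable[OF f] by simp
  have "(\<integral>\<^sup>+x. ennreal (norm (f x)) \<partial>lborel) = ennreal (\<bar>c\<bar> ^ 3) * (\<integral>\<^sup>+x. ennreal (norm (f (t + c *\<^sub>R x))) \<partial>lborel)"
    using nn_integral_affine_euclidean[OF _ c, of "\<lambda>x. ennreal (norm (f x))" t] by simp
  moreover have "(\<integral>\<^sup>+x. ennreal (norm (f x)) \<partial>lborel) < \<infinity>"
    using f by (simp add: integrable_iff_bounded)
  ultimately show ?thesis
    using c by (auto simp: integrable_iff_bounded ennreal_mult_less_top)
qed

text \<open>The positive and the negative part of g are densities of measures that agree on boxes.
  Boxes are closed under intersection and generate the Borel sets, so the measures agree, and
  densities are unique almost everywhere.\<close>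

lemma AE_zero_if_box_integrals_zero_real:
  fixes g :: "real^3 \<Rightarrow> real"
  assumes g: "integrable lborel g" and z: "\<And>l u. (LINT x|lborel. indicator (box l u) x *\<^sub>R g x) = 0"
  shows "AE x in lborel. g x = 0"
proof -
  have [measurable]: "g \<in> borel_measurable borel" using borel_measurable_integrable[OF g] by simp
  let ?f = "\<lambda>x. ennreal (g x)" and ?h = "\<lambda>x. ennreal (- g x)"
  have box_eq: "(\<integral>\<^sup>+x. ?f x * indicator (box l u) x \<partial>lborel) = (\<integral>\<^sup>+x. ?h x * indicator (box l u) x \<partial>lborel)"
    and box_fin: "(\<integral>\<^sup>+x. ?f x * indicator (box l u) x \<partial>lborel) < \<infinity>" for l u
  proof -
    let ?k = "\<lambda>x. indicator (box l u) x *\<^sub>R g x"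
    have k: "integrable lborel ?k" using integrable_mult_indicator[OF _ g, of "box l u"] by simp
    have 1: "(\<integral>\<^sup>+x. ?f x * indicator (box l u) x \<partial>lborel) = (\<integral>\<^sup>+x. ennreal (?k x) \<partial>lborel)"
      "(\<integral>\<^sup>+x. ?h x * indicator (box l u) x \<partial>lborel) = (\<integral>\<^sup>+x. ennreal (- ?k x) \<partial>lborel)"
      by (auto intro!: nn_integral_cong split: split_indicator)
    have fin: "(\<integral>\<^sup>+x. ennreal (?k x) \<partial>lborel) < \<infinity>" "(\<integral>\<^sup>+x. ennreal (- ?k x) \<partial>lborel) < \<infinity>"
      using k unfolding real_integrable_def by (auto simp: less_top)
    have "enn2real (\<integral>\<^sup>+x. ennreal (?k x) \<partial>lborel) - enn2real (\<integral>\<^sup>+x. ennreal (- ?k x) \<partial>lborel) = 0"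
      using real_lebesgue_integral_def[OF k] z[of l u] by simp
    then have "ennreal (enn2real (\<integral>\<^sup>+x. ennreal (?k x) \<partial>lborel)) = ennreal (enn2real (\<integral>\<^sup>+x. ennreal (- ?k x) \<partial>lborel))"
      by simp
    then have "(\<integral>\<^sup>+x. ennreal (?k x) \<partial>lborel) = (\<integral>\<^sup>+x. ennreal (- ?k x) \<partial>lborel)"
      unfolding ennreal_enn2real[OF fin(1)[unfolded infinity_ennreal_def]] ennreal_enn2real[OF fin(2)[unfolded infinity_ennreal_def]] .
    then show "(\<integral>\<^sup>+x. ?f x * indicator (box l u) x \<partial>lborel) = (\<integral>\<^sup>+x. ?h x * indicator (box l u) x \<partial>lborel)"
      "(\<integral>\<^sup>+x. ?f x * indicator (box l u) x \<partial>lborel) < \<infinity>"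
      using 1 fin by simp_all
  qed
  have "density lborel ?f = density lborel ?h"
  proof (rule measure_eqI_generator_eq)
    let ?E = "range (\<lambda>(a, b). box a b::(real^3) set)"
    show "Int_stable ?E" by (auto simp: Int_stable_def box_Int_box)
    show "?E \<subseteq> Pow UNIV" "sets (density lborel ?f) = sigma_sets UNIV ?E" "sets (density lborel ?h) = sigma_sets UNIV ?E"
      by (simp_all add: borel_eq_box)
    let ?A = "\<lambda>n::nat. box (- (real n *\<^sub>R One)) (real n *\<^sub>R One) :: (real^3) set"
    show "range ?A \<subseteq> ?E" "(\<Union>i. ?A i) = UNIV" unfolding UN_box_eq_UNIV by auto
    show "emeasure (density lborel ?f) (?A i) \<noteq> \<infinity>" for i
      using box_fin by (simp add: emeasure_density less_top)
    show "emeasure (density lborel ?f) X = emeasure (density lborel ?h) X" if "X \<in> ?E" for X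
      using that box_eq by (auto simp: emeasure_density)
  qed
  then have "AE x in lborel. ?f x = ?h x"
    by (intro sigma_finite_measure.density_unique[OF sigma_finite_lborel]) auto
  then show ?thesis
  proof eventually_elim
    fix x assume "ennreal (g x) = ennreal (- g x)"
    then show "g x = 0"
      by (cases "0 \<le> g x") (simp_all add: ennreal_neg)
  qed
qed

lemma AE_zero_if_box_integrals_zero:
  fixes h :: "real^3 \<Rightarrow> 'a::euclidean_space"
  assumes h: "integrable lborel h" and z: "\<And>l u. (LINT x|lborel. indicator (box l u) x *\<^sub>R h x) = 0"
  shows "AE x in lborel. h x = 0"
proof -
  have "AE x in lborel. h x \<bullet> b = 0" if "b \<in> Basis" for b
  proof (rule AE_zero_if_box_integrals_zero_real)
    show "integrable lborel (\<lambda>x. h x \<bullet> b)" using h by (intro integrable_inner_left) auto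
    fix l u
    have i: "integrable lborel (\<lambda>x. indicator (box l u) x *\<^sub>R h x)"
      using integrable_mult_indicator[OF _ h, of "box l u"] by simp
    have "(LINT x|lborel. indicator (box l u) x *\<^sub>R (h x \<bullet> b)) = (LINT x|lborel. (indicator (box l u) x *\<^sub>R h x) \<bullet> b)"
      by simp
    also have "\<dots> = 0" using z[of l u] i by (subst integral_inner_left) auto
    finally show "(LINT x|lborel. indicator (box l u) x *\<^sub>R (h x \<bullet> b)) = 0" .
  qed
  then have "AE x in lborel. \<forall>b\<in>Basis. h x \<bullet> b = 0"
    by (subst AE_ball_countable) (auto intro: countable_finite)
  then show ?thesis by eventually_elim (auto intro: euclidean_eqI)
qed

section \<open>The mollifier\<close>

lemma rho_nonneg: "0 < \<nu> \<Longrightarrow> 0 \<le> rho \<nu> z"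
  by (auto simp: rho_def step'_nonneg)

lemma rho_scale: "0 < \<nu> \<Longrightarrow> rho \<nu> ((1 / \<nu>) *\<^sub>R z) = \<nu> ^ 3 * rho 1 z"
  by (simp add: rho_def power_divide)

lemma rho_support: "0 < \<nu> \<Longrightarrow> rho \<nu> z \<noteq> 0 \<Longrightarrow> norm z \<le> 2 / \<nu>"
proof -
  assume \<nu>: "0 < \<nu>" and "rho \<nu> z \<noteq> 0"
  then have "\<not> 1 \<le> \<nu>\<^sup>2 * (norm z)\<^sup>2 - 1"
    using step'_eq_0[of "\<nu>\<^sup>2 * (norm z)\<^sup>2 - 1"] by (auto simp: rho_def)
  then have "(\<nu> * norm z)\<^sup>2 \<le> 2\<^sup>2" by (simp add: power_mult_distrib)
  then have "\<nu> * norm z \<le> 2" by (rule power2_le_imp_le) simp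
  then show ?thesis using \<nu> by (simp add: field_simps)
qed

lemma rho_bounded:
  obtains B where "0 < B" "\<And>\<nu> z. 0 < \<nu> \<Longrightarrow> rho \<nu> z \<le> \<nu> ^ 3 * B"
proof -
  obtain B where B: "0 < B" "\<And>t. step' t \<le> B" by (rule step'_bounded) blast
  have "2 * step' (t - 1) * t powr - (1/2) \<le> 2 * B * 1" for t
  proof (cases "1 \<le> t")
    case True
    then have "t powr - (1/2) \<le> 1 powr - (1/2)" by (intro powr_mono2') auto
    then show ?thesis using B step'_nonneg by (intro mult_mono) auto
  qed (use B in \<open>simp add: step'_eq_0\<close>)
  then show ?thesis
    using B by (intro that[of "2 * B"]) (auto simp: rho_def intro!: mult_left_mono)
qed

text \<open>The flux of z / |z|^3 through spheres, that is 4 pi. By scaling it is the integral of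
  \<open>rho\<close> at every \<nu>.\<close>

definition rho_mass :: real where
  "rho_mass = (LINT z|lborel. rho 1 z)"

lemma rho_measurable [measurable]: "0 < \<nu> \<Longrightarrow> rho \<nu> \<in> borel_measurable borel"
  by (intro borel_measurable_continuous_onI rho_continuous)

lemma integrable_rho: "integrable lborel (rho 1)"
proof -
  have "integrable lborel (\<lambda>z. indicator (cball 0 2) z *\<^sub>R rho 1 z)"
    by (intro borel_integrable_compact compact_cball continuous_on_subset[OF rho_continuous]) auto
  moreover have "indicator (cball 0 2) z *\<^sub>R rho 1 z = rho 1 z" for z
    using rho_support[of 1 z] by (cases "rho 1 z = 0") (auto split: split_indicator)
  ultimately show ?thesis by (simp only:)
qed

lemma rho_mass_pos: "0 < rho_mass"
proof -
  have nn: "AE z in lborel. 0 \<le> rho 1 z" by (simp add: rho_nonneg)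
  have "rho_mass \<noteq> 0"
  proof
    assume "rho_mass = 0"
    then have "AE z in lborel. rho 1 z = 0"
      unfolding rho_mass_def using integral_nonneg_eq_0_iff_AE[OF integrable_rho nn] by simp
    then have "AE z in lebesgue. z \<in> {z. rho 1 z = 0}" by (auto intro: AE_completion)
    moreover have "closed {z. rho 1 z = 0}"
      by (intro closed_Collect_eq rho_continuous continuous_intros) auto
    ultimately have "z \<in> {z. rho 1 z = 0}" for z
      by (intro mem_closed_if_AE_lebesgue)
    \<comment> \<open>At this point the squared norm minus 1 is 9/16, inside the interval where the
      step increases strictly.\<close>
    then have "rho 1 ((5/4) *\<^sub>R axis 1 1) = 0" by blast
    then show False using step'_pos[of "9/16"] by (simp add: rho_def power2_eq_square)
  qed
  moreover have "0 \<le> rho_mass" unfolding rho_mass_def by (intro Bochner_Integration.integral_nonneg) (simp add: rho_nonneg)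
  ultimately show ?thesis by simp
qed

lemma AE_lborel_scale:
  fixes P :: "real^3 \<Rightarrow> bool"
  assumes P: "AE x in lborel. P x" and c: "c \<noteq> 0"
  shows "AE x in lborel. P (c *\<^sub>R x)"
proof -
  obtain N where N: "N \<in> null_sets lborel" "{x \<in> space lborel. \<not> P x} \<subseteq> N"
    using P by (auto simp: eventually_ae_filter)
  then have [measurable]: "N \<in> sets borel" by auto
  have "0 = (\<integral>\<^sup>+x. indicator N x \<partial>lborel)" using N by (simp add: null_setsD1)
  also have "\<dots> = ennreal (\<bar>c\<bar> ^ 3) * (\<integral>\<^sup>+x. indicator N (0 + c *\<^sub>R x) \<partial>lborel)"
    by (subst nn_integral_affine_euclidean[OF _ c, where t=0]) auto
  finally have "(\<integral>\<^sup>+x. indicator N (0 + c *\<^sub>R x) \<partial>lborel) = 0"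
    using c by simp
  then have "AE x in lborel. indicator N (0 + c *\<^sub>R x) = (0::ennreal)"
    by (subst (asm) nn_integral_0_iff_AE) auto
  then show ?thesis
    by eventually_elim (use N in \<open>auto simp: indicator_def split: if_splits\<close>)
qed

lemma integrable_lborel_prodI:
  fixes \<Theta> :: "(real^3) \<times> (real^3) \<Rightarrow> 'b::{banach, second_countable_topology}" and u v :: "real^3 \<Rightarrow> real"
  assumes [measurable]: "\<Theta> \<in> borel_measurable (lborel \<Otimes>\<^sub>M lborel)" "u \<in> borel_measurable borel" "v \<in> borel_measurable borel"
    and uv: "\<And>x. 0 \<le> u x" "\<And>y. 0 \<le> v y"
    and fin: "(\<integral>\<^sup>+x. ennreal (u x) \<partial>lborel) < \<infinity>" "(\<integral>\<^sup>+x. ennreal (v x) \<partial>lborel) < \<infinity>"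
    and le: "\<And>x y. norm (\<Theta> (x, y)) \<le> u x * v y"
  shows "integrable (lborel \<Otimes>\<^sub>M lborel) \<Theta>"
proof (rule integrableI_bounded)
  have "(\<integral>\<^sup>+p. ennreal (norm (\<Theta> p)) \<partial>(lborel \<Otimes>\<^sub>M lborel)) = (\<integral>\<^sup>+x. \<integral>\<^sup>+y. ennreal (norm (\<Theta> (x, y))) \<partial>lborel \<partial>lborel)"
    by (subst lborel.nn_integral_fst[symmetric]) auto
  also have "\<dots> \<le> (\<integral>\<^sup>+x. \<integral>\<^sup>+y. ennreal (u x) * ennreal (v y) \<partial>lborel \<partial>lborel)"
    using le uv by (intro nn_integral_mono) (simp flip: ennreal_mult add: ennreal_leI)
  also have "\<dots> = (\<integral>\<^sup>+x. ennreal (u x) \<partial>lborel) * (\<integral>\<^sup>+x. ennreal (v x) \<partial>lborel)"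
    by (simp add: nn_integral_cmult nn_integral_multc)
  also have "\<dots> < \<infinity>" using fin by (simp add: ennreal_mult_less_top)
  finally show "(\<integral>\<^sup>+p. ennreal (norm (\<Theta> p)) \<partial>(lborel \<Otimes>\<^sub>M lborel)) < \<infinity>" .
qed simp

lemma cutoff_measurable [measurable]: "cutoff \<nu> \<in> borel_measurable borel"
  by (intro borel_measurable_continuous_onI cutoff_continuous)

lemma annulus_sets [measurable]: "annulus a b \<in> sets borel"
  by (intro borel_compact compact_annulus)

lemma cutoff_tendsto: "y \<noteq> 0 \<Longrightarrow> (\<lambda>n. cutoff (real n) y) \<longlonglongrightarrow> 1"
  and grad_cutoff_tendsto: "y \<noteq> 0 \<Longrightarrow> (\<lambda>n. grad_cutoff (real n) y) \<longlonglongrightarrow> 0"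
proof -
  have ev: "\<forall>\<^sub>F n in sequentially. cutoff (real n) y = 1 \<and> grad_cutoff (real n) y = 0" if "y \<noteq> 0"
  proof -
    obtain N :: nat where N: "max 1 (max (2 / norm y) (norm y)) < real N" using reals_Archimedean2 by blast
    show ?thesis
    proof (rule eventually_sequentiallyI[of N])
      fix n assume "N \<le> n"
      then have "max 1 (max (2 / norm y) (norm y)) < real n" using N by linarith
      then show "cutoff (real n) y = 1 \<and> grad_cutoff (real n) y = 0"
        using cutoff_eq_1[of "real n" y] that by (auto simp: field_simps)
    qed
  qed
  show "(\<lambda>n. cutoff (real n) y) \<longlonglongrightarrow> 1" if "y \<noteq> 0"
    by (rule tendsto_eventually) (use ev[OF that] in \<open>auto elim: eventually_mono\<close>)
  show "(\<lambda>n. grad_cutoff (real n) y) \<longlonglongrightarrow> 0" if "y \<noteq> 0"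
    by (rule tendsto_eventually) (use ev[OF that] in \<open>auto elim: eventually_mono\<close>)
qed

section \<open>Convergence of mollified dilates in the mean over a set\<close>

context
  fixes \<psi> :: "real^3 \<Rightarrow> complex^2" and B :: "(real^3) set" and r R s :: real
  assumes \<psi>_meas [measurable]: "\<psi> \<in> borel_measurable borel"
    and loc: "\<And>a b. 0 < a \<Longrightarrow> integrable lborel (\<lambda>y. indicator (annulus a b) y *\<^sub>R \<psi> y)"
    and B_meas [measurable]: "B \<in> sets borel" and B: "B \<subseteq> annulus r R" and r: "0 < r"
    and front: "negligible (frontier B)" and s: "0 < s"
begin

lemma integrable_dilated_on_set: "integrable lborel (\<lambda>x. indicator B x *\<^sub>R \<psi> ((1 / s) *\<^sub>R x))"
proof -
  have "integrable lborel (\<lambda>y. indicator (annulus (r / s) (R / s)) y *\<^sub>R \<psi> y)"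
    using r s by (intro loc) auto
  from lborel_integrable_affine_euclidean[OF this, of "1 / s" 0] s
  have "integrable lborel (\<lambda>x. indicator (annulus (r / s) (R / s)) ((1 / s) *\<^sub>R x) *\<^sub>R \<psi> ((1 / s) *\<^sub>R x))"
    by simp
  from integrable_mult_indicator[OF _ this, of B]
  have "integrable lborel (\<lambda>x. indicator B x *\<^sub>R indicator (annulus (r / s) (R / s)) ((1 / s) *\<^sub>R x) *\<^sub>R \<psi> ((1 / s) *\<^sub>R x))"
    by simp
  moreover have "indicator B x *\<^sub>R indicator (annulus (r / s) (R / s)) ((1 / s) *\<^sub>R x) *\<^sub>R \<psi> ((1 / s) *\<^sub>R x)
      = indicator B x *\<^sub>R \<psi> ((1 / s) *\<^sub>R x)" for x
  proof (cases "x \<in> B")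
    case True
    then have "(1 / s) *\<^sub>R x \<in> annulus (r / s) (R / s)"
      using B s by (auto simp: annulus_def divide_right_mono)
    then show ?thesis by simp
  qed simp
  ultimately show ?thesis by (simp only:)
qed

lemma integrable_mollified_on_set:
  assumes \<nu>: "0 < \<nu>"
  shows "integrable (lborel \<Otimes>\<^sub>M lborel) (\<lambda>(x, y). indicator B x *\<^sub>R (cutoff \<nu> y * rho \<nu> (y - (1 / s) *\<^sub>R x)) *\<^sub>R \<psi> y)"
proof -
  obtain C where C: "0 < C" "\<And>\<nu> z. 0 < \<nu> \<Longrightarrow> rho \<nu> z \<le> \<nu> ^ 3 * C" by (rule rho_bounded) blast
  note [measurable] = rho_measurable[OF \<nu>]
  let ?A = "annulus (1 / \<nu>) (2 * \<nu>)"
  show ?thesis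
  proof (rule integrable_lborel_prodI[where u="\<lambda>x. \<nu> ^ 3 * C * indicator B x" and v="\<lambda>y. norm (indicator ?A y *\<^sub>R \<psi> y)"])
    have "(\<integral>\<^sup>+x. ennreal (\<nu> ^ 3 * C * indicator B x) \<partial>lborel) = (\<integral>\<^sup>+x. ennreal (\<nu> ^ 3 * C) * indicator B x \<partial>lborel)"
      by (intro nn_integral_cong) (auto split: split_indicator)
    also have "\<dots> = ennreal (\<nu> ^ 3 * C) * emeasure lborel B"
      by (rule nn_integral_cmult_indicator) simp
    also have "\<dots> < \<infinity>"
    proof -
      have "emeasure lborel B \<le> emeasure lborel (annulus r R)" using B by (intro emeasure_mono) auto
      also have "\<dots> < \<infinity>" using emeasure_compact_finite[OF compact_annulus] .
      finally show ?thesis by (simp add: ennreal_mult_less_top)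
    qed
    finally show "(\<integral>\<^sup>+x. ennreal (\<nu> ^ 3 * C * indicator B x) \<partial>lborel) < \<infinity>" .
    show "(\<integral>\<^sup>+y. ennreal (norm (indicator ?A y *\<^sub>R \<psi> y)) \<partial>lborel) < \<infinity>"
      using loc[of "1 / \<nu>" "2 * \<nu>"] \<nu> by (simp add: integrable_iff_bounded)
    fix x y
    show "norm (case (x, y) of (x, y) \<Rightarrow> indicator B x *\<^sub>R (cutoff \<nu> y * rho \<nu> (y - (1 / s) *\<^sub>R x)) *\<^sub>R \<psi> y)
        \<le> \<nu> ^ 3 * C * indicator B x * norm (indicator ?A y *\<^sub>R \<psi> y)"
    proof (cases "cutoff \<nu> y = 0")
      case False
      then have y: "y \<in> ?A" using cutoff_support[OF \<nu>, of y] by (auto simp: annulus_def)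
      have "cutoff \<nu> y * rho \<nu> (y - (1 / s) *\<^sub>R x) \<le> 1 * (\<nu> ^ 3 * C)"
        using cutoff_bounds rho_nonneg[OF \<nu>] C \<nu> by (intro mult_mono) auto
      moreover have "0 \<le> cutoff \<nu> y * rho \<nu> (y - (1 / s) *\<^sub>R x)"
        using cutoff_bounds rho_nonneg[OF \<nu>] by simp
      ultimately have "\<bar>cutoff \<nu> y * rho \<nu> (y - (1 / s) *\<^sub>R x)\<bar> \<le> \<nu> ^ 3 * C" by simp
      then have "\<bar>cutoff \<nu> y * rho \<nu> (y - (1 / s) *\<^sub>R x)\<bar> * norm (\<psi> y) \<le> \<nu> ^ 3 * C * norm (\<psi> y)"
        by (rule mult_right_mono) simp
      then show ?thesis using y by (auto simp: abs_mult split: split_indicator)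
    qed (use C \<nu> in auto)
  qed (use C \<nu> in \<open>auto intro!: mult_nonneg_nonneg\<close>)
qed

text \<open>Substitution x = s y - (s / \<nu>) z: the Jacobian (s / \<nu>)^3 cancels the factor
  \<nu>^3 in the scaling of \<open>rho\<close>. In the new form only the indicator depends on
  \<nu>.\<close>

lemma mollified_indicator:
  assumes \<nu>: "0 < \<nu>"
  shows "(LINT x|lborel. indicator B x * rho \<nu> (y - (1 / s) *\<^sub>R x))
    = s ^ 3 * (LINT z|lborel. indicator B (s *\<^sub>R y + (- s / \<nu>) *\<^sub>R z) * rho 1 z)"
proof -
  note [measurable] = rho_measurable[OF \<nu>]
  have "(LINT x|lborel. indicator B x * rho \<nu> (y - (1 / s) *\<^sub>R x))
     = \<bar>- s / \<nu>\<bar> ^ 3 *\<^sub>R (LINT z|lborel. indicator B (s *\<^sub>R y + (- s / \<nu>) *\<^sub>R z) * rho \<nu> (y - (1 / s) *\<^sub>R (s *\<^sub>R y + (- s / \<nu>) *\<^sub>R z)))"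
    using s \<nu> by (intro lborel_integral_affine_euclidean) auto
  also have "(\<lambda>z. indicator B (s *\<^sub>R y + (- s / \<nu>) *\<^sub>R z) * rho \<nu> (y - (1 / s) *\<^sub>R (s *\<^sub>R y + (- s / \<nu>) *\<^sub>R z)))
     = (\<lambda>z. \<nu> ^ 3 * (indicator B (s *\<^sub>R y + (- s / \<nu>) *\<^sub>R z) * rho 1 z))"
  proof
    fix z
    have "y - (1 / s) *\<^sub>R (s *\<^sub>R y + (- s / \<nu>) *\<^sub>R z) = (1 / \<nu>) *\<^sub>R z"
      using s by (simp add: scaleR_add_right scaleR_diff_right)
    then show "indicator B (s *\<^sub>R y + (- s / \<nu>) *\<^sub>R z) * rho \<nu> (y - (1 / s) *\<^sub>R (s *\<^sub>R y + (- s / \<nu>) *\<^sub>R z))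
      = \<nu> ^ 3 * (indicator B (s *\<^sub>R y + (- s / \<nu>) *\<^sub>R z) * rho 1 z)"
      using rho_scale[OF \<nu>, of z] by simp
  qed
  finally show ?thesis
    using s \<nu> by (simp add: power_divide)
qed

lemma mollified_indicator_le:
  assumes \<nu>: "0 < \<nu>"
  shows "\<bar>LINT x|lborel. indicator B x * rho \<nu> (y - (1 / s) *\<^sub>R x)\<bar> \<le> s ^ 3 * rho_mass"
proof -
  note [measurable] = rho_measurable[of 1, simplified]
  have i: "integrable lborel (\<lambda>z. indicator B (s *\<^sub>R y + (- s / \<nu>) *\<^sub>R z) * rho 1 z)"
    by (rule Bochner_Integration.integrable_bound[OF integrable_rho])
       (auto split: split_indicator)
  have "0 \<le> (LINT z|lborel. indicator B (s *\<^sub>R y + (- s / \<nu>) *\<^sub>R z) * rho 1 z)"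
    by (intro Bochner_Integration.integral_nonneg) (auto simp: rho_nonneg)
  moreover have "(LINT z|lborel. indicator B (s *\<^sub>R y + (- s / \<nu>) *\<^sub>R z) * rho 1 z) \<le> rho_mass"
    unfolding rho_mass_def by (intro integral_mono i integrable_rho) (auto simp: rho_nonneg split: split_indicator)
  ultimately show ?thesis
    unfolding mollified_indicator[OF \<nu>] using s by (simp add: abs_mult mult_left_mono)
qed

text \<open>Beyond the threshold the radius 2 / \<nu> of the mollifier is at most r / (2 s), half
  the distance of the dilated set from 0. The supports then stay in one annulus away from the
  origin, on which \<psi> is integrable.\<close>

lemma mollified_indicator_eq_0:
  assumes \<nu>: "0 < \<nu>" "4 * s / r \<le> \<nu>" "1 \<le> \<nu>" and y: "y \<notin> annulus (r / (2 * s)) (R / s + 2)"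
  shows "(LINT x|lborel. indicator B x * rho \<nu> (y - (1 / s) *\<^sub>R x)) = 0"
proof -
  have "indicator B x * rho \<nu> (y - (1 / s) *\<^sub>R x) = 0" for x
  proof (rule ccontr)
    assume "indicator B x * rho \<nu> (y - (1 / s) *\<^sub>R x) \<noteq> 0"
    then have x: "r \<le> norm x" "norm x \<le> R" and "rho \<nu> (y - (1 / s) *\<^sub>R x) \<noteq> 0"
      using B by (auto simp: annulus_def indicator_def split: if_splits)
    then have d: "norm (y - (1 / s) *\<^sub>R x) \<le> 2 / \<nu>" using rho_support \<nu> by blast
    have n: "r / s \<le> norm ((1 / s) *\<^sub>R x)" "norm ((1 / s) *\<^sub>R x) \<le> R / s"
      using x s by (auto simp: divide_right_mono)
    have "2 / \<nu> \<le> r / (2 * s)" "2 / \<nu> \<le> 2"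
      using \<nu> r s by (auto simp: field_simps)
    moreover have "r / s - r / (2 * s) = r / (2 * s)" using s by (simp add: field_simps)
    moreover have "norm ((1 / s) *\<^sub>R x) - norm (y - (1 / s) *\<^sub>R x) \<le> norm y" "norm y \<le> norm ((1 / s) *\<^sub>R x) + norm (y - (1 / s) *\<^sub>R x)"
      using norm_triangle_ineq3[of "(1 / s) *\<^sub>R x" y] norm_triangle_sub[of y "(1 / s) *\<^sub>R x"]
      by (auto simp: norm_minus_commute)
    ultimately have "r / (2 * s) \<le> norm y" "norm y \<le> R / s + 2" using d n by linarith+
    then show False using y by (simp add: annulus_def)
  qed
  then show ?thesis by (simp only: Bochner_Integration.integral_zero)
qed

lemma mollified_indicator_tendsto:
  assumes y: "s *\<^sub>R y \<notin> frontier B"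
  shows "(\<lambda>n. LINT x|lborel. indicator B x * rho (real (Suc n)) (y - (1 / s) *\<^sub>R x)) \<longlonglongrightarrow> s ^ 3 * (rho_mass * indicator B (s *\<^sub>R y))"
proof -
  note [measurable] = rho_measurable[of 1, simplified]
  have "(\<lambda>n. LINT z|lborel. indicator B (s *\<^sub>R y + (- s / real (Suc n)) *\<^sub>R z) * rho 1 z) \<longlonglongrightarrow> (LINT z|lborel. indicator B (s *\<^sub>R y) * rho 1 z)"
  proof (rule integral_dominated_convergence[where w="rho 1"])
    show "AE z in lborel. (\<lambda>n. indicator B (s *\<^sub>R y + (- s / real (Suc n)) *\<^sub>R z) * rho 1 z) \<longlonglongrightarrow> indicator B (s *\<^sub>R y) * rho 1 z"
    proof (intro AE_I2 tendsto_mult tendsto_const)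
      fix z
      have "(\<lambda>n. - s * inverse (real (Suc n))) \<longlonglongrightarrow> - s * 0"
        by (intro tendsto_mult tendsto_const LIMSEQ_inverse_real_of_nat)
      then have "(\<lambda>n. s *\<^sub>R y + (- s / real (Suc n)) *\<^sub>R z) \<longlonglongrightarrow> s *\<^sub>R y + 0 *\<^sub>R z"
        by (intro tendsto_add tendsto_scaleR tendsto_const) (simp add: divide_inverse)
      then have lim: "(\<lambda>n. s *\<^sub>R y + (- s / real (Suc n)) *\<^sub>R z) \<longlonglongrightarrow> s *\<^sub>R y" by simp
      have "\<forall>\<^sub>F n in sequentially. indicator B (s *\<^sub>R y + (- s / real (Suc n)) *\<^sub>R z) = (indicator B (s *\<^sub>R y) :: real)"
      proof (cases "s *\<^sub>R y \<in> interior B")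
        case True
        from topological_tendstoD[OF lim open_interior True] show ?thesis
          by eventually_elim (use True interior_subset in \<open>auto simp: indicator_def\<close>)
      next
        case False
        then have "s *\<^sub>R y \<in> - closure B" using y by (auto simp: frontier_def)
        from topological_tendstoD[OF lim open_Compl[OF closed_closure] this] show ?thesis
          by eventually_elim (use \<open>s *\<^sub>R y \<in> - closure B\<close> closure_subset in \<open>auto simp: indicator_def\<close>)
      qed
      then show "(\<lambda>n. indicator B (s *\<^sub>R y + (- s / real (Suc n)) *\<^sub>R z)) \<longlonglongrightarrow> (indicator B (s *\<^sub>R y) :: real)"
        by (rule tendsto_eventually)
    qed
    show "AE z in lborel. norm (indicator B (s *\<^sub>R y + (- s / real (Suc n)) *\<^sub>R z) * rho 1 z) \<le> rho 1 z" for n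
      by (auto simp: rho_nonneg split: split_indicator)
  qed (auto simp: integrable_rho)
  moreover have "(LINT z|lborel. indicator B (s *\<^sub>R y) * rho 1 z) = rho_mass * indicator B (s *\<^sub>R y)"
    by (simp add: rho_mass_def)
  ultimately have lim: "(\<lambda>n. LINT z|lborel. indicator B (s *\<^sub>R y + (- s / real (Suc n)) *\<^sub>R z) * rho 1 z) \<longlonglongrightarrow> rho_mass * indicator B (s *\<^sub>R y)"
    by (simp only:)
  have eq: "(LINT x|lborel. indicator B x * rho (real (Suc n)) (y - (1 / s) *\<^sub>R x))
      = s ^ 3 * (LINT z|lborel. indicator B (s *\<^sub>R y + (- s / real (Suc n)) *\<^sub>R z) * rho 1 z)" for n
    by (rule mollified_indicator) simp
  show ?thesis unfolding eq by (rule tendsto_mult_left[OF lim])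
qed

text \<open>Since \<psi> is only locally integrable, no pointwise limit is attempted. Averaging over
  B and exchanging the integrals moves the mollifier from \<psi> to the indicator of B, whose
  mollifications are bounded and converge off the dilated frontier, a null set.\<close>

lemma mollifier_tendsto:
  "(\<lambda>n. LINT p|(lborel \<Otimes>\<^sub>M lborel). (case p of (x, y) \<Rightarrow>
      indicator B x *\<^sub>R (cutoff (real (Suc n)) y * rho (real (Suc n)) (y - (1 / s) *\<^sub>R x)) *\<^sub>R \<psi> y))
    \<longlonglongrightarrow> rho_mass *\<^sub>R (LINT x|lborel. indicator B x *\<^sub>R \<psi> ((1 / s) *\<^sub>R x))"
proof -
  define mi where "mi n y = (LINT x|lborel. indicator B x * rho (real (Suc n)) (y - (1 / s) *\<^sub>R x))" for n y
  have [measurable]: "rho (real (Suc n)) \<in> borel_measurable borel" for n by (rule rho_measurable) simp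
  have [measurable]: "mi n \<in> borel_measurable borel" for n
    unfolding mi_def[abs_def] by measurable
  have swap: "(LINT p|(lborel \<Otimes>\<^sub>M lborel). (case p of (x, y) \<Rightarrow>
      indicator B x *\<^sub>R (cutoff (real (Suc n)) y * rho (real (Suc n)) (y - (1 / s) *\<^sub>R x)) *\<^sub>R \<psi> y))
      = (LINT y|lborel. (cutoff (real (Suc n)) y * mi n y) *\<^sub>R \<psi> y)" for n
  proof -
    have "(LINT p|(lborel \<Otimes>\<^sub>M lborel). (case p of (x, y) \<Rightarrow>
      indicator B x *\<^sub>R (cutoff (real (Suc n)) y * rho (real (Suc n)) (y - (1 / s) *\<^sub>R x)) *\<^sub>R \<psi> y))
      = (LINT y|lborel. LINT x|lborel. indicator B x *\<^sub>R (cutoff (real (Suc n)) y * rho (real (Suc n)) (y - (1 / s) *\<^sub>R x)) *\<^sub>R \<psi> y)"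
      by (rule lborel_pair.integral_snd[symmetric, OF integrable_mollified_on_set]) simp
    also have "\<dots> = (LINT y|lborel. (cutoff (real (Suc n)) y * mi n y) *\<^sub>R \<psi> y)"
    proof (rule Bochner_Integration.integral_cong[OF refl])
      fix y
      have "(LINT x|lborel. indicator B x *\<^sub>R (cutoff (real (Suc n)) y * rho (real (Suc n)) (y - (1 / s) *\<^sub>R x)) *\<^sub>R \<psi> y)
        = (LINT x|lborel. (indicator B x * rho (real (Suc n)) (y - (1 / s) *\<^sub>R x)) *\<^sub>R (cutoff (real (Suc n)) y *\<^sub>R \<psi> y))"
        by (simp add: mult_ac)
      also have "\<dots> = mi n y *\<^sub>R (cutoff (real (Suc n)) y *\<^sub>R \<psi> y)"
        unfolding mi_def
      proof (rule integral_scaleR_left)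
        obtain C where C: "0 < C" "\<And>\<nu> z. 0 < \<nu> \<Longrightarrow> rho \<nu> z \<le> \<nu> ^ 3 * C" by (rule rho_bounded) blast
        have "integrable lborel (\<lambda>x. indicator (annulus r R) x *\<^sub>R (real (Suc n) ^ 3 * C))"
          by (intro borel_integrable_compact compact_annulus continuous_intros)
        then show "integrable lborel (\<lambda>x. indicator B x * rho (real (Suc n)) (y - (1 / s) *\<^sub>R x))"
        proof (rule Bochner_Integration.integrable_bound)
          show "AE x in lborel. norm (indicator B x * rho (real (Suc n)) (y - (1 / s) *\<^sub>R x)) \<le> norm (indicator (annulus r R) x *\<^sub>R (real (Suc n) ^ 3 * C))"
          proof (intro AE_I2)
            fix x
            have "rho (real (Suc n)) (y - (1 / s) *\<^sub>R x) \<le> real (Suc n) ^ 3 * C" by (rule C(2)) simp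
            moreover have "0 \<le> rho (real (Suc n)) (y - (1 / s) *\<^sub>R x)" by (rule rho_nonneg) simp
            ultimately show "norm (indicator B x * rho (real (Suc n)) (y - (1 / s) *\<^sub>R x)) \<le> norm (indicator (annulus r R) x *\<^sub>R (real (Suc n) ^ 3 * C))"
              using B by (auto split: split_indicator simp del: of_nat_Suc)
          qed
        qed measurable
      qed
      finally show "(LINT x|lborel. indicator B x *\<^sub>R (cutoff (real (Suc n)) y * rho (real (Suc n)) (y - (1 / s) *\<^sub>R x)) *\<^sub>R \<psi> y)
         = (cutoff (real (Suc n)) y * mi n y) *\<^sub>R \<psi> y" by (simp add: mult.commute)
    qed
    finally show ?thesis .
  qed
  \<comment> \<open>Past this index the mollified indicators all vanish off the annulus
    \<open>?A\<close>, which gives an integrable majorant independent of n. Discarding finitely many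
    terms does not affect the limit.\<close>
  obtain N :: nat where N: "max (4 * s / r) 1 < real N" using reals_Archimedean2 by blast
  let ?A = "annulus (r / (2 * s)) (R / s + 2)"
  have "(\<lambda>n. LINT y|lborel. (cutoff (real (Suc (n + N))) y * mi (n + N) y) *\<^sub>R \<psi> y)
     \<longlonglongrightarrow> (LINT y|lborel. (1 * (s ^ 3 * (rho_mass * indicator B (s *\<^sub>R y)))) *\<^sub>R \<psi> y)"
  proof (rule integral_dominated_convergence[where w="\<lambda>y. s ^ 3 * rho_mass * norm (indicator ?A y *\<^sub>R \<psi> y)"])
    show "integrable lborel (\<lambda>y. s ^ 3 * rho_mass * norm (indicator ?A y *\<^sub>R \<psi> y))"
      using r s by (intro integrable_mult_right integrable_norm loc) auto
    have "AE x in lborel. x \<notin> frontier B"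
    proof -
      have "frontier B \<in> null_sets lebesgue" using front by (simp add: negligible_iff_null_sets)
      then have "frontier B \<in> null_sets lborel" by (subst (asm) null_sets_completion_iff) auto
      then show ?thesis by (rule AE_not_in)
    qed
    then have "AE y in lborel. s *\<^sub>R y \<notin> frontier B" by (rule AE_lborel_scale) (use s in simp)
    then show "AE y in lborel. (\<lambda>n. (cutoff (real (Suc (n + N))) y * mi (n + N) y) *\<^sub>R \<psi> y) \<longlonglongrightarrow> (1 * (s ^ 3 * (rho_mass * indicator B (s *\<^sub>R y)))) *\<^sub>R \<psi> y"
      using AE_lborel_singleton[of "0::real^3"]
    proof eventually_elim
      fix y assume y: "s *\<^sub>R y \<notin> frontier B" "y \<noteq> 0"
      have c: "(\<lambda>n. cutoff (real (Suc (n + N))) y) \<longlonglongrightarrow> 1"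
        using LIMSEQ_ignore_initial_segment[OF cutoff_tendsto[OF y(2)], of "Suc N"] by simp
      have m: "(\<lambda>n. mi (n + N) y) \<longlonglongrightarrow> s ^ 3 * (rho_mass * indicator B (s *\<^sub>R y))"
        unfolding mi_def by (rule LIMSEQ_ignore_initial_segment[OF mollified_indicator_tendsto[OF y(1)]])
      show "(\<lambda>n. (cutoff (real (Suc (n + N))) y * mi (n + N) y) *\<^sub>R \<psi> y) \<longlonglongrightarrow> (1 * (s ^ 3 * (rho_mass * indicator B (s *\<^sub>R y)))) *\<^sub>R \<psi> y"
        by (intro tendsto_scaleR tendsto_mult c m tendsto_const)
    qed
    fix n
    show "AE y in lborel. norm ((cutoff (real (Suc (n + N))) y * mi (n + N) y) *\<^sub>R \<psi> y) \<le> s ^ 3 * rho_mass * norm (indicator ?A y *\<^sub>R \<psi> y)"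
    proof (intro AE_I2)
      fix y
      show "norm ((cutoff (real (Suc (n + N))) y * mi (n + N) y) *\<^sub>R \<psi> y) \<le> s ^ 3 * rho_mass * norm (indicator ?A y *\<^sub>R \<psi> y)"
      proof (cases "y \<in> ?A")
        case True
        have "\<bar>cutoff (real (Suc (n + N))) y * mi (n + N) y\<bar> \<le> 1 * (s ^ 3 * rho_mass)"
          unfolding abs_mult mi_def using cutoff_bounds
          by (intro mult_mono mollified_indicator_le) auto
        then have "\<bar>cutoff (real (Suc (n + N))) y * mi (n + N) y\<bar> * norm (\<psi> y) \<le> s ^ 3 * rho_mass * norm (\<psi> y)"
          by (intro mult_right_mono) auto
        then show ?thesis using True by simp
      next
        case False
        have "mi (n + N) y = 0"
          unfolding mi_def by (rule mollified_indicator_eq_0[OF _ _ _ False]) (use N in auto)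
        then show ?thesis using False by simp
      qed
    qed
  qed measurable
  then have "(\<lambda>n. LINT y|lborel. (cutoff (real (Suc n)) y * mi n y) *\<^sub>R \<psi> y)
     \<longlonglongrightarrow> (LINT y|lborel. (1 * (s ^ 3 * (rho_mass * indicator B (s *\<^sub>R y)))) *\<^sub>R \<psi> y)"
    by (rule LIMSEQ_offset)
  moreover have "(LINT y|lborel. (1 * (s ^ 3 * (rho_mass * indicator B (s *\<^sub>R y)))) *\<^sub>R \<psi> y)
      = rho_mass *\<^sub>R (LINT x|lborel. indicator B x *\<^sub>R \<psi> ((1 / s) *\<^sub>R x))"
  proof -
    have "(LINT x|lborel. indicator B x *\<^sub>R \<psi> ((1 / s) *\<^sub>R x)) = \<bar>s\<bar> ^ 3 *\<^sub>R (LINT y|lborel. indicator B (0 + s *\<^sub>R y) *\<^sub>R \<psi> ((1 / s) *\<^sub>R (0 + s *\<^sub>R y)))"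
      using s by (intro lborel_integral_affine_euclidean) auto
    then have "rho_mass *\<^sub>R (LINT x|lborel. indicator B x *\<^sub>R \<psi> ((1 / s) *\<^sub>R x)) = (rho_mass * s ^ 3) *\<^sub>R (LINT y|lborel. indicator B (s *\<^sub>R y) *\<^sub>R \<psi> y)"
      using s by simp
    also have "\<dots> = (LINT y|lborel. (rho_mass * s ^ 3) *\<^sub>R indicator B (s *\<^sub>R y) *\<^sub>R \<psi> y)"
      by (rule integral_scaleR_right[symmetric])
    finally show ?thesis by (simp add: mult_ac)
  qed
  ultimately show ?thesis unfolding swap by simp
qed

end

lemma pot_scale:
  assumes [measurable]: "g \<in> borel_measurable borel" and "\<And>y. 0 \<le> g y" "0 \<le> s"
  shows "pot m (\<lambda>y. s * g y) x = ennreal s * pot m g x"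
proof -
  have "pot m (\<lambda>y. s * g y) x = (\<integral>\<^sup>+y. ennreal s * ennreal (W m x y * g y) \<partial>lborel)"
    unfolding pot_def using assms(2,3) W_nonneg by (intro nn_integral_cong) (simp flip: ennreal_mult add: mult_ac)
  then show ?thesis by (simp add: nn_integral_cmult pot_def)
qed

lemma pot_Schur_finite:
  assumes [measurable]: "g \<in> borel_measurable borel" and g: "\<And>y. 0 \<le> g y"
    and fin: "nn_lborel (\<lambda>y. ennreal ((g y)\<^sup>2)) < \<infinity>"
  shows "nn_lborel (\<lambda>x. ennreal (norm x powr - 2) * (pot m g x)\<^sup>2) < \<infinity>"
proof -
  obtain C where C: "0 < C"
    "\<And>g. \<lbrakk>g \<in> borel_measurable borel; \<And>y. 0 \<le> g y; nn_lborel (\<lambda>y. ennreal ((g y)\<^sup>2)) \<le> 1\<rbrakk> \<Longrightarrow>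
       nn_lborel (\<lambda>x. ennreal (norm x powr - 2) * (pot m g x)\<^sup>2) \<le> ennreal C"
    using pot_Schur by blast
  obtain T where T: "nn_lborel (\<lambda>y. ennreal ((g y)\<^sup>2)) = ennreal T" "0 \<le> T"
    using fin by (cases "nn_lborel (\<lambda>y. ennreal ((g y)\<^sup>2))") auto
  \<comment> \<open>Normalizes the density to norm at most 1; the summand 1 keeps the division
    meaningful for T = 0.\<close>
  define s where "s = 1 / sqrt (T + 1)"
  have s: "0 < s" "s\<^sup>2 * T \<le> 1" using T by (auto simp: s_def power_divide)
  let ?h = "\<lambda>y. s * g y"
  have "nn_lborel (\<lambda>y. ennreal ((?h y)\<^sup>2)) = nn_lborel (\<lambda>y. ennreal (s\<^sup>2) * ennreal ((g y)\<^sup>2))"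
    by (simp add: power_mult_distrib ennreal_mult)
  also have "\<dots> = ennreal (s\<^sup>2 * T)"
    using T by (simp add: nn_integral_cmult ennreal_mult)
  also have "\<dots> \<le> 1" using s by (simp add: ennreal_le_1)
  finally have "nn_lborel (\<lambda>x. ennreal (norm x powr - 2) * (pot m ?h x)\<^sup>2) \<le> ennreal C"
    using s g by (intro C(2)) auto
  moreover have "pot m ?h x = ennreal s * pot m g x" for x
    using s g by (intro pot_scale) auto
  then have "nn_lborel (\<lambda>x. ennreal (norm x powr - 2) * (pot m ?h x)\<^sup>2) = nn_lborel (\<lambda>x. ennreal (s\<^sup>2) * (ennreal (norm x powr - 2) * (pot m g x)\<^sup>2))"
    using s by (intro nn_integral_cong) (simp add: power_mult_distrib ennreal_power mult_ac)
  also have "\<dots> = ennreal (s\<^sup>2) * nn_lborel (\<lambda>x. ennreal (norm x powr - 2) * (pot m g x)\<^sup>2)"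
    by (rule nn_integral_cmult) simp
  ultimately have "ennreal (s\<^sup>2) * nn_lborel (\<lambda>x. ennreal (norm x powr - 2) * (pot m g x)\<^sup>2) < \<infinity>"
    by (simp add: le_less_trans less_top)
  then show ?thesis using s by (auto simp: ennreal_mult_less_top)
qed

lemma powr_annulus_le: "x \<in> annulus r R \<Longrightarrow> 0 < r \<Longrightarrow> norm x powr e \<le> r powr e + R powr e"
proof -
  assume x: "x \<in> annulus r R" and r: "0 < r"
  show ?thesis
  proof (cases "0 \<le> e")
    case True
    then have "norm x powr e \<le> R powr e" using x by (intro powr_mono2) (auto simp: annulus_def)
    then show ?thesis by (simp add: add_increasing)
  next
    case False
    then have "norm x powr e \<le> r powr e" using x r by (intro powr_mono2') (auto simp: annulus_def)
    then show ?thesis by (simp add: add_increasing2)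
  qed
qed

text \<open>After division by b this is r \<le> 1 + r^p. It splits a function with finite weighted
  norm of exponent p into an explicit power and an integrable term.\<close>

lemma le_add_powr_mult:
  fixes a b p :: real
  assumes "0 \<le> a" "0 < b" "1 \<le> p"
  shows "a \<le> b + a powr p * b powr (1 - p)"
proof (cases "a \<le> b")
  case False
  then have "(a / b) powr 1 \<le> (a / b) powr p" using assms by (intro powr_mono) auto
  then have "a / b \<le> a powr p * b powr - p"
    using assms False by (simp add: powr_divide powr_minus_divide)
  then have "a \<le> a powr p * b powr - p * b" using assms by (simp add: field_simps)
  also have "a powr p * b powr - p * b = a powr p * b powr (1 - p)"
    using assms by (simp add: powr_diff powr_minus_divide)
  finally show ?thesis using assms by simp
qed (use assms in \<open>simp add: add_increasing2\<close>)

lemma sg_measurable [measurable (raw)]: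
  assumes "a \<in> borel_measurable N" "v \<in> borel_measurable N"
  shows "(\<lambda>x. sg (a x) (v x)) \<in> borel_measurable N"
  by (rule borel_measurable_continuous_Pair[OF assms]) (intro sg.continuous_on continuous_intros)

lemma G_measurable [measurable]: "G \<in> borel_measurable borel"
  unfolding G_def[abs_def] by measurable

lemma step_measurable [measurable]: "step \<in> borel_measurable borel" "step' \<in> borel_measurable borel"
  by (intro borel_measurable_continuous_onI step_continuous step'_continuous)+

lemma moll_measurable [measurable]: "moll \<nu> \<in> borel_measurable borel"
  unfolding moll_def[abs_def] qk_def by measurable

lemma grad_cutoff_measurable [measurable]: "grad_cutoff \<nu> \<in> borel_measurable borel"
  unfolding grad_cutoff_def[abs_def] by measurable

lemma moll_tendsto: "(\<lambda>n. moll (real n) z) \<longlonglongrightarrow> G z"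
proof (cases "z = 0")
  case False
  obtain N :: nat where N: "max 1 (2 / norm z) < real N" using reals_Archimedean2 by blast
  have "\<forall>\<^sub>F n in sequentially. moll (real n) z = G z"
  proof (rule eventually_sequentiallyI[of N])
    fix n assume "N \<le> n"
    then have n: "max 1 (2 / norm z) < real n" using N by linarith
    then have "2 \<le> real n * norm z" using False by (simp add: field_simps)
    then have "2\<^sup>2 \<le> (real n * norm z)\<^sup>2" by (intro power_mono) auto
    then show "moll (real n) z = G z" using n by (intro moll_eq_G) (auto simp: power_mult_distrib)
  qed
  then show ?thesis by (rule tendsto_eventually)
qed simp

section \<open>The representation formula for the dilated combination\<close>

context
  fixes \<psi> f :: "real^3 \<Rightarrow> complex^2" and \<alpha> \<beta> p :: real and M m :: nat and c :: "nat \<Rightarrow> real"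
  assumes meas [measurable]: "\<psi> \<in> borel_measurable borel" "f \<in> borel_measurable borel" and f0: "f 0 = 0"
    and M: "\<bar>\<alpha>\<bar> + 1 \<le> real M" and m: "m = 2 * M" and c: "c = coeff (dil_poly M)"
    and loc: "\<And>a b. 0 < a \<Longrightarrow> integrable lborel (\<lambda>y. indicator (annulus a b) y *\<^sub>R \<psi> y)"
    and f2: "nn_lborel (\<lambda>y. ennreal ((norm y powr - \<alpha> * norm (f y))\<^sup>2)) < \<infinity>"
    and \<psi>p: "nn_lborel (\<lambda>y. ennreal ((norm y powr - \<beta> * norm (\<psi> y)) powr p)) < \<infinity>"
    and p: "1 \<le> p" "3 / p = 1 / 2 - \<alpha> + \<beta>"
    and ident_int: "\<And>\<nu> a. 0 < \<nu> \<Longrightarrow> integrable lborel (\<lambda>y. (cutoff \<nu> y * rho \<nu> (y - a)) *\<^sub>R \<psi> y)"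
      "\<And>\<nu> a. 0 < \<nu> \<Longrightarrow> integrable lborel (\<lambda>y. sg (cutoff \<nu> y *\<^sub>R moll \<nu> (y - a)) (f y))"
      "\<And>\<nu> a. 0 < \<nu> \<Longrightarrow> integrable lborel (\<lambda>y. sg (moll \<nu> (y - a)) (sg (grad_cutoff \<nu> y) (\<psi> y)))"
    and ident: "\<And>\<nu> a. 0 < \<nu> \<Longrightarrow> (LINT y|lborel. (cutoff \<nu> y * rho \<nu> (y - a)) *\<^sub>R \<psi> y) =
      - (LINT y|lborel. sg (cutoff \<nu> y *\<^sub>R moll \<nu> (y - a)) (f y))
      - (LINT y|lborel. sg (moll \<nu> (y - a)) (sg (grad_cutoff \<nu> y) (\<psi> y)))"
begin

text \<open>The majorant for the dominated convergence that removes cutoff and mollifier. The term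
  with f is finite by the Schur bound. The boundary term |\<psi>| / |y| is dominated by the Schur
  weight |y|^(-3/2) plus |y|^(3/2) times the integrable p-th power; the first part is handled by
  integrating \<open>W\<close> in y, the second by integrating it in x.\<close>

lemma kernel_majorant_integrable:
  assumes [measurable]: "B \<in> sets borel" and B: "B \<subseteq> annulus r R" and r: "0 < r"
  shows "integrable (lborel \<Otimes>\<^sub>M lborel) (\<lambda>(x, y). indicator B x *
    (norm x powr \<alpha> * norm y powr - \<alpha> * W m x y * (norm (f y) + norm (\<psi> y) / norm y)))"
proof (rule integrableI_bounded)
  let ?D = "\<lambda>(x, y). indicator B x * (norm x powr \<alpha> * norm y powr - \<alpha> * W m x y * (norm (f y) + norm (\<psi> y) / norm y)) :: real"
  define fw where "fw y = norm y powr - \<alpha> * norm (f y)" for y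
  define uw where "uw y = (norm y powr - \<beta> * norm (\<psi> y)) powr p" for y
  have [measurable]: "fw \<in> borel_measurable borel" "uw \<in> borel_measurable borel"
    unfolding fw_def[abs_def] uw_def[abs_def] by measurable
  obtain C1 where C1: "0 < C1" "\<And>x. x \<noteq> 0 \<Longrightarrow>
    (\<integral>\<^sup>+y. ennreal (W m x y * norm y powr - (3/2)) \<partial>lborel) \<le> ennreal (C1 * norm x powr - (1/2))"
    using W_integral_right by blast
  obtain C2 where C2: "0 < C2" "\<And>y. y \<noteq> 0 \<Longrightarrow>
    (\<integral>\<^sup>+x. ennreal (W m x y * norm x powr - (5/2)) \<partial>lborel) \<le> ennreal (C2 * norm y powr - (3/2))"
    using W_integral_left by blast
  define b where "b e = r powr e + R powr e" for e
  have b0: "0 \<le> b e" for e by (simp add: b_def)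
  have b: "norm x powr e \<le> b e" if "x \<in> B" for x e
    using that B r unfolding b_def by (intro powr_annulus_le) auto
  have x0: "x \<noteq> 0" if "x \<in> B" for x using that B r by (auto simp: annulus_def)
  have Bfin: "emeasure lborel B < \<infinity>"
  proof -
    have "emeasure lborel B \<le> emeasure lborel (annulus r R)" using B by (intro emeasure_mono) auto
    also have "\<dots> < \<infinity>" using emeasure_compact_finite[OF compact_annulus] .
    finally show ?thesis .
  qed
  have young: "norm y powr - \<alpha> * (norm (\<psi> y) / norm y) \<le> norm y powr - (3/2) + norm y powr (3/2) * uw y" for y
  proof (cases "y = 0")
    case False
    define N where "N = norm y"
    have N: "0 < N" using False by (simp add: N_def)
    define a where "a = N powr - \<beta> * norm (\<psi> y)"
    have p0: "0 < p" using p by simp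
    \<comment> \<open>|y|^(-3/p) is the power on the borderline of integrability at exponent p.
      Multiplication by |y|^(\<beta> - \<alpha> - 1) turns the two exponents into -3/2 and 3/2 by
      the relation between p, \<alpha> and \<beta>.\<close>
    have "a \<le> N powr - (3/p) + a powr p * (N powr - (3/p)) powr (1 - p)"
      using N p by (intro le_add_powr_mult) (auto simp: a_def)
    also have "(N powr - (3/p)) powr (1 - p) = N powr (3 - 3/p)"
    proof -
      have "- (3/p) * (1 - p) = 3 - 3/p" using p0 by (simp add: field_simps)
      then show ?thesis unfolding powr_powr by simp
    qed
    finally have "N powr (\<beta> - \<alpha> - 1) * a \<le> N powr (\<beta> - \<alpha> - 1) * (N powr - (3/p) + a powr p * N powr (3 - 3/p))"
      by (rule mult_left_mono) simp
    also have "\<dots> = N powr (\<beta> - \<alpha> - 1) * N powr - (3/p) + (N powr (\<beta> - \<alpha> - 1) * N powr (3 - 3/p)) * a powr p"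
      by (simp add: algebra_simps)
    also have "N powr (\<beta> - \<alpha> - 1) * N powr - (3/p) = N powr - (3/2)"
      unfolding powr_add[symmetric] p(2) by simp
    also have "N powr (\<beta> - \<alpha> - 1) * N powr (3 - 3/p) = N powr (3/2)"
      unfolding powr_add[symmetric] p(2) by simp
    also have "N powr (\<beta> - \<alpha> - 1) * a = N powr - \<alpha> * (norm (\<psi> y) / N)"
    proof -
      have "N powr (\<beta> - \<alpha> - 1) * N powr - \<beta> = N powr - \<alpha> * N powr - 1"
        unfolding powr_add[symmetric] by simp
      also have "\<dots> = N powr - \<alpha> / N" using N by (simp add: powr_minus_divide)
      finally show ?thesis by (simp add: a_def mult.assoc[symmetric])
    qed
    finally show ?thesis by (simp add: N_def a_def uw_def)
  qed (simp add: uw_def)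
  have point: "ennreal (norm (?D (x, y))) \<le> indicator B x * ennreal (b \<alpha>) * ennreal (W m x y * fw y)
      + indicator B x * ennreal (b \<alpha>) * ennreal (W m x y * norm y powr - (3/2))
      + ennreal (b (\<alpha> + 5/2)) * (ennreal (norm y powr (3/2) * uw y) * ennreal (W m x y * norm x powr - (5/2)))" for x y
  proof (cases "x \<in> B")
    case True
    have "norm x powr \<alpha> = norm x powr (\<alpha> + 5/2) * norm x powr - (5/2)"
      unfolding powr_add[symmetric] by simp
    also have "\<dots> \<le> b (\<alpha> + 5/2) * norm x powr - (5/2)"
      by (intro mult_right_mono b[OF True]) simp
    finally have x5: "norm x powr \<alpha> \<le> b (\<alpha> + 5/2) * norm x powr - (5/2)" .
    have "?D (x, y) = norm x powr \<alpha> * (W m x y * fw y) + norm x powr \<alpha> * (W m x y * (norm y powr - \<alpha> * (norm (\<psi> y) / norm y)))"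
      using True by (simp add: fw_def algebra_simps)
    also have "\<dots> \<le> norm x powr \<alpha> * (W m x y * fw y) + norm x powr \<alpha> * (W m x y * (norm y powr - (3/2) + norm y powr (3/2) * uw y))"
      by (intro add_left_mono mult_left_mono young W_nonneg) simp
    also have "\<dots> = norm x powr \<alpha> * (W m x y * fw y) + norm x powr \<alpha> * (W m x y * norm y powr - (3/2)) + norm x powr \<alpha> * (W m x y * (norm y powr (3/2) * uw y))"
      by (simp add: algebra_simps)
    also have "\<dots> \<le> b \<alpha> * (W m x y * fw y) + b \<alpha> * (W m x y * norm y powr - (3/2)) + b (\<alpha> + 5/2) * norm x powr - (5/2) * (W m x y * (norm y powr (3/2) * uw y))"
      by (intro add_mono mult_right_mono b[OF True] x5 mult_nonneg_nonneg W_nonneg) (auto simp: fw_def uw_def)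
    also have "\<dots> = b \<alpha> * (W m x y * fw y) + b \<alpha> * (W m x y * norm y powr - (3/2)) + b (\<alpha> + 5/2) * ((norm y powr (3/2) * uw y) * (W m x y * norm x powr - (5/2)))"
      by (simp add: mult_ac)
    finally have le: "?D (x, y) \<le> \<dots>" .
    have D0: "0 \<le> ?D (x, y)" using W_nonneg by (simp add: mult_nonneg_nonneg)
    have nn: "0 \<le> W m x y * fw y" "0 \<le> W m x y * norm y powr - (3/2)" "0 \<le> norm y powr (3/2) * uw y" "0 \<le> W m x y * norm x powr - (5/2)"
      using W_nonneg by (auto simp: fw_def uw_def)
    have "ennreal (norm (?D (x, y))) \<le> ennreal (b \<alpha> * (W m x y * fw y) + b \<alpha> * (W m x y * norm y powr - (3/2)) + b (\<alpha> + 5/2) * ((norm y powr (3/2) * uw y) * (W m x y * norm x powr - (5/2))))"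
      using le D0 by (intro ennreal_leI) simp
    also have "\<dots> = ennreal (b \<alpha>) * ennreal (W m x y * fw y) + ennreal (b \<alpha>) * ennreal (W m x y * norm y powr - (3/2))
      + ennreal (b (\<alpha> + 5/2)) * (ennreal (norm y powr (3/2) * uw y) * ennreal (W m x y * norm x powr - (5/2)))"
      by (simp only: ennreal_plus ennreal_mult nn b0 mult_nonneg_nonneg add_nonneg_nonneg)
    finally show ?thesis using True by simp
  qed simp
  have "(\<integral>\<^sup>+q. ennreal (norm (?D q)) \<partial>(lborel \<Otimes>\<^sub>M lborel)) = (\<integral>\<^sup>+x. \<integral>\<^sup>+y. ennreal (norm (?D (x, y))) \<partial>lborel \<partial>lborel)"
  proof -
    have "(\<lambda>q. ennreal (norm (?D q))) \<in> borel_measurable (lborel \<Otimes>\<^sub>M lborel)" by measurable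
    then show ?thesis by (rule lborel.nn_integral_fst[symmetric])
  qed
  also have "\<dots> \<le> (\<integral>\<^sup>+x. \<integral>\<^sup>+y. indicator B x * ennreal (b \<alpha>) * ennreal (W m x y * fw y)
      + indicator B x * ennreal (b \<alpha>) * ennreal (W m x y * norm y powr - (3/2))
      + ennreal (b (\<alpha> + 5/2)) * (ennreal (norm y powr (3/2) * uw y) * ennreal (W m x y * norm x powr - (5/2))) \<partial>lborel \<partial>lborel)"
    by (intro nn_integral_mono point)
  also have "\<dots> = (\<integral>\<^sup>+x. indicator B x * ennreal (b \<alpha>) * pot m fw x \<partial>lborel)
      + (\<integral>\<^sup>+x. indicator B x * ennreal (b \<alpha>) * (\<integral>\<^sup>+y. ennreal (W m x y * norm y powr - (3/2)) \<partial>lborel) \<partial>lborel)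
      + (\<integral>\<^sup>+x. \<integral>\<^sup>+y. ennreal (b (\<alpha> + 5/2)) * (ennreal (norm y powr (3/2) * uw y) * ennreal (W m x y * norm x powr - (5/2))) \<partial>lborel \<partial>lborel)"
    (is "_ = ?I1 + ?I2 + ?I3")
    unfolding pot_def by (simp add: nn_integral_add nn_integral_cmult)
  also have "\<dots> < \<infinity>"
  proof -
    have I1: "?I1 < \<infinity>"
    proof -
      have "?I1 \<le> (\<integral>\<^sup>+x. ennreal (b \<alpha>) * (indicator B x + ennreal (R\<^sup>2) * (ennreal (norm x powr - 2) * (pot m fw x)\<^sup>2)) \<partial>lborel)"
      proof (intro nn_integral_mono)
        fix x
        show "indicator B x * ennreal (b \<alpha>) * pot m fw x \<le> ennreal (b \<alpha>) * (indicator B x + ennreal (R\<^sup>2) * (ennreal (norm x powr - 2) * (pot m fw x)\<^sup>2))"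
        proof (cases "x \<in> B")
          case True
          \<comment> \<open>Only the squared potential is known to be integrable; since B has finite
            measure, v \<le> 1 + v^2 suffices.\<close>
          have sq: "v \<le> 1 + v\<^sup>2" for v :: ennreal
          proof (cases "v \<le> 1")
            case False
            then have "v * 1 \<le> v * v" by (intro mult_left_mono) auto
            then show ?thesis by (simp add: power2_eq_square add_increasing)
          qed (simp add: add_increasing2)
          have "1 \<le> R\<^sup>2 * norm x powr - 2"
          proof -
            have "(norm x)\<^sup>2 \<le> R\<^sup>2" using True B by (intro power_mono) (auto simp: annulus_def)
            then show ?thesis using x0[OF True] by (simp add: powr_minus_divide field_simps)
          qed
          then have "ennreal 1 \<le> ennreal (R\<^sup>2 * norm x powr - 2)" by (rule ennreal_leI)
          then have "1 \<le> ennreal (R\<^sup>2) * ennreal (norm x powr - 2)" by (simp add: ennreal_mult)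
          then have "1 * (pot m fw x)\<^sup>2 \<le> ennreal (R\<^sup>2) * ennreal (norm x powr - 2) * (pot m fw x)\<^sup>2"
            by (rule mult_right_mono) simp
          then have "pot m fw x \<le> 1 + ennreal (R\<^sup>2) * (ennreal (norm x powr - 2) * (pot m fw x)\<^sup>2)"
            using sq[of "pot m fw x"] by (simp add: mult.assoc add_left_mono order_trans)
          then show ?thesis using True by (simp add: mult_left_mono)
        qed simp
      qed
      also have "\<dots> = ennreal (b \<alpha>) * (emeasure lborel B + ennreal (R\<^sup>2) * nn_lborel (\<lambda>x. ennreal (norm x powr - 2) * (pot m fw x)\<^sup>2))"
        by (simp add: nn_integral_cmult nn_integral_add)
      also have "\<dots> < \<infinity>"
        using Bfin pot_Schur_finite[of fw m] f2 by (simp add: fw_def ennreal_mult_less_top)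
      finally show ?thesis .
    qed
    have I2: "?I2 < \<infinity>"
    proof -
      have "?I2 \<le> (\<integral>\<^sup>+x. ennreal (b \<alpha> * (C1 * b (- (1/2)))) * indicator B x \<partial>lborel)"
      proof (intro nn_integral_mono)
        fix x
        show "indicator B x * ennreal (b \<alpha>) * (\<integral>\<^sup>+y. ennreal (W m x y * norm y powr - (3/2)) \<partial>lborel) \<le> ennreal (b \<alpha> * (C1 * b (- (1/2)))) * indicator B x"
        proof (cases "x \<in> B")
          case True
          have "(\<integral>\<^sup>+y. ennreal (W m x y * norm y powr - (3/2)) \<partial>lborel) \<le> ennreal (C1 * norm x powr - (1/2))"
            by (rule C1(2)[OF x0[OF True]])
          also have "\<dots> \<le> ennreal (C1 * b (- (1/2)))"
            using C1 by (intro ennreal_leI mult_left_mono b[OF True]) auto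
          finally have "ennreal (b \<alpha>) * (\<integral>\<^sup>+y. ennreal (W m x y * norm y powr - (3/2)) \<partial>lborel) \<le> ennreal (b \<alpha>) * ennreal (C1 * b (- (1/2)))"
            by (rule mult_left_mono) simp
          then show ?thesis using True b0 C1 by (simp add: ennreal_mult)
        qed simp
      qed
      also have "\<dots> = ennreal (b \<alpha> * (C1 * b (- (1/2)))) * emeasure lborel B"
        by (rule nn_integral_cmult_indicator) simp
      also have "\<dots> < \<infinity>" using Bfin by (simp add: ennreal_mult_less_top)
      finally show ?thesis .
    qed
    have I3: "?I3 < \<infinity>"
    proof -
      have "?I3 = (\<integral>\<^sup>+y. \<integral>\<^sup>+x. ennreal (b (\<alpha> + 5/2)) * (ennreal (norm y powr (3/2) * uw y) * ennreal (W m x y * norm x powr - (5/2))) \<partial>lborel \<partial>lborel)"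
      proof -
        have "(\<lambda>(x, y). ennreal (b (\<alpha> + 5/2)) * (ennreal (norm y powr (3/2) * uw y) * ennreal (W m x y * norm x powr - (5/2)))) \<in> borel_measurable (lborel \<Otimes>\<^sub>M lborel)"
          by measurable
        from lborel_pair.Fubini'[OF this] show ?thesis by simp
      qed
      also have "\<dots> = (\<integral>\<^sup>+y. ennreal (b (\<alpha> + 5/2)) * (ennreal (norm y powr (3/2) * uw y) * (\<integral>\<^sup>+x. ennreal (W m x y * norm x powr - (5/2)) \<partial>lborel)) \<partial>lborel)"
        by (simp add: nn_integral_cmult)
      also have "\<dots> \<le> (\<integral>\<^sup>+y. ennreal (b (\<alpha> + 5/2) * C2) * ennreal (uw y) \<partial>lborel)"
      proof (rule nn_integral_mono_AE, use AE_lborel_singleton[of "0::real^3"] in eventually_elim)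
        fix y :: "real^3" assume y: "y \<noteq> 0"
        have "ennreal (norm y powr (3/2) * uw y) * (\<integral>\<^sup>+x. ennreal (W m x y * norm x powr - (5/2)) \<partial>lborel)
            \<le> ennreal (norm y powr (3/2) * uw y) * ennreal (C2 * norm y powr - (3/2))"
          by (intro mult_left_mono C2(2) y) simp
        also have "\<dots> = ennreal (norm y powr (3/2) * uw y * (C2 * norm y powr - (3/2)))"
          using C2 by (intro ennreal_mult[symmetric]) (auto simp: uw_def)
        also have "norm y powr (3/2) * uw y * (C2 * norm y powr - (3/2)) = C2 * uw y"
          using y by (simp add: powr_minus_divide)
        finally have "ennreal (b (\<alpha> + 5/2)) * (ennreal (norm y powr (3/2) * uw y) * (\<integral>\<^sup>+x. ennreal (W m x y * norm x powr - (5/2)) \<partial>lborel))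
           \<le> ennreal (b (\<alpha> + 5/2)) * ennreal (C2 * uw y)" by (rule mult_left_mono) simp
        also have "\<dots> = ennreal (b (\<alpha> + 5/2) * C2) * ennreal (uw y)"
          using b0 C2 by (subst (1 2) ennreal_mult[symmetric]) (auto simp: uw_def mult.assoc)
        finally show "ennreal (b (\<alpha> + 5/2)) * (ennreal (norm y powr (3/2) * uw y) * (\<integral>\<^sup>+x. ennreal (W m x y * norm x powr - (5/2)) \<partial>lborel)) \<le> \<dots>" .
      qed
      also have "\<dots> = ennreal (b (\<alpha> + 5/2) * C2) * nn_lborel (\<lambda>y. ennreal (uw y))"
        by (rule nn_integral_cmult) simp
      also have "\<dots> < \<infinity>" using \<psi>p by (simp add: uw_def ennreal_mult_less_top)
      finally show ?thesis .
    qed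
    show ?thesis using I1 I2 I3 by simp
  qed
  finally show "(\<integral>\<^sup>+q. ennreal (norm (?D q)) \<partial>(lborel \<Otimes>\<^sub>M lborel)) < \<infinity>" .
qed measurable

definition Psi :: "real^3 \<Rightarrow> complex^2" where
  "Psi x = (\<Sum>k\<le>m. c k *\<^sub>R \<psi> ((1 / 2 ^ k) *\<^sub>R x))"

definition Kn :: "real \<Rightarrow> real^3 \<Rightarrow> real^3 \<Rightarrow> real^3" where
  "Kn \<nu> x y = (\<Sum>k\<le>m. c k *\<^sub>R moll \<nu> (y - (1 / 2 ^ k) *\<^sub>R x))"

definition KG :: "real^3 \<Rightarrow> real^3 \<Rightarrow> real^3" where
  "KG x y = (\<Sum>k\<le>m. c k *\<^sub>R G (y - (1 / 2 ^ k) *\<^sub>R x))"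

text \<open>The two terms on the right of the mollified identity, already summed over the dilates.
  The sum is formed before any limit because only the combined kernel has the decay needed for a
  majorant.\<close>

definition Th :: "real \<Rightarrow> real^3 \<Rightarrow> real^3 \<Rightarrow> complex^2" where
  "Th \<nu> x y = sg (cutoff \<nu> y *\<^sub>R Kn \<nu> x y) (f y) + sg (Kn \<nu> x y) (sg (grad_cutoff \<nu> y) (\<psi> y))"

lemma Kn_measurable [measurable]: "(\<lambda>(x, y). Kn \<nu> x y) \<in> borel_measurable (borel \<Otimes>\<^sub>M borel)"
  unfolding Kn_def by measurable

lemma KG_measurable [measurable]: "(\<lambda>(x, y). KG x y) \<in> borel_measurable (borel \<Otimes>\<^sub>M borel)"
  unfolding KG_def by measurable

lemma Th_measurable [measurable]: "(\<lambda>(x, y). Th \<nu> x y) \<in> borel_measurable (borel \<Otimes>\<^sub>M borel)"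
  unfolding Th_def by measurable

lemma Psi_measurable [measurable]: "Psi \<in> borel_measurable borel"
  unfolding Psi_def[abs_def] by measurable

lemma integral_Th:
  assumes \<nu>: "0 < \<nu>"
  shows "(LINT y|lborel. Th \<nu> x y) = - (\<Sum>k\<le>m. c k *\<^sub>R (LINT y|lborel. (cutoff \<nu> y * rho \<nu> (y - (1 / 2 ^ k) *\<^sub>R x)) *\<^sub>R \<psi> y))"
proof -
  let ?a = "\<lambda>k. (1 / 2 ^ k) *\<^sub>R x"
  let ?A = "\<lambda>k y. sg (cutoff \<nu> y *\<^sub>R moll \<nu> (y - ?a k)) (f y)"
  let ?B = "\<lambda>k y. sg (moll \<nu> (y - ?a k)) (sg (grad_cutoff \<nu> y) (\<psi> y))"
  have Th: "Th \<nu> x y = (\<Sum>k\<le>m. c k *\<^sub>R (?A k y + ?B k y))" for y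
    unfolding Th_def Kn_def by (simp add: scaleR_sum_right sg.sum_left sg.scaleR_left scaleR_add_right sum.distrib mult.commute)
  have iA: "integrable lborel (?A k)" and iB: "integrable lborel (?B k)" for k
    using ident_int(2,3)[OF \<nu>, of "?a k"] by auto
  have iAB: "integrable lborel (\<lambda>y. ?A k y + ?B k y)" for k by (intro Bochner_Integration.integrable_add iA iB)
  have "(LINT y|lborel. Th \<nu> x y) = (\<Sum>k\<le>m. c k *\<^sub>R (LINT y|lborel. ?A k y + ?B k y))"
    unfolding Th by (subst Bochner_Integration.integral_sum) (intro integrable_scaleR_right iAB, simp only: integral_scaleR_right)
  also have "\<dots> = (\<Sum>k\<le>m. c k *\<^sub>R - (LINT y|lborel. (cutoff \<nu> y * rho \<nu> (y - ?a k)) *\<^sub>R \<psi> y))"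
  proof (intro sum.cong refl arg_cong2[where f=scaleR])
    fix k
    have grp: "u = - v - w \<Longrightarrow> v + w = - u" for u v w :: "complex^2" by simp
    show "(LINT y|lborel. ?A k y + ?B k y) = - (LINT y|lborel. (cutoff \<nu> y * rho \<nu> (y - ?a k)) *\<^sub>R \<psi> y)"
      unfolding Bochner_Integration.integral_add[OF iA iB] by (rule grp[OF ident[OF \<nu>]])
  qed
  finally show ?thesis by (simp add: sum_negf)
qed

context
  fixes B :: "(real^3) set" and r R :: real
  assumes B_meas [measurable]: "B \<in> sets borel" and B: "B \<subseteq> annulus r R" and r: "0 < r" and front: "negligible (frontier B)"
begin

text \<open>The mollified identity at the centres x / 2^k expresses the integral of
  \<open>Th\<close> through the mollified dilates, whose averages over B converge. The shift by
  \<open>N\<close> matches the range of indices in which the kernel bound is valid.\<close>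

lemma integral_Th_tendsto:
  assumes int: "\<And>n. integrable (lborel \<Otimes>\<^sub>M lborel) (\<lambda>(x, y). indicator B x *\<^sub>R Th (real (Suc (n + N))) x y)"
  shows "(\<lambda>n. LINT q|(lborel \<Otimes>\<^sub>M lborel). (case q of (x, y) \<Rightarrow> indicator B x *\<^sub>R Th (real (Suc (n + N))) x y))
    \<longlonglongrightarrow> - (rho_mass *\<^sub>R (LINT x|lborel. indicator B x *\<^sub>R Psi x))"
proof -
  define X where "X k n = (\<lambda>(x, y). indicator B x *\<^sub>R (cutoff (real (Suc n)) y * rho (real (Suc n)) (y - (1 / 2 ^ k) *\<^sub>R x)) *\<^sub>R \<psi> y)" for k n :: nat
  have iX: "integrable (lborel \<Otimes>\<^sub>M lborel) (X k n)" for k n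
    unfolding X_def by (rule integrable_mollified_on_set[OF meas(1) loc B_meas B r front]) auto
  have lim: "(\<lambda>n. LINT q|(lborel \<Otimes>\<^sub>M lborel). X k n q) \<longlonglongrightarrow> rho_mass *\<^sub>R (LINT x|lborel. indicator B x *\<^sub>R \<psi> ((1 / 2 ^ k) *\<^sub>R x))" for k
    unfolding X_def by (rule mollifier_tendsto[OF meas(1) loc B_meas B r front]) auto
  have eq: "(LINT q|(lborel \<Otimes>\<^sub>M lborel). (case q of (x, y) \<Rightarrow> indicator B x *\<^sub>R Th (real (Suc (n + N))) x y))
      = - (\<Sum>k\<le>m. c k *\<^sub>R (LINT q|(lborel \<Otimes>\<^sub>M lborel). X k (n + N) q))" for n
  proof -
    let ?\<nu> = "real (Suc (n + N))"
    have "(LINT q|(lborel \<Otimes>\<^sub>M lborel). (case q of (x, y) \<Rightarrow> indicator B x *\<^sub>R Th ?\<nu> x y))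
        = (LINT x|lborel. LINT y|lborel. indicator B x *\<^sub>R Th ?\<nu> x y)"
      using lborel_pair.integral_fst'[OF int[of n]] by simp
    also have "\<dots> = (LINT x|lborel. - (\<Sum>k\<le>m. c k *\<^sub>R (LINT y|lborel. X k (n + N) (x, y))))"
    proof (intro Bochner_Integration.integral_cong refl)
      fix x
      have e: "(LINT y|lborel. X k (n + N) (x, y)) = indicator B x *\<^sub>R (LINT y|lborel. (cutoff ?\<nu> y * rho ?\<nu> (y - (1 / 2 ^ k) *\<^sub>R x)) *\<^sub>R \<psi> y)" for k
        unfolding X_def case_prod_conv by (rule integral_scaleR_right)
      have \<nu>: "0 < ?\<nu>" by simp
      show "(LINT y|lborel. indicator B x *\<^sub>R Th ?\<nu> x y) = - (\<Sum>k\<le>m. c k *\<^sub>R (LINT y|lborel. X k (n + N) (x, y)))"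
        unfolding e integral_scaleR_right integral_Th[OF \<nu>]
        by (simp only: scaleR_minus_right scaleR_sum_right scaleR_left_commute)
    qed
    also have "\<dots> = - (\<Sum>k\<le>m. c k *\<^sub>R (LINT x|lborel. LINT y|lborel. X k (n + N) (x, y)))"
    proof -
      have i: "integrable lborel (\<lambda>x. LINT y|lborel. X k (n + N) (x, y))" for k
        by (rule lborel_pair.integrable_fst'[OF iX])
      show ?thesis
        unfolding Bochner_Integration.integral_minus
        by (subst Bochner_Integration.integral_sum) (intro integrable_scaleR_right i, simp only: integral_scaleR_right)
    qed
    also have "\<dots> = - (\<Sum>k\<le>m. c k *\<^sub>R (LINT q|(lborel \<Otimes>\<^sub>M lborel). X k (n + N) q))"
      by (subst lborel_pair.integral_fst'[OF iX]) simp
    finally show ?thesis .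
  qed
  have "(\<lambda>n. - (\<Sum>k\<le>m. c k *\<^sub>R (LINT q|(lborel \<Otimes>\<^sub>M lborel). X k (n + N) q)))
     \<longlonglongrightarrow> - (\<Sum>k\<le>m. c k *\<^sub>R (rho_mass *\<^sub>R (LINT x|lborel. indicator B x *\<^sub>R \<psi> ((1 / 2 ^ k) *\<^sub>R x))))"
    by (intro tendsto_minus tendsto_sum tendsto_scaleR tendsto_const LIMSEQ_ignore_initial_segment[OF lim])
  moreover have "(\<Sum>k\<le>m. c k *\<^sub>R (rho_mass *\<^sub>R (LINT x|lborel. indicator B x *\<^sub>R \<psi> ((1 / 2 ^ k) *\<^sub>R x))))
     = rho_mass *\<^sub>R (LINT x|lborel. indicator B x *\<^sub>R Psi x)"
  proof -
    have i: "integrable lborel (\<lambda>x. indicator B x *\<^sub>R \<psi> ((1 / 2 ^ k) *\<^sub>R x))" for k :: nat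
      by (rule integrable_dilated_on_set[OF meas(1) loc B_meas B r front]) auto
    have "(LINT x|lborel. indicator B x *\<^sub>R Psi x) = (LINT x|lborel. (\<Sum>k\<le>m. c k *\<^sub>R (indicator B x *\<^sub>R \<psi> ((1 / 2 ^ k) *\<^sub>R x))))"
      unfolding Psi_def scaleR_sum_right by (simp add: mult.commute)
    also have "\<dots> = (\<Sum>k\<le>m. c k *\<^sub>R (LINT x|lborel. indicator B x *\<^sub>R \<psi> ((1 / 2 ^ k) *\<^sub>R x)))"
      by (subst Bochner_Integration.integral_sum) (intro integrable_scaleR_right i, simp only: integral_scaleR_right)
    finally show ?thesis by (simp add: scaleR_sum_right mult.commute)
  qed
  ultimately show ?thesis unfolding eq by simp
qed

text \<open>Two limits of the same double integral are compared: one from convergence of the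
  mollified dilates, the other from dominated convergence of the integrand. In the latter the
  mollified kernel becomes \<open>G\<close> and the boundary term disappears, since at each y
  \<noteq> 0 the gradient of the cutoff is eventually 0.\<close>

lemma Psi_on_set:
  shows "integrable (lborel \<Otimes>\<^sub>M lborel) (\<lambda>(x, y). indicator B x *\<^sub>R sg (KG x y) (f y))"
    and "integrable lborel (\<lambda>x. indicator B x *\<^sub>R Psi x)"
    and "(LINT q|(lborel \<Otimes>\<^sub>M lborel). (case q of (x, y) \<Rightarrow> indicator B x *\<^sub>R sg (KG x y) (f y)))
      = - (rho_mass *\<^sub>R (LINT x|lborel. indicator B x *\<^sub>R Psi x))"
proof -
  obtain C where C: "0 < C"
    "\<And>g x y. \<lbrakk>x \<noteq> 0; y \<noteq> 0; \<And>z. norm (g z) \<le> norm z powr - 2;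
        \<And>k. \<not> near m x y \<Longrightarrow> k \<le> m \<Longrightarrow> g (y - (1 / 2 ^ k) *\<^sub>R x) = G (y - (1 / 2 ^ k) *\<^sub>R x)\<rbrakk> \<Longrightarrow>
      norm (\<Sum>k\<le>m. c k *\<^sub>R g (y - (1 / 2 ^ k) *\<^sub>R x)) \<le> C * (norm x powr \<alpha> * norm y powr - \<alpha> * W m x y)"
    using kernel_bound[OF M] unfolding m c by blast
  obtain L where L: "0 < L" "\<And>a v. norm (sg a v) \<le> norm a * norm v * L" using sg.pos_bounded by blast
  obtain D where D: "0 < D" "\<And>\<nu> y. 0 < \<nu> \<Longrightarrow> norm (grad_cutoff \<nu> y) \<le> D / norm y" by (rule grad_cutoff_bound) blast
  \<comment> \<open>If x and y are not near, each |y - x / 2^k| is at least |x| / 2^(m+1) \<ge> r /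
    2^(m+1). For \<nu> \<ge> N the product of \<nu> with this distance is at least 2, where
    \<open>moll\<close> coincides with \<open>G\<close>; this is what \<open>kernel_bound\<close>
    asks of the kernel.\<close>
  obtain N :: nat where N: "2 * 2 ^ (m + 1) / r < real N" using reals_Archimedean2 by blast
  let ?w = "\<lambda>(x, y). (L * C + L * C * (L * D)) * (indicator B x * (norm x powr \<alpha> * norm y powr - \<alpha> * W m x y * (norm (f y) + norm (\<psi> y) / norm y)))"
  have iw: "integrable (lborel \<Otimes>\<^sub>M lborel) ?w"
    using integrable_mult_right[OF kernel_majorant_integrable[OF B_meas B r], of "L * C + L * C * (L * D)"]
    by (simp add: case_prod_unfold)
  have Kn_le: "norm (Kn \<nu> x y) \<le> C * (norm x powr \<alpha> * norm y powr - \<alpha> * W m x y)"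
    if x: "x \<in> B" and y: "y \<noteq> 0" and \<nu>: "real N \<le> \<nu>" for \<nu> x y
  proof -
    have xr: "r \<le> norm x" using x B by (auto simp: annulus_def)
    have \<nu>': "2 * 2 ^ (m + 1) / r < \<nu>" using N \<nu> by linarith
    then have \<nu>0: "0 < \<nu>" using r by (smt (verit) divide_pos_pos zero_less_power)
    show ?thesis
      unfolding Kn_def
    proof (rule C(2)[OF _ y])
      show "x \<noteq> 0" using xr r by auto
      show "norm (moll \<nu> z) \<le> norm z powr - 2" for z by (rule norm_moll[OF \<nu>0])
      fix k assume nn: "\<not> near m x y" and k: "k \<le> m"
      have k2: "(2::real) ^ k \<le> 2 ^ m" using k by (intro power_increasing) auto
      have nk: "norm ((1 / 2 ^ k) *\<^sub>R x) = norm x / 2 ^ k" by simp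
      have xk: "norm x / 2 ^ m \<le> norm x / 2 ^ k" "norm x / 2 ^ k \<le> norm x / 1"
      proof -
        show "norm x / 2 ^ m \<le> norm x / 2 ^ k" using k2 by (intro divide_left_mono) auto
        have "norm x * 1 \<le> norm x * 2 ^ k" by (intro mult_left_mono one_le_power) auto
        then show "norm x / 2 ^ k \<le> norm x / 1" by (simp add: divide_le_eq)
      qed
      have xm: "norm x / 2 ^ (m + 1) \<le> norm x / 1" "norm x / 2 ^ (m + 1) = norm x / 2 ^ m / 2"
      proof -
        have "norm x * 1 \<le> norm x * 2 ^ (m + 1)" by (intro mult_left_mono one_le_power) auto
        then show "norm x / 2 ^ (m + 1) \<le> norm x / 1" by (simp add: divide_le_eq)
        show "norm x / 2 ^ (m + 1) = norm x / 2 ^ m / 2" by simp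
      qed
      have "norm x / 2 ^ (m + 1) \<le> norm (y - (1 / 2 ^ k) *\<^sub>R x)"
      proof (cases "4 * norm x < norm y")
        case True
        then show ?thesis
          using norm_triangle_ineq2[of y "(1 / 2 ^ k) *\<^sub>R x"] nk xk xm norm_ge_zero[of x] by linarith
      next
        case False
        then have "4 * 2 ^ m * norm y < norm x" using nn by (simp add: near_def not_le)
        then have b: "norm y \<le> norm x / 2 ^ m / 4" by (simp add: field_simps)
        have q0: "0 \<le> norm x / 2 ^ m" by simp
        have tri: "norm ((1 / 2 ^ k) *\<^sub>R x) - norm y \<le> norm (y - (1 / 2 ^ k) *\<^sub>R x)"
          by (rule norm_triangle_ineq2[of "(1 / 2 ^ k) *\<^sub>R x" y, unfolded norm_minus_commute[of "(1 / 2 ^ k) *\<^sub>R x" y]])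
        have gen: "A - b \<le> d \<Longrightarrow> A = e \<Longrightarrow> q \<le> e \<Longrightarrow> b \<le> q / 4 \<Longrightarrow> 0 \<le> q \<Longrightarrow> q / 2 \<le> d" for A b d e q :: real
          by linarith
        show ?thesis unfolding xm(2) by (rule gen[OF tri nk xk(1) b q0])
      qed
      moreover have "r / 2 ^ (m + 1) \<le> norm x / 2 ^ (m + 1)" using xr by (intro divide_right_mono) auto
      ultimately have d: "r / 2 ^ (m + 1) \<le> norm (y - (1 / 2 ^ k) *\<^sub>R x)" by linarith
      have "2 = (2 * 2 ^ (m + 1) / r) * (r / 2 ^ (m + 1))" using r by simp
      also have "\<dots> \<le> \<nu> * norm (y - (1 / 2 ^ k) *\<^sub>R x)"
        using \<nu>' d r \<nu>0 by (intro mult_mono) auto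
      finally have "2\<^sup>2 \<le> (\<nu> * norm (y - (1 / 2 ^ k) *\<^sub>R x))\<^sup>2" by (intro power_mono) auto
      then show "moll \<nu> (y - (1 / 2 ^ k) *\<^sub>R x) = G (y - (1 / 2 ^ k) *\<^sub>R x)"
        using \<nu>0 by (intro moll_eq_G) (auto simp: power_mult_distrib)
    qed
  qed
  have Th_le: "norm (indicator B x *\<^sub>R Th (real (Suc (n + N))) x y) \<le> ?w (x, y)" for n x y
  proof (cases "x \<in> B \<and> y \<noteq> 0")
    case False
    have "Th (real (Suc (n + N))) x 0 = 0"
      by (simp add: Th_def cutoff_def grad_cutoff_def step_eq_0 sg.zero_left sg.zero_right)
    then show ?thesis using False by auto
  next
    case True
    let ?\<nu> = "real (Suc (n + N))" and ?e = "norm x powr \<alpha> * norm y powr - \<alpha> * W m x y"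
    have e0: "0 \<le> ?e" using W_nonneg by simp
    have K: "norm (Kn ?\<nu> x y) \<le> C * ?e" using True by (intro Kn_le) auto
    have "norm (sg (cutoff ?\<nu> y *\<^sub>R Kn ?\<nu> x y) (f y)) \<le> norm (cutoff ?\<nu> y *\<^sub>R Kn ?\<nu> x y) * norm (f y) * L"
      by (rule L(2))
    also have "norm (cutoff ?\<nu> y *\<^sub>R Kn ?\<nu> x y) \<le> 1 * (C * ?e)"
      unfolding norm_scaleR using cutoff_bounds[of ?\<nu> y] K by (intro mult_mono) auto
    finally have 1: "norm (sg (cutoff ?\<nu> y *\<^sub>R Kn ?\<nu> x y) (f y)) \<le> L * C * (?e * norm (f y))"
      using L by (simp add: mult_ac mult_right_mono mult_left_mono)
    have "norm (sg (grad_cutoff ?\<nu> y) (\<psi> y)) \<le> norm (grad_cutoff ?\<nu> y) * norm (\<psi> y) * L" by (rule L(2))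
    also have "\<dots> \<le> D / norm y * norm (\<psi> y) * L"
      using L by (intro mult_right_mono D(2)) auto
    finally have g: "norm (sg (grad_cutoff ?\<nu> y) (\<psi> y)) \<le> L * D * (norm (\<psi> y) / norm y)" by (simp add: mult_ac)
    have "norm (sg (Kn ?\<nu> x y) (sg (grad_cutoff ?\<nu> y) (\<psi> y))) \<le> norm (Kn ?\<nu> x y) * norm (sg (grad_cutoff ?\<nu> y) (\<psi> y)) * L"
      by (rule L(2))
    also have "\<dots> \<le> (C * ?e) * (L * D * (norm (\<psi> y) / norm y)) * L"
      using L D C e0 by (intro mult_right_mono mult_mono K g) auto
    finally have 2: "norm (sg (Kn ?\<nu> x y) (sg (grad_cutoff ?\<nu> y) (\<psi> y))) \<le> L * C * (L * D) * (?e * (norm (\<psi> y) / norm y))"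
      by (simp add: mult_ac)
    have "norm (Th ?\<nu> x y) \<le> L * C * (?e * norm (f y)) + L * C * (L * D) * (?e * (norm (\<psi> y) / norm y))"
      unfolding Th_def by (rule norm_triangle_le[OF add_mono[OF 1 2]])
    also have "\<dots> \<le> (L * C + L * C * (L * D)) * (?e * norm (f y)) + (L * C + L * C * (L * D)) * (?e * (norm (\<psi> y) / norm y))"
      using L C D e0 by (intro add_mono mult_right_mono) auto
    finally show ?thesis using True by (simp add: distrib_left)
  qed
  have iTh: "integrable (lborel \<Otimes>\<^sub>M lborel) (\<lambda>(x, y). indicator B x *\<^sub>R Th (real (Suc (n + N))) x y)" for n
  proof (rule Bochner_Integration.integrable_bound[OF iw])
    show "AE q in lborel \<Otimes>\<^sub>M lborel. norm (case q of (x, y) \<Rightarrow> indicator B x *\<^sub>R Th (real (Suc (n + N))) x y) \<le> norm (?w q)"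
      using Th_le[where n=n] by (intro AE_I2) (auto intro: order_trans[OF _ abs_ge_self])
  qed measurable
  have ptw: "(\<lambda>n. indicator B x *\<^sub>R Th (real (Suc (n + N))) x y) \<longlonglongrightarrow> indicator B x *\<^sub>R sg (KG x y) (f y)" for x y
  proof (cases "y = 0")
    case True
    have "Th (real (Suc (n + N))) x 0 = 0" for n
      by (simp add: Th_def cutoff_def grad_cutoff_def step_eq_0 sg.zero_left sg.zero_right)
    then show ?thesis using True f0 by (simp add: sg.zero_right)
  next
    case False
    have Kl: "(\<lambda>n. Kn (real (Suc (n + N))) x y) \<longlonglongrightarrow> KG x y"
    proof -
      have "(\<lambda>n. moll (real (Suc (n + N))) z) \<longlonglongrightarrow> G z" for z
        using LIMSEQ_ignore_initial_segment[OF moll_tendsto, of "Suc N"] by simp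
      then show ?thesis unfolding Kn_def KG_def by (intro tendsto_sum tendsto_scaleR tendsto_const)
    qed
    have cl: "(\<lambda>n. cutoff (real (Suc (n + N))) y) \<longlonglongrightarrow> 1"
      using LIMSEQ_ignore_initial_segment[OF cutoff_tendsto[OF False], of "Suc N"] by simp
    have gl: "(\<lambda>n. grad_cutoff (real (Suc (n + N))) y) \<longlonglongrightarrow> 0"
      using LIMSEQ_ignore_initial_segment[OF grad_cutoff_tendsto[OF False], of "Suc N"] by simp
    have "(\<lambda>n. indicator B x *\<^sub>R Th (real (Suc (n + N))) x y) \<longlonglongrightarrow> indicator B x *\<^sub>R (sg (1 *\<^sub>R KG x y) (f y) + sg (KG x y) (sg 0 (\<psi> y)))"
      unfolding Th_def by (intro tendsto_scaleR tendsto_const tendsto_add sg.tendsto Kl cl gl)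
    then show ?thesis by (simp add: sg.zero_left sg.zero_right)
  qed
  have meas1: "(\<lambda>(x, y). indicator B x *\<^sub>R sg (KG x y) (f y)) \<in> borel_measurable (lborel \<Otimes>\<^sub>M lborel)" by measurable
  have meas2: "(\<lambda>(x, y). indicator B x *\<^sub>R Th (real (Suc (n + N))) x y) \<in> borel_measurable (lborel \<Otimes>\<^sub>M lborel)" for n by measurable
  have ae1: "AE q in lborel \<Otimes>\<^sub>M lborel. (\<lambda>n. case q of (x, y) \<Rightarrow> indicator B x *\<^sub>R Th (real (Suc (n + N))) x y) \<longlonglongrightarrow> (case q of (x, y) \<Rightarrow> indicator B x *\<^sub>R sg (KG x y) (f y))"
    using ptw by (intro AE_I2) auto
  have ae2: "AE q in lborel \<Otimes>\<^sub>M lborel. norm (case q of (x, y) \<Rightarrow> indicator B x *\<^sub>R Th (real (Suc (n + N))) x y) \<le> ?w q" for n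
    using Th_le[where n=n] by (intro AE_I2) auto
  show "integrable (lborel \<Otimes>\<^sub>M lborel) (\<lambda>(x, y). indicator B x *\<^sub>R sg (KG x y) (f y))"
    by (rule integrable_dominated_convergence[OF meas1 meas2 iw ae1 ae2])
  have "(\<lambda>n. LINT q|(lborel \<Otimes>\<^sub>M lborel). (case q of (x, y) \<Rightarrow> indicator B x *\<^sub>R Th (real (Suc (n + N))) x y))
    \<longlonglongrightarrow> (LINT q|(lborel \<Otimes>\<^sub>M lborel). (case q of (x, y) \<Rightarrow> indicator B x *\<^sub>R sg (KG x y) (f y)))"
    by (rule integral_dominated_convergence[OF meas1 meas2 iw ae1 ae2])
  then show "(LINT q|(lborel \<Otimes>\<^sub>M lborel). (case q of (x, y) \<Rightarrow> indicator B x *\<^sub>R sg (KG x y) (f y)))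
      = - (rho_mass *\<^sub>R (LINT x|lborel. indicator B x *\<^sub>R Psi x))"
    by (rule LIMSEQ_unique) (rule integral_Th_tendsto[OF iTh])
  show "integrable lborel (\<lambda>x. indicator B x *\<^sub>R Psi x)"
  proof -
    have i: "integrable lborel (\<lambda>x. indicator B x *\<^sub>R \<psi> ((1 / 2 ^ k) *\<^sub>R x))" for k :: nat
      by (rule integrable_dilated_on_set[OF meas(1) loc B_meas B r front]) auto
    have "integrable lborel (\<lambda>x. (\<Sum>k\<le>m. c k *\<^sub>R (indicator B x *\<^sub>R \<psi> ((1 / 2 ^ k) *\<^sub>R x))))"
      by (intro Bochner_Integration.integrable_sum integrable_scaleR_right i)
    then show ?thesis unfolding Psi_def scaleR_sum_right by (simp add: mult.commute)
  qed
qed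

end

text \<open>The averaged identity holds for every box inside a closed box that avoids the origin,
  boxes being convex and so having negligible frontier. Vanishing box integrals give the identity
  almost everywhere on the closed box, and countably many such boxes cover the punctured
  space.\<close>

lemma Psi_representation: "AE x in lborel. rho_mass *\<^sub>R Psi x + (LINT y|lborel. sg (KG x y) (f y)) = 0"
proof -
  define H where "H x = rho_mass *\<^sub>R Psi x + (LINT y|lborel. sg (KG x y) (f y))" for x
  have on_set: "integrable lborel (\<lambda>x. indicator B x *\<^sub>R H x)" "(LINT x|lborel. indicator B x *\<^sub>R H x) = 0"
    if B [measurable]: "B \<in> sets borel" and Br: "B \<subseteq> annulus r R" "0 < r" "negligible (frontier B)" for B r R
  proof -
    note P = Psi_on_set[OF B Br]
    have i1: "integrable lborel (\<lambda>x. indicator B x *\<^sub>R (LINT y|lborel. sg (KG x y) (f y)))"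
      using lborel_pair.integrable_fst'[OF P(1)] by simp
    have i2: "integrable lborel (\<lambda>x. rho_mass *\<^sub>R indicator B x *\<^sub>R Psi x)"
      by (intro integrable_scaleR_right P(2))
    have H: "indicator B x *\<^sub>R H x = rho_mass *\<^sub>R indicator B x *\<^sub>R Psi x + indicator B x *\<^sub>R (LINT y|lborel. sg (KG x y) (f y))" for x
      by (simp add: H_def scaleR_add_right mult.commute)
    show "integrable lborel (\<lambda>x. indicator B x *\<^sub>R H x)"
      unfolding H by (intro Bochner_Integration.integrable_add i1 i2)
    have "(LINT x|lborel. indicator B x *\<^sub>R (LINT y|lborel. sg (KG x y) (f y))) = - (rho_mass *\<^sub>R (LINT x|lborel. indicator B x *\<^sub>R Psi x))"
      using P(3) lborel_pair.integral_fst'[OF P(1)] by simp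
    then show "(LINT x|lborel. indicator B x *\<^sub>R H x) = 0"
      unfolding H Bochner_Integration.integral_add[OF i2 i1] integral_scaleR_right by simp
  qed
  have box: "AE x in lborel. x \<in> cbox a b \<longrightarrow> H x = 0" if "0 \<notin> cbox a b" for a b
  proof (cases "cbox a b = {}")
    case False
    obtain r where "0 < r" "\<forall>x\<in>cbox a b. r \<le> dist 0 x"
      using separate_point_closed[OF closed_cbox \<open>0 \<notin> cbox a b\<close>] by blast
    then have r: "0 < r" "\<And>x. x \<in> cbox a b \<Longrightarrow> r \<le> norm x" by (auto simp: dist_norm)
    obtain R where R: "\<And>x. x \<in> cbox a b \<Longrightarrow> norm x \<le> R"
      using bounded_cbox[of a b] by (auto simp: bounded_iff)
    have sub: "cbox a b \<subseteq> annulus r R" using r R by (auto simp: annulus_def)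
    have "AE x in lborel. indicator (cbox a b) x *\<^sub>R H x = 0"
    proof (rule AE_zero_if_box_integrals_zero)
      show "integrable lborel (\<lambda>x. indicator (cbox a b) x *\<^sub>R H x)"
        by (rule on_set(1)[OF _ sub r(1)]) (auto intro: negligible_convex_frontier)
      fix l u
      have "(LINT x|lborel. indicator (box l u) x *\<^sub>R (indicator (cbox a b) x *\<^sub>R H x)) = (LINT x|lborel. indicator (box l u \<inter> cbox a b) x *\<^sub>R H x)"
        by (intro Bochner_Integration.integral_cong refl) (auto split: split_indicator)
      also have "\<dots> = 0"
        by (rule on_set(2)[OF _ _ r(1)]) (use sub in \<open>auto intro!: negligible_convex_frontier convex_Int convex_box\<close>)
      finally show "(LINT x|lborel. indicator (box l u) x *\<^sub>R (indicator (cbox a b) x *\<^sub>R H x)) = 0" .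
    qed
    then show ?thesis by eventually_elim auto
  qed simp
  obtain \<D> :: "(real^3) set set" where D: "countable \<D>" "\<And>X. X \<in> \<D> \<Longrightarrow> X \<subseteq> - {0}"
      "\<And>X. X \<in> \<D> \<Longrightarrow> \<exists>a b. X = cbox a b" "\<Union>\<D> = - {0}"
    by (rule open_countable_Union_open_cbox[OF open_Compl[OF closed_singleton[of "0::real^3"]]]) blast
  have "AE x in lborel. \<forall>X\<in>\<D>. x \<in> X \<longrightarrow> H x = 0"
    unfolding AE_ball_countable[OF D(1)]
  proof
    fix X assume X: "X \<in> \<D>"
    then obtain a b where "X = cbox a b" using D(3) by blast
    then show "AE x in lborel. x \<in> X \<longrightarrow> H x = 0" using box[of a b] D(2)[OF X] by auto
  qed
  then have "AE x in lborel. H x = 0"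
    using AE_lborel_singleton[of "0::real^3"]
  proof eventually_elim
    fix x :: "real^3" assume *: "\<forall>X\<in>\<D>. x \<in> X \<longrightarrow> H x = 0" "x \<noteq> 0"
    then have "x \<in> \<Union>\<D>" using D(4) by simp
    with * show "H x = 0" by blast
  qed
  then show ?thesis by (simp add: H_def)
qed

lemma dilation_representation:
  "AE x in lborel. rho_mass *\<^sub>R (\<Sum>k\<le>m. c k *\<^sub>R \<psi> ((1 / 2 ^ k) *\<^sub>R x))
     + (LINT y|lborel. sg (\<Sum>k\<le>m. c k *\<^sub>R G (y - (1 / 2 ^ k) *\<^sub>R x)) (f y)) = 0"
  using Psi_representation unfolding Psi_def KG_def .

end

section \<open>Dilations in weighted norms\<close>

text \<open>Dilation \<open>\<psi> \<mapsto> \<psi> (x / 2)\<close> multiplies the weighted norm by \<open>2 powr (3 / p - \<beta>)\<close>, so \<open>1 - c S\<close> is bounded below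
  as soon as \<open>c * 2 powr (3 / p - \<beta>) \<noteq> 1\<close>.\<close>

definition wnorm :: "real \<Rightarrow> real \<Rightarrow> (real^3 \<Rightarrow> complex^2) \<Rightarrow> ennreal" where
  "wnorm \<beta> p \<psi> = (\<integral>\<^sup>+x. ennreal ((norm x powr - \<beta> * norm (\<psi> x)) powr p) \<partial>lborel)"

text \<open>The polynomial Q evaluated at the operator S; products of polynomials correspond to
  composition, one linear factor at a time in \<open>dil_mult\<close>.\<close>

definition dil :: "real poly \<Rightarrow> (real^3 \<Rightarrow> complex^2) \<Rightarrow> real^3 \<Rightarrow> complex^2" where
  "dil Q \<psi> x = (\<Sum>k\<le>degree Q. coeff Q k *\<^sub>R \<psi> ((1 / 2 ^ k) *\<^sub>R x))"

lemma dil_eq: "degree Q \<le> n \<Longrightarrow> dil Q \<psi> x = (\<Sum>k\<le>n. coeff Q k *\<^sub>R \<psi> ((1 / 2 ^ k) *\<^sub>R x))"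
  unfolding dil_def by (intro sum.mono_neutral_left) (auto simp: coeff_eq_0)

lemma dil_1: "dil 1 \<psi> = \<psi>"
  by (simp add: dil_def fun_eq_iff)

lemma dil_mult: "dil ([:1, - c:] * Q) \<psi> x = dil Q \<psi> x - c *\<^sub>R dil Q \<psi> ((1 / 2) *\<^sub>R x)"
proof -
  let ?n = "degree Q"
  have d: "degree ([:1, - c:] * Q) \<le> Suc ?n"
    using degree_mult_le[of "[:1, - c:]" Q] by (auto intro: order_trans)
  have co: "coeff ([:1, - c:] * Q) k = coeff Q k - c * (case k of 0 \<Rightarrow> 0 | Suc j \<Rightarrow> coeff Q j)" for k
    by (simp add: coeff_pCons split: nat.split)
  have "dil ([:1, - c:] * Q) \<psi> x = (\<Sum>k\<le>Suc ?n. (coeff Q k - c * (case k of 0 \<Rightarrow> 0 | Suc j \<Rightarrow> coeff Q j)) *\<^sub>R \<psi> ((1 / 2 ^ k) *\<^sub>R x))"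
    unfolding dil_eq[OF d] co ..
  also have "\<dots> = (\<Sum>k\<le>Suc ?n. coeff Q k *\<^sub>R \<psi> ((1 / 2 ^ k) *\<^sub>R x)) - (\<Sum>k\<le>Suc ?n. (c * (case k of 0 \<Rightarrow> 0 | Suc j \<Rightarrow> coeff Q j)) *\<^sub>R \<psi> ((1 / 2 ^ k) *\<^sub>R x))"
    unfolding scaleR_diff_left sum_subtractf ..
  also have "(\<Sum>k\<le>Suc ?n. coeff Q k *\<^sub>R \<psi> ((1 / 2 ^ k) *\<^sub>R x)) = dil Q \<psi> x"
    by (rule dil_eq[symmetric]) simp
  also have "(\<Sum>k\<le>Suc ?n. (c * (case k of 0 \<Rightarrow> 0 | Suc j \<Rightarrow> coeff Q j)) *\<^sub>R \<psi> ((1 / 2 ^ k) *\<^sub>R x)) = (\<Sum>k\<le>?n. (c * coeff Q k) *\<^sub>R \<psi> ((1 / 2 ^ k) *\<^sub>R ((1 / 2) *\<^sub>R x)))"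
    by (subst sum.atMost_Suc_shift) (simp add: mult.commute)
  also have "\<dots> = c *\<^sub>R dil Q \<psi> ((1 / 2) *\<^sub>R x)"
    unfolding dil_def scaleR_sum_right by simp
  finally show ?thesis .
qed

lemma dil_measurable [measurable]:
  assumes [measurable]: "\<psi> \<in> borel_measurable borel"
  shows "dil Q \<psi> \<in> borel_measurable borel"
  unfolding dil_def[abs_def] by measurable

lemma wnorm_dilate:
  assumes [measurable]: "\<psi> \<in> borel_measurable borel" and p: "1 \<le> p"
  shows "wnorm \<beta> p (\<lambda>x. \<psi> ((1 / 2) *\<^sub>R x)) = ennreal ((2 powr (3 / p - \<beta>)) powr p) * wnorm \<beta> p \<psi>"
proof -
  have "wnorm \<beta> p (\<lambda>x. \<psi> ((1 / 2) *\<^sub>R x)) = ennreal (\<bar>2\<bar> ^ 3) * (\<integral>\<^sup>+x. ennreal ((norm (0 + 2 *\<^sub>R x) powr - \<beta> * norm (\<psi> ((1 / 2) *\<^sub>R (0 + 2 *\<^sub>R x)))) powr p) \<partial>lborel)"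
    unfolding wnorm_def
    using nn_integral_affine_euclidean[of "\<lambda>x. ennreal ((norm x powr - \<beta> * norm (\<psi> ((1 / 2) *\<^sub>R x))) powr p)" 2 0] by simp
  also have "(\<integral>\<^sup>+x. ennreal ((norm (0 + 2 *\<^sub>R x) powr - \<beta> * norm (\<psi> ((1 / 2) *\<^sub>R (0 + 2 *\<^sub>R x)))) powr p) \<partial>lborel)
     = (\<integral>\<^sup>+x. ennreal (2 powr (- \<beta> * p)) * ennreal ((norm x powr - \<beta> * norm (\<psi> x)) powr p) \<partial>lborel)"
    by (intro nn_integral_cong) (simp add: powr_mult powr_powr mult.assoc flip: ennreal_mult)
  also have "\<dots> = ennreal (2 powr (- \<beta> * p)) * wnorm \<beta> p \<psi>"
    unfolding wnorm_def by (rule nn_integral_cmult) simp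
  finally have "wnorm \<beta> p (\<lambda>x. \<psi> ((1 / 2) *\<^sub>R x)) = ennreal (8 * 2 powr (- \<beta> * p)) * wnorm \<beta> p \<psi>"
    by (simp add: ennreal_mult' mult.assoc)
  also have "8 * 2 powr (- \<beta> * p) = (2 powr (3 / p - \<beta>)) powr p"
  proof -
    have "(3 / p - \<beta>) * p = 3 + - \<beta> * p" using p by (simp add: field_simps)
    then have "(2 powr (3 / p - \<beta>)) powr p = 2 powr 3 * 2 powr (- \<beta> * p)"
      unfolding powr_powr by (simp only: powr_add)
    then show ?thesis by simp
  qed
  finally show ?thesis .
qed

text \<open>A substitute for Minkowski's inequality that stays with p-th powers: convexity of the
  power for weights 1 - s and s. The free s can be tuned so that the term to be absorbed receives a
  small enough constant.\<close>

lemma powr_convex_bound: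
  fixes a b s p :: real
  assumes "0 \<le> a" "0 \<le> b" "0 < s" "s < 1" "1 \<le> p"
  shows "(a + b) powr p \<le> (1 - s) powr (1 - p) * a powr p + s powr (1 - p) * b powr p"
proof -
  have ge1: "1 \<le> t powr (1 - p)" if "0 < t" "t \<le> 1" for t :: real
  proof -
    have "1 powr (1 - p) \<le> t powr (1 - p)" using that assms by (intro powr_mono2') auto
    then show ?thesis by simp
  qed
  consider "a = 0" | "b = 0" | "0 < a" "0 < b" using assms by linarith
  then show ?thesis
  proof cases
    case 1
    have "1 * b powr p \<le> s powr (1 - p) * b powr p"
      using ge1[of s] assms by (intro mult_right_mono) auto
    then show ?thesis using 1 by simp
  next
    case 2
    have "1 * a powr p \<le> (1 - s) powr (1 - p) * a powr p"
      using ge1[of "1 - s"] assms by (intro mult_right_mono) auto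
    then show ?thesis using 2 by simp
  next
    case 3
    have "((1 - s) *\<^sub>R (a / (1 - s)) + s *\<^sub>R (b / s)) powr p \<le> (1 - s) * (a / (1 - s)) powr p + s * (b / s) powr p"
      using assms 3 by (intro convex_onD[OF powr_convex]) auto
    moreover have "(1 - s) *\<^sub>R (a / (1 - s)) + s *\<^sub>R (b / s) = a + b" using assms by simp
    moreover have "(1 - s) * (a / (1 - s)) powr p = (1 - s) powr (1 - p) * a powr p"
      using assms by (simp add: powr_divide powr_diff)
    moreover have "s * (b / s) powr p = s powr (1 - p) * b powr p"
      using assms by (simp add: powr_divide powr_diff)
    ultimately show ?thesis by simp
  qed
qed

lemma wnorm_add_le:
  assumes [measurable]: "u \<in> borel_measurable borel" "v \<in> borel_measurable borel" and p: "1 \<le> p" and s: "0 < s" "s < 1"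
    and le: "\<And>x. norm (w x) \<le> norm (u x) + norm (v x)"
  shows "wnorm \<beta> p w \<le> ennreal ((1 - s) powr (1 - p)) * wnorm \<beta> p u + ennreal (s powr (1 - p)) * wnorm \<beta> p v"
proof -
  have "wnorm \<beta> p w \<le> (\<integral>\<^sup>+x. ennreal ((1 - s) powr (1 - p)) * ennreal ((norm x powr - \<beta> * norm (u x)) powr p)
      + ennreal (s powr (1 - p)) * ennreal ((norm x powr - \<beta> * norm (v x)) powr p) \<partial>lborel)"
    unfolding wnorm_def
  proof (intro nn_integral_mono)
    fix x :: "real^3"
    have "norm x powr - \<beta> * norm (w x) \<le> norm x powr - \<beta> * norm (u x) + norm x powr - \<beta> * norm (v x)"
      using mult_left_mono[OF le, of "norm x powr - \<beta>" x] by (simp add: distrib_left)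
    then have "(norm x powr - \<beta> * norm (w x)) powr p \<le> (norm x powr - \<beta> * norm (u x) + norm x powr - \<beta> * norm (v x)) powr p"
      using p by (intro powr_mono2) auto
    also have "\<dots> \<le> (1 - s) powr (1 - p) * (norm x powr - \<beta> * norm (u x)) powr p + s powr (1 - p) * (norm x powr - \<beta> * norm (v x)) powr p"
      using p s by (intro powr_convex_bound) auto
    finally show "ennreal ((norm x powr - \<beta> * norm (w x)) powr p) \<le> ennreal ((1 - s) powr (1 - p)) * ennreal ((norm x powr - \<beta> * norm (u x)) powr p)
      + ennreal (s powr (1 - p)) * ennreal ((norm x powr - \<beta> * norm (v x)) powr p)"
      by (simp flip: ennreal_mult ennreal_plus add: ennreal_leI)
  qed
  also have "\<dots> = ennreal ((1 - s) powr (1 - p)) * wnorm \<beta> p u + ennreal (s powr (1 - p)) * wnorm \<beta> p v"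
    unfolding wnorm_def by (simp add: nn_integral_add nn_integral_cmult)
  finally show ?thesis .
qed

lemma wnorm_scale:
  assumes [measurable]: "\<psi> \<in> borel_measurable borel"
  shows "wnorm \<beta> p (\<lambda>x. c *\<^sub>R \<psi> x) = ennreal (\<bar>c\<bar> powr p) * wnorm \<beta> p \<psi>"
proof -
  have "wnorm \<beta> p (\<lambda>x. c *\<^sub>R \<psi> x) = (\<integral>\<^sup>+x. ennreal (\<bar>c\<bar> powr p) * ennreal ((norm x powr - \<beta> * norm (\<psi> x)) powr p) \<partial>lborel)"
    unfolding wnorm_def by (intro nn_integral_cong) (simp add: powr_mult mult.left_commute flip: ennreal_mult)
  also have "\<dots> = ennreal (\<bar>c\<bar> powr p) * wnorm \<beta> p \<psi>"
    unfolding wnorm_def by (rule nn_integral_cmult) simp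
  finally show ?thesis .
qed

text \<open>Subtracting \<open>d * X\<close> is legitimate only because X is finite. The one subtle
  case is b = 0 with Y infinite, where the right side is 0 and X = 0 has to be shown.\<close>

lemma ennreal_absorb:
  fixes X Y :: ennreal
  assumes fin: "X < \<infinity>" and le: "ennreal a * X \<le> ennreal b * Y + ennreal d * X" and ab: "0 \<le> d" "d < a" "0 \<le> b"
  shows "X \<le> ennreal (b / (a - d)) * Y"
proof (cases Y)
  case top
  show ?thesis
  proof (cases "b = 0")
    case True
    then have "ennreal a * X \<le> ennreal d * X" using le by simp
    moreover obtain x where x: "X = ennreal x" "0 \<le> x" using fin by (cases X) auto
    ultimately have "a * x \<le> d * x" using ab by (simp flip: ennreal_mult)
    then have "x = 0" using ab x by (smt (verit) mult_right_less_imp_less mult_strict_right_mono)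
    then show ?thesis using x by simp
  next
    case False
    then show ?thesis using ab top by (simp add: ennreal_mult_top)
  qed
next
  case (real y)
  obtain x where x: "X = ennreal x" "0 \<le> x" using fin by (cases X) auto
  have "a * x \<le> b * y + d * x"
    using le real x ab by (simp flip: ennreal_mult ennreal_plus)
  then have "x \<le> b / (a - d) * y" using ab by (simp add: field_simps)
  then show ?thesis using real x ab by (simp flip: ennreal_mult add: ennreal_leI)
qed

text \<open>The operator c S multiplies the norm by \<tau>. For \<tau> < 1 the function is estimated
  by the difference and its contracted dilate; for \<tau> > 1 the dilate is the larger one and is
  estimated instead. Finiteness of the norm permits the absorption in both cases.\<close>

lemma wnorm_dilation_factor:
  assumes p: "1 \<le> p" and c: "0 < c" and ne: "c * 2 powr (3 / p - \<beta>) \<noteq> 1"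
  obtains C where "0 < C" "\<And>\<phi>. \<lbrakk>\<phi> \<in> borel_measurable borel; wnorm \<beta> p \<phi> < \<infinity>\<rbrakk> \<Longrightarrow>
     wnorm \<beta> p \<phi> \<le> ennreal C * wnorm \<beta> p (\<lambda>x. \<phi> x - c *\<^sub>R \<phi> ((1 / 2) *\<^sub>R x))"
proof -
  define \<tau> where "\<tau> = c * 2 powr (3 / p - \<beta>)"
  have \<tau>: "0 < \<tau>" "\<tau> \<noteq> 1" using c ne by (auto simp: \<tau>_def)
  have S: "wnorm \<beta> p (\<lambda>x. c *\<^sub>R \<phi> ((1 / 2) *\<^sub>R x)) = ennreal (\<tau> powr p) * wnorm \<beta> p \<phi>"
    if [measurable]: "\<phi> \<in> borel_measurable borel" for \<phi>
  proof -
    have "wnorm \<beta> p (\<lambda>x. c *\<^sub>R \<phi> ((1 / 2) *\<^sub>R x)) = ennreal (c powr p) * (ennreal ((2 powr (3 / p - \<beta>)) powr p) * wnorm \<beta> p \<phi>)"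
      using c by (subst wnorm_scale) (auto simp: wnorm_dilate[OF that p])
    then show ?thesis using c by (simp add: \<tau>_def powr_mult ennreal_mult mult.assoc)
  qed
  show ?thesis
  proof (cases "\<tau> < 1")
    case True
    \<comment> \<open>With s = \<tau> the dilate enters with coefficient \<tau>^(1-p) \<tau>^p =
      \<tau>, below 1, as Minkowski's inequality would suggest.\<close>
    have q: "\<tau> powr (1 - p) * \<tau> powr p = \<tau>" using \<tau> by (simp flip: powr_add)
    show ?thesis
    proof (rule that[of "(1 - \<tau>) powr (1 - p) / (1 - \<tau>)"])
      fix \<phi> :: "real^3 \<Rightarrow> complex^2" assume m [measurable]: "\<phi> \<in> borel_measurable borel" and fin: "wnorm \<beta> p \<phi> < \<infinity>"
      let ?d = "\<lambda>x. \<phi> x - c *\<^sub>R \<phi> ((1 / 2) *\<^sub>R x)"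
      have "wnorm \<beta> p \<phi> \<le> ennreal ((1 - \<tau>) powr (1 - p)) * wnorm \<beta> p ?d + ennreal (\<tau> powr (1 - p)) * wnorm \<beta> p (\<lambda>x. c *\<^sub>R \<phi> ((1 / 2) *\<^sub>R x))"
      proof (intro wnorm_add_le p \<tau>(1) True)
        show "norm (\<phi> x) \<le> norm (?d x) + norm (c *\<^sub>R \<phi> ((1 / 2) *\<^sub>R x))" for x
          using norm_triangle_ineq[of "?d x" "c *\<^sub>R \<phi> ((1 / 2) *\<^sub>R x)"] by simp
      qed measurable
      also have "ennreal (\<tau> powr (1 - p)) * wnorm \<beta> p (\<lambda>x. c *\<^sub>R \<phi> ((1 / 2) *\<^sub>R x)) = ennreal \<tau> * wnorm \<beta> p \<phi>"
        unfolding S[OF m] by (simp flip: ennreal_mult mult.assoc add: q)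
      finally show "wnorm \<beta> p \<phi> \<le> ennreal ((1 - \<tau>) powr (1 - p) / (1 - \<tau>)) * wnorm \<beta> p ?d"
        using \<tau> True fin by (intro ennreal_absorb[where a=1 and d=\<tau>]) auto
    qed (use \<tau> True in auto)
  next
    case False
    then have t1: "1 < \<tau>" using \<tau> by simp
    \<comment> \<open>Here \<phi> enters with coefficient s^(1-p) = \<tau>^(p-1), which is below the
      factor \<tau>^p on the left.\<close>
    define s where "s = 1 / \<tau>"
    have s: "0 < s" "s < 1" using t1 by (auto simp: s_def)
    have q: "s powr (1 - p) < \<tau> powr p"
    proof -
      have "s powr (1 - p) = \<tau> powr (p - 1)"
        using t1 by (simp add: s_def powr_divide powr_diff)
      also have "\<dots> < \<tau> powr p" using t1 by (intro powr_less_mono) auto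
      finally show ?thesis .
    qed
    show ?thesis
    proof (rule that[of "(1 - s) powr (1 - p) / (\<tau> powr p - s powr (1 - p))"])
      fix \<phi> :: "real^3 \<Rightarrow> complex^2" assume m [measurable]: "\<phi> \<in> borel_measurable borel" and fin: "wnorm \<beta> p \<phi> < \<infinity>"
      let ?d = "\<lambda>x. \<phi> x - c *\<^sub>R \<phi> ((1 / 2) *\<^sub>R x)"
      have "norm (c *\<^sub>R \<phi> ((1 / 2) *\<^sub>R x)) \<le> norm (?d x) + norm (\<phi> x)" for x
        using norm_triangle_sub[of "c *\<^sub>R \<phi> ((1 / 2) *\<^sub>R x)" "\<phi> x"] by (simp only: norm_minus_commute add.commute)
      then have "wnorm \<beta> p (\<lambda>x. c *\<^sub>R \<phi> ((1 / 2) *\<^sub>R x)) \<le> ennreal ((1 - s) powr (1 - p)) * wnorm \<beta> p ?d + ennreal (s powr (1 - p)) * wnorm \<beta> p \<phi>"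
        using s by (intro wnorm_add_le p) auto
      then have "ennreal (\<tau> powr p) * wnorm \<beta> p \<phi> \<le> ennreal ((1 - s) powr (1 - p)) * wnorm \<beta> p ?d + ennreal (s powr (1 - p)) * wnorm \<beta> p \<phi>"
        unfolding S[OF m] .
      then show "wnorm \<beta> p \<phi> \<le> ennreal ((1 - s) powr (1 - p) / (\<tau> powr p - s powr (1 - p))) * wnorm \<beta> p ?d"
        using fin q by (intro ennreal_absorb) auto
    qed (use q s in auto)
  qed
qed

lemma wnorm_dil_finite:
  assumes [measurable]: "\<psi> \<in> borel_measurable borel" and p: "1 \<le> p" and fin: "wnorm \<beta> p \<psi> < \<infinity>"
  shows "wnorm \<beta> p (\<lambda>x. \<psi> x - c *\<^sub>R \<psi> ((1 / 2) *\<^sub>R x)) < \<infinity>"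
proof -
  have "wnorm \<beta> p (\<lambda>x. \<psi> x - c *\<^sub>R \<psi> ((1 / 2) *\<^sub>R x)) \<le>
      ennreal ((1 - 1/2) powr (1 - p)) * wnorm \<beta> p \<psi> + ennreal ((1/2) powr (1 - p)) * wnorm \<beta> p (\<lambda>x. c *\<^sub>R \<psi> ((1 / 2) *\<^sub>R x))"
    by (intro wnorm_add_le p norm_triangle_ineq4) auto
  also have "\<dots> < \<infinity>"
    using fin by (subst wnorm_scale) (auto simp: wnorm_dilate[OF assms(1) p] ennreal_mult_less_top)
  finally show ?thesis .
qed

lemma wnorm_dil_prod:
  fixes D :: "int set"
  assumes fin: "finite D" and p: "1 \<le> p" and D: "\<And>d. d \<in> D \<Longrightarrow> (2::real) powi d * 2 powr (3 / p - \<beta>) \<noteq> 1"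
  shows "\<exists>C>0. \<forall>\<psi>. \<psi> \<in> borel_measurable borel \<and> wnorm \<beta> p \<psi> < \<infinity> \<longrightarrow>
     wnorm \<beta> p (dil (\<Prod>d\<in>D. [:1, - (2 powi d):]) \<psi>) < \<infinity> \<and>
     wnorm \<beta> p \<psi> \<le> ennreal C * wnorm \<beta> p (dil (\<Prod>d\<in>D. [:1, - (2 powi d):]) \<psi>)"
  using fin D
proof (induction D rule: finite_induct)
  case empty
  then show ?case by (intro exI[of _ 1]) (simp add: dil_1)
next
  case (insert d D)
  let ?Q = "\<Prod>d\<in>D. [:1, - (2 powi d):] :: real poly"
  obtain C where C: "0 < C" "\<And>\<psi>. \<psi> \<in> borel_measurable borel \<Longrightarrow> wnorm \<beta> p \<psi> < \<infinity> \<Longrightarrow>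
     wnorm \<beta> p (dil ?Q \<psi>) < \<infinity> \<and> wnorm \<beta> p \<psi> \<le> ennreal C * wnorm \<beta> p (dil ?Q \<psi>)"
    using insert.IH insert.prems by blast
  obtain C' where C': "0 < C'" "\<And>\<phi>. \<lbrakk>\<phi> \<in> borel_measurable borel; wnorm \<beta> p \<phi> < \<infinity>\<rbrakk> \<Longrightarrow>
     wnorm \<beta> p \<phi> \<le> ennreal C' * wnorm \<beta> p (\<lambda>x. \<phi> x - (2 powi d) *\<^sub>R \<phi> ((1 / 2) *\<^sub>R x))"
    by (rule wnorm_dilation_factor[OF p, of "2 powi d" \<beta>]) (use insert.prems[of d] in auto)
  have Q: "(\<Prod>d\<in>insert d D. [:1, - (2 powi d):]) = [:1, - (2 powi d):] * ?Q"
    using insert.hyps by simp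
  have dQ: "dil ([:1, - (2 powi d):] * ?Q) \<psi> = (\<lambda>x. dil ?Q \<psi> x - (2 powi d) *\<^sub>R dil ?Q \<psi> ((1 / 2) *\<^sub>R x))" for \<psi>
    by (rule ext) (rule dil_mult)
  show ?case
    unfolding Q dQ
  proof (intro exI[of _ "C * C'"] conjI allI impI)
    show "0 < C * C'" using C C' by simp
    fix \<psi> :: "real^3 \<Rightarrow> complex^2" assume "\<psi> \<in> borel_measurable borel \<and> wnorm \<beta> p \<psi> < \<infinity>"
    then have m [measurable]: "\<psi> \<in> borel_measurable borel" and f: "wnorm \<beta> p \<psi> < \<infinity>" by auto
    note fQ = C(2)[OF m f]
    have mQ: "dil ?Q \<psi> \<in> borel_measurable borel" by measurable
    show "wnorm \<beta> p (\<lambda>x. dil ?Q \<psi> x - (2 powi d) *\<^sub>R dil ?Q \<psi> ((1 / 2) *\<^sub>R x)) < \<infinity>"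
      using fQ by (intro wnorm_dil_finite[OF mQ p]) auto
    have "wnorm \<beta> p \<psi> \<le> ennreal C * wnorm \<beta> p (dil ?Q \<psi>)" using fQ by simp
    also have "\<dots> \<le> ennreal C * (ennreal C' * wnorm \<beta> p (\<lambda>x. dil ?Q \<psi> x - (2 powi d) *\<^sub>R dil ?Q \<psi> ((1 / 2) *\<^sub>R x)))"
      using fQ by (intro mult_left_mono C'(2)[OF mQ]) auto
    finally show "wnorm \<beta> p \<psi> \<le> ennreal (C * C') * wnorm \<beta> p (\<lambda>x. dil ?Q \<psi> x - (2 powi d) *\<^sub>R dil ?Q \<psi> ((1 / 2) *\<^sub>R x))"
      using C C' by (simp add: ennreal_mult mult.assoc)
  qed
qed

section \<open>The weighted inequality\<close>

text \<open>With \<theta> = (6 - p) / 4 one has p = 2 \<theta> + 6 (1 - \<theta>), and the left side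
  is exactly the geometric mean of the two terms with exponents \<theta> and 1 - \<theta>. So the
  interpolation between the two endpoint bounds is pointwise.\<close>

lemma powr_interpolation:
  fixes N w :: real
  assumes N: "0 < N" and w: "0 \<le> w" and p: "2 \<le> p" "p \<le> 6" and g: "\<gamma> * p = 3 - p / 2"
  shows "(N powr - \<gamma> * w) powr p \<le> N powr - 2 * w\<^sup>2 + w ^ 6"
proof (cases "w = 0")
  case False
  then have w: "0 < w" using assms by simp
  define \<theta> where "\<theta> = (6 - p) / 4"
  have \<theta>: "0 \<le> \<theta>" "\<theta> \<le> 1" using p by (auto simp: \<theta>_def)
  let ?A = "N powr - 2 * w powr 2" and ?B = "w powr 6"
  have "(N powr - \<gamma> * w) powr p = N powr (- (\<gamma> * p)) * w powr p"
    using N w by (simp add: powr_mult powr_powr)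
  also have "\<dots> = N powr (- 2 * \<theta>) * w powr (2 * \<theta> + 6 * (1 - \<theta>))"
  proof -
    have "- (\<gamma> * p) = - 2 * \<theta>" "p = 2 * \<theta> + 6 * (1 - \<theta>)"
      unfolding g by (auto simp: \<theta>_def field_simps)
    then show ?thesis by metis
  qed
  also have "\<dots> = ?A powr \<theta> * ?B powr (1 - \<theta>)"
    by (simp only: powr_mult powr_powr powr_add mult.assoc)
  also have "\<dots> \<le> (?A + ?B) powr \<theta> * (?A + ?B) powr (1 - \<theta>)"
    using \<theta> by (intro mult_mono powr_mono2) auto
  also have "\<dots> = (?A + ?B) powr 1" by (simp flip: powr_add)
  also have "\<dots> = ?A + ?B" by simp
  finally show ?thesis using w by (simp add: powr_numeral)
qed (use p in simp)

text \<open>Restores homogeneity: E is quadratic in the spinor and N is of degree p, while the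
  estimates are proved for energy at most 1. The optimal scaling makes the energy 1; if E = 0 every
  scaling is allowed and N must vanish.\<close>

lemma powr_scaling_conclude:
  fixes N E C0 p :: real
  assumes N: "0 \<le> N" and E: "0 \<le> E" and C0: "0 < C0" and p: "0 < p"
    and le: "\<And>t. 0 < t \<Longrightarrow> t\<^sup>2 * E \<le> 1 \<Longrightarrow> N \<le> C0 * t powr - p"
  shows "C0 powr - (2 / p) * N powr (2 / p) \<le> E"
proof (cases "E = 0")
  case True
  have "N = 0"
  proof (rule ccontr)
    assume "N \<noteq> 0"
    then have N: "0 < N" using N by simp
    \<comment> \<open>Chosen so that the bound \<open>C0 * t powr - p\<close> equals N / 2.\<close>
    define t where "t = (2 * C0 / N) powr (1 / p)"
    have t: "0 < t" using N C0 by (simp add: t_def)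
    have "t powr - p = (2 * C0 / N) powr - 1" using p by (simp add: t_def powr_powr)
    also have "\<dots> = N / (2 * C0)" using N C0 by (simp add: powr_minus_divide)
    finally have "N \<le> C0 * (N / (2 * C0))" using le[OF t] True by simp
    then show False using N C0 by simp
  qed
  then show ?thesis using True by simp
next
  case False
  then have E: "0 < E" using E by simp
  define t where "t = E powr - (1/2)"
  have t: "0 < t" using E by (simp add: t_def)
  have "t\<^sup>2 = t powr 2" using t by simp
  also have "\<dots> = E powr - 1" by (simp add: t_def powr_powr)
  finally have "t\<^sup>2 * E = 1" using E by (simp add: powr_minus_divide)
  then have "N \<le> C0 * t powr - p" using le[OF t] by simp
  also have "t powr - p = E powr (p / 2)" by (simp add: t_def powr_powr)
  finally have "N powr (2 / p) \<le> (C0 * E powr (p / 2)) powr (2 / p)" using N p by (intro powr_mono2) auto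
  also have "\<dots> = C0 powr (2 / p) * E" using C0 E p by (simp add: powr_mult powr_powr)
  finally have "C0 powr - (2 / p) * N powr (2 / p) \<le> C0 powr - (2 / p) * (C0 powr (2 / p) * E)"
    by (rule mult_left_mono) simp
  also have "\<dots> = E" using C0 by (simp add: powr_minus)
  finally show ?thesis .
qed

text \<open>Measurability is assumed for the weighted function, so the weight is multiplied back
  after passing to a Borel version. The convention \<open>0 powr a = 0\<close> gives the value 0 at
  the origin, which later makes the kernel estimates hold at y = 0 too.\<close>

lemma weighted_borel_version:
  fixes F :: "real^3 \<Rightarrow> complex^2"
  assumes "(\<lambda>x. norm x powr - a *\<^sub>R F x) \<in> borel_measurable lebesgue"
  obtains F0 where "F0 \<in> borel_measurable borel" "AE x in lborel. F x = F0 x" "F0 0 = 0"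
proof -
  obtain U where U [measurable]: "U \<in> borel_measurable borel" "AE x in lborel. norm x powr - a *\<^sub>R F x = U x"
    using lebesgue_ex_borel_measurable_spinor[OF assms] by blast
  show ?thesis
  proof (rule that[of "\<lambda>x. norm x powr a *\<^sub>R U x"])
    show "AE x in lborel. F x = norm x powr a *\<^sub>R U x"
      using U(2) AE_lborel_singleton[of "0::real^3"]
    proof eventually_elim
      fix x :: "real^3" assume x: "norm x powr - a *\<^sub>R F x = U x" "x \<noteq> 0"
      have "norm x powr a * norm x powr - a = 1" using x(2) by (simp flip: powr_add)
      then show "F x = norm x powr a *\<^sub>R U x" unfolding x(1)[symmetric] by simp
    qed
  qed auto
qed

lemma weighted_integral_transfer:
  fixes F F0 :: "real^3 \<Rightarrow> complex^2"
  assumes F: "in_Lp q (\<lambda>x. norm x powr - a *\<^sub>R F x)" and [measurable]: "F0 \<in> borel_measurable borel"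
    and ae: "AE x in lborel. F x = F0 x"
  shows "(\<integral>\<^sup>+x. ennreal ((norm x powr - a * norm (F0 x)) powr q) \<partial>lborel)
     = ennreal (LINT x|lebesgue. norm (norm x powr - a *\<^sub>R F x) powr q)"
proof -
  have i: "integrable lebesgue (\<lambda>x. norm (norm x powr - a *\<^sub>R F x) powr q)"
    using F by (simp add: in_Lp_def)
  have ae': "AE x in lborel. norm (norm x powr - a *\<^sub>R F x) powr q = (norm x powr - a * norm (F0 x)) powr q"
    using ae by eventually_elim simp
  note T = lebesgue_integral_transfer[OF i _ ae']
  have "(\<integral>\<^sup>+x. ennreal ((norm x powr - a * norm (F0 x)) powr q) \<partial>lborel) = ennreal (LINT x|lborel. (norm x powr - a * norm (F0 x)) powr q)"
    by (intro nn_integral_eq_integral T) auto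
  then show ?thesis using T(2) by simp
qed

text \<open>The representation formula together with \<open>kernel_bound\<close>. The norm of \<psi>
  enters qualitatively, to justify the representation; the constant comes from the kernel and
  \<open>rho_mass\<close> and is therefore the same for all spinors, \<beta> and p.\<close>

lemma dil_pointwise_bound:
  fixes \<alpha> :: real and M :: nat
  assumes M: "\<bar>\<alpha>\<bar> + 1 \<le> real M"
  obtains K where "0 < K"
    "\<And>\<psi> f \<psi>0 f0 \<beta> p. \<lbrakk>has_sigma_grad \<psi> f; \<psi>0 \<in> borel_measurable borel; f0 \<in> borel_measurable borel; f0 0 = 0;
       AE x in lborel. \<psi> x = \<psi>0 x; AE x in lborel. f x = f0 x;
       nn_lborel (\<lambda>y. ennreal ((norm y powr - \<alpha> * norm (f0 y))\<^sup>2)) < \<infinity>;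
       wnorm \<beta> p \<psi>0 < \<infinity>; 1 \<le> p; 3 / p = 1 / 2 - \<alpha> + \<beta>\<rbrakk> \<Longrightarrow>
     AE x in lborel. ennreal (norm (dil (dil_poly M) \<psi>0 x)) \<le> ennreal (K * norm x powr \<alpha>) * pot (2 * M) (\<lambda>y. norm y powr - \<alpha> * norm (f0 y)) x"
proof -
  let ?m = "2 * M" and ?c = "coeff (dil_poly M)"
  obtain C where C: "0 < C"
    "\<And>g x y. \<lbrakk>x \<noteq> 0; y \<noteq> 0; \<And>z. norm (g z) \<le> norm z powr - 2;
        \<And>k. \<not> near ?m x y \<Longrightarrow> k \<le> ?m \<Longrightarrow> g (y - (1 / 2 ^ k) *\<^sub>R x) = G (y - (1 / 2 ^ k) *\<^sub>R x)\<rbrakk> \<Longrightarrow>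
      norm (\<Sum>k\<le>?m. ?c k *\<^sub>R g (y - (1 / 2 ^ k) *\<^sub>R x)) \<le> C * (norm x powr \<alpha> * norm y powr - \<alpha> * W ?m x y)"
    using kernel_bound[OF M] by blast
  obtain L where L: "0 < L" "\<And>a v. norm (sg a v) \<le> norm a * norm v * L" using sg.pos_bounded by blast
  show ?thesis
  proof (rule that[of "L * C / rho_mass"])
    show "0 < L * C / rho_mass" using L(1) C(1) rho_mass_pos by simp
    fix \<psi> f \<psi>0 f0 :: "real^3 \<Rightarrow> complex^2" and \<beta> p :: real
    assume sg: "has_sigma_grad \<psi> f" and m [measurable]: "\<psi>0 \<in> borel_measurable borel" "f0 \<in> borel_measurable borel"
      and f00: "f0 0 = 0" and ae: "AE x in lborel. \<psi> x = \<psi>0 x" "AE x in lborel. f x = f0 x"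
      and f2: "nn_lborel (\<lambda>y. ennreal ((norm y powr - \<alpha> * norm (f0 y))\<^sup>2)) < \<infinity>"
      and \<psi>p: "wnorm \<beta> p \<psi>0 < \<infinity>" and p: "1 \<le> p" "3 / p = 1 / 2 - \<alpha> + \<beta>"
    have loc: "integrable lborel (\<lambda>y. indicator (annulus a b) y *\<^sub>R \<psi>0 y)" if a: "0 < a" for a b
    proof -
      have "integrable lebesgue (\<lambda>y. indicator (annulus a b) y *\<^sub>R \<psi> y)"
        using sg zero_notin_annulus[OF a] compact_annulus
        by (auto simp: has_sigma_grad_def locally_integrable_punctured_def set_integrable_def)
      then show ?thesis
        by (rule lebesgue_integral_transfer(1)) (use ae(1) in \<open>auto elim: eventually_mono\<close>)
    qed
    have m1: "(\<lambda>y. (cutoff \<nu> y * rho \<nu> (y - a)) *\<^sub>R \<psi>0 y) \<in> borel_measurable borel" if "0 < \<nu>" for \<nu> a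
      using rho_measurable[OF that] by measurable
    have m2: "(\<lambda>y. sg (cutoff \<nu> y *\<^sub>R moll \<nu> (y - a)) (f0 y)) \<in> borel_measurable borel" for \<nu> a by measurable
    have m3: "(\<lambda>y. sg (moll \<nu> (y - a)) (sg (grad_cutoff \<nu> y) (\<psi>0 y))) \<in> borel_measurable borel" for \<nu> a by measurable
    have a1: "AE y in lborel. (cutoff \<nu> y * rho \<nu> (y - a)) *\<^sub>R \<psi> y = (cutoff \<nu> y * rho \<nu> (y - a)) *\<^sub>R \<psi>0 y" for \<nu> a
      using ae(1) by eventually_elim simp
    have a2: "AE y in lborel. sg (cutoff \<nu> y *\<^sub>R moll \<nu> (y - a)) (f y) = sg (cutoff \<nu> y *\<^sub>R moll \<nu> (y - a)) (f0 y)" for \<nu> a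
      using ae(2) by eventually_elim simp
    have a3: "AE y in lborel. sg (moll \<nu> (y - a)) (sg (grad_cutoff \<nu> y) (\<psi> y)) = sg (moll \<nu> (y - a)) (sg (grad_cutoff \<nu> y) (\<psi>0 y))" for \<nu> a
      using ae(1) by eventually_elim simp
    note I = mollified_identity[OF sg]
    have rep: "AE x in lborel. rho_mass *\<^sub>R (\<Sum>k\<le>?m. ?c k *\<^sub>R \<psi>0 ((1 / 2 ^ k) *\<^sub>R x)) + (LINT y|lborel. sg (\<Sum>k\<le>?m. ?c k *\<^sub>R G (y - (1 / 2 ^ k) *\<^sub>R x)) (f0 y)) = 0"
    proof (rule dilation_representation[OF m f00 M refl refl loc f2 _ p])
      show "nn_lborel (\<lambda>y. ennreal ((norm y powr - \<beta> * norm (\<psi>0 y)) powr p)) < \<infinity>"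
        using \<psi>p by (simp add: wnorm_def)
      fix \<nu> :: real and a :: "real^3" assume \<nu>: "0 < \<nu>"
      show "integrable lborel (\<lambda>y. (cutoff \<nu> y * rho \<nu> (y - a)) *\<^sub>R \<psi>0 y)"
        by (rule lebesgue_integral_transfer(1)[OF I(1)[OF \<nu>] m1[OF \<nu>] a1])
      show "integrable lborel (\<lambda>y. sg (cutoff \<nu> y *\<^sub>R moll \<nu> (y - a)) (f0 y))"
        by (rule lebesgue_integral_transfer(1)[OF I(2)[OF \<nu>] m2 a2])
      show "integrable lborel (\<lambda>y. sg (moll \<nu> (y - a)) (sg (grad_cutoff \<nu> y) (\<psi>0 y)))"
        by (rule lebesgue_integral_transfer(1)[OF I(3)[OF \<nu>] m3 a3])
      show "(LINT y|lborel. (cutoff \<nu> y * rho \<nu> (y - a)) *\<^sub>R \<psi>0 y) =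
          - (LINT y|lborel. sg (cutoff \<nu> y *\<^sub>R moll \<nu> (y - a)) (f0 y))
          - (LINT y|lborel. sg (moll \<nu> (y - a)) (sg (grad_cutoff \<nu> y) (\<psi>0 y)))"
        using I(4)[OF \<nu>, of a]
        unfolding lebesgue_integral_transfer(2)[OF I(1)[OF \<nu>] m1[OF \<nu>] a1]
          lebesgue_integral_transfer(2)[OF I(2)[OF \<nu>] m2 a2] lebesgue_integral_transfer(2)[OF I(3)[OF \<nu>] m3 a3] .
    qed
    show "AE x in lborel. ennreal (norm (dil (dil_poly M) \<psi>0 x)) \<le> ennreal (L * C / rho_mass * norm x powr \<alpha>) * pot ?m (\<lambda>y. norm y powr - \<alpha> * norm (f0 y)) x"
      using rep AE_lborel_singleton[of "0::real^3"]
    proof eventually_elim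
      fix x :: "real^3"
      let ?k = "\<lambda>y. sg (\<Sum>k\<le>?m. ?c k *\<^sub>R G (y - (1 / 2 ^ k) *\<^sub>R x)) (f0 y)"
      let ?g = "\<lambda>y :: real^3. norm y powr - \<alpha> * norm (f0 y)"
      assume r: "rho_mass *\<^sub>R (\<Sum>k\<le>?m. ?c k *\<^sub>R \<psi>0 ((1 / 2 ^ k) *\<^sub>R x)) + (LINT y|lborel. ?k y) = 0" and x: "x \<noteq> 0"
      have k_le: "norm (?k y) \<le> L * C * norm x powr \<alpha> * (W ?m x y * ?g y)" for y
      proof (cases "y = 0")
        case False
        have "norm (?k y) \<le> norm (\<Sum>k\<le>?m. ?c k *\<^sub>R G (y - (1 / 2 ^ k) *\<^sub>R x)) * norm (f0 y) * L"
          by (rule L(2))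
        also have "\<dots> \<le> C * (norm x powr \<alpha> * norm y powr - \<alpha> * W ?m x y) * norm (f0 y) * L"
          using L(1) False x by (intro mult_right_mono C(2)) (auto simp: norm_G)
        finally show ?thesis by (simp add: mult_ac)
      qed (simp add: f00 sg.zero_right)
      have "ennreal (rho_mass * norm (dil (dil_poly M) \<psi>0 x)) = ennreal (norm (LINT y|lborel. ?k y))"
      proof -
        have "rho_mass *\<^sub>R dil (dil_poly M) \<psi>0 x = - (LINT y|lborel. ?k y)"
          using r unfolding dil_eq[OF degree_dil_poly] by (simp only: eq_neg_iff_add_eq_0)
        then have "norm (rho_mass *\<^sub>R dil (dil_poly M) \<psi>0 x) = norm (LINT y|lborel. ?k y)"
          by (simp only: norm_minus_cancel)
        then show ?thesis using rho_mass_pos by simp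
      qed
      \<comment> \<open>If the integrand is not integrable, its integral is 0 by convention and the
        bound is trivial.\<close>
      also have "\<dots> \<le> (\<integral>\<^sup>+y. ennreal (norm (?k y)) \<partial>lborel)"
        by (cases "integrable lborel ?k") (auto intro: integral_norm_bound_ennreal simp: not_integrable_integral_eq)
      also have "\<dots> \<le> (\<integral>\<^sup>+y. ennreal (L * C * norm x powr \<alpha>) * ennreal (W ?m x y * ?g y) \<partial>lborel)"
        using k_le L(1) C(1) W_nonneg by (intro nn_integral_mono) (simp flip: ennreal_mult add: ennreal_leI)
      also have "\<dots> = ennreal (L * C * norm x powr \<alpha>) * pot ?m ?g x"
        unfolding pot_def by (rule nn_integral_cmult) measurable
      finally have "ennreal (1 / rho_mass) * ennreal (rho_mass * norm (dil (dil_poly M) \<psi>0 x))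
          \<le> ennreal (1 / rho_mass) * (ennreal (L * C * norm x powr \<alpha>) * pot ?m ?g x)"
        by (rule mult_left_mono) simp
      also have "\<dots> = ennreal (L * C / rho_mass * norm x powr \<alpha>) * pot ?m ?g x"
        using rho_mass_pos L(1) C(1) by (simp flip: ennreal_mult mult.assoc)
      also have "ennreal (1 / rho_mass) * ennreal (rho_mass * norm (dil (dil_poly M) \<psi>0 x)) = ennreal (norm (dil (dil_poly M) \<psi>0 x))"
        using rho_mass_pos by (simp flip: ennreal_mult)
      finally show "ennreal (norm (dil (dil_poly M) \<psi>0 x)) \<le> ennreal (L * C / rho_mass * norm x powr \<alpha>) * pot ?m ?g x" .
    qed
  qed
qed

lemma wnorm_le_pot:
  fixes \<alpha> \<beta> p A C2 C6 :: real
  assumes p: "2 \<le> p" "p \<le> 6" "3 / p = 1 / 2 - \<alpha> + \<beta>" and A: "0 < A" and C: "0 < C2" "0 < C6"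
    and [measurable]: "V \<in> borel_measurable borel"
    and V2: "nn_lborel (\<lambda>x. ennreal (norm x powr - 2) * (V x)\<^sup>2) \<le> ennreal C2"
    and V6: "nn_lborel (\<lambda>x. (V x) ^ 6) \<le> ennreal C6"
    and le: "AE x in lborel. ennreal (norm (\<Psi> x)) \<le> ennreal (A * norm x powr \<alpha>) * V x"
  shows "wnorm \<beta> p \<Psi> \<le> ennreal (A powr p * (C2 + C6))"
proof -
  have "wnorm \<beta> p \<Psi> \<le> (\<integral>\<^sup>+x. ennreal (A powr p) * (ennreal (norm x powr - 2) * (V x)\<^sup>2 + (V x) ^ 6) \<partial>lborel)"
    unfolding wnorm_def
  proof (rule nn_integral_mono_AE)
    show "AE x in lborel. ennreal ((norm x powr - \<beta> * norm (\<Psi> x)) powr p)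
       \<le> ennreal (A powr p) * (ennreal (norm x powr - 2) * (V x)\<^sup>2 + (V x) ^ 6)"
      using le AE_lborel_singleton[of "0::real^3"]
    proof eventually_elim
      fix x :: "real^3" assume l: "ennreal (norm (\<Psi> x)) \<le> ennreal (A * norm x powr \<alpha>) * V x" and x: "x \<noteq> 0"
      show "ennreal ((norm x powr - \<beta> * norm (\<Psi> x)) powr p)
       \<le> ennreal (A powr p) * (ennreal (norm x powr - 2) * (V x)\<^sup>2 + (V x) ^ 6)"
      proof (cases "V x")
        case top
        then show ?thesis using A by (simp add: ennreal_mult_top)
      next
        case (real v)
        have "norm (\<Psi> x) \<le> A * norm x powr \<alpha> * v"
          using l A real by (simp flip: ennreal_mult)
        then have "norm x powr - \<beta> * norm (\<Psi> x) \<le> norm x powr - \<beta> * (A * norm x powr \<alpha> * v)"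
          by (rule mult_left_mono) simp
        also have "\<dots> = A * ((norm x powr - \<beta> * norm x powr \<alpha>) * v)" by (simp only: mult_ac)
        also have "norm x powr - \<beta> * norm x powr \<alpha> = norm x powr - (\<beta> - \<alpha>)" by (simp flip: powr_add)
        finally have "(norm x powr - \<beta> * norm (\<Psi> x)) powr p \<le> (A * (norm x powr - (\<beta> - \<alpha>) * v)) powr p"
          using p by (intro powr_mono2) auto
        also have "\<dots> = A powr p * (norm x powr - (\<beta> - \<alpha>) * v) powr p"
          using A real by (simp only: powr_mult)
        also have "\<dots> \<le> A powr p * (norm x powr - 2 * v\<^sup>2 + v ^ 6)"
          using p x real by (intro mult_left_mono powr_interpolation) (auto simp: field_simps)
        finally have "ennreal ((norm x powr - \<beta> * norm (\<Psi> x)) powr p) \<le> ennreal (A powr p * (norm x powr - 2 * v\<^sup>2 + v ^ 6))"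
          by (rule ennreal_leI)
        also have "\<dots> = ennreal (A powr p) * (ennreal (norm x powr - 2) * (V x)\<^sup>2 + (V x) ^ 6)"
          using real by (simp add: ennreal_mult ennreal_power)
        finally show ?thesis .
      qed
    qed
  qed
  also have "\<dots> = ennreal (A powr p) * (nn_lborel (\<lambda>x. ennreal (norm x powr - 2) * (V x)\<^sup>2) + nn_lborel (\<lambda>x. (V x) ^ 6))"
    by (simp add: nn_integral_cmult nn_integral_add)
  also have "\<dots> \<le> ennreal (A powr p) * (ennreal C2 + ennreal C6)"
    by (intro mult_left_mono add_mono V2 V6) simp
  also have "\<dots> = ennreal (A powr p * (C2 + C6))"
    using C by (simp add: ennreal_mult)
  finally show ?thesis .
qed

lemma p_exp_bounds:
  assumes "\<alpha> \<le> \<beta>" "\<beta> \<le> \<alpha> + 1"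
  shows "2 \<le> p_exp \<alpha> \<beta>" "p_exp \<alpha> \<beta> \<le> 6" "3 / p_exp \<alpha> \<beta> = 1 / 2 - \<alpha> + \<beta>"
  using assms by (auto simp: p_exp_def field_simps)

text \<open>A value 1 would force \<alpha> = (d + 1) - 1/2, which is the point of
  \<open>Lambda\<close> with k = d + 1; the excluded degree d = -1 is the excluded index k =
  0.\<close>

lemma dilation_eigenvalue:
  assumes \<alpha>: "\<alpha> \<notin> Lambda" and d: "d \<noteq> -1"
  shows "(2::real) powi d * 2 powr (1 / 2 - \<alpha>) \<noteq> 1"
proof
  assume "(2::real) powi d * 2 powr (1 / 2 - \<alpha>) = 1"
  moreover have "(2::real) powi d = 2 powr real_of_int d" by (simp add: powr_real_of_int')
  ultimately have "2 powr (real_of_int d + (1 / 2 - \<alpha>)) = 1" by (simp only: powr_add)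
  then have "real_of_int d + (1 / 2 - \<alpha>) = 0" by simp
  then have "\<alpha> = real_of_int (d + 1) - 1 / 2" by simp
  moreover have "d + 1 \<noteq> 0" using d by linarith
  ultimately show False using \<alpha> unfolding Lambda_def by blast
qed

text \<open>The norm of \<psi> is bounded by that of Q \<psi>, and Q \<psi> pointwise by
  |x|^\<alpha> times a potential of the weighted density of \<sigma> \<cdot> \<nabla>\<psi>. The two
  endpoint bounds for the potential are stated for densities of norm at most 1, hence the scaling at
  the end.\<close>

lemma weighted_sigma_grad_inequality:
  assumes \<alpha>: "\<alpha> \<notin> Lambda" and \<beta>: "\<alpha> \<le> \<beta>" "\<beta> \<le> \<alpha> + 1"
  obtains C where "0 < C"
    "\<And>\<psi> f. \<lbrakk>in_Lp (p_exp \<alpha> \<beta>) (\<lambda>x. norm x powr - \<beta> *\<^sub>R \<psi> x); sigma_grad_in_L2 \<alpha> \<psi> f\<rbrakk> \<Longrightarrow>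
       C * (LINT x|lebesgue. norm (norm x powr - \<beta> *\<^sub>R \<psi> x) powr p_exp \<alpha> \<beta>) powr (2 / p_exp \<alpha> \<beta>)
         \<le> (LINT x|lebesgue. norm (norm x powr - \<alpha> *\<^sub>R f x) powr 2)"
proof -
  define p where "p = p_exp \<alpha> \<beta>"
  have p: "2 \<le> p" "p \<le> 6" "3 / p = 1 / 2 - \<alpha> + \<beta>" "1 \<le> p"
    using p_exp_bounds[OF \<beta>] by (auto simp: p_def)
  define M where "M = nat \<lceil>\<bar>\<alpha>\<bar> + 1\<rceil>"
  have M: "\<bar>\<alpha>\<bar> + 1 \<le> real M" unfolding M_def by linarith
  let ?Q = "dil_poly M"
  obtain K where K: "0 < K"
    "\<And>\<psi> f \<psi>0 f0. \<lbrakk>has_sigma_grad \<psi> f; \<psi>0 \<in> borel_measurable borel; f0 \<in> borel_measurable borel; f0 0 = 0;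
       AE x in lborel. \<psi> x = \<psi>0 x; AE x in lborel. f x = f0 x;
       nn_lborel (\<lambda>y. ennreal ((norm y powr - \<alpha> * norm (f0 y))\<^sup>2)) < \<infinity>;
       wnorm \<beta> p \<psi>0 < \<infinity>\<rbrakk> \<Longrightarrow>
     AE x in lborel. ennreal (norm (dil ?Q \<psi>0 x)) \<le> ennreal (K * norm x powr \<alpha>) * pot (2 * M) (\<lambda>y. norm y powr - \<alpha> * norm (f0 y)) x"
    by (rule dil_pointwise_bound[OF M], rule that) (blast intro: p(3,4))+
  have "(2::real) powi d * 2 powr (3 / p - \<beta>) \<noteq> 1" if "d \<in> degs M" for d
    using dilation_eigenvalue[OF \<alpha>, of d] that p(3) by (simp add: degs_def)
  moreover have "finite (degs M)" by (simp add: degs_def)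
  ultimately obtain Cd where Cd: "0 < Cd" "\<And>\<psi>. \<lbrakk>\<psi> \<in> borel_measurable borel; wnorm \<beta> p \<psi> < \<infinity>\<rbrakk> \<Longrightarrow>
      wnorm \<beta> p \<psi> \<le> ennreal Cd * wnorm \<beta> p (dil ?Q \<psi>)"
    using wnorm_dil_prod[of "degs M" p \<beta>] p(4) unfolding dil_poly_def[symmetric] by blast
  obtain C2 where C2: "0 < C2"
    "\<And>g. \<lbrakk>g \<in> borel_measurable borel; \<And>y. 0 \<le> g y; nn_lborel (\<lambda>y. ennreal ((g y)\<^sup>2)) \<le> 1\<rbrakk> \<Longrightarrow>
       nn_lborel (\<lambda>x. ennreal (norm x powr - 2) * (pot (2 * M) g x)\<^sup>2) \<le> ennreal C2"
    using pot_Schur by blast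
  obtain C6 where C6: "0 < C6"
    "\<And>g. \<lbrakk>g \<in> borel_measurable borel; \<And>y. 0 \<le> g y; nn_lborel (\<lambda>y. ennreal ((g y)\<^sup>2)) \<le> 1\<rbrakk> \<Longrightarrow>
       nn_lborel (\<lambda>x. (pot (2 * M) g x) ^ 6) \<le> ennreal C6"
    using pot_HLS by blast
  define C0 where "C0 = Cd * K powr p * (C2 + C6)"
  have C0: "0 < C0" using Cd(1) K(1) C2(1) C6(1) by (simp add: C0_def)
  show ?thesis
  proof (rule that[of "C0 powr - (2 / p)"], fold p_def)
    show "0 < C0 powr - (2 / p)" using C0 by simp
    fix \<psi> f assume \<psi>: "in_Lp p (\<lambda>x. norm x powr - \<beta> *\<^sub>R \<psi> x)" and f: "sigma_grad_in_L2 \<alpha> \<psi> f"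
    have sg: "has_sigma_grad \<psi> f" and fL: "in_Lp 2 (\<lambda>x. norm x powr - \<alpha> *\<^sub>R f x)"
      using f by (auto simp: sigma_grad_in_L2_def)
    obtain \<psi>0 where \<psi>0 [measurable]: "\<psi>0 \<in> borel_measurable borel" and \<psi>ae: "AE x in lborel. \<psi> x = \<psi>0 x" "\<psi>0 0 = 0"
      using weighted_borel_version[of \<beta> \<psi>] \<psi> unfolding in_Lp_def by metis
    obtain f0 where f0 [measurable]: "f0 \<in> borel_measurable borel" and fae: "AE x in lborel. f x = f0 x" "f0 0 = 0"
      using weighted_borel_version[of \<alpha> f] fL unfolding in_Lp_def by metis
    let ?N = "LINT x|lebesgue. norm (norm x powr - \<beta> *\<^sub>R \<psi> x) powr p"
    let ?E = "LINT x|lebesgue. norm (norm x powr - \<alpha> *\<^sub>R f x) powr 2"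
    let ?fw = "\<lambda>y :: real^3. norm y powr - \<alpha> * norm (f0 y)"
    have N: "wnorm \<beta> p \<psi>0 = ennreal ?N"
      unfolding wnorm_def by (rule weighted_integral_transfer[OF \<psi> \<psi>0 \<psi>ae(1)])
    have E: "nn_lborel (\<lambda>y. ennreal ((?fw y)\<^sup>2)) = ennreal ?E"
      using weighted_integral_transfer[OF fL f0 fae(1)] by simp
    have fin: "wnorm \<beta> p \<psi>0 < \<infinity>" "nn_lborel (\<lambda>y. ennreal ((?fw y)\<^sup>2)) < \<infinity>"
      by (simp_all add: N E)
    show "C0 powr - (2 / p) * ?N powr (2 / p) \<le> ?E"
    proof (rule powr_scaling_conclude[OF _ _ C0])
      fix t :: real assume t: "0 < t" "t\<^sup>2 * ?E \<le> 1"
      let ?g = "\<lambda>y. t * ?fw y"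
      have E0: "0 \<le> ?E" by (rule integral_nonneg_AE) simp
      have "nn_lborel (\<lambda>y. ennreal ((?g y)\<^sup>2)) = nn_lborel (\<lambda>y. ennreal (t\<^sup>2) * ennreal ((?fw y)\<^sup>2))"
        by (intro nn_integral_cong) (simp only: power_mult_distrib[of t] ennreal_mult zero_le_power2)
      also have "\<dots> = ennreal (t\<^sup>2) * ennreal ?E"
        unfolding E[symmetric] by (rule nn_integral_cmult) measurable
      also have "\<dots> \<le> 1" using t E0 by (simp flip: ennreal_mult)
      finally have g1: "nn_lborel (\<lambda>y. ennreal ((?g y)\<^sup>2)) \<le> 1" .
      have gm: "?g \<in> borel_measurable borel" by measurable
      have g0: "0 \<le> ?g y" for y using t by simp
      \<comment> \<open>Normalizing the density by t multiplies its potential by t, so the constant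
        becomes K / t; this is the source of the power t^-p.\<close>
      have "AE x in lborel. ennreal (norm (dil ?Q \<psi>0 x)) \<le> ennreal (K / t * norm x powr \<alpha>) * pot (2 * M) ?g x"
        using K(2)[OF sg \<psi>0 f0 fae(2) \<psi>ae(1) fae(1) fin(2,1)]
      proof eventually_elim
        fix x :: "real^3"
        assume "ennreal (norm (dil ?Q \<psi>0 x)) \<le> ennreal (K * norm x powr \<alpha>) * pot (2 * M) ?fw x"
        also have "ennreal (K * norm x powr \<alpha>) = ennreal (K / t * norm x powr \<alpha>) * ennreal t"
          using t K(1) by (simp flip: ennreal_mult)
        also have "ennreal (K / t * norm x powr \<alpha>) * ennreal t * pot (2 * M) ?fw x = ennreal (K / t * norm x powr \<alpha>) * pot (2 * M) ?g x"
          using t by (subst pot_scale) (auto simp: mult.assoc)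
        finally show "ennreal (norm (dil ?Q \<psi>0 x)) \<le> ennreal (K / t * norm x powr \<alpha>) * pot (2 * M) ?g x" .
      qed
      then have "wnorm \<beta> p (dil ?Q \<psi>0) \<le> ennreal ((K / t) powr p * (C2 + C6))"
        using K(1) t by (intro wnorm_le_pot[OF p(1,2,3) _ C2(1) C6(1) _ C2(2)[OF gm g0 g1] C6(2)[OF gm g0 g1]] pot_measurable gm) auto
      then have "ennreal ?N \<le> ennreal Cd * ennreal ((K / t) powr p * (C2 + C6))"
        using order_trans[OF Cd(2)[OF \<psi>0 fin(1)] mult_left_mono] N by simp
      also have "\<dots> = ennreal (C0 * t powr - p)"
        using Cd(1) C2(1) C6(1) K(1) t by (simp add: C0_def powr_divide powr_minus_divide mult_ac flip: ennreal_mult)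
      finally show "?N \<le> C0 * t powr - p" using C0 by simp
    qed (use p in \<open>auto intro!: integral_nonneg_AE\<close>)
  qed
qed

lemma weighted_energy_eq:
  "(LINT x|lebesgue. (norm (f x))\<^sup>2 / norm x powr (2 * \<alpha>)) = (LINT x|lebesgue. norm (norm x powr - \<alpha> *\<^sub>R f x) powr 2)"
  for f :: "real^3 \<Rightarrow> complex^2"
proof (intro Bochner_Integration.integral_cong refl)
  fix x :: "real^3"
  have "(norm x powr - \<alpha>)\<^sup>2 = norm x powr (- \<alpha> * 2)" by (simp flip: powr_numeral add: powr_powr)
  then show "(norm (f x))\<^sup>2 / norm x powr (2 * \<alpha>) = norm (norm x powr - \<alpha> *\<^sub>R f x) powr 2"
    by (simp add: power_mult_distrib power_divide powr_minus_divide mult.commute)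
qed

lemma weighted_Lp_eq:
  "(LINT x|lebesgue. norm (\<psi> x) powr p / norm x powr (\<beta> * p)) = (LINT x|lebesgue. norm (norm x powr - \<beta> *\<^sub>R \<psi> x) powr p)"
  for \<psi> :: "real^3 \<Rightarrow> complex^2"
  by (intro Bochner_Integration.integral_cong refl) (simp add: powr_mult powr_divide powr_powr powr_minus_divide)

section \<open>Spinors with smooth components\<close>

lemma continuous_compact_support_integrable:
  fixes F :: "real^3 \<Rightarrow> 'b::{banach, second_countable_topology}"
  assumes F: "continuous_on UNIV F" and K: "compact K" "\<And>x. x \<notin> K \<Longrightarrow> F x = 0"
  shows "integrable lborel F"
proof -
  have "integrable lborel (\<lambda>x. indicator K x *\<^sub>R F x)"
    by (rule borel_integrable_compact[OF K(1)]) (rule continuous_on_subset[OF F], simp)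
  moreover have "(\<lambda>x. indicator K x *\<^sub>R F x) = F"
    using K(2) by (auto simp: fun_eq_iff indicator_def)
  ultimately show ?thesis by simp
qed

lemma difference_quotient_le:
  assumes h: "test_function h" and B: "\<And>x. norm (partial_deriv j h x) \<le> B" and s: "0 < s"
  shows "norm (h (x + s *\<^sub>R axis j 1) - h x) \<le> B * s"
proof -
  let ?e = "axis j (1::real) :: real^3"
  have d: "((\<lambda>r. h (x + r *\<^sub>R ?e)) has_derivative (\<lambda>u. frechet_derivative h (at (x + r *\<^sub>R ?e)) (u *\<^sub>R ?e))) (at r)" for r
  proof (rule has_derivative_compose[of "\<lambda>r. x + r *\<^sub>R ?e" "\<lambda>u. u *\<^sub>R ?e" r UNIV h])
    show "((\<lambda>r. x + r *\<^sub>R ?e) has_derivative (\<lambda>u. u *\<^sub>R ?e)) (at r)"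
      by (auto intro!: derivative_eq_intros)
    show "(h has_derivative frechet_derivative h (at (x + r *\<^sub>R ?e))) (at (x + r *\<^sub>R ?e))"
      using test_function_continuous(3)[OF h] by (simp add: frechet_derivative_works)
  qed
  have "\<exists>r\<in>{0<..<s}. norm (h (x + s *\<^sub>R ?e) - h (x + 0 *\<^sub>R ?e)) \<le> norm (frechet_derivative h (at (x + r *\<^sub>R ?e)) ((s - 0) *\<^sub>R ?e))"
  proof (rule mvt_general[OF s])
    show "continuous_on {0..s} (\<lambda>r. h (x + r *\<^sub>R ?e))"
      using d by (intro continuous_at_imp_continuous_on ballI has_derivative_continuous) blast
  qed (rule d)
  then obtain r where r: "norm (h (x + s *\<^sub>R ?e) - h x) \<le> norm (frechet_derivative h (at (x + r *\<^sub>R ?e)) (s *\<^sub>R ?e))"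
    by auto
  have "linear (frechet_derivative h (at (x + r *\<^sub>R ?e)))"
    by (rule linear_frechet_derivative) (rule test_function_continuous(3)[OF h])
  then have "frechet_derivative h (at (x + r *\<^sub>R ?e)) (s *\<^sub>R ?e) = s *\<^sub>R partial_deriv j h (x + r *\<^sub>R ?e)"
    by (simp add: linear_cmul partial_deriv_def)
  then have "norm (h (x + s *\<^sub>R ?e) - h x) \<le> s * norm (partial_deriv j h (x + r *\<^sub>R ?e))"
    using r s by simp
  also have "\<dots> \<le> s * B" using s by (intro mult_left_mono B) simp
  finally show ?thesis by (simp add: mult.commute)
qed

lemma difference_quotient_tendsto:
  assumes h: "test_function h"
  shows "(\<lambda>n. real (Suc n) *\<^sub>R (h (x + (1 / real (Suc n)) *\<^sub>R axis j 1) - h x)) \<longlonglongrightarrow> partial_deriv j h x"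
proof -
  let ?e = "axis j (1::real) :: real^3" and ?D = "frechet_derivative h (at x)"
  let ?y = "\<lambda>n. x + (1 / real (Suc n)) *\<^sub>R ?e"
  have D: "(h has_derivative ?D) (at x)"
    using test_function_continuous(3)[OF h] by (simp add: frechet_derivative_works)
  have y0: "?y \<longlonglongrightarrow> x + 0 *\<^sub>R ?e"
    by (intro tendsto_intros LIMSEQ_Suc lim_1_over_n)
  have "filterlim ?y (at x) sequentially"
    unfolding filterlim_at using y0 by (auto simp: axis_eq_0_iff)
  moreover have "((\<lambda>y. norm ((h y - h x) - ?D (y - x)) / norm (y - x)) \<longlongrightarrow> 0) (at x)"
    using D by (simp add: has_derivative_iff_norm)
  ultimately have "(\<lambda>n. norm ((h (?y n) - h x) - ?D (?y n - x)) / norm (?y n - x)) \<longlonglongrightarrow> 0"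
    by (rule filterlim_compose[rotated])
  moreover have "norm ((h (?y n) - h x) - ?D (?y n - x)) / norm (?y n - x)
     = norm (real (Suc n) *\<^sub>R (h (?y n) - h x) - partial_deriv j h x)" for n
  proof -
    have lin: "linear ?D" using D by (rule has_derivative_linear)
    have "partial_deriv j h x = real (Suc n) *\<^sub>R ?D (?y n - x)"
      by (simp add: linear_cmul[OF lin] partial_deriv_def)
    then have "real (Suc n) *\<^sub>R (h (?y n) - h x) - partial_deriv j h x = real (Suc n) *\<^sub>R ((h (?y n) - h x) - ?D (?y n - x))"
      by (simp only: scaleR_diff_right)
    then have "norm (real (Suc n) *\<^sub>R (h (?y n) - h x) - partial_deriv j h x) = real (Suc n) * norm ((h (?y n) - h x) - ?D (?y n - x))"
      by simp
    moreover have "norm (?y n - x) = 1 / real (Suc n)" by simp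
    ultimately show ?thesis by simp
  qed
  ultimately have "(\<lambda>n. norm (real (Suc n) *\<^sub>R (h (?y n) - h x) - partial_deriv j h x)) \<longlonglongrightarrow> 0" by simp
  then show ?thesis by (rule LIM_zero_cancel[OF tendsto_norm_zero_cancel])
qed

text \<open>Difference quotients integrate to 0 by translation invariance. They converge to the
  partial derivative and are dominated by its maximum on a ball of radius R + 1, the 1 covering
  steps of length at most 1.\<close>

lemma integral_partial_deriv:
  assumes h: "test_function h"
  shows "(LINT x|lborel. partial_deriv j h x) = 0"
proof -
  let ?e = "axis j (1::real) :: real^3"
  obtain K where K: "compact K" "\<And>x. x \<notin> K \<Longrightarrow> h x = 0" "\<And>x. x \<notin> K \<Longrightarrow> partial_deriv j h x = 0"
    using test_function_support[OF h] by metis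
  note c = test_function_continuous(1,2)[OF h]
  have "bounded (partial_deriv j h ` K)"
    by (intro compact_imp_bounded compact_continuous_image K continuous_on_subset[OF c(2)]) auto
  then obtain B where B0: "0 < B" "\<And>x. x \<in> K \<Longrightarrow> norm (partial_deriv j h x) \<le> B"
    unfolding bounded_pos by auto
  then have B: "norm (partial_deriv j h x) \<le> B" for x using K(3) by (cases "x \<in> K") auto
  obtain R where R: "\<And>x. x \<in> K \<Longrightarrow> norm x \<le> R"
    using compact_imp_bounded[OF K(1)] unfolding bounded_iff by auto
  define q where "q n x = real (Suc n) *\<^sub>R (h (x + (1 / real (Suc n)) *\<^sub>R ?e) - h x)" for n x
  have ih: "integrable lborel h" by (rule continuous_compact_support_integrable[OF c(1) K(1,2)])
  have hm [measurable]: "h \<in> borel_measurable borel" by (rule borel_measurable_continuous_onI[OF c(1)])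
  have q0: "(LINT x|lborel. q n x) = 0" for n
  proof -
    have i: "integrable lborel (\<lambda>x. h (x + (1 / real (Suc n)) *\<^sub>R ?e))"
      using lborel_integrable_affine_euclidean[OF ih, of 1 "(1 / real (Suc n)) *\<^sub>R ?e"] by (simp add: add.commute)
    have "(LINT x|lborel. h x) = (LINT x|lborel. h (x + (1 / real (Suc n)) *\<^sub>R ?e))"
      using lborel_integral_affine_euclidean[OF hm, of 1 "(1 / real (Suc n)) *\<^sub>R ?e"] by (simp add: add.commute)
    then show ?thesis unfolding q_def integral_scaleR_right Bochner_Integration.integral_diff[OF i ih] by simp
  qed
  have "(\<lambda>n. LINT x|lborel. q n x) \<longlonglongrightarrow> (LINT x|lborel. partial_deriv j h x)"
  proof (rule integral_dominated_convergence)
    show "partial_deriv j h \<in> borel_measurable lborel"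
      using borel_measurable_continuous_onI[OF c(2)] by simp
    show "q n \<in> borel_measurable lborel" for n unfolding q_def by measurable
    show "integrable lborel (\<lambda>x::real^3. indicator (cball 0 (R + 1)) x *\<^sub>R B)"
      using emeasure_lborel_cball_finite[of "0::real^3" "R + 1"] by (intro integrable_indicator) auto
    show "AE x in lborel. (\<lambda>n. q n x) \<longlonglongrightarrow> partial_deriv j h x"
      unfolding q_def by (intro AE_I2 difference_quotient_tendsto h)
    show "AE x in lborel. norm (q n x) \<le> indicator (cball 0 (R + 1)) x *\<^sub>R B" for n
    proof (rule AE_I2)
      fix x :: "real^3"
      have "norm (q n x) = real (Suc n) * norm (h (x + (1 / real (Suc n)) *\<^sub>R ?e) - h x)"
        by (simp add: q_def)
      also have "\<dots> \<le> real (Suc n) * (B * (1 / real (Suc n)))"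
        by (intro mult_left_mono difference_quotient_le h B) auto
      finally have le: "norm (q n x) \<le> B" by simp
      have "q n x = 0" if x: "x \<notin> cball 0 (R + 1)"
      proof -
        have "R + 1 < norm x" using x by simp
        also have "norm x \<le> norm (x + (1 / real (Suc n)) *\<^sub>R ?e) + norm ((1 / real (Suc n)) *\<^sub>R ?e)"
          by (metis add_diff_cancel norm_triangle_ineq4)
        also have "norm ((1 / real (Suc n)) *\<^sub>R ?e) \<le> 1" by simp
        finally have "R < norm (x + (1 / real (Suc n)) *\<^sub>R ?e)" by simp
        then have "x + (1 / real (Suc n)) *\<^sub>R ?e \<notin> K" using R by fastforce
        moreover have "x \<notin> K" using R x by fastforce
        ultimately show ?thesis by (simp add: q_def K(2))
      qed
      then show "norm (q n x) \<le> indicator (cball 0 (R + 1)) x *\<^sub>R B"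
        using le by (auto simp: indicator_def)
    qed
  qed
  then show ?thesis unfolding q0 by (simp add: LIMSEQ_const_iff)
qed

lemma test_function_mult:
  assumes "test_function \<phi>" "test_function \<eta>"
  shows "test_function (\<lambda>x. \<phi> x * \<eta> x)"
proof -
  obtain K where "compact K" "0 \<notin> K" "\<And>x. x \<notin> K \<Longrightarrow> \<phi> x = 0"
    using test_function_support[OF assms(1)] by metis
  then show ?thesis
    using assms by (intro test_functionI[of _ K] smooth_on_mult) (auto simp: test_function_def smooth_on_UNIV_Ck)
qed

lemma integral_by_parts_test:
  assumes \<phi>: "test_function \<phi>" and \<eta>: "test_function \<eta>"
  shows "integrable lborel (\<lambda>x. \<phi> x * partial_deriv j \<eta> x)" "integrable lborel (\<lambda>x. partial_deriv j \<phi> x * \<eta> x)"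
    "(LINT x|lborel. \<phi> x * partial_deriv j \<eta> x) = - (LINT x|lborel. partial_deriv j \<phi> x * \<eta> x)"
proof -
  obtain K where K: "compact K" "\<And>x. x \<notin> K \<Longrightarrow> \<phi> x = 0" "\<And>x. x \<notin> K \<Longrightarrow> partial_deriv j \<phi> x = 0"
    using test_function_support[OF \<phi>] by metis
  note c = test_function_continuous[OF \<phi>] test_function_continuous[OF \<eta>]
  show i1: "integrable lborel (\<lambda>x. \<phi> x * partial_deriv j \<eta> x)"
    by (rule continuous_compact_support_integrable[OF _ K(1)]) (auto intro!: continuous_on_mult c simp: K)
  show i2: "integrable lborel (\<lambda>x. partial_deriv j \<phi> x * \<eta> x)"
    by (rule continuous_compact_support_integrable[OF _ K(1)]) (auto intro!: continuous_on_mult c simp: K)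
  have "(LINT x|lborel. \<phi> x * partial_deriv j \<eta> x + partial_deriv j \<phi> x * \<eta> x) = 0"
    using integral_partial_deriv[OF test_function_mult[OF \<phi> \<eta>], of j] by (simp add: partial_deriv_mult c add.commute)
  then show "(LINT x|lborel. \<phi> x * partial_deriv j \<eta> x) = - (LINT x|lborel. partial_deriv j \<phi> x * \<eta> x)"
    by (simp only: Bochner_Integration.integral_add[OF i1 i2] eq_neg_iff_add_eq_0)
qed

definition spinor :: "(2 \<Rightarrow> real^3 \<Rightarrow> complex) \<Rightarrow> real^3 \<Rightarrow> complex^2" where
  "spinor A x = (\<chi> i. A i x)"

definition sgrad :: "(2 \<Rightarrow> real^3 \<Rightarrow> complex) \<Rightarrow> real^3 \<Rightarrow> complex^2" where
  "sgrad A x = (\<Sum>j\<in>UNIV. pauli $ j *v (\<chi> i. partial_deriv j (A i) x))"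

lemma spinor_continuous:
  assumes "\<And>i. test_function (A i)"
  shows "continuous_on UNIV (spinor A)" "continuous_on UNIV (sgrad A)"
  unfolding spinor_def[abs_def] sgrad_def[abs_def]
  by (intro continuous_on_vec_lambda continuous_on_sum test_function_continuous assms
      continuous_on_compose2[OF linear_continuous_on[OF bounded_linear_pauli, of UNIV]]; simp)+

lemma spinor_support:
  assumes "\<And>i. test_function (A i)"
  obtains K where "compact K" "0 \<notin> K" "\<And>x. x \<notin> K \<Longrightarrow> spinor A x = 0" "\<And>x. x \<notin> K \<Longrightarrow> sgrad A x = 0"
proof -
  obtain K where K: "\<And>i. compact (K i)" "\<And>i. 0 \<notin> K i" "\<And>i x. x \<notin> K i \<Longrightarrow> A i x = 0"
      "\<And>i x j. x \<notin> K i \<Longrightarrow> partial_deriv j (A i) x = 0"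
  proof -
    have "\<forall>i. \<exists>K. compact K \<and> 0 \<notin> K \<and> (\<forall>x. x \<notin> K \<longrightarrow> A i x = 0) \<and> (\<forall>x j. x \<notin> K \<longrightarrow> partial_deriv j (A i) x = 0)"
      using test_function_support[OF assms] by metis
    then show thesis using that by metis
  qed
  show ?thesis
  proof (rule that[of "\<Union>i\<in>UNIV. K i"])
    show "compact (\<Union>i\<in>UNIV. K i)" by (intro compact_UN K) auto
    show "0 \<notin> (\<Union>i\<in>UNIV. K i)" using K by auto
    fix x assume x: "x \<notin> (\<Union>i\<in>UNIV. K i)"
    have z: "pauli $ j *v 0 = 0" for j by (simp add: vec_eq_iff matrix_vector_mult_def)
    show "spinor A x = 0" using x K(3) by (simp add: spinor_def vec_eq_iff)
    have "(\<chi> i. partial_deriv j (A i) x) = 0" for j using x K(4) by (simp add: vec_eq_iff)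
    then show "sgrad A x = 0" by (simp add: sgrad_def z)
  qed
qed

lemma integral_vec_lambda:
  fixes F :: "2 \<Rightarrow> real^3 \<Rightarrow> complex"
  assumes i: "\<And>i. integrable lborel (F i)"
  shows "integrable lborel (\<lambda>x. \<chi> i. F i x)" "(LINT x|lborel. (\<chi> i. F i x)) = (\<chi> i. LINT x|lborel. F i x)"
proof -
  have "(\<lambda>x. \<chi> i. F i x) = (\<lambda>x. \<Sum>i\<in>UNIV. axis i (F i x))"
    by (auto simp: fun_eq_iff vec_eq_iff axis_def if_distrib cong: if_cong)
  moreover have "integrable lborel (\<lambda>x. axis i (F i x))" for i :: 2
    by (rule integrable_bounded_linear[OF _ i]) (auto intro!: bounded_linear_intros simp: linear_conv_bounded_linear[symmetric] linear_iff vec_eq_iff axis_def)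
  ultimately show v: "integrable lborel (\<lambda>x. \<chi> i. F i x)" by simp
  show "(LINT x|lborel. (\<chi> i. F i x)) = (\<chi> i. LINT x|lborel. F i x)"
  proof (rule vec_eq_iff[THEN iffD2], rule allI)
    fix i
    show "(LINT x|lborel. (\<chi> i. F i x)) $ i = (\<chi> i. LINT x|lborel. F i x) $ i"
      using integral_bounded_linear[OF bounded_linear_vec_nth v, of i] by simp
  qed
qed

lemma continuous_weighted:
  fixes F :: "real^3 \<Rightarrow> complex^2"
  assumes F: "continuous_on UNIV F" and K: "compact K" "0 \<notin> K" "\<And>x. x \<notin> K \<Longrightarrow> F x = 0" and q: "0 < q"
  shows "locally_integrable_punctured F" "in_Lp q (\<lambda>x. norm x powr - a *\<^sub>R F x)"
proof -
  have [measurable]: "F \<in> borel_measurable borel" by (rule borel_measurable_continuous_onI[OF F])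
  have "set_integrable lborel C F" if "compact C" for C
    unfolding set_integrable_def
    by (rule borel_integrable_compact[OF that continuous_on_subset[OF F]]) simp
  then show "locally_integrable_punctured F"
    unfolding locally_integrable_punctured_def set_integrable_def
    by (auto intro!: integrable_completion[THEN iffD2] dest: compact_imp_closed)
  have "integrable lborel (\<lambda>x. indicator K x *\<^sub>R (norm (norm x powr - a *\<^sub>R F x) powr q))"
    using K(2) q by (intro borel_integrable_compact K(1) continuous_intros continuous_on_powr' continuous_on_subset[OF F]) auto
  moreover have "(\<lambda>x. indicator K x *\<^sub>R (norm (norm x powr - a *\<^sub>R F x) powr q)) = (\<lambda>x. norm (norm x powr - a *\<^sub>R F x) powr q)"
    using K(3) by (auto simp: fun_eq_iff indicator_def)
  ultimately have "integrable lborel (\<lambda>x. norm (norm x powr - a *\<^sub>R F x) powr q)" by (simp only:)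
  then show "in_Lp q (\<lambda>x. norm x powr - a *\<^sub>R F x)"
    unfolding in_Lp_def by (auto intro!: integrable_completion[THEN iffD2] measurable_completion)
qed

text \<open>Integration by parts shows that the classical \<sigma> \<cdot> \<nabla> is the
  distributional one, and the support away from 0 makes all weights harmless. This is the source of
  concrete competitors, both for the resonant case and for the boundedness of the set of admissible
  constants.\<close>

lemma spinor_in_space:
  assumes A: "\<And>i. test_function (A i)" and p: "0 < p"
  shows "in_Lp p (\<lambda>x. norm x powr - \<beta> *\<^sub>R spinor A x)" "sigma_grad_in_L2 \<alpha> (spinor A) (sgrad A)"
proof -
  obtain K where K: "compact K" "0 \<notin> K" "\<And>x. x \<notin> K \<Longrightarrow> spinor A x = 0" "\<And>x. x \<notin> K \<Longrightarrow> sgrad A x = 0"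
    by (rule spinor_support[of A, OF A]) (rule that)
  note c = spinor_continuous[of A, OF A]
  show "in_Lp p (\<lambda>x. norm x powr - \<beta> *\<^sub>R spinor A x)"
    by (rule continuous_weighted(2)[OF c(1) K(1-3) p])
  have "has_sigma_grad (spinor A) (sgrad A)"
    unfolding has_sigma_grad_def
  proof (intro conjI allI impI)
    show "locally_integrable_punctured (spinor A)" "locally_integrable_punctured (sgrad A)"
      using continuous_weighted(1)[OF c(1) K(1-3), of 1] continuous_weighted(1)[OF c(2) K(1,2,4), of 1] by simp_all
    fix \<phi> assume \<phi>: "test_function \<phi>"
    have \<phi>m [measurable]: "\<phi> \<in> borel_measurable borel" "partial_deriv j \<phi> \<in> borel_measurable borel" for j
      using test_function_continuous[OF \<phi>] by (auto intro: borel_measurable_continuous_onI)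
    have Am [measurable]: "spinor A \<in> borel_measurable borel" "sgrad A \<in> borel_measurable borel"
      using c by (auto intro: borel_measurable_continuous_onI)
    define Fj where "Fj j x = (\<chi> i. \<phi> x * partial_deriv j (A i) x)" for j x
    note P = integral_by_parts_test[OF \<phi> A]
    have iF: "integrable lborel (Fj j)" for j
      unfolding Fj_def[abs_def] by (rule integral_vec_lambda(1)[OF P(1)])
    have "(LINT x|lborel. Fj j x) = (\<chi> i. LINT x|lborel. \<phi> x * partial_deriv j (A i) x)" for j
      unfolding Fj_def by (rule integral_vec_lambda(2)[OF P(1)])
    also have "\<dots> j = - (\<chi> i. LINT x|lborel. partial_deriv j \<phi> x * A i x)" for j
      unfolding P(3) by (simp add: vec_eq_iff)
    also have "\<dots> j = - (LINT x|lborel. partial_deriv j \<phi> x *s spinor A x)" for j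
      unfolding integral_vec_lambda(2)[OF P(2), symmetric]
      by (simp add: spinor_def vector_scalar_mult_def)
    finally have F_eq: "(LINT x|lborel. Fj j x) = - (LINT x|lborel. partial_deriv j \<phi> x *s spinor A x)" for j .
    have s: "\<phi> x *s sgrad A x = (\<Sum>j\<in>UNIV. pauli $ j *v Fj j x)" for x
      by (rule vec2_eqI) (simp_all add: sgrad_def Fj_def sum_3 algebra_simps)
    have "(LINT x|lborel. \<phi> x *s sgrad A x) = (\<Sum>j\<in>UNIV. LINT x|lborel. pauli $ j *v Fj j x)"
      unfolding s by (intro Bochner_Integration.integral_sum integrable_bounded_linear[OF bounded_linear_pauli] iF)
    also have "\<dots> = (\<Sum>j\<in>UNIV. pauli $ j *v (LINT x|lborel. Fj j x))"
      by (intro sum.cong refl integral_bounded_linear[OF bounded_linear_pauli] iF)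
    finally have "(LINT x|lborel. \<phi> x *s sgrad A x) = (\<Sum>j\<in>UNIV. pauli $ j *v (- (LINT x|lborel. partial_deriv j \<phi> x *s spinor A x)))"
      unfolding F_eq .
    moreover have "(\<lambda>x. \<phi> x *s sgrad A x) \<in> borel_measurable lborel"
      unfolding s using iF by (intro borel_measurable_sum borel_measurable_integrable integrable_bounded_linear[OF bounded_linear_pauli])
    moreover have "(\<lambda>x. partial_deriv j \<phi> x *s spinor A x) \<in> borel_measurable lborel" for j
      using borel_measurable_integrable[OF integral_vec_lambda(1)[OF P(2)], of "\<lambda>_. j"] by (simp add: spinor_def vector_scalar_mult_def)
    ultimately show "(LINT x|lebesgue. \<phi> x *s sgrad A x) = (\<Sum>j\<in>UNIV. pauli $ j *v (- (LINT x|lebesgue. partial_deriv j \<phi> x *s spinor A x)))"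
      by (simp add: integral_completion)
  qed
  then show "sigma_grad_in_L2 \<alpha> (spinor A) (sgrad A)"
    unfolding sigma_grad_in_L2_def using continuous_weighted(2)[OF c(2) K(1,2,4), of 2] by simp
qed

section \<open>Truncated zero modes\<close>

definition zeta :: "real^3 \<Rightarrow> complex" where
  "zeta x = of_real (x $ 1) + \<i> * of_real (x $ 2)"

lemma zeta_axis [simp]: "zeta (axis 1 1) = 1" "zeta (axis 2 1) = \<i>" "zeta (axis 3 1) = 0"
  by (simp_all add: zeta_def axis_def)

lemma norm_zeta_sq: "(norm (zeta x))\<^sup>2 = (x $ 1)\<^sup>2 + (x $ 2)\<^sup>2"
  by (simp add: zeta_def cmod_power2)

lemma norm_zeta_le: "norm (zeta x) \<le> norm x"
  by (rule power2_le_imp_le) (simp_all add: norm_zeta_sq norm_sq_vec3)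

lemma smooth_on_coord: "smooth_on S (\<lambda>x. complex_of_real (x $ i))"
  using rsmooth_on_coord[of S i] by (simp add: rsmooth_on_def)

lemma smooth_on_zeta_power: "smooth_on UNIV (\<lambda>x. zeta x ^ m)"
  unfolding zeta_def by (intro smooth_on_power smooth_on_add smooth_on_mult smooth_on_const smooth_on_coord open_UNIV)

lemma smooth_on_differentiable: "smooth_on UNIV \<phi> \<Longrightarrow> \<phi> differentiable at x"
  using Ck.simps(2)[of 0 \<phi>] by (auto simp: smooth_on_UNIV_Ck differentiable_on_def)

lemma partial_deriv_zeta_power: "partial_deriv j (\<lambda>x. zeta x ^ m) x = of_nat m * zeta (axis j 1) * zeta x ^ (m - 1)"
proof -
  have "(zeta has_derivative zeta) (at x)"
    unfolding zeta_def[abs_def] by (intro has_derivative_add has_derivative_mult_right has_derivative_coord)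
  from partial_deriv_eq[OF has_derivative_power[OF this]] show ?thesis .
qed

lemma partial_deriv_coord: "partial_deriv j (\<lambda>x. complex_of_real (x $ i)) x = of_real (axis j 1 $ i)"
  by (rule partial_deriv_eq[OF has_derivative_coord])

text \<open>The highest weight solid harmonic of degree l in the upper component. It is a zero mode
  because \<partial>_3 and \<partial>_1 + i \<partial>_2 both annihilate powers of x_1 + i
  x_2.\<close>

definition mode_plus :: "nat \<Rightarrow> 2 \<Rightarrow> real^3 \<Rightarrow> complex" where
  "mode_plus l i x = (if i = 1 then zeta x ^ l else 0)"

text \<open>This is \<sigma> \<cdot> x applied to \<open>mode_plus l\<close>. Multiplied by |x|^(-2
  l - 3) it becomes the Kelvin transform of that mode, a zero mode of degree -l - 2.\<close>

definition mode_minus :: "nat \<Rightarrow> 2 \<Rightarrow> real^3 \<Rightarrow> complex" where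
  "mode_minus l i x = (if i = 1 then of_real (x $ 3) * zeta x ^ l else zeta x ^ Suc l)"

lemma smooth_mode: "smooth_on UNIV (mode_plus l i)" "smooth_on UNIV (mode_minus l i)"
  unfolding mode_plus_def[abs_def] mode_minus_def[abs_def]
  by (cases "i = 1"; simp del: power_Suc; intro smooth_on_mult smooth_on_const smooth_on_coord smooth_on_zeta_power open_UNIV)+

lemma sgrad_nth:
  "sgrad A x $ 1 = partial_deriv 3 (A 1) x + partial_deriv 1 (A 2) x - \<i> * partial_deriv 2 (A 2) x"
  "sgrad A x $ 2 = partial_deriv 1 (A 1) x + \<i> * partial_deriv 2 (A 1) x - partial_deriv 3 (A 2) x"
  by (simp_all add: sgrad_def sum_3 algebra_simps)

lemma i_times_i: "\<i> * (a * \<i> * w) = - (a * w)"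
proof -
  have "\<i> * (a * \<i> * w) = (\<i> * \<i>) * (a * w)" by (simp only: mult_ac)
  then show ?thesis by simp
qed

lemma mode_simps:
  "mode_plus l 1 = (\<lambda>x. zeta x ^ l)" "mode_plus l 2 = (\<lambda>x. 0)"
  "mode_minus l 1 = (\<lambda>x. of_real (x $ 3) * zeta x ^ l)" "mode_minus l 2 = (\<lambda>x. zeta x ^ Suc l)"
  by (auto simp: mode_plus_def mode_minus_def fun_eq_iff)

lemma partial_deriv_0: "partial_deriv j (\<lambda>x. 0) x = 0"
  by (simp add: partial_deriv_def)

lemma sgrad_mode_plus: "sgrad (mode_plus l) x = 0"
  by (rule vec2_eqI; unfold sgrad_nth mode_simps partial_deriv_zeta_power partial_deriv_0 zeta_axis i_times_i; simp)

text \<open>Together with \<open>sg_mode_minus\<close> this fixes the power: \<sigma> \<cdot>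
  \<nabla> of |x|^(2c) times the spinor is (2 c + 3 + 2 l) |x|^(2c) times \<open>mode_plus\<close>,
  which vanishes for c = -(l + 3/2).\<close>

lemma sgrad_mode_minus: "sgrad (mode_minus l) x = (3 + 2 * real l) *\<^sub>R spinor (mode_plus l) x"
proof -
  have d: "partial_deriv j (\<lambda>x. complex_of_real (x $ 3) * zeta x ^ l) x
     = of_real (axis j 1 $ 3) * zeta x ^ l + of_real (x $ 3) * (of_nat l * zeta (axis j 1) * zeta x ^ (l - 1))" for j
    by (subst partial_deriv_mult)
      (auto simp: partial_deriv_zeta_power partial_deriv_coord intro!: smooth_on_differentiable smooth_on_coord smooth_on_zeta_power)
  have ax: "axis 1 (1::real) $ (3::3) = 0" "axis 2 (1::real) $ (3::3) = 0" "axis 3 (1::real) $ (3::3) = 1"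
    by (simp_all add: axis_def)
  show ?thesis
    by (rule vec2_eqI; unfold sgrad_nth mode_simps d ax partial_deriv_zeta_power zeta_axis i_times_i spinor_def)
      (simp_all add: scaleR_conv_of_real[where 'a=complex] mode_simps algebra_simps)
qed

lemma sg_mode_minus: "sg x (spinor (mode_minus l) x) = (norm x)\<^sup>2 *\<^sub>R spinor (mode_plus l) x"
proof -
  have i: "\<i> * (\<i> * w) = - w" for w by (simp flip: mult.assoc)
  have n: "complex_of_real ((norm x)\<^sup>2) = of_real (x $ 3) * of_real (x $ 3) + (of_real (x $ 1) - \<i> * of_real (x $ 2)) * zeta x"
    unfolding norm_sq_vec3 by (simp add: zeta_def power2_eq_square algebra_simps i)
  show ?thesis
    by (rule vec2_eqI; unfold sg_1 sg_2 spinor_def vector_scaleR_component scaleR_conv_of_real[where 'a=complex] n vec_lambda_beta mode_simps)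
      (simp_all add: zeta_def algebra_simps)
qed

lemma norm_vec2_sq: "(norm (v :: complex^2))\<^sup>2 = (norm (v $ 1))\<^sup>2 + (norm (v $ 2))\<^sup>2"
  by (simp add: norm_vec_def L2_set_def sum_2)

lemma norm_mode_plus: "norm (spinor (mode_plus l) x) \<le> norm x ^ l"
proof -
  have "(norm (spinor (mode_plus l) x))\<^sup>2 = (norm (zeta x) ^ l)\<^sup>2"
    by (simp add: norm_vec2_sq spinor_def mode_simps norm_power)
  then have "norm (spinor (mode_plus l) x) = norm (zeta x) ^ l"
    by (rule power2_eq_imp_eq) simp_all
  then show ?thesis by (simp add: power_mono norm_zeta_le)
qed

lemma mode_nonzero:
  assumes "0 < x $ 1"
  shows "spinor (mode_plus l) x \<noteq> 0" "spinor (mode_minus l) x \<noteq> 0"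
proof -
  have "zeta x \<noteq> 0" using assms by (auto simp: zeta_def complex_eq_iff)
  then have "spinor (mode_plus l) x $ 1 \<noteq> 0" "spinor (mode_minus l) x $ 2 \<noteq> 0"
    by (simp_all add: spinor_def mode_simps)
  then show "spinor (mode_plus l) x \<noteq> 0" "spinor (mode_minus l) x \<noteq> 0"
    by (auto simp only: zero_index)
qed

text \<open>A function of t = |x|^2: the power t^c times a cutoff on the logarithmic scale, equal to
  1 for |ln t| \<le> n and 0 for |ln t| \<ge> sqrt 2 n. The square of the logarithm treats both ends
  with a single smooth step.\<close>

definition profile :: "real \<Rightarrow> real \<Rightarrow> real \<Rightarrow> real" where
  "profile c n t = (if 0 < t then t powr c * step (2 - (ln t / n)\<^sup>2) else 0)"

definition profile' :: "real \<Rightarrow> real \<Rightarrow> real \<Rightarrow> real" where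
  "profile' c n t = (if 0 < t then c * t powr (c - 1) * step (2 - (ln t / n)\<^sup>2)
     - t powr c * (step' (2 - (ln t / n)\<^sup>2) * (2 * ln t / (n\<^sup>2 * t))) else 0)"

lemma profile_cut:
  fixes n t :: real
  assumes n: "0 < n" and t: "0 < t" "t < exp (- 2 * n) \<or> exp (2 * n) < t"
  shows "2 - (ln t / n)\<^sup>2 \<le> 0"
proof -
  have "ln t < - 2 * n \<or> 2 * n < ln t"
    using t ln_less_cancel_iff[of t "exp (- 2 * n)"] ln_less_cancel_iff[of "exp (2 * n)" t] by auto
  then have "2 * n \<le> \<bar>ln t\<bar>" by auto
  then have "2 \<le> \<bar>ln t / n\<bar>" using n by (simp add: field_simps)
  then have "2\<^sup>2 \<le> \<bar>ln t / n\<bar>\<^sup>2" by (rule power_mono) simp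
  then show ?thesis unfolding power2_abs by simp
qed

lemma profile_support:
  fixes n t :: real
  assumes n: "0 < n" and t: "t < exp (- 2 * n) \<or> exp (2 * n) < t"
  shows "profile c n t = 0" "profile' c n t = 0"
  using profile_cut[OF n _ t] by (auto simp: profile_def profile'_def step_eq_0 step'_eq_0)

lemma profile_DERIV:
  assumes n: "0 < n"
  shows "(profile c n has_real_derivative profile' c n t) (at t)"
proof (cases "0 < t")
  case True
  have st: "((\<lambda>t. step (2 - (ln t / n)\<^sup>2)) has_real_derivative step' (2 - (ln t / n)\<^sup>2) * (- (2 * ln t / (n\<^sup>2 * t)))) (at t)"
    by (rule DERIV_chain2[OF step_DERIV])
      (use True n in \<open>auto intro!: derivative_eq_intros simp: power2_eq_square field_simps\<close>)
  have "((\<lambda>t. t powr c * step (2 - (ln t / n)\<^sup>2)) has_real_derivative profile' c n t) (at t)"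
    using DERIV_mult[OF DERIV_powr[OF DERIV_ident True DERIV_const[of c]] st] True
    by (simp add: profile'_def powr_diff algebra_simps)
  then show ?thesis
    by (rule has_field_derivative_transform_within_open[where S="{0<..}"]) (use True in \<open>auto simp: profile_def\<close>)
next
  case False
  have "((\<lambda>t. 0) has_real_derivative profile' c n t) (at t)"
    using False by (simp add: profile'_def)
  then show ?thesis
  proof (rule has_field_derivative_transform_within_open[where S="{..<exp (- 2 * n)}"])
    show "t \<in> {..<exp (- 2 * n)}" using False by (simp add: le_less_trans[OF _ exp_gt_zero])
  qed (use profile_support[OF n] in auto)
qed

lemma rsmooth_profile:
  assumes n: "0 < n"
  shows "rsmooth_on UNIV (\<lambda>x :: real^3. profile c n ((norm x)\<^sup>2))"
proof -
  let ?U = "- {0} :: (real^3) set" and ?V = "ball 0 (exp (- n)) :: (real^3) set"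
  have nsq: "rsmooth_on S (\<lambda>x :: real^3. (norm x)\<^sup>2)" if "open S" for S
    using rsmooth_on_norm_sq[OF that, of 0] by simp
  have oU: "open ?U" by (intro open_Compl closed_singleton)
  have "rsmooth_on ?U (\<lambda>x. ((norm x)\<^sup>2) powr c * step (2 - (ln ((norm x)\<^sup>2) * (1 / n)) ^ 2))"
    by (intro rsmooth_on_mult rsmooth_on_powr rsmooth_on_step rsmooth_on_diff rsmooth_on_const rsmooth_on_power rsmooth_on_ln nsq oU) auto
  then have 1: "rsmooth_on ?U (\<lambda>x. profile c n ((norm x)\<^sup>2))"
    by (rule rsmooth_on_cong[OF oU]) (simp add: profile_def)
  have "rsmooth_on ?V (\<lambda>x. 0)" by (rule rsmooth_on_const)
  then have 2: "rsmooth_on ?V (\<lambda>x. profile c n ((norm x)\<^sup>2))"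
  proof (rule rsmooth_on_cong[OF open_ball])
    fix x :: "real^3" assume "x \<in> ?V"
    then have "(norm x)\<^sup>2 < (exp (- n))\<^sup>2" by (intro power_strict_mono) auto
    also have "(exp (- n))\<^sup>2 = exp (- 2 * n)" by (simp add: power2_eq_square flip: exp_add)
    finally show "0 = profile c n ((norm x)\<^sup>2)" using profile_support(1)[OF n] by simp
  qed
  have "?U \<union> ?V = UNIV" by auto
  then show ?thesis using rsmooth_on_Un[OF oU open_ball 1 2] by simp
qed

definition cut_mode :: "real \<Rightarrow> real \<Rightarrow> (2 \<Rightarrow> real^3 \<Rightarrow> complex) \<Rightarrow> 2 \<Rightarrow> real^3 \<Rightarrow> complex" where
  "cut_mode c n Q i x = of_real (profile c n ((norm x)\<^sup>2)) * Q i x"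

lemma spinor_cut_mode: "spinor (cut_mode c n Q) x = profile c n ((norm x)\<^sup>2) *\<^sub>R spinor Q x"
  by (simp add: spinor_def cut_mode_def vec_eq_iff scaleR_conv_of_real[where 'a=complex])

lemma cut_mode_support:
  assumes n: "0 < n" and x: "x \<notin> annulus (exp (- n)) (exp n)"
  shows "profile c n ((norm x)\<^sup>2) = 0" "profile' c n ((norm x)\<^sup>2) = 0"
proof -
  have e: "exp (- 2 * n) = (exp (- n))\<^sup>2" "exp (2 * n) = (exp n)\<^sup>2"
    by (simp_all add: power2_eq_square flip: exp_add)
  have "norm x < exp (- n) \<or> exp n < norm x" using x by (auto simp: annulus_def)
  then have "(norm x)\<^sup>2 < exp (- 2 * n) \<or> exp (2 * n) < (norm x)\<^sup>2"
    unfolding e by (auto intro: power_strict_mono)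
  then show "profile c n ((norm x)\<^sup>2) = 0" "profile' c n ((norm x)\<^sup>2) = 0"
    using profile_support[OF n] by auto
qed

lemma test_function_cut_mode:
  assumes n: "0 < n" and Q: "\<And>i. smooth_on UNIV (Q i)"
  shows "test_function (cut_mode c n Q i)"
proof (rule test_functionI[OF _ compact_annulus])
  show "smooth_on UNIV (cut_mode c n Q i)"
    unfolding cut_mode_def[abs_def] using rsmooth_profile[OF n, of c]
    by (intro smooth_on_mult Q open_UNIV) (simp add: rsmooth_on_def)
  show "0 \<notin> annulus (exp (- n)) (exp n)" by (rule zero_notin_annulus) simp
  show "x \<in> annulus (exp (- n)) (exp n)" if "cut_mode c n Q i x \<noteq> 0" for x
    using that cut_mode_support(1)[OF n, of x c] by (auto simp: cut_mode_def)
qed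

lemma sgrad_cut_mode:
  assumes n: "0 < n" and Q: "\<And>i. smooth_on UNIV (Q i)"
  shows "sgrad (cut_mode c n Q) x = (2 * profile' c n ((norm x)\<^sup>2)) *\<^sub>R sg x (spinor Q x) + profile c n ((norm x)\<^sup>2) *\<^sub>R sgrad Q x"
proof -
  let ?S = "\<lambda>x :: real^3. complex_of_real (profile c n ((norm x)\<^sup>2))"
  have "((\<lambda>x :: real^3. (norm x)\<^sup>2) has_derivative (\<lambda>h. 2 * (x \<bullet> h))) (at x)"
    using has_derivative_norm_sq[of 0 x] by simp
  from has_derivative_of_real[OF has_derivative_compose[OF this profile_DERIV[OF n, unfolded has_field_derivative_def]]]
  have dS: "(?S has_derivative (\<lambda>h. of_real (profile' c n ((norm x)\<^sup>2) * (2 * (x \<bullet> h))))) (at x)" .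
  have pS: "partial_deriv j ?S x = of_real (2 * profile' c n ((norm x)\<^sup>2) * x $ j)" for j
    by (simp add: partial_deriv_eq[OF dS] inner_axis)
  have "partial_deriv j (cut_mode c n Q i) x = of_real (2 * profile' c n ((norm x)\<^sup>2) * x $ j) * Q i x + ?S x * partial_deriv j (Q i) x" for i j
    unfolding cut_mode_def[abs_def] pS[symmetric]
    by (rule partial_deriv_mult) (use dS in \<open>auto simp: differentiable_def intro: smooth_on_differentiable[OF Q, unfolded differentiable_def]\<close>)
  note d = this
  show ?thesis
    by (rule vec2_eqI) (simp_all add: sgrad_nth d sg_1 sg_2 spinor_def scaleR_conv_of_real[where 'a=complex] algebra_simps)
qed

text \<open>The measure |x|^-3 dx is invariant under dilations, so every shell between radii e^j and
  e^(j+1) has the same finite mass. The annulus is covered by the 2 n + 1 shells with -n \<le> j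
  \<le> n, at most 3 n of them.\<close>

lemma log_annulus_integral:
  obtains C where "0 < C" "\<And>n::nat. 1 \<le> n \<Longrightarrow>
    nn_lborel (\<lambda>x. indicator (annulus (exp (- real n)) (exp (real n))) x * ennreal (norm x powr - 3)) \<le> ennreal (C * real n)"
proof -
  define sh where "sh j = {x :: real^3. exp (real_of_int j) \<le> norm x \<and> norm x < exp (real_of_int j + 1)}" for j :: int
  have sh_m [measurable]: "sh j \<in> sets borel" for j unfolding sh_def by measurable
  define I where "I j = nn_lborel (\<lambda>x. indicator (sh j) x * ennreal (norm x powr - 3))" for j
  have I_eq: "I j = I 0" for j
  proof -
    let ?c = "exp (real_of_int j)"
    have "I j = ennreal (\<bar>?c\<bar> ^ 3) * nn_lborel (\<lambda>x. indicator (sh j) (0 + ?c *\<^sub>R x) * ennreal (norm (0 + ?c *\<^sub>R x) powr - 3))"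
      unfolding I_def
      using nn_integral_affine_euclidean[of "\<lambda>x. indicator (sh j) x * ennreal (norm x powr - 3)" ?c 0] by simp
    also have "nn_lborel (\<lambda>x. indicator (sh j) (0 + ?c *\<^sub>R x) * ennreal (norm (0 + ?c *\<^sub>R x) powr - 3))
       = nn_lborel (\<lambda>x. ennreal (?c powr - 3) * (indicator (sh 0) x * ennreal (norm x powr - 3)))"
    proof (rule nn_integral_cong)
      fix x :: "real^3"
      have "?c *\<^sub>R x \<in> sh j \<longleftrightarrow> x \<in> sh 0"
        by (simp add: sh_def exp_add)
      then show "indicator (sh j) (0 + ?c *\<^sub>R x) * ennreal (norm (0 + ?c *\<^sub>R x) powr - 3) = ennreal (?c powr - 3) * (indicator (sh 0) x * ennreal (norm x powr - 3))"
        by (simp add: indicator_def powr_mult ennreal_mult)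
    qed
    also have "\<dots> = ennreal (?c powr - 3) * I 0"
      unfolding I_def by (rule nn_integral_cmult) measurable
    also have "ennreal (\<bar>?c\<bar> ^ 3) * (ennreal (?c powr - 3) * I 0) = I 0"
      by (simp add: powr_minus powr_numeral flip: ennreal_mult mult.assoc)
    finally show ?thesis .
  qed
  have "I 0 \<le> nn_lborel (indicator (cball 0 (exp 1)))"
    unfolding I_def
  proof (rule nn_integral_mono)
    fix x :: "real^3"
    have "norm x powr - 3 \<le> 1" if "1 \<le> norm x"
      using that powr_mono2'[of "-3" 1 "norm x"] by simp
    then show "indicator (sh 0) x * ennreal (norm x powr - 3) \<le> indicator (cball 0 (exp 1)) x"
      by (auto simp: indicator_def sh_def)
  qed
  also have "\<dots> < \<infinity>" using emeasure_lborel_cball_finite[of "0::real^3" "exp 1"] by simp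
  finally obtain i where i: "I 0 = ennreal i" "0 \<le> i" by (cases "I 0") auto
  show ?thesis
  proof (rule that[of "3 * (i + 1)"])
    fix n :: nat assume n: "1 \<le> n"
    have "nn_lborel (\<lambda>x. indicator (annulus (exp (- real n)) (exp (real n))) x * ennreal (norm x powr - 3))
       \<le> nn_lborel (\<lambda>x. \<Sum>j\<in>{- int n..int n}. indicator (sh j) x * ennreal (norm x powr - 3))"
    proof (rule nn_integral_mono)
      fix x :: "real^3"
      show "indicator (annulus (exp (- real n)) (exp (real n))) x * ennreal (norm x powr - 3) \<le> (\<Sum>j\<in>{- int n..int n}. indicator (sh j) x * ennreal (norm x powr - 3))"
      proof (cases "x \<in> annulus (exp (- real n)) (exp (real n))")
        case True
        then have x: "exp (- real n) \<le> norm x" "norm x \<le> exp (real n)" by (auto simp: annulus_def)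
        then have x0: "0 < norm x" using exp_gt_zero less_le_trans by blast
        define j where "j = \<lfloor>ln (norm x)\<rfloor>"
        have "- real n \<le> ln (norm x)" "ln (norm x) \<le> real n"
          using x x0 ln_le_cancel_iff[of "norm x" "exp (real n)"] ln_le_cancel_iff[of "exp (- real n)" "norm x"] by auto
        then have j: "j \<in> {- int n..int n}" unfolding j_def by (auto simp: le_floor_iff floor_le_iff)
        have "exp (real_of_int j) \<le> exp (ln (norm x))" "exp (ln (norm x)) < exp (real_of_int j + 1)"
          unfolding exp_le_cancel_iff exp_less_cancel_iff j_def by linarith+
        then have "x \<in> sh j" unfolding exp_ln[OF x0] sh_def by simp
        then have "indicator (annulus (exp (- real n)) (exp (real n))) x * ennreal (norm x powr - 3) = indicator (sh j) x * ennreal (norm x powr - 3)"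
          using True by simp
        also have "\<dots> \<le> (\<Sum>j\<in>{- int n..int n}. indicator (sh j) x * ennreal (norm x powr - 3))"
          using j by (intro member_le_sum) auto
        finally show ?thesis .
      qed simp
    qed
    also have "\<dots> = (\<Sum>j\<in>{- int n..int n}. I j)"
      unfolding I_def by (rule nn_integral_sum) measurable
    also have "\<dots> = (\<Sum>j\<in>{- int n..int n}. I 0)" by (intro sum.cong refl I_eq)
    also have "\<dots> = of_nat (2 * n + 1) * ennreal i"
    proof -
      have "card {- int n..int n} = 2 * n + 1" unfolding card_atLeastAtMost_int by linarith
      then show ?thesis unfolding i sum_constant by (simp only:)
    qed
    also have "\<dots> = ennreal (real (2 * n + 1) * i)"
      unfolding ennreal_of_nat_eq_real_of_nat using i(2) by (intro ennreal_mult[symmetric]) auto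
    also have "\<dots> \<le> ennreal (3 * (i + 1) * real n)"
    proof (rule ennreal_leI)
      have "real (2 * n + 1) * i \<le> (3 * real n) * (i + 1)" using n i(2) by (intro mult_mono) auto
      then show "real (2 * n + 1) * i \<le> 3 * (i + 1) * real n" by (simp only: mult_ac)
    qed
    finally show "nn_lborel (\<lambda>x. indicator (annulus (exp (- real n)) (exp (real n))) x * ennreal (norm x powr - 3)) \<le> ennreal (3 * (i + 1) * real n)" .
  qed (use i in simp)
qed

text \<open>Squaring the pointwise bound gains n^-2, the logarithmic volume of the annulus costs a
  factor n, and the energy is of order 1 / n.\<close>

lemma log_annulus_energy:
  fixes n :: nat and C K \<alpha> :: real and f :: "real^3 \<Rightarrow> complex^2"
  defines "A \<equiv> annulus (exp (- real n)) (exp (real n))"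
  assumes C: "0 < C" "nn_lborel (\<lambda>x. indicator A x * ennreal (norm x powr - 3)) \<le> ennreal (C * real n)"
    and n: "1 \<le> n" and K: "0 \<le> K" and L: "in_Lp 2 (\<lambda>x. norm x powr - \<alpha> *\<^sub>R f x)" and c: "continuous_on UNIV f"
    and z: "\<And>x. x \<notin> A \<Longrightarrow> f x = 0"
    and le: "\<And>x. x \<in> A \<Longrightarrow> norm x powr - \<alpha> * norm (f x) \<le> K / real n * norm x powr - (3/2)"
  shows "(LINT x|lebesgue. norm (norm x powr - \<alpha> *\<^sub>R f x) powr 2) \<le> C * K\<^sup>2 / real n"
proof -
  have fm: "f \<in> borel_measurable borel" by (rule borel_measurable_continuous_onI[OF c])
  have Am [measurable]: "A \<in> sets borel" unfolding A_def using compact_annulus by (intro borel_closed compact_imp_closed)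
  have "ennreal (LINT x|lebesgue. norm (norm x powr - \<alpha> *\<^sub>R f x) powr 2) = nn_lborel (\<lambda>x. ennreal ((norm x powr - \<alpha> * norm (f x)) powr 2))"
    using weighted_integral_transfer[OF L fm] by simp
  also have "\<dots> \<le> nn_lborel (\<lambda>x. ennreal ((K / real n)\<^sup>2) * (indicator A x * ennreal (norm x powr - 3)))"
  proof (rule nn_integral_mono)
    fix x :: "real^3"
    show "ennreal ((norm x powr - \<alpha> * norm (f x)) powr 2) \<le> ennreal ((K / real n)\<^sup>2) * (indicator A x * ennreal (norm x powr - 3))"
    proof (cases "x \<in> A")
      case True
      have "(norm x powr - \<alpha> * norm (f x)) powr 2 \<le> (K / real n * norm x powr - (3/2)) powr 2"
        by (intro powr_mono2 le True) auto
      also have "\<dots> = (K / real n) powr 2 * norm x powr - 3"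
      proof -
        have e: "- (3/2) * 2 = (- 3 :: real)" by simp
        show ?thesis by (simp only: powr_mult powr_powr e)
      qed
      also have "(K / real n) powr 2 = (K / real n)\<^sup>2" using K by simp
      finally show ?thesis using True by (simp add: ennreal_leI flip: ennreal_mult)
    qed (simp add: z)
  qed
  also have "\<dots> = ennreal ((K / real n)\<^sup>2) * nn_lborel (\<lambda>x. indicator A x * ennreal (norm x powr - 3))"
    by (rule nn_integral_cmult) measurable
  also have "\<dots> \<le> ennreal ((K / real n)\<^sup>2) * ennreal (C * real n)"
    by (rule mult_left_mono[OF C(2)]) simp
  also have "\<dots> = ennreal (C * K\<^sup>2 / real n)"
    using C(1) n by (simp add: power2_eq_square divide_simps mult_ac flip: ennreal_mult)
  finally show ?thesis
    using C(1) by simp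
qed

lemma profile_eq_powr:
  assumes "1 \<le> n" "1 \<le> t" "t \<le> exp 1"
  shows "profile c n t = t powr c"
proof -
  have "0 \<le> ln t" "ln t \<le> 1" using assms ln_le_cancel_iff[of t "exp 1"] by auto
  then have "0 \<le> ln t / n" "ln t / n \<le> 1" using assms by (auto simp: field_simps)
  then have "(ln t / n)\<^sup>2 \<le> 1" by (simp add: abs_square_le_1)
  then show ?thesis using assms by (simp add: profile_def step_eq_1)
qed

text \<open>On a fixed open set inside 1 < |x|^2 < e the cutoff equals 1 for every n \<ge> 1, so its
  contribution does not depend on n. It is positive because the mode has no zeros where x_1 >
  0.\<close>

lemma cut_mode_norm_lower:
  assumes Q: "\<And>i. smooth_on UNIV (Q i)" and nz: "\<And>x. 0 < x $ 1 \<Longrightarrow> spinor Q x \<noteq> 0" and p: "0 < p"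
  obtains N0 where "0 < N0"
    "\<And>n. 1 \<le> n \<Longrightarrow> N0 \<le> (LINT x|lebesgue. norm (norm x powr - \<beta> *\<^sub>R spinor (cut_mode c n Q) x) powr p)"
proof -
  define U where "U = {x :: real^3. 1 < norm x} \<inter> {x. (norm x)\<^sup>2 < exp 1} \<inter> {x. 0 < x $ 1}"
  have oU: "open U" unfolding U_def by (intro open_Int open_Collect_less continuous_intros)
  have [measurable]: "U \<in> sets borel" using oU by simp
  define g where "g x = indicator U x * ennreal ((norm x powr - \<beta> * norm (spinor (cut_mode c 1 Q) x)) powr p)" for x
  have mode_U: "spinor (cut_mode c n Q) x = ((norm x)\<^sup>2) powr c *\<^sub>R spinor Q x" if "1 \<le> n" "x \<in> U" for n x
  proof -
    have "1\<^sup>2 \<le> (norm x)\<^sup>2" using that(2) by (intro power_mono) (auto simp: U_def)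
    then show ?thesis using that by (simp add: spinor_cut_mode profile_eq_powr U_def less_imp_le)
  qed
  have cm: "spinor (cut_mode c n Q) \<in> borel_measurable borel" if "1 \<le> n" for n
    using that by (intro borel_measurable_continuous_onI spinor_continuous test_function_cut_mode Q) auto
  note [measurable] = cm[OF order_refl]
  have le: "nn_lborel g \<le> ennreal (LINT x|lebesgue. norm (norm x powr - \<beta> *\<^sub>R spinor (cut_mode c n Q) x) powr p)" if n: "1 \<le> n" for n
  proof -
    have "nn_lborel g \<le> nn_lborel (\<lambda>x. ennreal ((norm x powr - \<beta> * norm (spinor (cut_mode c n Q) x)) powr p))"
      unfolding g_def using mode_U[OF n] mode_U[of 1] by (intro nn_integral_mono) (auto simp: indicator_def)
    also have "\<dots> = ennreal (LINT x|lebesgue. norm (norm x powr - \<beta> *\<^sub>R spinor (cut_mode c n Q) x) powr p)"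
      using n by (intro weighted_integral_transfer spinor_in_space(1) test_function_cut_mode Q p cm) auto
    finally show ?thesis .
  qed
  have "nn_lborel g \<noteq> 0"
  proof
    assume "nn_lborel g = 0"
    then have "AE x in lborel. g x = 0" unfolding g_def by (subst (asm) nn_integral_0_iff_AE) auto
    then have "AE x in lborel. x \<notin> U"
    proof eventually_elim
      fix x assume x: "g x = 0"
      show "x \<notin> U"
      proof
        assume U: "x \<in> U"
        then have "0 < norm x" "0 < x $ 1" by (auto simp: U_def)
        then show False using x U nz[of x] by (simp add: g_def mode_U)
      qed
    qed
    then have "U \<in> null_sets lborel" by (subst AE_iff_null_sets) auto
    then have "negligible U" using null_sets_completionI negligible_iff_null_sets by blast
    \<comment> \<open>A witness that the open set is nonempty: 1 < 36/25 < 2 \<le> e.\<close>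
    moreover have "(6/5) *\<^sub>R axis 1 1 \<in> U"
    proof -
      have "(6/5)\<^sup>2 < (2::real)" by (simp add: power2_eq_square)
      also have "2 \<le> exp (1::real)" using exp_ge_add_one_self[of 1] by simp
      finally show ?thesis by (simp add: U_def)
    qed
    ultimately show False using open_not_negligible[OF oU] by blast
  qed
  moreover obtain N0 where "nn_lborel g = ennreal N0" "0 \<le> N0"
    using le[of 1] by (cases "nn_lborel g") (auto simp: top_unique)
  ultimately show ?thesis
    using that[of N0] le by (auto simp: ennreal_le_iff2)
qed

text \<open>The Euler operator 2 t d/dt - 2 c annihilates t^c, so only the derivative of the cutoff
  survives. It carries 1 / n from the logarithmic scale, times ln t / n, which is at most 2 in
  absolute value where the step varies.\<close>

lemma profile_commutator:
  obtains B where "0 < B" "\<And>n t. 1 \<le> n \<Longrightarrow> 0 < t \<Longrightarrow> \<bar>2 * t * profile' c n t - 2 * c * profile c n t\<bar> \<le> B / n * t powr c"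
proof -
  obtain B where B: "0 < B" "\<And>t. step' t \<le> B" using step'_bounded by blast
  show ?thesis
  proof (rule that[of "8 * B"])
    fix n t :: real assume n: "1 \<le> n" and t: "0 < t"
    let ?u = "ln t / n"
    have su: "step' (2 - ?u\<^sup>2) * \<bar>?u\<bar> \<le> B * 2"
    proof (cases "2 - ?u\<^sup>2 \<le> 0")
      case False
      then have "\<bar>?u\<bar>\<^sup>2 \<le> 2\<^sup>2" unfolding power2_abs by simp
      then have "\<bar>?u\<bar> \<le> 2" by (rule power2_le_imp_le) simp
      then show ?thesis using B step'_nonneg by (intro mult_mono) (auto simp: less_imp_le)
    qed (use B in \<open>simp add: step'_eq_0\<close>)
    have "t * t powr (c - 1) = t powr c" using t by (simp add: powr_diff)
    then have "2 * t * profile' c n t - 2 * c * profile c n t = - (4 * t powr c / n * (step' (2 - ?u\<^sup>2) * ?u))"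
      using t n by (simp add: profile'_def profile_def power2_eq_square field_simps)
    then have "\<bar>2 * t * profile' c n t - 2 * c * profile c n t\<bar> = 4 * t powr c / n * (step' (2 - ?u\<^sup>2) * \<bar>?u\<bar>)"
      using n step'_nonneg by (simp add: abs_mult)
    also have "\<dots> \<le> 4 * t powr c / n * (B * 2)" using n by (intro mult_left_mono su) auto
    finally show "\<bar>2 * t * profile' c n t - 2 * c * profile c n t\<bar> \<le> 8 * B / n * t powr c" by (simp add: mult_ac)
  qed (use B in simp)
qed

lemma zero_mode_decay_plus:
  obtains K where "0 \<le> K" "\<And>n x. \<lbrakk>1 \<le> n; x \<noteq> 0\<rbrakk> \<Longrightarrow>
    norm x powr - (real l + 1 / 2) * norm (sgrad (cut_mode 0 n (mode_plus l)) x) \<le> K / n * norm x powr - (3/2)"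
proof -
  obtain B where B: "0 < B" "\<And>n t. 1 \<le> n \<Longrightarrow> 0 < t \<Longrightarrow> \<bar>2 * t * profile' 0 n t - 2 * 0 * profile 0 n t\<bar> \<le> B / n * t powr 0"
    using profile_commutator by metis
  obtain L where L: "0 < L" "\<And>a v. norm (sg a v) \<le> norm a * norm v * L" using sg.pos_bounded by blast
  show ?thesis
  proof (rule that[of "B * L"])
    fix n :: real and x :: "real^3" assume n: "1 \<le> n" and x: "x \<noteq> 0"
    let ?t = "(norm x)\<^sup>2" and ?r = "norm x"
    have t: "0 < ?t" using x by simp
    have "\<bar>2 * profile' 0 n ?t\<bar> * ?t \<le> B / n" using B(2)[OF n t] x by (simp add: abs_mult mult_ac)
    then have "\<bar>2 * profile' 0 n ?t\<bar> \<le> B / n / ?t" by (rule pos_le_divide_eq[OF t, THEN iffD2])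
    also have "\<dots> = B / n * ?r powr - 2" using x by (simp add: powr_minus_divide powr_numeral)
    finally have D: "\<bar>2 * profile' 0 n ?t\<bar> \<le> B / n * ?r powr - 2" .
    have "norm (sg x (spinor (mode_plus l) x)) \<le> ?r * norm (spinor (mode_plus l) x) * L" by (rule L(2))
    also have "\<dots> \<le> ?r * ?r ^ l * L" using L(1) by (intro mult_right_mono mult_left_mono norm_mode_plus) auto
    also have "\<dots> = L * ?r powr (real l + 1)" using x by (simp add: powr_add powr_realpow)
    finally have S: "norm (sg x (spinor (mode_plus l) x)) \<le> L * ?r powr (real l + 1)" .
    have "norm (sgrad (cut_mode 0 n (mode_plus l)) x) = \<bar>2 * profile' 0 n ?t\<bar> * norm (sg x (spinor (mode_plus l) x))"
      using n by (subst sgrad_cut_mode) (auto simp: smooth_mode sgrad_mode_plus)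
    also have "\<dots> \<le> (B / n * ?r powr - 2) * (L * ?r powr (real l + 1))"
      using B(1) n by (intro mult_mono D S) auto
    finally have "?r powr - (real l + 1 / 2) * norm (sgrad (cut_mode 0 n (mode_plus l)) x)
        \<le> ?r powr - (real l + 1 / 2) * ((B / n * ?r powr - 2) * (L * ?r powr (real l + 1)))"
      by (rule mult_left_mono) simp
    also have "\<dots> = B * L / n * (?r powr - (real l + 1 / 2) * ?r powr - 2 * ?r powr (real l + 1))" by simp
    also have "?r powr - (real l + 1 / 2) * ?r powr - 2 * ?r powr (real l + 1) = ?r powr - (3/2)"
      unfolding powr_add[symmetric] by simp
    finally show "?r powr - (real l + 1 / 2) * norm (sgrad (cut_mode 0 n (mode_plus l)) x) \<le> B * L / n * ?r powr - (3/2)" .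
  qed (use B L in simp)
qed

lemma zero_mode_decay_minus:
  obtains K where "0 \<le> K" "\<And>n x. \<lbrakk>1 \<le> n; x \<noteq> 0\<rbrakk> \<Longrightarrow>
    norm x powr (real l + 3 / 2) * norm (sgrad (cut_mode (- (real l + 3 / 2)) n (mode_minus l)) x) \<le> K / n * norm x powr - (3/2)"
proof -
  let ?c = "- (real l + 3 / 2)"
  obtain B where B: "0 < B" "\<And>n t. 1 \<le> n \<Longrightarrow> 0 < t \<Longrightarrow> \<bar>2 * t * profile' ?c n t - 2 * ?c * profile ?c n t\<bar> \<le> B / n * t powr ?c"
    using profile_commutator by metis
  show ?thesis
  proof (rule that[of B])
    fix n :: real and x :: "real^3" assume n: "1 \<le> n" and x: "x \<noteq> 0"
    let ?t = "(norm x)\<^sup>2" and ?r = "norm x"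
    \<comment> \<open>The coefficient 3 + 2 l of the zero order term is -2 c for this c, so the
      commutator bound applies to the whole expression.\<close>
    have "sgrad (cut_mode ?c n (mode_minus l)) x = (2 * ?t * profile' ?c n ?t - 2 * ?c * profile ?c n ?t) *\<^sub>R spinor (mode_plus l) x"
      using n by (subst sgrad_cut_mode) (auto simp: smooth_mode sgrad_mode_minus sg_mode_minus algebra_simps)
    then have "norm (sgrad (cut_mode ?c n (mode_minus l)) x) = \<bar>2 * ?t * profile' ?c n ?t - 2 * ?c * profile ?c n ?t\<bar> * norm (spinor (mode_plus l) x)"
      by simp
    also have "\<dots> \<le> (B / n * ?t powr ?c) * ?r ^ l"
      using x n B(1) by (intro mult_mono B(2) norm_mode_plus) auto
    also have "?t powr ?c = ?r powr (2 * ?c)" using x powr_powr[of ?r 2 ?c] by (simp add: powr_numeral)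
    also have "?r ^ l = ?r powr real l" using x by (simp add: powr_realpow)
    finally have "?r powr (real l + 3 / 2) * norm (sgrad (cut_mode ?c n (mode_minus l)) x)
       \<le> ?r powr (real l + 3 / 2) * ((B / n * ?r powr (2 * ?c)) * ?r powr real l)"
      by (rule mult_left_mono) simp
    also have "\<dots> = B / n * (?r powr (real l + 3 / 2) * ?r powr (2 * ?c) * ?r powr real l)" by (simp only: mult_ac)
    also have "?r powr (real l + 3 / 2) * ?r powr (2 * ?c) * ?r powr real l = ?r powr - (3/2)"
      unfolding powr_add[symmetric] by simp
    finally show "?r powr (real l + 3 / 2) * norm (sgrad (cut_mode ?c n (mode_minus l)) x) \<le> B / n * ?r powr - (3/2)" .
  qed (use B in simp)
qed

lemma zero_mode:
  assumes "\<alpha> \<in> Lambda"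
  obtains Q c K where "\<And>i. smooth_on UNIV (Q i)" "\<And>x. 0 < x $ 1 \<Longrightarrow> spinor Q x \<noteq> 0" "0 \<le> K"
    "\<And>n x. \<lbrakk>1 \<le> n; x \<noteq> 0\<rbrakk> \<Longrightarrow> norm x powr - \<alpha> * norm (sgrad (cut_mode c n Q) x) \<le> K / n * norm x powr - (3/2)"
proof -
  obtain k :: int where k: "\<alpha> = real_of_int k - 1 / 2" "k \<noteq> 0" using assms by (auto simp: Lambda_def)
  show ?thesis
  proof (cases "0 < k")
    case True
    \<comment> \<open>The mode of degree l = \<alpha> - 1/2, regular at the origin.\<close>
    define l where "l = nat (k - 1)"
    have \<alpha>: "\<alpha> = real l + 1 / 2" using True k by (simp add: l_def)
    obtain K where "0 \<le> K" "\<And>n x. \<lbrakk>1 \<le> n; x \<noteq> 0\<rbrakk> \<Longrightarrow>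
      norm x powr - (real l + 1 / 2) * norm (sgrad (cut_mode 0 n (mode_plus l)) x) \<le> K / n * norm x powr - (3/2)"
      using zero_mode_decay_plus by blast
    then show ?thesis unfolding \<alpha>[symmetric] by (intro that[of "mode_plus l"] smooth_mode mode_nonzero)
  next
    case False
    \<comment> \<open>The mode of degree -l - 2 = \<alpha> - 1/2, singular at the origin.\<close>
    define l where "l = nat (- 1 - k)"
    have \<alpha>: "real l + 3 / 2 = - \<alpha>" using False k by (simp add: l_def)
    obtain K where "0 \<le> K" "\<And>n x. \<lbrakk>1 \<le> n; x \<noteq> 0\<rbrakk> \<Longrightarrow>
      norm x powr (real l + 3 / 2) * norm (sgrad (cut_mode (- (real l + 3 / 2)) n (mode_minus l)) x) \<le> K / n * norm x powr - (3/2)"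
      using zero_mode_decay_minus by blast
    then show ?thesis unfolding \<alpha> by (intro that[of "mode_minus l"] smooth_mode mode_nonzero)
  qed
qed

section \<open>The best constant\<close>

definition admissible :: "real \<Rightarrow> real \<Rightarrow> real set" where
  "admissible \<alpha> \<beta> = {C. 0 \<le> C \<and>
     (\<forall>\<psi> f. in_Lp (p_exp \<alpha> \<beta>) (\<lambda>x. norm x powr (- \<beta>) *\<^sub>R \<psi> x) \<longrightarrow> sigma_grad_in_L2 \<alpha> \<psi> f \<longrightarrow>
        C * (LINT x|lebesgue. norm (norm x powr - \<beta> *\<^sub>R \<psi> x) powr p_exp \<alpha> \<beta>) powr (2 / p_exp \<alpha> \<beta>)
          \<le> (LINT x|lebesgue. norm (norm x powr - \<alpha> *\<^sub>R f x) powr 2))}"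

lemma best_const_eq: "best_const \<alpha> \<beta> = Sup (admissible \<alpha> \<beta>)"
  unfolding best_const_def admissible_def weighted_energy_eq weighted_Lp_eq D_space_def
  by (intro arg_cong[where f=Sup] Collect_cong) blast

lemma best_const_resonant:
  assumes \<alpha>: "\<alpha> \<in> Lambda" and \<beta>: "\<alpha> \<le> \<beta>" "\<beta> \<le> \<alpha> + 1"
  shows "best_const \<alpha> \<beta> = 0"
proof -
  let ?p = "p_exp \<alpha> \<beta>"
  have p: "0 < ?p" using p_exp_bounds(1)[OF \<beta>] by simp
  obtain Q c K where Q: "\<And>i. smooth_on UNIV (Q i)" "\<And>x. 0 < x $ 1 \<Longrightarrow> spinor Q x \<noteq> 0" and K: "0 \<le> K"
    "\<And>n x. \<lbrakk>1 \<le> n; x \<noteq> 0\<rbrakk> \<Longrightarrow> norm x powr - \<alpha> * norm (sgrad (cut_mode c n Q) x) \<le> K / n * norm x powr - (3/2)"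
    by (rule zero_mode[OF \<alpha>]) (rule that)
  obtain N0 where N0: "0 < N0"
    "\<And>n. 1 \<le> n \<Longrightarrow> N0 \<le> (LINT x|lebesgue. norm (norm x powr - \<beta> *\<^sub>R spinor (cut_mode c n Q) x) powr ?p)"
    using cut_mode_norm_lower[where Q=Q, OF Q p] by blast
  obtain C where C: "0 < C" "\<And>n::nat. 1 \<le> n \<Longrightarrow>
    nn_lborel (\<lambda>x. indicator (annulus (exp (- real n)) (exp (real n))) x * ennreal (norm x powr - 3)) \<le> ennreal (C * real n)"
    using log_annulus_integral by blast
  have test: "test_function (cut_mode c (real n) Q i)" if "1 \<le> n" for n i
    using that Q(1) by (intro test_function_cut_mode) auto
  have E: "(LINT x|lebesgue. norm (norm x powr - \<alpha> *\<^sub>R sgrad (cut_mode c (real n) Q) x) powr 2) \<le> C * K\<^sup>2 / real n" if n: "1 \<le> n" for n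
  proof (rule log_annulus_energy[OF C(1) C(2)[OF n] n K(1)])
    show "in_Lp 2 (\<lambda>x. norm x powr - \<alpha> *\<^sub>R sgrad (cut_mode c (real n) Q) x)"
      using spinor_in_space(2)[where A="cut_mode c (real n) Q", OF test[OF n] p] by (simp add: sigma_grad_in_L2_def)
    show "continuous_on UNIV (sgrad (cut_mode c (real n) Q))"
      by (rule spinor_continuous(2)[where A="cut_mode c (real n) Q", OF test[OF n]])
    fix x :: "real^3"
    have n0: "0 < real n" using n by simp
    show "sgrad (cut_mode c (real n) Q) x = 0" if "x \<notin> annulus (exp (- real n)) (exp (real n))"
      using cut_mode_support[OF n0 that] by (simp add: sgrad_cut_mode[where Q=Q, OF n0 Q(1)])
    show "norm x powr - \<alpha> * norm (sgrad (cut_mode c (real n) Q) x) \<le> K / real n * norm x powr - (3/2)"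
      if "x \<in> annulus (exp (- real n)) (exp (real n))"
      using that n zero_notin_annulus[of "exp (- real n)" "exp (real n)"] by (intro K(2)) auto
  qed
  have "C' \<le> 0" if C': "C' \<in> admissible \<alpha> \<beta>" for C'
  proof (rule ccontr)
    assume "\<not> C' \<le> 0"
    then have m: "0 < C' * N0 powr (2 / ?p)" using N0(1) by simp
    \<comment> \<open>For this n the energy bound C K^2 / n lies below the lower bound that a
      positive admissible constant would impose.\<close>
    obtain n :: nat where n: "C * K\<^sup>2 / (C' * N0 powr (2 / ?p)) < real n" using reals_Archimedean2 by blast
    moreover have "0 \<le> C * K\<^sup>2 / (C' * N0 powr (2 / ?p))" using m C(1) by simp
    ultimately have n1: "1 \<le> n" by (cases n) auto
    have "C' * N0 powr (2 / ?p) \<le> C' * (LINT x|lebesgue. norm (norm x powr - \<beta> *\<^sub>R spinor (cut_mode c (real n) Q) x) powr ?p) powr (2 / ?p)"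
      using N0 n1 p C' by (intro mult_left_mono powr_mono2) (auto simp: admissible_def)
    also have "\<dots> \<le> (LINT x|lebesgue. norm (norm x powr - \<alpha> *\<^sub>R sgrad (cut_mode c (real n) Q) x) powr 2)"
      using C' spinor_in_space[where A="cut_mode c (real n) Q", OF test[OF n1] p] unfolding admissible_def by blast
    also have "\<dots> \<le> C * K\<^sup>2 / real n" by (rule E[OF n1])
    finally have "C' * N0 powr (2 / ?p) * real n \<le> C * K\<^sup>2" using n1 by (simp add: field_simps)
    moreover have "C * K\<^sup>2 < C' * N0 powr (2 / ?p) * real n" using n m by (simp add: field_simps)
    ultimately show False by simp
  qed
  moreover have "0 \<in> admissible \<alpha> \<beta>" by (auto simp: admissible_def intro!: integral_nonneg_AE)
  ultimately have "admissible \<alpha> \<beta> = {0}" by (force simp: admissible_def)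
  then show ?thesis by (simp add: best_const_eq)
qed

lemma best_const_nonresonant:
  assumes \<alpha>: "\<alpha> \<notin> Lambda" and \<beta>: "\<alpha> \<le> \<beta>" "\<beta> \<le> \<alpha> + 1"
  shows "0 < best_const \<alpha> \<beta>"
proof -
  let ?p = "p_exp \<alpha> \<beta>"
  have p: "0 < ?p" using p_exp_bounds(1)[OF \<beta>] by simp
  obtain C where C: "0 < C"
    "\<And>\<psi> f. \<lbrakk>in_Lp ?p (\<lambda>x. norm x powr - \<beta> *\<^sub>R \<psi> x); sigma_grad_in_L2 \<alpha> \<psi> f\<rbrakk> \<Longrightarrow>
       C * (LINT x|lebesgue. norm (norm x powr - \<beta> *\<^sub>R \<psi> x) powr ?p) powr (2 / ?p)
         \<le> (LINT x|lebesgue. norm (norm x powr - \<alpha> *\<^sub>R f x) powr 2)"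
    using weighted_sigma_grad_inequality[OF \<alpha> \<beta>] by blast
  have mem: "C \<in> admissible \<alpha> \<beta>"
    unfolding admissible_def using C(1) by (intro CollectI conjI allI impI C(2); (assumption | simp))
  \<comment> \<open>A positive admissible constant bounds the supremum from below only if the set is
    bounded above. One spinor with positive norm provides such a bound, and a truncated mode serves
    for this whatever \<alpha> is.\<close>
  let ?A = "cut_mode 0 1 (mode_plus 0)"
  let ?N = "LINT x|lebesgue. norm (norm x powr - \<beta> *\<^sub>R spinor ?A x) powr ?p"
  let ?E = "LINT x|lebesgue. norm (norm x powr - \<alpha> *\<^sub>R sgrad ?A x) powr 2"
  obtain N0 where N0: "0 < N0"
    "\<And>n. 1 \<le> n \<Longrightarrow> N0 \<le> (LINT x|lebesgue. norm (norm x powr - \<beta> *\<^sub>R spinor (cut_mode 0 n (mode_plus 0)) x) powr ?p)"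
    by (rule cut_mode_norm_lower[of "mode_plus 0" ?p \<beta> 0, OF smooth_mode(1) mode_nonzero(1) p]) (assumption, rule that)
  have N: "0 < ?N" using less_le_trans[OF N0(1) N0(2)] by simp
  have test: "test_function (?A i)" for i by (intro test_function_cut_mode smooth_mode) simp
  have "bdd_above (admissible \<alpha> \<beta>)"
  proof (rule bdd_aboveI)
    fix C' assume "C' \<in> admissible \<alpha> \<beta>"
    then have "C' * ?N powr (2 / ?p) \<le> ?E"
      using spinor_in_space[where A="?A", OF test p] unfolding admissible_def by blast
    then show "C' \<le> ?E / ?N powr (2 / ?p)" using N by (simp add: pos_le_divide_eq)
  qed
  with mem have "C \<le> Sup (admissible \<alpha> \<beta>)" by (rule cSup_upper)
  then show ?thesis using C(1) by (simp add: best_const_eq)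
qed

theorem proposition1:
  fixes \<alpha> :: real
  shows "(\<alpha> \<in> Lambda \<longrightarrow>
            (\<forall>\<beta>. \<alpha> \<le> \<beta> \<and> \<beta> \<le> \<alpha> + 1 \<longrightarrow> best_const \<alpha> \<beta> = 0)) \<and>
         (\<alpha> \<notin> Lambda \<longrightarrow>
            (\<forall>\<beta>. \<alpha> \<le> \<beta> \<and> \<beta> \<le> \<alpha> + 1 \<longrightarrow> best_const \<alpha> \<beta> > 0))"
  using best_const_resonant best_const_nonresonant by auto

end
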